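(* Let $D=\mathbb{R}^2$ or $D=\mathbb{T}^2$. There exist an integer $m\ge 2$ and a constant $C>0$ such that the following holds. Let $u\in C([0,\infty);H^m(D))\cap C^1([0,\infty);H^{m-2}(D))$, with pressure $p$ satisfying $\nabla p\in C([0,\infty);L^2(D))$, be a global solution of $$\partial_t u+u\cdot\nabla u-\partial_1^2u=-\nabla p,\qquad \operatorname{div}u=0,\qquad u|_{t=0}=u_0\qquad\text{on }D.$$ Then for all $t\ge0$ $$\|\partial_2u(t)\|_{L^2}^2+\int_0^t\|\partial_1\partial_2u(s)\|_{L^2}^2\,ds\le\|\partial_2u_0\|_{L^2}^2\,e^{C\|u_0\|_{L^2}^2}.$$
   Context: $\mathbb{T}^2=(\mathbb{R}/2\pi\mathbb{Z})^2$; $u=(u^1,u^2)$ is a vector field, $\partial_j=\partial_{x_j}$, and $H^m(D)$ is the usual $L^2$-based Sobolev space. The quantifier "there exists an integer $m$" together with the stated function spaces expresses "smooth enough solution"; $C$ does not depend on $u$ or $t$. *)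

theory Defs
  imports "HOL-Analysis.Analysis"
begin

text \<open>Functions on the torus are encoded as everywhere \<open>2\<pi>\<close>-periodic functions on \<open>\<real>\<^sup>2\<close>, integrated
  over one period cell. Elements of \<open>L\<^sup>2\<close>, \<open>H\<^sup>k\<close> are represented by functions,
  and equality in these spaces is equality almost everywhere.\<close>

datatype flow_domain = Plane | Torus

fun cell :: "flow_domain \<Rightarrow> (real^2) set" where
  "cell Plane = UNIV"
| "cell Torus = cbox 0 (\<chi> i. 2 * pi)"

abbreviation dom_measure :: "flow_domain \<Rightarrow> (real^2) measure" where
  "dom_measure D \<equiv> lebesgue_on (cell D)"

fun fun_on :: "flow_domain \<Rightarrow> (real^2 \<Rightarrow> 'a) \<Rightarrow> bool" where
  "fun_on Plane f \<longleftrightarrow> True"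
| "fun_on Torus f \<longleftrightarrow> (\<forall>x i. f (x + axis i (2 * pi)) = f x)"

subsection \<open>Weak derivatives\<close>

definition pd :: "2 \<Rightarrow> (real^2 \<Rightarrow> real) \<Rightarrow> real^2 \<Rightarrow> real" where
  "pd i \<phi> x = frechet_derivative \<phi> (at x) (axis i 1)"

definition smooth_fun :: "(real^2 \<Rightarrow> real) \<Rightarrow> bool" where
  "smooth_fun \<phi> \<longleftrightarrow> (\<forall>js x. foldr pd js \<phi> differentiable at x)"

text \<open>On the torus every smooth function is a test function, since the torus is compact.\<close>

definition test_fun :: "flow_domain \<Rightarrow> (real^2 \<Rightarrow> real) \<Rightarrow> bool" where
  "test_fun D \<phi> \<longleftrightarrow> smooth_fun \<phi> \<and> fun_on D \<phi>
     \<and> (D = Plane \<longrightarrow> compact (closure {x. \<phi> x \<noteq> 0}))"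

definition loc_integrable :: "flow_domain \<Rightarrow> (real^2 \<Rightarrow> 'a::euclidean_space) \<Rightarrow> bool" where
  "loc_integrable D f \<longleftrightarrow> fun_on D f \<and> (\<forall>K. compact K \<longrightarrow> f absolutely_integrable_on K)"

text \<open>\<open>g\<close> is the weak derivative \<open>\<partial>\<^sub>1\<^sup>a \<partial>\<^sub>2\<^sup>b f\<close> (componentwise for vector-valued \<open>f\<close>).\<close>

definition has_weak_deriv ::
  "flow_domain \<Rightarrow> nat \<Rightarrow> nat \<Rightarrow> (real^2 \<Rightarrow> 'a::euclidean_space) \<Rightarrow> (real^2 \<Rightarrow> 'a) \<Rightarrow> bool" where
  "has_weak_deriv D a b f g \<longleftrightarrow> loc_integrable D f \<and> loc_integrable D g \<and>
     (\<forall>\<phi>. test_fun D \<phi> \<longrightarrow>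
        (\<integral>x. ((pd 1 ^^ a) ((pd 2 ^^ b) \<phi>)) x *\<^sub>R f x \<partial>dom_measure D)
        = (-1) ^ (a + b) *\<^sub>R (\<integral>x. \<phi> x *\<^sub>R g x \<partial>dom_measure D))"

text \<open>The weak derivative is unique up to a null set, so the choice of representative is
  immaterial; if no weak derivative exists, the value is meaningless.\<close>

definition wderiv ::
  "flow_domain \<Rightarrow> nat \<Rightarrow> nat \<Rightarrow> (real^2 \<Rightarrow> 'a::euclidean_space) \<Rightarrow> real^2 \<Rightarrow> 'a" where
  "wderiv D a b f = (SOME g. has_weak_deriv D a b f g)"

subsection \<open>Lebesgue and Sobolev spaces\<close>

definition L2_space :: "flow_domain \<Rightarrow> (real^2 \<Rightarrow> 'a::euclidean_space) set" where
  "L2_space D = {f. fun_on D f \<and> f \<in> borel_measurable (dom_measure D)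
     \<and> integrable (dom_measure D) (\<lambda>x. (norm (f x))\<^sup>2)}"

definition L2_norm_on :: "flow_domain \<Rightarrow> (real^2 \<Rightarrow> 'a::euclidean_space) \<Rightarrow> real" where
  "L2_norm_on D f = sqrt (\<integral>x. (norm (f x))\<^sup>2 \<partial>dom_measure D)"

definition H_space :: "flow_domain \<Rightarrow> nat \<Rightarrow> (real^2 \<Rightarrow> 'a::euclidean_space) set" where
  "H_space D k = {f. f \<in> L2_space D \<and>
     (\<forall>a b. a + b \<le> k \<longrightarrow> (\<exists>g \<in> L2_space D. has_weak_deriv D a b f g))}"

definition H_norm :: "flow_domain \<Rightarrow> nat \<Rightarrow> (real^2 \<Rightarrow> 'a::euclidean_space) \<Rightarrow> real" where
  "H_norm D k f =
     sqrt (\<Sum>(a, b) \<in> {(a, b). a + b \<le> k}. (L2_norm_on D (wderiv D a b f))\<^sup>2)"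

subsection \<open>Time-dependent functions\<close>

text \<open>Time-dependent functions have type \<open>real \<Rightarrow> real^2 \<Rightarrow> 'a\<close>; only their values at times \<open>t \<ge> 0\<close>
  matter. \<open>C_L2\<close> and \<open>C_H\<close> express membership in \<open>C([0,\<infinity>); L\<^sup>2)\<close> and \<open>C([0,\<infinity>); H\<^sup>k)\<close>.\<close>

definition C_L2 :: "flow_domain \<Rightarrow> (real \<Rightarrow> real^2 \<Rightarrow> 'a::euclidean_space) \<Rightarrow> bool" where
  "C_L2 D f \<longleftrightarrow> (\<forall>t\<ge>0. f t \<in> L2_space D \<and>
     ((\<lambda>s. L2_norm_on D (\<lambda>x. f s x - f t x)) \<longlongrightarrow> 0) (at t within {0..}))"

definition C_H :: "flow_domain \<Rightarrow> nat \<Rightarrow> (real \<Rightarrow> real^2 \<Rightarrow> 'a::euclidean_space) \<Rightarrow> bool" where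
  "C_H D k f \<longleftrightarrow> (\<forall>t\<ge>0. f t \<in> H_space D k \<and>
     ((\<lambda>s. H_norm D k (\<lambda>x. f s x - f t x)) \<longlongrightarrow> 0) (at t within {0..}))"

text \<open>\<open>f \<in> C\<^sup>1([0,\<infinity>); H\<^sup>k)\<close> with time derivative \<open>f'\<close> (one-sided at \<open>t = 0\<close>).\<close>

definition C1_H_with_deriv :: "flow_domain \<Rightarrow> nat \<Rightarrow> (real \<Rightarrow> real^2 \<Rightarrow> 'a::euclidean_space)
    \<Rightarrow> (real \<Rightarrow> real^2 \<Rightarrow> 'a) \<Rightarrow> bool" where
  "C1_H_with_deriv D k f f' \<longleftrightarrow> C_H D k f \<and> C_H D k f' \<and>
     (\<forall>t\<ge>0. ((\<lambda>s. H_norm D k (\<lambda>x. (f s x - f t x) /\<^sub>R (s - t) - f' t x)) \<longlongrightarrow> 0)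
        (at t within {0..}))"

subsection \<open>The equation\<close>

definition grad :: "flow_domain \<Rightarrow> (real^2 \<Rightarrow> real) \<Rightarrow> real^2 \<Rightarrow> real^2" where
  "grad D p x = vector [wderiv D 1 0 p x, wderiv D 0 1 p x]"

definition divergence :: "flow_domain \<Rightarrow> (real^2 \<Rightarrow> real^2) \<Rightarrow> real^2 \<Rightarrow> real" where
  "divergence D w x = wderiv D 1 0 w x $ 1 + wderiv D 0 1 w x $ 2"

definition advection :: "flow_domain \<Rightarrow> (real^2 \<Rightarrow> real^2) \<Rightarrow> real^2 \<Rightarrow> real^2" where
  "advection D w x = (w x $ 1) *\<^sub>R wderiv D 1 0 w x + (w x $ 2) *\<^sub>R wderiv D 0 1 w x"

definition has_weak_grad :: "flow_domain \<Rightarrow> (real^2 \<Rightarrow> real) \<Rightarrow> bool" where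
  "has_weak_grad D p \<longleftrightarrow> (\<exists>g. has_weak_deriv D 1 0 p g) \<and> (\<exists>g. has_weak_deriv D 0 1 p g)"

text \<open>For \<open>m \<ge> 2\<close> every term of the equation is a square-integrable function at each time (\<open>H\<^sup>2\<close> embeds into
  \<open>L\<^sup>\<infinity>\<close>), so the equation is an identity almost everywhere in space, for each \<open>t \<ge> 0\<close>.\<close>

definition global_solution :: "flow_domain \<Rightarrow> nat \<Rightarrow> (real \<Rightarrow> real^2 \<Rightarrow> real^2)
    \<Rightarrow> (real \<Rightarrow> real^2 \<Rightarrow> real) \<Rightarrow> (real^2 \<Rightarrow> real^2) \<Rightarrow> bool" where
  "global_solution D m u p u\<^sub>0 \<longleftrightarrow>
     C_H D m u \<and>
     (\<forall>t\<ge>0. has_weak_grad D (p t)) \<and> C_L2 D (\<lambda>t. grad D (p t)) \<and>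
     (\<exists>u'. C1_H_with_deriv D (m - 2) u u' \<and>
        (\<forall>t\<ge>0. AE x in dom_measure D.
           u' t x + advection D (u t) x - wderiv D 2 0 (u t) x = - grad D (p t) x)) \<and>
     (\<forall>t\<ge>0. AE x in dom_measure D. divergence D (u t) x = 0) \<and>
     fun_on D u\<^sub>0 \<and> (AE x in dom_measure D. u 0 x = u\<^sub>0 x)"

end

theory Submission imports Defs begin

text \<open>
  Write \<open>F, H, P\<close> for the \<open>L\<^sup>2\<close> norms of \<open>\<partial>\<^sub>1u\<close>, \<open>\<partial>\<^sub>2u\<close>, \<open>\<partial>\<^sub>1\<partial>\<^sub>2u\<close>. Testing the equation with \<open>u\<close> and
  with \<open>- \<partial>\<^sub>2\<^sup>2u\<close> gives \<open>(|u|\<^sup>2)' = - 2 F\<^sup>2\<close> and \<open>(H\<^sup>2)' = - 2 P\<^sup>2 - 2 \<integral>\<partial>\<^sub>2u\<^sup>2 (\<partial>\<^sub>1u\<^sup>2 \<partial>\<^sub>2u\<^sup>1 + (\<partial>\<^sub>2u\<^sup>2)\<^sup>2)\<close>: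
  because \<open>\<partial>\<^sub>1u\<^sup>1 + \<partial>\<^sub>2u\<^sup>2 = 0\<close>, every cubic term contains the factor \<open>g = \<partial>\<^sub>2u\<^sup>2 = - \<partial>\<^sub>1u\<^sup>1\<close>, whose norm is
  bounded both by \<open>F\<close> and by \<open>H\<close>. The anisotropic inequality puts one factor in \<open>L\<^sup>2\<close>, one in \<open>L\<^sup>2\<close> of
  \<open>x\<^sub>1\<close> with values in \<open>L\<^sup>\<infinity>\<close> of \<open>x\<^sub>2\<close>, and one the other way round; it bounds the cubic terms by a multiple
  of \<open>F H P\<close>. On the torus the lower-order terms of the one-dimensional sup bounds are absorbed with
  the Poincare inequality for \<open>g\<close>, which has mean zero in \<open>x\<^sub>1\<close>. Gronwall's inequality with \<open>\<integral>F\<^sup>2 \<le> |u\<^sub>0|\<^sup>2 / 2\<close>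
  concludes. The choice \<open>m = 5\<close> provides classical derivatives of order three for \<open>u\<close> and of order one
  for \<open>\<partial>\<^sub>tu\<close>, so that the pressure gradient, read off from the equation, is continuously differentiable.

  Only \<open>Q = \<nabla>p \<in> L\<^sup>2\<close> is known on the plane, not \<open>p \<in> L\<^sup>2\<close>. The field \<open>\<tau>\<^sub>hu - u\<close>, with \<open>\<tau>\<^sub>h\<close> a translation,
  has a square-integrable stream function, so that \<open>Q\<close> is orthogonal to it; as \<open>\<tau>\<^sub>hu\<close> tends weakly to \<open>0\<close>
  for large \<open>h\<close>, \<open>Q\<close> is orthogonal to \<open>u\<close>.
\<close>

section \<open>Smooth functions of one variable\<close>

text \<open>The hypotheses speak of weak derivatives chosen by \<open>SOME\<close>, of functions up
  to null sets and, on the torus, of integrals over one cell, while the estimates need classical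
  calculus. The bridge is a regularity theory on pairs of reals that tests only with products of
  one-variable functions: their limits include all boxes, which generate the Borel sets, and summing
  such a product over all periods turns an integral over the cell into one over the plane, so both
  domains yield the same weak identities. Local integrability of the weak \<partial>1, \<partial>2
  and \<partial>1\<partial>2 forces a continuous representative; this costs two derivatives, hence
  the orders 5 to 3 and 3 to 1.

  On the plane div(p u) = Q . u is useless, since the flux p u need not be integrable. A stream
  function in L^2 times the rotated field Q is an integrable flux instead, and curl Q = 0 gives it
  the right divergence. The divergence theorem is proved by a cutoff that asks for integrability of
  the flux and of the total divergence only; thus derivatives of Q and third derivatives of u need
  no decay.\<close>

fun times_differentiable :: "nat \<Rightarrow> (real \<Rightarrow> real) \<Rightarrow> bool" where
  "times_differentiable 0 f \<longleftrightarrow> True"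
| "times_differentiable (Suc n) f \<longleftrightarrow>
     (\<exists>f'. (\<forall>x. (f has_real_derivative f' x) (at x)) \<and> times_differentiable n f')"

definition smooth1 :: "(real \<Rightarrow> real) \<Rightarrow> bool" where
  "smooth1 f \<longleftrightarrow> (\<forall>n. times_differentiable n f)"

lemma times_differentiable_SucI:
  assumes "\<And>x. (f has_real_derivative f' x) (at x)" "times_differentiable n f'"
  shows "times_differentiable (Suc n) f"
  using assms by (auto intro: exI[of _ f'])

lemma times_differentiable_SucE:
  assumes "times_differentiable (Suc n) f"
  shows "\<exists>f'. (\<forall>x. (f has_real_derivative f' x) (at x)) \<and> times_differentiable n f'"
  using assms by simp

declare times_differentiable.simps(2) [simp del]

lemma times_differentiable_lower:
  "times_differentiable (Suc n) f \<Longrightarrow> times_differentiable n f"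
proof (induction n arbitrary: f)
  case (Suc n)
  obtain f' where f': "\<And>x. (f has_real_derivative f' x) (at x)" "times_differentiable (Suc n) f'"
    using times_differentiable_SucE[OF Suc.prems] by blast
  show ?case by (rule times_differentiable_SucI[OF f'(1) Suc.IH[OF f'(2)]])
qed simp

lemma times_differentiable_const: "times_differentiable n (\<lambda>x. c)"
proof (induction n arbitrary: c)
  case (Suc n)
  show ?case by (rule times_differentiable_SucI[OF DERIV_const Suc.IH])
qed simp

lemma times_differentiable_add:
  "times_differentiable n f \<Longrightarrow> times_differentiable n g \<Longrightarrow> times_differentiable n (\<lambda>x. f x + g x)"
proof (induction n arbitrary: f g)
  case (Suc n)
  obtain f' where f': "\<And>x. (f has_real_derivative f' x) (at x)" "times_differentiable n f'"
    using times_differentiable_SucE[OF Suc.prems(1)] by blast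
  obtain g' where g': "\<And>x. (g has_real_derivative g' x) (at x)" "times_differentiable n g'"
    using times_differentiable_SucE[OF Suc.prems(2)] by blast
  show ?case
    by (rule times_differentiable_SucI[OF DERIV_add[OF f'(1) g'(1)] Suc.IH[OF f'(2) g'(2)]])
qed simp

lemma times_differentiable_mult:
  "times_differentiable n f \<Longrightarrow> times_differentiable n g \<Longrightarrow> times_differentiable n (\<lambda>x. f x * g x)"
proof (induction n arbitrary: f g)
  case (Suc n)
  obtain f' where f': "\<And>x. (f has_real_derivative f' x) (at x)" "times_differentiable n f'"
    using times_differentiable_SucE[OF Suc.prems(1)] by blast
  obtain g' where g': "\<And>x. (g has_real_derivative g' x) (at x)" "times_differentiable n g'"
    using times_differentiable_SucE[OF Suc.prems(2)] by blast
  have "times_differentiable n (\<lambda>x. f' x * g x + g' x * f x)"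
    by (rule times_differentiable_add[OF Suc.IH[OF f'(2) times_differentiable_lower[OF Suc.prems(2)]]
          Suc.IH[OF g'(2) times_differentiable_lower[OF Suc.prems(1)]]])
  then show ?case
    by (rule times_differentiable_SucI[OF DERIV_mult[OF f'(1) g'(1)]])
qed simp

lemma times_differentiable_affine:
  "times_differentiable n f \<Longrightarrow> times_differentiable n (\<lambda>x. f (a * x + b))"
proof (induction n arbitrary: f)
  case (Suc n)
  obtain f' where f': "\<And>x. (f has_real_derivative f' x) (at x)" "times_differentiable n f'"
    using times_differentiable_SucE[OF Suc.prems] by blast
  have d: "((\<lambda>x. f (a * x + b)) has_real_derivative a * f' (a * x + b)) (at x)" for x
  proof -
    have "((\<lambda>x. a * x + b) has_real_derivative a) (at x)"
      by (auto intro!: derivative_eq_intros)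
    from DERIV_chain2[OF f'(1) this] show ?thesis by (simp add: mult.commute)
  qed
  have "times_differentiable n (\<lambda>x. a * f' (a * x + b))"
    by (rule times_differentiable_mult[OF times_differentiable_const Suc.IH[OF f'(2)]])
  then show ?case by (rule times_differentiable_SucI[OF d])
qed simp

text \<open>The derivative supplied by each order n could a priori differ; uniqueness of derivatives
  identifies all of them with \<open>deriv f\<close>, which is therefore smooth itself.\<close>

lemma
  assumes "smooth1 f"
  shows has_deriv_smooth1: "\<And>x. (f has_real_derivative deriv f x) (at x)"
    and smooth1_deriv: "smooth1 (deriv f)"
proof -
  have ex: "times_differentiable (Suc n) f" for n
    using assms by (simp add: smooth1_def)
  have eq: "f' = deriv f" if "\<And>x. (f has_real_derivative f' x) (at x)" for f'
    by (rule ext) (rule DERIV_imp_deriv[symmetric, OF that])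
  have *: "(\<forall>x. (f has_real_derivative deriv f x) (at x)) \<and> times_differentiable n (deriv f)" for n
  proof -
    obtain f' where f': "\<forall>x. (f has_real_derivative f' x) (at x)" "times_differentiable n f'"
      using times_differentiable_SucE[OF ex[of n]] by blast
    then show ?thesis using eq[of f'] by simp
  qed
  show "(f has_real_derivative deriv f x) (at x)" for x
    using *[of 0] by simp
  have "times_differentiable n (deriv f)" for n
    using *[of n] by simp
  then show "smooth1 (deriv f)" by (simp add: smooth1_def)
qed

lemma smooth1I:
  assumes "\<And>x. (f has_real_derivative f' x) (at x)" "smooth1 f'"
  shows "smooth1 f"
  unfolding smooth1_def
proof
  fix n
  show "times_differentiable n f"
  proof (cases n)
    case (Suc m)
    have "times_differentiable m f'" using assms(2) by (simp add: smooth1_def)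
    then show ?thesis unfolding Suc by (rule times_differentiable_SucI[OF assms(1)])
  qed simp
qed

lemma smooth1_const: "smooth1 (\<lambda>x. c)"
  and smooth1_add: "smooth1 f \<Longrightarrow> smooth1 g \<Longrightarrow> smooth1 (\<lambda>x. f x + g x)"
  and smooth1_mult: "smooth1 f \<Longrightarrow> smooth1 g \<Longrightarrow> smooth1 (\<lambda>x. f x * g x)"
  and smooth1_affine: "smooth1 f \<Longrightarrow> smooth1 (\<lambda>x. f (a * x + b))"
  by (simp_all add: smooth1_def times_differentiable_const times_differentiable_add
      times_differentiable_mult times_differentiable_affine)

lemma smooth1_continuous: "smooth1 f \<Longrightarrow> continuous_on A f"
  using DERIV_isCont[OF has_deriv_smooth1] by (blast intro: continuous_at_imp_continuous_on)

section \<open>Smooth functions that are flat at the origin\<close>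

lemma tendsto_poly_exp_0: "((\<lambda>x::real. poly p x * exp (- x)) \<longlongrightarrow> 0) at_top"
proof -
  have "((\<lambda>x::real. \<Sum>i\<le>degree p. coeff p i * (x ^ i / exp x)) \<longlongrightarrow> (\<Sum>i\<le>degree p. coeff p i * 0)) at_top"
    by (intro tendsto_sum tendsto_mult tendsto_const tendsto_power_div_exp_0)
  then show ?thesis
    by (simp add: poly_altdef exp_minus sum_distrib_right divide_inverse mult.assoc)
qed

text \<open>The functions P(1/x) exp(-1/x), extended by 0. Allowing a polynomial factor makes the
  class closed under differentiation, so smoothness is a single induction; P = 1 is the standard
  flat function.\<close>

definition flat_exp :: "real poly \<Rightarrow> real \<Rightarrow> real" where
  "flat_exp p x = (if x > 0 then poly p (1 / x) * exp (- (1 / x)) else 0)"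

text \<open>By the chain rule the derivative of P(1/x) exp(-1/x) is (P - P')(1/x) / x^2 times the
  exponential, and the factor 1/x^2 is \<open>monom 1 2\<close> evaluated at 1/x.\<close>

lemma flat_exp_deriv:
  "(flat_exp p has_real_derivative flat_exp (monom 1 2 * (p - pderiv p)) x) (at x)"
proof -
  consider "x < 0" | "x = 0" | "x > 0" by linarith
  then show ?thesis
  proof cases
    case 1
    have "((\<lambda>x. 0) has_real_derivative 0) (at x)" by simp
    then have "(flat_exp p has_real_derivative 0) (at x)"
      by (rule has_field_derivative_transform_within_open[of _ _ _ "{..<0}"])
        (use 1 in \<open>auto simp: flat_exp_def\<close>)
    then show ?thesis using 1 by (simp add: flat_exp_def)
  next
    case 3
    have "((\<lambda>x. poly p (1 / x) * exp (- (1 / x))) has_real_derivative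
        flat_exp (monom 1 2 * (p - pderiv p)) x) (at x)"
      using 3 by (auto simp: flat_exp_def poly_monom field_simps power2_eq_square
          intro!: derivative_eq_intros)
    then show ?thesis
      by (rule has_field_derivative_transform_within_open[of _ _ _ "{0<..}"])
        (use 3 in \<open>auto simp: flat_exp_def\<close>)
  next
    case 2
    have "((\<lambda>h. flat_exp p h / h) \<longlongrightarrow> 0) (at 0)"
    proof (rule filterlim_split_at)
      have "\<forall>\<^sub>F h in at_left 0. flat_exp p h / h = 0"
        by (auto simp: eventually_at_filter flat_exp_def)
      then show "((\<lambda>h. flat_exp p h / h) \<longlongrightarrow> 0) (at_left 0)"
        by (rule tendsto_eventually)
      \<comment> \<open>With x = 1/h the right-hand difference quotient becomes a polynomial times
        exp(-x) as x tends to infinity; \<open>monom 1 1\<close> is the extra factor 1/h.\<close>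
      have "((\<lambda>h. poly (monom 1 1 * p) (inverse h) * exp (- (inverse h))) \<longlongrightarrow> 0) (at_right 0)"
        by (rule filterlim_compose[OF tendsto_poly_exp_0 filterlim_inverse_at_top_right])
      moreover have "\<forall>\<^sub>F h in at_right 0. poly (monom 1 1 * p) (inverse h) * exp (- (inverse h)) = flat_exp p h / h"
        by (auto simp: eventually_at_filter flat_exp_def poly_monom inverse_eq_divide)
      ultimately show "((\<lambda>h. flat_exp p h / h) \<longlongrightarrow> 0) (at_right 0)"
        by (rule Lim_transform_eventually)
    qed
    then have "(flat_exp p has_real_derivative 0) (at 0)"
      by (simp add: DERIV_def flat_exp_def)
    with 2 show ?thesis by (simp add: flat_exp_def)
  qed
qed

lemma smooth1_flat_exp: "smooth1 (flat_exp p)"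
proof -
  have "times_differentiable n (flat_exp p)" for n
    by (induction n arbitrary: p) (auto intro: times_differentiable_SucI[OF flat_exp_deriv])
  then show ?thesis by (simp add: smooth1_def)
qed

section \<open>Compactly supported test functions on the line\<close>

definition test1 :: "(real \<Rightarrow> real) \<Rightarrow> bool" where
  "test1 f \<longleftrightarrow> smooth1 f \<and> (\<exists>R. \<forall>x. R < \<bar>x\<bar> \<longrightarrow> f x = 0)"

lemma test1_deriv: "test1 f \<Longrightarrow> test1 (deriv f)"
proof -
  assume f: "test1 f"
  then obtain R where R: "\<And>x. R < \<bar>x\<bar> \<Longrightarrow> f x = 0" by (auto simp: test1_def)
  have "deriv f x = 0" if x: "R < \<bar>x\<bar>" for x
  proof -
    have "open {x. R < \<bar>x\<bar>}" by (intro open_Collect_less continuous_intros)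
    then have "(f has_real_derivative 0) (at x)"
      by (rule has_field_derivative_transform_within_open[OF DERIV_const[of 0 "at x"]])
        (simp_all add: x R)
    then show ?thesis by (rule DERIV_imp_deriv)
  qed
  then show "test1 (deriv f)"
    using f smooth1_deriv[of f] unfolding test1_def by blast
qed

lemma test1_bounded:
  assumes "test1 f"
  shows "\<exists>B>0. \<forall>x. \<bar>f x\<bar> \<le> B"
proof -
  obtain R where R: "\<And>x. R < \<bar>x\<bar> \<Longrightarrow> f x = 0" using assms by (auto simp: test1_def)
  have "continuous_on {-R..R} f" using assms by (simp add: test1_def smooth1_continuous)
  then have "bounded (f ` {-R..R})"
    by (rule compact_imp_bounded[OF compact_continuous_image]) simp
  then obtain B where B: "B > 0" "\<forall>y \<in> f ` {-R..R}. \<bar>y\<bar> \<le> B"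
    unfolding bounded_pos real_norm_def by (elim exE conjE)
  have "\<bar>f x\<bar> \<le> B" for x 
  proof (cases "R < \<bar>x\<bar>")
    case False
    then have "x \<in> {-R..R}" by auto
    with B(2) show ?thesis by blast
  qed (use R B(1) in simp)
  with B(1) show ?thesis by (intro exI[of _ B]) simp
qed

lemma test1_measurable: "test1 f \<Longrightarrow> f \<in> borel_measurable borel"
  by (simp add: test1_def smooth1_continuous borel_measurable_continuous_onI)

text \<open>Multiplying the distances to a and b by n steepens the flanks, so that these bumps, all
  supported in [a, b], converge pointwise to the indicator of the open interval. They link test
  functions to boxes.\<close>

definition box_bump :: "real \<Rightarrow> real \<Rightarrow> nat \<Rightarrow> real \<Rightarrow> real" where
  "box_bump a b n x = flat_exp 1 (real n * (x - a)) * flat_exp 1 (real n * (b - x))"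

lemma box_bump_test: "test1 (box_bump a b n)"
proof -
  have "smooth1 (\<lambda>x. flat_exp 1 (real n * x + (- real n * a)) * flat_exp 1 (- real n * x + real n * b))"
    by (intro smooth1_mult smooth1_affine smooth1_flat_exp)
  moreover have "(\<lambda>x. flat_exp 1 (real n * x + (- real n * a)) * flat_exp 1 (- real n * x + real n * b))
    = box_bump a b n"
    by (auto simp: box_bump_def algebra_simps fun_eq_iff)
  moreover have "box_bump a b n x = 0" if "max \<bar>a\<bar> \<bar>b\<bar> < \<bar>x\<bar>" for x
  proof -
    have "x - a < 0 \<or> b - x < 0" using that by linarith
    then show ?thesis
      by (auto simp: box_bump_def flat_exp_def zero_less_mult_iff)
  qed
  ultimately show ?thesis unfolding test1_def by (simp only:) blast
qed

lemma flat_exp_1_bounds: "0 \<le> flat_exp 1 x" "flat_exp 1 x \<le> 1"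
  by (auto simp: flat_exp_def)

lemma flat_exp_1_lim: "(\<lambda>n. flat_exp 1 (real n * x)) \<longlonglongrightarrow> indicator {0<..} x"
proof (cases "x > 0")
  case True
  have "(\<lambda>n. exp (- (1 / x) * (1 / real n))) \<longlonglongrightarrow> exp (- (1 / x) * 0)"
    by (intro tendsto_exp tendsto_mult tendsto_const lim_1_over_n)
  moreover have "\<forall>\<^sub>F n in sequentially. exp (- (1 / x) * (1 / real n)) = flat_exp 1 (real n * x)"
    using eventually_gt_at_top[of 0]
    by eventually_elim (use True in \<open>auto simp: flat_exp_def zero_less_mult_iff mult.commute\<close>)
  ultimately show ?thesis using True by (auto intro: Lim_transform_eventually)
next
  case False
  then have "flat_exp 1 (real n * x) = 0" for n
    by (auto simp: flat_exp_def zero_less_mult_iff)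
  with False show ?thesis by simp
qed

lemma box_bump_lim: "(\<lambda>n. box_bump a b n x) \<longlonglongrightarrow> indicator {a<..<b} x"
proof -
  have "(\<lambda>n. box_bump a b n x) \<longlonglongrightarrow> indicator {0<..} (x - a) * indicator {0<..} (b - x)"
    unfolding box_bump_def by (intro tendsto_mult flat_exp_1_lim)
  also have "indicator {0<..} (x - a) * indicator {0<..} (b - x) = (indicator {a<..<b} x :: real)"
    by (auto simp: indicator_def)
  finally show ?thesis .
qed

lemma box_bump_bounds: "0 \<le> box_bump a b n x" "box_bump a b n x \<le> 1"
  by (auto simp: box_bump_def flat_exp_1_bounds mult_le_one)

lemma box_bump_le_indicator: "\<bar>box_bump a b n x\<bar> \<le> indicator {a..b} x"
proof (cases "x \<in> {a..b}")
  case True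
  then show ?thesis using box_bump_bounds[of a b n x] by simp
next
  case False
  then have "x - a < 0 \<or> b - x < 0" by auto
  then show ?thesis using False
    by (auto simp: box_bump_def flat_exp_def zero_less_mult_iff)
qed

lemma test1_zero_outside:
  assumes "test1 f"
  shows "\<exists>R>0. \<forall>x. R < \<bar>x\<bar> \<longrightarrow> f x = 0"
proof -
  obtain R where R: "\<And>x. R < \<bar>x\<bar> \<Longrightarrow> f x = 0" using assms by (auto simp: test1_def)
  show ?thesis
    by (rule exI[of _ "max R 1"]) (auto intro: R)
qed

lemma test1_integrable: "test1 f \<Longrightarrow> integrable lborel f"
proof -
  assume f: "test1 f"
  obtain R where R: "\<And>x. R < \<bar>x\<bar> \<Longrightarrow> f x = 0" using f by (auto simp: test1_def)
  have "set_integrable lborel {-R..R} f"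
    using f by (intro borel_integrable_atLeastAtMost') (auto simp: test1_def smooth1_continuous)
  moreover have "(\<lambda>x. indicator {-R..R} x *\<^sub>R f x) = f"
    using R by (force simp: indicator_def fun_eq_iff)
  ultimately show ?thesis by (simp add: set_integrable_def)
qed

text \<open>The fundamental theorem on an interval that reaches beyond the support. The two
  half-lines are those cut out by \<open>kernel\<close> below when x varies and s is fixed.\<close>

lemma test1_integral_deriv:
  assumes "test1 f"
  shows "(\<integral>x. indicator {s..} x * deriv f x \<partial>lborel) = - f s"
    and "(\<integral>x. indicator {..<s} x * deriv f x \<partial>lborel) = f s"
proof -
  obtain R where R: "R > 0" "\<And>x. R < \<bar>x\<bar> \<Longrightarrow> f x = 0"
    using test1_zero_outside[OF assms] by blast
  obtain R' where R': "R' > 0" "\<And>x. R' < \<bar>x\<bar> \<Longrightarrow> deriv f x = 0"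
    using test1_zero_outside[OF test1_deriv[OF assms]] by blast
  define S where "S = R + R' + \<bar>s\<bar> + 1"
  have assms: "test1 f" "smooth1 f" using assms by (auto simp: test1_def)
  have ftc: "(\<integral>x. indicator {a..b} x *\<^sub>R deriv f x \<partial>lborel) = f b - f a" if "a \<le> b" for a b
  proof (rule integral_FTC_atLeastAtMost[OF that])
    show "(f has_vector_derivative deriv f x) (at x within {a..b})" for x
      using has_deriv_smooth1[OF assms(2)]
      unfolding has_real_derivative_iff_has_vector_derivative
      by (rule has_vector_derivative_at_within)
    show "continuous_on {a..b} (deriv f)"
      by (intro smooth1_continuous smooth1_deriv assms)
  qed
  have S: "R < S" "R' < S" "s \<le> S" "- S \<le> s" "0 < S"
    using R(1) R'(1) unfolding S_def by linarith+
  have fS: "f S = 0" "f (- S) = 0"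
    using S R(1) by (auto intro!: R(2))
  have dS: "deriv f x = 0" if "S < x \<or> x < - S" for x
    using that S by (intro R'(2)) linarith
  have "(\<lambda>x. indicator {s..} x * deriv f x) = (\<lambda>x. indicator {s..S} x *\<^sub>R deriv f x)"
  proof
    fix x
    show "indicator {s..} x * deriv f x = indicator {s..S} x *\<^sub>R deriv f x"
      using dS[of x] by (cases "x \<le> S") (simp_all add: indicator_def)
  qed
  then show "(\<integral>x. indicator {s..} x * deriv f x \<partial>lborel) = - f s"
    using ftc[OF S(3)] fS by simp
  have "AE x in lborel. x \<noteq> s" by (rule AE_lborel_singleton)
  then have "AE x in lborel. indicator {..<s} x * deriv f x = indicator {-S..s} x *\<^sub>R deriv f x"
  proof eventually_elim
    case (elim x)
    then show ?case
      using dS[of x] by (cases "- S \<le> x") (simp_all add: indicator_def)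
  qed
  moreover have [measurable]: "deriv f \<in> borel_measurable borel"
    by (intro test1_measurable test1_deriv assms)
  ultimately have "(\<integral>x. indicator {..<s} x * deriv f x \<partial>lborel)
     = (\<integral>x. indicator {-S..s} x *\<^sub>R deriv f x \<partial>lborel)"
    by (intro integral_cong_AE) simp_all
  then show "(\<integral>x. indicator {..<s} x * deriv f x \<partial>lborel) = f s"
    using ftc[OF S(4)] fS by simp
qed

section \<open>Weak partial derivatives in the plane\<close>

lemma fst_borel [measurable]: "(fst :: real \<times> real \<Rightarrow> real) \<in> borel_measurable borel"
  and snd_borel [measurable]: "(snd :: real \<times> real \<Rightarrow> real) \<in> borel_measurable borel"
  by (auto intro!: borel_measurable_continuous_onI continuous_intros)

definition square :: "real \<Rightarrow> (real \<times> real) set" where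
  "square R = {-R..R} \<times> {-R..R}"

lemma square_borel [measurable]: "square R \<in> sets borel"
  unfolding square_def by (intro borel_closed closed_Times closed_atLeastAtMost)

lemma indicator_square: "indicator (square R) z = (indicator {-R..R} (fst z) * indicator {-R..R} (snd z) :: real)"
  by (cases z) (auto simp: square_def indicator_def)

text \<open>Borel rather than Lebesgue measurability passes to sections and to compositions with
  coordinate maps, as the Fubini arguments require. Squares exhaust the plane, so they decide local
  integrability.\<close>

definition loc_int :: "(real \<times> real \<Rightarrow> real) \<Rightarrow> bool" where
  "loc_int f \<longleftrightarrow> f \<in> borel_measurable borel \<and>
     (\<forall>R. integrable lborel (\<lambda>z. indicator (square R) z * f z))"

lemma loc_int_measurable [measurable_dest]: "loc_int f \<Longrightarrow> f \<in> borel_measurable borel"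
  by (simp add: loc_int_def)

lemma loc_intI:
  assumes [measurable]: "f \<in> borel_measurable borel"
    and w: "\<And>R. integrable lborel (w R)"
    and le: "\<And>R. AE z in lborel. \<bar>indicator (square R) z * f z\<bar> \<le> w R z"
  shows "loc_int f"
  unfolding loc_int_def
proof (intro conjI allI assms)
  fix R
  show "integrable lborel (\<lambda>z. indicator (square R) z * f z)"
  proof (rule Bochner_Integration.integrable_bound[OF w])
    show "AE z in lborel. norm (indicator (square R) z * f z) \<le> norm (w R z)"
      using le[of R] by eventually_elim simp
  qed measurable
qed

lemma loc_int_bound:
  assumes f: "loc_int f" and [measurable]: "h \<in> borel_measurable borel"
    and h: "\<And>z. \<bar>h z\<bar> \<le> B * indicator (square R) z"
  shows "integrable lborel (\<lambda>z. h z * f z)"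
proof (rule Bochner_Integration.integrable_bound)
  show "integrable lborel (\<lambda>z. B * (indicator (square R) z * f z))"
    using f by (simp add: loc_int_def)
  show "AE z in lborel. norm (h z * f z) \<le> norm (B * (indicator (square R) z * f z))"
  proof (rule AE_I2)
    fix z
    have "\<bar>h z\<bar> * \<bar>f z\<bar> \<le> (\<bar>B\<bar> * indicator (square R) z) * \<bar>f z\<bar>"
      using h[of z] by (intro mult_right_mono) (auto simp: indicator_def split: if_splits)
    then show "norm (h z * f z) \<le> norm (B * (indicator (square R) z * f z))"
      by (simp add: abs_mult mult.assoc)
  qed
  have [measurable]: "f \<in> borel_measurable borel" using f by (rule loc_int_measurable)
  show "(\<lambda>z. h z * f z) \<in> borel_measurable lborel" by measurable
qed

lemma test_product_bound:
  assumes "test1 \<psi>" "test1 \<eta>"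
  shows "\<exists>B R. \<forall>z. \<bar>\<psi> (fst z) * \<eta> (snd z)\<bar> \<le> B * indicator (square R) z"
proof -
  obtain B1 B2 where B: "B1 > 0" "\<And>x. \<bar>\<psi> x\<bar> \<le> B1" "B2 > 0" "\<And>x. \<bar>\<eta> x\<bar> \<le> B2"
    using test1_bounded[OF assms(1)] test1_bounded[OF assms(2)] by blast
  obtain R1 R2 where R: "R1 > 0" "\<And>x. R1 < \<bar>x\<bar> \<Longrightarrow> \<psi> x = 0" "R2 > 0" "\<And>x. R2 < \<bar>x\<bar> \<Longrightarrow> \<eta> x = 0"
    using test1_zero_outside[OF assms(1)] test1_zero_outside[OF assms(2)] by blast
  have "\<bar>\<psi> (fst z) * \<eta> (snd z)\<bar> \<le> (B1 * B2) * indicator (square (max R1 R2)) z" for z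
  proof (cases "z \<in> square (max R1 R2)")
    case True
    then show ?thesis using B by (auto simp: abs_mult intro!: mult_mono)
  next
    case False
    then have "R1 < \<bar>fst z\<bar> \<or> R2 < \<bar>snd z\<bar>"
      by (cases z) (auto simp: square_def)
    then show ?thesis using R(2,4) False by auto
  qed
  then show ?thesis by blast
qed

lemma integrable_test_product:
  assumes "test1 \<psi>" "test1 \<eta>" "loc_int f"
  shows "integrable lborel (\<lambda>z. \<psi> (fst z) * \<eta> (snd z) * f z)"
proof -
  have [measurable]: "\<psi> \<in> borel_measurable borel" "\<eta> \<in> borel_measurable borel"
    using assms by (auto intro: test1_measurable)
  obtain B R where "\<And>z. \<bar>\<psi> (fst z) * \<eta> (snd z)\<bar> \<le> B * indicator (square R) z"
    using test_product_bound[OF assms(1,2)] by blast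
  then show ?thesis by (intro loc_int_bound[OF assms(3), where B=B and R=R]) simp_all
qed

lemma box_Times: "box (a :: real \<times> real) b = {fst a<..<fst b} \<times> {snd a<..<snd b}"
  by (cases a; cases b) (auto simp: set_eq_iff mem_box Basis_prod_def)

lemma box_Int_box_ex: "\<exists>u v. box (a :: real \<times> real) b \<inter> box c d = box u v"
  by (rule exI[of _ "(max (fst a) (fst c), max (snd a) (snd c))"],
      rule exI[of _ "(min (fst b) (fst d), min (snd b) (snd d))"]) (auto simp: box_Times)

text \<open>Products of bumps converge to the indicator of the box, dominated by |f| on a large
  square.\<close>

lemma loc_int_null_on_boxes:
  assumes f: "loc_int f"
    and test: "\<And>\<psi> \<eta>. test1 \<psi> \<Longrightarrow> test1 \<eta> \<Longrightarrow> (\<integral>z. \<psi> (fst z) * \<eta> (snd z) * f z \<partial>lborel) = 0"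
  shows "(\<integral>z. indicator (box a b) z * f z \<partial>lborel) = 0"
proof -
  define R where "R = \<bar>fst a\<bar> + \<bar>fst b\<bar> + \<bar>snd a\<bar> + \<bar>snd b\<bar>"
  let ?s = "\<lambda>n z. box_bump (fst a) (fst b) n (fst z) * box_bump (snd a) (snd b) n (snd z) * f z"
  have [measurable]: "f \<in> borel_measurable borel" using f by (rule loc_int_measurable)
  have bm [measurable]: "box_bump c d n \<in> borel_measurable borel" for c d n
    by (intro test1_measurable box_bump_test)
  have "(\<lambda>n. \<integral>z. ?s n z \<partial>lborel) \<longlonglongrightarrow> (\<integral>z. indicator (box a b) z * f z \<partial>lborel)"
  proof (rule integral_dominated_convergence)
    show "integrable lborel (\<lambda>z. \<bar>indicator (square R) z * f z\<bar>)"
      using f by (intro integrable_abs) (simp add: loc_int_def)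
    have "(\<lambda>n. ?s n z) \<longlonglongrightarrow> indicator (box a b) z * f z" for z
    proof -
    have "(\<lambda>n. ?s n z) \<longlonglongrightarrow>
        indicator {fst a<..<fst b} (fst z) * indicator {snd a<..<snd b} (snd z) * f z"
      by (intro tendsto_mult box_bump_lim tendsto_const)
    also have "indicator {fst a<..<fst b} (fst z) * indicator {snd a<..<snd b} (snd z) = (indicator (box a b) z :: real)"
      by (auto simp: box_Times indicator_def mem_Times_iff)
    finally show ?thesis .
    qed
    then show "AE z in lborel. (\<lambda>n. ?s n z) \<longlonglongrightarrow> indicator (box a b) z * f z" by simp
    have "\<bar>?s n z\<bar> \<le> indicator (square R) z * \<bar>f z\<bar>" for n z
    proof -
      have "\<bar>?s n z\<bar> \<le> indicator {fst a..fst b} (fst z) * indicator {snd a..snd b} (snd z) * \<bar>f z\<bar>"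
        unfolding abs_mult by (intro mult_mono box_bump_le_indicator) auto
      also have "\<dots> \<le> indicator (square R) z * \<bar>f z\<bar>"
        by (intro mult_right_mono) (auto simp: indicator_def R_def square_def mem_Times_iff)
      finally show ?thesis .
    qed
    then show "AE z in lborel. norm (?s n z) \<le> \<bar>indicator (square R) z * f z\<bar>" for n
      by (simp add: abs_mult)
  qed measurable
  moreover have "(\<integral>z. ?s n z \<partial>lborel) = 0" for n
    by (intro test box_bump_test)
  ultimately show ?thesis by (simp add: LIMSEQ_const_iff)
qed

text \<open>The fundamental lemma of the calculus of variations. The sets over which the integral
  vanishes form a Dynkin system; it contains the boxes, an intersection-stable generator of the
  Borel sets, so products of one-variable test functions suffice.\<close>

lemma loc_int_AE_zero:
  assumes f: "loc_int f"
    and test: "\<And>\<psi> \<eta>. test1 \<psi> \<Longrightarrow> test1 \<eta> \<Longrightarrow> (\<integral>z. \<psi> (fst z) * \<eta> (snd z) * f z \<partial>lborel) = 0"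
  shows "AE z in lborel. f z = 0"
proof -
  have [measurable]: "f \<in> borel_measurable borel" using f by (rule loc_int_measurable)
  \<comment> \<open>f is integrable only locally. Cutting with the boxes \<open>B n\<close> makes
    complements and countable unions legitimate, and these boxes exhaust the plane.\<close>
  define B where "B n = box (- real n, - real n) (real n, real n)" for n
  have Bm [measurable]: "B n \<in> sets borel" for n by (simp add: B_def)
  have fB: "integrable lborel (\<lambda>z. indicator (B n) z * f z)" for n
  proof (rule loc_int_bound[OF f, where B=1 and R="real n"])
    show "\<bar>indicator (B n) z\<bar> \<le> 1 * (indicator (square (real n)) z :: real)" for z
      by (auto simp: indicator_def B_def box_Times square_def)
  qed measurable
  have box0: "(\<integral>z. indicator (box a b) z * f z \<partial>lborel) = 0" for a b
    by (rule loc_int_null_on_boxes[OF f test])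
  have "AE z in lborel. indicator (B n) z * f z = 0" for n
  proof (rule density_unique_real[OF fB])
    fix A :: "(real \<times> real) set" assume "A \<in> sets lborel"
    then have A: "A \<in> sigma_sets UNIV (range (\<lambda>(a, b). box a b))"
      by (simp add: borel_eq_box)
    have sb: "sigma_sets UNIV (range (\<lambda>(a, b :: real \<times> real). box a b)) = sets borel"
      by (simp add: borel_eq_box)
    have "(\<integral>z. indicator A z * (indicator (B n) z * f z) \<partial>lborel) = 0"
    proof (rule sigma_sets_induct_disjoint[OF _ _ A])
      show "Int_stable (range (\<lambda>(a, b :: real \<times> real). box a b))"
      proof (rule Int_stableI_image, safe)
        fix a b c d :: "real \<times> real"
        show "\<exists>k\<in>UNIV. box a b \<inter> box c d = (case k of (a, b) \<Rightarrow> box a b)"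
          using box_Int_box_ex[of a b c d] by (metis UNIV_I case_prod_conv)
      qed
      show "range (\<lambda>(a, b). box a b) \<subseteq> Pow (UNIV :: (real \<times> real) set)" by simp
    next
      fix A :: "(real \<times> real) set" assume "A \<in> range (\<lambda>(a, b). box a b)"
      then obtain a b where "A = box a b" by auto
      then obtain c d where "A \<inter> B n = box c d" using box_Int_box_ex unfolding B_def by blast
      moreover have "(\<integral>z. indicator A z * (indicator (B n) z * f z) \<partial>lborel)
          = (\<integral>z. indicator (A \<inter> B n) z * f z \<partial>lborel)"
        by (simp add: indicator_inter_arith mult.assoc)
      ultimately show "(\<integral>z. indicator A z * (indicator (B n) z * f z) \<partial>lborel) = 0"
        using box0 by simp
    next
      fix A :: "(real \<times> real) set"
      assume A: "A \<in> sigma_sets UNIV (range (\<lambda>(a, b). box a b))"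
        and *: "(\<integral>z. indicator A z * (indicator (B n) z * f z) \<partial>lborel) = 0"
      have Am [measurable]: "A \<in> sets borel" using A sb by simp
      have "integrable lborel (\<lambda>z. indicator A z * (indicator (B n) z * f z))"
        using integrable_mult_indicator[OF _ fB, of A] by simp
      then have "(\<integral>z. indicator (B n) z * f z - indicator A z * (indicator (B n) z * f z) \<partial>lborel) = 0"
        using box0[of "(- real n, - real n)" "(real n, real n)"] * fB
        by (subst Bochner_Integration.integral_diff) (simp_all add: B_def)
      moreover have "\<And>z. indicator (B n) z * f z - indicator A z * (indicator (B n) z * f z)
          = indicator (UNIV - A) z * (indicator (B n) z * f z)"
        by (auto simp: indicator_def)
      ultimately show "(\<integral>z. indicator (UNIV - A) z * (indicator (B n) z * f z) \<partial>lborel) = 0"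
        by simp
    next
      fix A :: "nat \<Rightarrow> (real \<times> real) set"
      assume d: "disjoint_family A" and "range A \<subseteq> sigma_sets UNIV (range (\<lambda>(a, b). box a b))"
        and *: "\<And>i. (\<integral>z. indicator (A i) z * (indicator (B n) z * f z) \<partial>lborel) = 0"
      then have Am: "\<And>i. A i \<in> sets borel" using sb by auto
      have "set_lebesgue_integral lborel (\<Union> (range A)) (\<lambda>z. indicator (B n) z * f z)
         = (\<Sum>i. set_lebesgue_integral lborel (A i) (\<lambda>z. indicator (B n) z * f z))"
      proof (rule lebesgue_integral_countable_add)
        show "set_integrable lborel (\<Union> (range A)) (\<lambda>z. indicator (B n) z * f z)"
          unfolding set_integrable_def using Am by (intro integrable_mult_indicator fB) auto
      qed (use Am d in \<open>auto simp: disjoint_family_on_def\<close>)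
      then show "(\<integral>z. indicator (\<Union> (range A)) z * (indicator (B n) z * f z) \<partial>lborel) = 0"
        using * by (simp add: set_lebesgue_integral_def)
    qed simp
    then show "set_lebesgue_integral lborel A (\<lambda>z. indicator (B n) z * f z)
        = set_lebesgue_integral lborel A (\<lambda>z. 0)"
      by (simp add: set_lebesgue_integral_def)
  qed simp
  then have "AE z in lborel. \<forall>n. indicator (B n) z * f z = 0"
    unfolding AE_all_countable by (rule allI)
  then show ?thesis
  proof eventually_elim
    case (elim z)
    obtain n where "\<bar>fst z\<bar> + \<bar>snd z\<bar> < real n" using reals_Archimedean2 by blast
    then have "z \<in> B n" by (auto simp: B_def box_Times mem_Times_iff)
    with elim show "f z = 0" by (metis indicator_simps(1) mult_1)
  qed
qed

section \<open>Null sets of the plane and their sections\<close>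

lemma AE_fst: "AE x in lborel. P x \<Longrightarrow> AE z in (lborel :: (real \<times> real) measure). P (fst z)"
proof -
  assume "AE x in lborel. P x"
  then obtain N where N: "N \<in> null_sets lborel" "{x. \<not> P x} \<subseteq> N"
    by (auto elim!: AE_E simp: null_sets_def)
  then have "N \<times> UNIV \<in> null_sets (lborel \<Otimes>\<^sub>M lborel)"
    by (intro lborel.times_in_null_sets1) auto
  with N(2) show ?thesis
    unfolding lborel_prod by (intro AE_I') auto
qed

lemma AE_swap: "AE z in (lborel :: (real \<times> real) measure). P z \<Longrightarrow> AE z in lborel. P (prod.swap z)"
proof -
  assume P: "AE z in (lborel :: (real \<times> real) measure). P z"
  have m: "(\<lambda>(x, y). (y, x)) \<in> lborel \<Otimes>\<^sub>M lborel \<rightarrow>\<^sub>M lborel \<Otimes>\<^sub>M (lborel :: real measure)"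
    by (rule measurable_pair_swap')
  have "AE z in distr (lborel \<Otimes>\<^sub>M lborel) (lborel \<Otimes>\<^sub>M lborel) (\<lambda>(x, y :: real). (y, x :: real)). P z"
    using P unfolding lborel_prod[symmetric] by (subst lborel_pair.distr_pair_swap[symmetric])
  from AE_distrD[OF m this] show ?thesis
    unfolding lborel_prod by (simp add: prod.swap_def split_beta)
qed

lemma AE_snd: "AE y in lborel. P y \<Longrightarrow> AE z in (lborel :: (real \<times> real) measure). P (snd z)"
  using AE_swap[OF AE_fst[of P]] by (simp add: prod.swap_def)

lemma AE_lines:
  assumes "AE z in (lborel :: (real \<times> real) measure). P z"
  shows AE_vertical: "AE x in lborel. AE y in lborel. P (x, y)"
    and AE_horizontal: "AE y in lborel. AE x in lborel. P (x, y)"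
  using assms AE_swap[OF assms] lborel_pair.AE_pair[of P] lborel_pair.AE_pair[of "\<lambda>z. P (prod.swap z)"]
  unfolding lborel_prod by simp_all

text \<open>The set where two continuous functions differ is open, and a non-empty open set is never
  null. This upgrades identities almost everywhere to identities everywhere.\<close>

lemma continuous_AE_eq:
  fixes f g :: "'a :: euclidean_space \<Rightarrow> real"
  assumes "continuous_on UNIV f" "continuous_on UNIV g" "AE x in lborel. f x = g x"
  shows "f x = g x"
proof -
  have o: "open {x. f x \<noteq> g x}" by (intro open_Collect_neq assms)
  then have "{x. f x \<noteq> g x} \<in> null_sets lborel"
    using assms(3) AE_iff_null[of lborel "\<lambda>x. f x = g x"] by auto
  then have "negligible {x. f x \<noteq> g x}"
    unfolding negligible_iff_null_sets by (rule null_sets_completionI)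
  with o show ?thesis using open_not_negligible by blast
qed

lemma integrable_product_lborel:
  fixes f g :: "real \<Rightarrow> real"
  assumes f: "integrable lborel f" and g: "integrable lborel g"
  shows "integrable lborel (\<lambda>z. f (fst z) * g (snd z))"
proof -
  have [measurable]: "f \<in> borel_measurable borel" "g \<in> borel_measurable borel"
    using borel_measurable_integrable[OF f] borel_measurable_integrable[OF g] by simp_all
  have "integrable (lborel \<Otimes>\<^sub>M lborel) (\<lambda>z. f (fst z) * g (snd z))"
  proof (rule lborel_pair.Fubini_integrable)
    show "integrable lborel (\<lambda>x. \<integral>y. norm (f (fst (x, y)) * g (snd (x, y))) \<partial>lborel)"
      using f by (simp add: abs_mult)
    show "AE x in lborel. integrable lborel (\<lambda>y. f (fst (x, y)) * g (snd (x, y)))"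
      using g by simp
  qed measurable
  then show ?thesis by (simp add: lborel_prod)
qed

section \<open>Primitives of locally integrable functions on the line\<close>

definition loc_int1 :: "(real \<Rightarrow> real) \<Rightarrow> bool" where
  "loc_int1 h \<longleftrightarrow> h \<in> borel_measurable borel \<and>
     (\<forall>R. integrable lborel (\<lambda>x. indicator {-R..R} x * h x))"

text \<open>The signed indicator of the interval between 0 and x. It turns the integral from 0 to x,
  for x of either sign, into one Lebesgue integral whose integrand is jointly measurable in x and s,
  ready for Fubini.\<close>

definition kernel :: "real \<Rightarrow> real \<Rightarrow> real" where
  "kernel x s = (if 0 < s \<and> s \<le> x then 1 else if x < s \<and> s \<le> 0 then - 1 else 0)"

definition primitive :: "(real \<Rightarrow> real) \<Rightarrow> real \<Rightarrow> real" where
  "primitive h x = (\<integral>s. kernel x s * h s \<partial>lborel)"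

lemma kernel_measurable [measurable]:
  assumes [measurable]: "f \<in> borel_measurable M" "g \<in> borel_measurable M"
  shows "(\<lambda>w. kernel (f w) (g w)) \<in> borel_measurable M"
  unfolding kernel_def by measurable

lemma kernel_le: "\<bar>x\<bar> \<le> R \<Longrightarrow> \<bar>kernel x s\<bar> \<le> indicator {-R..R} s"
  by (auto simp: kernel_def indicator_def)

lemma kernel_diff: "0 < N \<Longrightarrow> - N < x \<Longrightarrow> kernel x s = indicator {-N<..x} s - indicator {-N<..0} s"
  by (auto simp: kernel_def indicator_def)

lemma kernel_tendsto:
  assumes X: "X \<longlonglongrightarrow> x" and "s \<noteq> x"
  shows "(\<lambda>n. kernel (X n) s) \<longlonglongrightarrow> kernel x s"
proof (cases "s < x")
  case True
  from order_tendstoD(1)[OF X this] have "\<forall>\<^sub>F n in sequentially. kernel (X n) s = kernel x s"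
    by eventually_elim (use True in \<open>auto simp: kernel_def\<close>)
  then show ?thesis by (rule tendsto_eventually)
next
  case False
  then have "x < s" using assms by simp
  from order_tendstoD(2)[OF X this] have "\<forall>\<^sub>F n in sequentially. kernel (X n) s = kernel x s"
    by eventually_elim (use \<open>x < s\<close> in \<open>auto simp: kernel_def\<close>)
  then show ?thesis by (rule tendsto_eventually)
qed

text \<open>As a function of x the kernel is 1 on \<open>{s..}\<close> if s > 0 and -1 on
  \<open>{..<s}\<close> otherwise, and 0 elsewhere. In both cases it jumps up by one at s, so its
  weak derivative is the Dirac mass at s.\<close>

lemma kernel_test_integral:
  assumes "test1 \<psi>"
  shows "(\<integral>x. deriv \<psi> x * kernel x s \<partial>lborel) = - \<psi> s"
proof (cases "0 < s")
  case True
  then have *: "(\<lambda>x. deriv \<psi> x * kernel x s) = (\<lambda>x. indicator {s..} x * deriv \<psi> x)"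
    by (auto simp: kernel_def indicator_def)
  show ?thesis unfolding * using test1_integral_deriv(1)[OF assms, of s] by simp
next
  case False
  then have *: "(\<lambda>x. deriv \<psi> x * kernel x s) = (\<lambda>x. - (indicator {..<s} x * deriv \<psi> x))"
    by (auto simp: kernel_def indicator_def)
  show ?thesis unfolding * using test1_integral_deriv(2)[OF assms, of s] by simp
qed

lemma loc_int1_bound:
  assumes h: "loc_int1 h" and [measurable]: "k \<in> borel_measurable borel"
    and k: "\<And>s. \<bar>k s\<bar> \<le> B * indicator {-R..R} s"
  shows "integrable lborel (\<lambda>s. k s * h s)"
proof (rule Bochner_Integration.integrable_bound)
  show "integrable lborel (\<lambda>z. B * (indicator {-R..R} z * h z))"
    using h by (simp add: loc_int1_def)
  show "AE z in lborel. norm (k z * h z) \<le> norm (B * (indicator {-R..R} z * h z))"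
  proof (rule AE_I2)
    fix z
    have "\<bar>k z\<bar> * \<bar>h z\<bar> \<le> (\<bar>B\<bar> * indicator {-R..R} z) * \<bar>h z\<bar>"
      using k[of z] by (intro mult_right_mono) (auto simp: indicator_def split: if_splits)
    then show "norm (k z * h z) \<le> norm (B * (indicator {-R..R} z * h z))"
      by (simp add: abs_mult mult.assoc)
  qed
  have [measurable]: "h \<in> borel_measurable borel" using h by (simp add: loc_int1_def)
  show "(\<lambda>z. k z * h z) \<in> borel_measurable lborel" by measurable
qed

lemma integrable_kernel: "loc_int1 h \<Longrightarrow> integrable lborel (\<lambda>s. kernel x s * h s)"
  using kernel_le[of x "\<bar>x\<bar>"] by (intro loc_int1_bound[where B=1 and R="\<bar>x\<bar>"]) simp_all

lemma primitive_bound: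
  assumes "loc_int1 h" "\<bar>x\<bar> \<le> R"
  shows "\<bar>primitive h x\<bar> \<le> (\<integral>s. \<bar>indicator {-R..R} s * h s\<bar> \<partial>lborel)"
proof -
  have "norm (primitive h x) \<le> (\<integral>s. \<bar>indicator {-R..R} s * h s\<bar> \<partial>lborel)"
    unfolding primitive_def
  proof (rule Bochner_Integration.integral_norm_bound_integral)
    show "integrable lborel (\<lambda>s. \<bar>indicator {-R..R} s * h s\<bar>)"
      using assms by (intro integrable_abs) (simp add: loc_int1_def)
    show "norm (kernel x s * h s) \<le> \<bar>indicator {-R..R} s * h s\<bar>" for s
      using mult_right_mono[OF kernel_le[OF assms(2), of s], of "\<bar>h s\<bar>"] by (simp add: abs_mult)
  qed (rule integrable_kernel[OF assms(1)])
  then show ?thesis by simp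
qed

lemma test1_sup: "test1 \<psi> \<Longrightarrow> \<exists>B R. R > 0 \<and> B > 0 \<and> (\<forall>x. \<bar>\<psi> x\<bar> \<le> B * indicator {-R..R} x)"
proof -
  assume t: "test1 \<psi>"
  obtain B R where "B > 0" "\<forall>x. \<bar>\<psi> x\<bar> \<le> B" "R > 0" and R: "\<forall>x. R < \<bar>x\<bar> \<longrightarrow> \<psi> x = 0"
    using test1_bounded[OF t] test1_zero_outside[OF t] by blast
  moreover from this have "\<bar>\<psi> x\<bar> \<le> B * indicator {-R..R} x" for x
  proof (cases "R < \<bar>x\<bar>")
    case False
    then have "x \<in> {-R..R}" by auto
    then show ?thesis using \<open>\<forall>x. \<bar>\<psi> x\<bar> \<le> B\<close> by simp
  qed (simp add: R)
  ultimately show ?thesis by blast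
qed

text \<open>Fubini exchanges the integrals over x and s, and \<open>kernel_test_integral\<close>
  evaluates the inner one.\<close>

lemma primitive_test:
  assumes h: "loc_int1 h" and t: "test1 \<psi>"
  shows "(\<integral>x. deriv \<psi> x * primitive h x \<partial>lborel) = - (\<integral>s. \<psi> s * h s \<partial>lborel)"
proof -
  let ?f = "\<lambda>x s. deriv \<psi> x * (kernel x s * h s)"
  have [measurable]: "h \<in> borel_measurable borel" "deriv \<psi> \<in> borel_measurable borel"
    using h t by (auto simp: loc_int1_def intro!: test1_measurable test1_deriv)
  obtain B R where R: "\<forall>x. \<bar>deriv \<psi> x\<bar> \<le> B * indicator {-R..R} x" "R > 0"
    using test1_sup[OF test1_deriv[OF t]] by blast
  \<comment> \<open>The dominating product: x is confined to the support of
    \<open>deriv \<psi>\<close>, and then s to the same symmetric interval, because the kernel lives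
    between 0 and x.\<close>
  have "integrable lborel (\<lambda>z. (B * indicator {-R..R} (fst z)) * (indicator {-R..R} (snd z) * h (snd z)))"
  proof (rule integrable_product_lborel)
    show "integrable lborel (\<lambda>x. B * indicator {-R..R} x)"
      using R(2) by (intro integrable_mult_right integrable_real_indicator) auto
  qed (use h in \<open>simp add: loc_int1_def\<close>)
  then have "integrable lborel (\<lambda>z. ?f (fst z) (snd z))"
  proof (rule Bochner_Integration.integrable_bound)
    show "AE z in lborel. norm (?f (fst z) (snd z))
       \<le> norm ((B * indicator {-R..R} (fst z)) * (indicator {-R..R} (snd z) * h (snd z)))"
    proof (rule AE_I2)
      fix z :: "real \<times> real"
      show "norm (?f (fst z) (snd z))
       \<le> norm ((B * indicator {-R..R} (fst z)) * (indicator {-R..R} (snd z) * h (snd z)))"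
      proof (cases "\<bar>fst z\<bar> \<le> R")
        case True
        have "\<bar>deriv \<psi> (fst z)\<bar> * (\<bar>kernel (fst z) (snd z)\<bar> * \<bar>h (snd z)\<bar>)
          \<le> (\<bar>B\<bar> * indicator {-R..R} (fst z)) * (indicator {-R..R} (snd z) * \<bar>h (snd z)\<bar>)"
        proof (intro mult_mono mult_right_mono kernel_le[OF True])
          show "\<bar>deriv \<psi> (fst z)\<bar> \<le> \<bar>B\<bar> * indicator {- R..R} (fst z)"
            using R(1)[rule_format, of "fst z"] by (auto simp: indicator_def split: if_splits)
        qed auto
        then show ?thesis by (simp add: abs_mult)
      next
        case False
        then have "indicator {-R..R} (fst z) = (0 :: real)"
            by (intro indicator_simps(2)) auto
        with R(1)[rule_format, of "fst z"] have "deriv \<psi> (fst z) = 0" by simp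
        then show ?thesis by simp
      qed
    qed
  qed measurable
  then have int: "integrable (lborel \<Otimes>\<^sub>M lborel) (\<lambda>(x, s). ?f x s)"
    by (simp only: lborel_prod case_prod_beta')
  have "(\<integral>x. deriv \<psi> x * primitive h x \<partial>lborel) = (\<integral>x. (\<integral>s. ?f x s \<partial>lborel) \<partial>lborel)"
    by (simp add: primitive_def)
  also have "\<dots> = (\<integral>s. (\<integral>x. ?f x s \<partial>lborel) \<partial>lborel)"
    by (rule lborel_pair.Fubini_integral[OF int, symmetric])
  also have "\<dots> = (\<integral>s. h s * (\<integral>x. deriv \<psi> x * kernel x s \<partial>lborel) \<partial>lborel)"
  proof (rule Bochner_Integration.integral_cong[OF refl])
    fix s
    have "?f x s = h s * (deriv \<psi> x * kernel x s)" for x by simp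
    then show "(\<integral>x. ?f x s \<partial>lborel) = h s * (\<integral>x. deriv \<psi> x * kernel x s \<partial>lborel)"
      by (simp only: integral_mult_right_zero)
  qed
  also have "\<dots> = (\<integral>s. - (\<psi> s * h s) \<partial>lborel)"
    by (simp add: kernel_test_integral[OF t] mult.commute)
  finally show ?thesis by simp
qed

lemma continuous_loc_int1: "continuous_on UNIV h \<Longrightarrow> loc_int1 h"
  unfolding loc_int1_def
proof (intro conjI allI)
  assume h: "continuous_on UNIV h"
  then show "h \<in> borel_measurable borel" by (rule borel_measurable_continuous_onI)
  fix R
  have "integrable lborel (\<lambda>x. indicator {-R..R} x *\<^sub>R h x)"
    by (rule borel_integrable_compact) (auto intro: continuous_on_subset[OF h])
  then show "integrable lborel (\<lambda>x. indicator {-R..R} x * h x)" by simp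
qed

lemma continuous_loc_int: "continuous_on UNIV f \<Longrightarrow> loc_int f"
  unfolding loc_int_def
proof (intro conjI allI)
  assume h: "continuous_on UNIV f"
  then show "f \<in> borel_measurable borel" by (rule borel_measurable_continuous_onI)
  fix R
  have "integrable lborel (\<lambda>x. indicator (square R) x *\<^sub>R f x)"
    unfolding square_def
    by (rule borel_integrable_compact) (auto intro: continuous_on_subset[OF h] compact_Times)
  then show "integrable lborel (\<lambda>x. indicator (square R) x * f x)" by simp
qed

lemma primitive_deriv:
  assumes h: "continuous_on UNIV h"
  shows "(primitive h has_real_derivative h x) (at x)"
proof -
  define N where "N = \<bar>x\<bar> + 1"
  have N: "0 < N" "- N < x" "x < N" by (auto simp: N_def)
  have hm [measurable]: "h \<in> borel_measurable borel" using h by (rule borel_measurable_continuous_onI)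
  have set_int: "set_integrable lborel {-N..y} h" for y
    using h by (intro borel_integrable_atLeastAtMost') (auto intro: continuous_on_subset)
  have I: "(\<integral>s. indicator {-N<..y} s * h s \<partial>lborel) = integral {-N..y} h" for y
  proof -
    have "AE s in lborel. s \<noteq> - N" by (rule AE_lborel_singleton)
    then have "AE s in lborel. indicator {-N<..y} s * h s = indicator {-N..y} s *\<^sub>R h s"
      by eventually_elim (auto simp: indicator_def)
    then have "(\<integral>s. indicator {-N<..y} s * h s \<partial>lborel) = (\<integral>s. indicator {-N..y} s *\<^sub>R h s \<partial>lborel)"
      by (intro integral_cong_AE) simp_all
    also have "\<dots> = integral {-N..y} h"
      using set_borel_integral_eq_integral(2)[OF set_int[of y]] by (simp add: set_lebesgue_integral_def)
    finally show ?thesis .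
  qed
  have int: "integrable lborel (\<lambda>s. indicator {-N<..y} s * h s)" for y
    by (rule loc_int1_bound[OF continuous_loc_int1[OF h], where B=1 and R="max N \<bar>y\<bar>"])
      (auto simp: indicator_def)
  \<comment> \<open>To the right of -N the signed integral from 0 is a difference of two integrals
    with the fixed lower end -N, the form to which the fundamental theorem applies.\<close>
  have eq: "integral {-N..y} h - integral {-N..0} h = primitive h y" if "- N < y" for y
    unfolding primitive_def kernel_diff[OF N(1) that] left_diff_distrib
    by (subst Bochner_Integration.integral_diff) (auto intro: int simp: I)
  have "((\<lambda>y. integral {-N..y} h) has_real_derivative h x) (at x within {-N..N})"
    using N by (intro integral_has_real_derivative) (auto intro: continuous_on_subset[OF h])
  then have "((\<lambda>y. integral {-N..y} h) has_real_derivative h x) (at x)"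
    using N by (simp add: at_within_Icc_at)
  then have "((\<lambda>y. integral {-N..y} h - integral {-N..0} h) has_real_derivative h x) (at x)"
    using DERIV_diff[OF _ DERIV_const] by fastforce
  then show ?thesis
    by (rule has_field_derivative_transform_within_open[of _ _ _ "{-N<..}"]) (use N eq in auto)
qed

lemma primitive_0 [simp]: "primitive h 0 = 0"
proof -
  have "kernel 0 s = 0" for s by (simp add: kernel_def)
  then show ?thesis by (simp add: primitive_def)
qed

text \<open>A primitive that vanishes to the left of the support is constant to its right, with the
  total integral as value; mean zero is what makes its support compact.\<close>

lemma test1_primitive:
  assumes t: "test1 \<phi>" and 0: "(\<integral>x. \<phi> x \<partial>lborel) = 0"
  shows "\<exists>\<eta>. test1 \<eta> \<and> deriv \<eta> = \<phi>"
proof -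
  have c: "continuous_on UNIV \<phi>" using t by (simp add: test1_def smooth1_continuous)
  note l = continuous_loc_int1[OF c]
  obtain R where R: "R > 0" "\<forall>x. R < \<bar>x\<bar> \<longrightarrow> \<phi> x = 0"
    using test1_zero_outside[OF t] by blast
  \<comment> \<open>The value of the primitive to the left of the support, subtracted so that \<eta>
    vanishes there.\<close>
  define a where "a = primitive \<phi> (- (R + 1))"
  define \<eta> where "\<eta> = (\<lambda>x. primitive \<phi> x - a)"
  have d: "(\<eta> has_real_derivative \<phi> x) (at x)" for x
    using DERIV_diff[OF primitive_deriv[OF c, of x] DERIV_const[of a]] by (simp add: \<eta>_def)
  have eq: "\<eta> x = \<integral>s. (kernel x s - kernel (- (R + 1)) s) * \<phi> s \<partial>lborel" for x
    unfolding \<eta>_def a_def primitive_def left_diff_distrib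
    by (rule Bochner_Integration.integral_diff[symmetric]) (rule integrable_kernel[OF l])+
  have "\<eta> x = 0" if "R + 1 < \<bar>x\<bar>" for x
  proof (cases "x < 0")
    case True
    have eq0: "(\<lambda>s. (kernel x s - kernel (- (R + 1)) s) * \<phi> s) = (\<lambda>s. 0)"
    proof (rule ext)
      fix s
      show "(kernel x s - kernel (- (R + 1)) s) * \<phi> s = 0"
    proof (cases "R < \<bar>s\<bar>")
      case False
      then have "kernel x s = kernel (- (R + 1)) s" using True that by (auto simp: kernel_def)
      then show ?thesis by simp
      qed (simp add: R(2))
    qed
    then show ?thesis unfolding eq eq0 by simp
  next
    case False
    have eq0: "(\<lambda>s. (kernel x s - kernel (- (R + 1)) s) * \<phi> s) = \<phi>"
    proof (rule ext)
      fix s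
      show "(kernel x s - kernel (- (R + 1)) s) * \<phi> s = \<phi> s"
    proof (cases "R < \<bar>s\<bar>")
      case s: False
      then have "kernel x s = kernel (- (R + 1)) s + 1" using False that by (auto simp: kernel_def)
      then show ?thesis by simp
      qed (simp add: R(2))
    qed
    then show ?thesis unfolding eq eq0 using 0 by simp
  qed
  moreover have "smooth1 \<eta>" by (rule smooth1I[OF d]) (use t in \<open>simp add: test1_def\<close>)
  moreover have "deriv \<eta> = \<phi>" by (rule ext) (rule DERIV_imp_deriv[OF d])
  ultimately show ?thesis unfolding test1_def by blast
qed

lemma test1_add: "test1 f \<Longrightarrow> test1 g \<Longrightarrow> test1 (\<lambda>x. f x + g x)"
proof -
  assume *: "test1 f" "test1 g"
  then obtain R S where "\<forall>x. R < \<bar>x\<bar> \<longrightarrow> f x = 0" "\<forall>x. S < \<bar>x\<bar> \<longrightarrow> g x = 0"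
    by (auto simp: test1_def)
  then have "\<forall>x. max R S < \<bar>x\<bar> \<longrightarrow> f x + g x = 0" by simp
  with * show ?thesis unfolding test1_def by (blast intro: smooth1_add)
qed

lemma test1_cmult: "test1 f \<Longrightarrow> test1 (\<lambda>x. c * f x)"
  using smooth1_mult[OF smooth1_const[of c], of f] unfolding test1_def by auto

lemma test1_normalized: "\<exists>\<rho>. test1 \<rho> \<and> (\<integral>x. \<rho> x \<partial>lborel) = 1"
proof -
  have [measurable]: "box_bump c d n \<in> borel_measurable borel" for c d n
    by (intro test1_measurable box_bump_test)
  have "(\<lambda>n. \<integral>x. box_bump 0 1 n x \<partial>lborel) \<longlonglongrightarrow> (\<integral>x. indicator {0<..<1 :: real} x \<partial>lborel)"
  proof (rule integral_dominated_convergence)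
    show "integrable lborel (indicator {0..1} :: real \<Rightarrow> real)"
      by (intro integrable_real_indicator) auto
    show "AE x in lborel. (\<lambda>n. box_bump 0 1 n x) \<longlonglongrightarrow> indicator {0<..<1} x"
      by (intro AE_I2 box_bump_lim)
    show "AE x in lborel. norm (box_bump 0 1 n x) \<le> indicator {0..1} x" for n
      using box_bump_le_indicator[of 0 1 n] by simp
  qed simp_all
  then have "(\<lambda>n. \<integral>x. box_bump 0 1 n x \<partial>lborel) \<longlonglongrightarrow> 1" by simp
  then have "\<forall>\<^sub>F n in sequentially. 0 < (\<integral>x. box_bump 0 1 n x \<partial>lborel)"
    by (rule order_tendstoD(1)) simp
  then obtain n where "0 < (\<integral>x. box_bump 0 1 n x \<partial>lborel)"
    using eventually_happens' sequentially_bot by blast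
  then show ?thesis
    by (intro exI[of _ "\<lambda>x. inverse (\<integral>x. box_bump 0 1 n x \<partial>lborel) * box_bump 0 1 n x"] conjI
        test1_cmult box_bump_test) simp
qed

section \<open>Primitives along horizontal lines\<close>

lemma loc_int_horizontal:
  assumes g: "loc_int g"
  shows "AE y in lborel. loc_int1 (\<lambda>s. g (s, y))"
proof -
  have [measurable]: "g \<in> borel_measurable borel" using g by (rule loc_int_measurable)
  have "AE y in lborel. integrable lborel (\<lambda>s. indicator (square (real n)) (s, y) * g (s, y))" for n
  proof -
    have "integrable (lborel \<Otimes>\<^sub>M lborel) (\<lambda>(s, y). indicator (square (real n)) (s, y) * g (s, y))"
      using g by (simp add: loc_int_def lborel_prod case_prod_beta')
    then show ?thesis by (rule lborel_pair.AE_integrable_snd)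
  qed
  then have "AE y in lborel. \<forall>n. integrable lborel (\<lambda>s. indicator (square (real n)) (s, y) * g (s, y))"
    unfolding AE_all_countable by (rule allI)
  then show ?thesis
  proof eventually_elim
    case (elim y)
    show ?case unfolding loc_int1_def
    proof (intro conjI allI)
      fix R
      obtain n where n: "\<bar>R\<bar> + \<bar>y\<bar> < real n" using reals_Archimedean2 by blast
      have "integrable lborel (\<lambda>s. indicator {-R..R} s *\<^sub>R (indicator (square (real n)) (s, y) * g (s, y)))"
        by (rule integrable_mult_indicator) (use elim in auto)
      moreover have "(\<lambda>s. indicator {-R..R} s *\<^sub>R (indicator (square (real n)) (s, y) * g (s, y)))
          = (\<lambda>s. indicator {-R..R} s * g (s, y))"
        using n by (intro ext) (auto simp: indicator_def square_def)
      ultimately show "integrable lborel (\<lambda>s. indicator {-R..R} s * g (s, y))" by simp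
    qed measurable
  qed
qed

lemma loc_int_swap: "loc_int f \<Longrightarrow> loc_int (\<lambda>z. f (prod.swap z))"
  unfolding loc_int_def
proof (intro conjI allI)
  assume f: "f \<in> borel_measurable borel \<and> (\<forall>R. integrable lborel (\<lambda>z. indicator (square R) z * f z))"
  then have [measurable]: "f \<in> borel_measurable borel" by simp
  have [measurable]: "(prod.swap :: real \<times> real \<Rightarrow> _) \<in> borel_measurable borel"
    by (intro borel_measurable_continuous_onI continuous_intros)
  show "(\<lambda>z. f (prod.swap z)) \<in> borel_measurable borel" by measurable
  fix R
  have "integrable (lborel \<Otimes>\<^sub>M lborel) (\<lambda>z. indicator (square R) z * f z)"
    using f by (simp add: lborel_prod)
  from lborel_pair.integrable_product_swap[OF this]
  have "integrable lborel (\<lambda>z. indicator (square R) (prod.swap z) * f (prod.swap z))"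
    by (simp add: lborel_prod case_prod_beta' prod.swap_def)
  moreover have "indicator (square R) (prod.swap z) = (indicator (square R) z :: real)" for z
    by (cases z) (auto simp: square_def indicator_def)
  ultimately show "integrable lborel (\<lambda>z. indicator (square R) z * f (prod.swap z))" by simp
qed

definition primitive1 :: "(real \<times> real \<Rightarrow> real) \<Rightarrow> real \<times> real \<Rightarrow> real" where
  "primitive1 g z = primitive (\<lambda>s. g (s, snd z)) (fst z)"

lemma primitive1_measurable [measurable]:
  assumes [measurable]: "g \<in> borel_measurable borel"
  shows "primitive1 g \<in> borel_measurable borel"
proof -
  have "(\<lambda>z. \<integral>s. kernel (fst z) s * g (s, snd z) \<partial>lborel) \<in> borel_measurable borel"
    by (intro lborel.borel_measurable_lebesgue_integral) measurable
  then show ?thesis by (simp add: primitive1_def[abs_def] primitive_def)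
qed

lemma loc_int_horizontal_mass:
  assumes g: "loc_int g"
  shows "integrable lborel (\<lambda>y. \<integral>s. \<bar>indicator (square R) (s, y) * g (s, y)\<bar> \<partial>lborel)"
proof -
  have "integrable (lborel \<Otimes>\<^sub>M lborel) (\<lambda>(s, y). \<bar>indicator (square R) (s, y) * g (s, y)\<bar>)"
    using g by (simp add: loc_int_def lborel_prod case_prod_beta' del: abs_mult)
  then show ?thesis by (rule lborel_pair.integrable_snd)
qed

text \<open>On a square the primitive along a horizontal line is bounded by the mass of g on that
  line, a function of y alone that Fubini shows to be integrable.\<close>

lemma loc_int_primitive1:
  assumes g: "loc_int g"
  shows "loc_int (primitive1 g)"
proof (rule loc_intI)
  have [measurable]: "g \<in> borel_measurable borel" using g by (rule loc_int_measurable)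
  show "primitive1 g \<in> borel_measurable borel" by measurable
  let ?A = "\<lambda>R y. \<integral>s. \<bar>indicator (square R) (s, y) * g (s, y)\<bar> \<partial>lborel"
  fix R
  show "integrable lborel (\<lambda>z. indicator {-R..R} (fst z) * ?A R (snd z))"
  proof (rule integrable_product_lborel)
    show "integrable lborel (indicator {-R..R} :: real \<Rightarrow> real)"
      by (intro integrable_real_indicator) (simp_all add: emeasure_lborel_Icc_eq)
  qed (rule loc_int_horizontal_mass[OF g])
  from AE_snd[OF loc_int_horizontal[OF g]]
  show "AE z in lborel. \<bar>indicator (square R) z * primitive1 g z\<bar> \<le> indicator {-R..R} (fst z) * ?A R (snd z)"
  proof eventually_elim
    case (elim z)
    show ?case
    proof (cases "z \<in> square R")
      case True
      then have z: "\<bar>fst z\<bar> \<le> R" "fst z \<in> {-R..R}" "snd z \<in> {-R..R}" by (auto simp: square_def)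
      have "(\<lambda>s. \<bar>indicator {-R..R} s * g (s, snd z)\<bar>) = (\<lambda>s. \<bar>indicator (square R) (s, snd z) * g (s, snd z)\<bar>)"
        using z by (intro ext) (simp add: indicator_square)
      then show ?thesis
        using primitive_bound[OF elim z(1)] True z by (simp add: primitive1_def)
    next
      case False
      have "0 \<le> ?A R (snd z)" by (rule Bochner_Integration.integral_nonneg) simp
      with False show ?thesis by simp
    qed
  qed
qed

text \<open>On almost every horizontal line \<open>primitive_test\<close> applies; the result is
  integrated over y.\<close>

lemma primitive1_test:
  assumes g: "loc_int g" and t: "test1 \<psi>" "test1 \<eta>"
  shows "(\<integral>z. deriv \<psi> (fst z) * \<eta> (snd z) * primitive1 g z \<partial>lborel)
    = - (\<integral>z. \<psi> (fst z) * \<eta> (snd z) * g z \<partial>lborel)"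
proof -
  have i1: "integrable (lborel \<Otimes>\<^sub>M lborel) (\<lambda>(x, y). deriv \<psi> x * \<eta> y * primitive1 g (x, y))"
    using integrable_test_product[OF test1_deriv[OF t(1)] t(2) loc_int_primitive1[OF g]]
    by (simp only: lborel_prod case_prod_beta' prod.collapse)
  have i2: "integrable (lborel \<Otimes>\<^sub>M lborel) (\<lambda>(x, y). \<psi> x * \<eta> y * g (x, y))"
    using integrable_test_product[OF t g]
    by (simp only: lborel_prod case_prod_beta' prod.collapse)
  have "(\<integral>z. deriv \<psi> (fst z) * \<eta> (snd z) * primitive1 g z \<partial>lborel)
     = (\<integral>y. (\<integral>x. deriv \<psi> x * \<eta> y * primitive1 g (x, y) \<partial>lborel) \<partial>lborel)"
    using lborel_pair.integral_snd[OF i1] by (simp only: lborel_prod case_prod_beta' prod.collapse)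
  also have "\<dots> = (\<integral>y. - (\<integral>x. \<psi> x * \<eta> y * g (x, y) \<partial>lborel) \<partial>lborel)"
  proof (rule integral_cong_AE)
    show "(\<lambda>y. \<integral>x. deriv \<psi> x * \<eta> y * primitive1 g (x, y) \<partial>lborel) \<in> borel_measurable lborel"
      using lborel_pair.integrable_snd[OF i1] by (rule borel_measurable_integrable)
    show "(\<lambda>y. - (\<integral>x. \<psi> x * \<eta> y * g (x, y) \<partial>lborel)) \<in> borel_measurable lborel"
      using lborel_pair.integrable_snd[OF i2] by (intro borel_measurable_uminus borel_measurable_integrable)
    from loc_int_horizontal[OF g]
    show "AE y in lborel. (\<integral>x. deriv \<psi> x * \<eta> y * primitive1 g (x, y) \<partial>lborel)
      = - (\<integral>x. \<psi> x * \<eta> y * g (x, y) \<partial>lborel)"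
    proof eventually_elim
      case (elim y)
      have "(\<integral>x. deriv \<psi> x * \<eta> y * primitive1 g (x, y) \<partial>lborel)
        = (\<integral>x. \<eta> y * (deriv \<psi> x * primitive (\<lambda>s. g (s, y)) x) \<partial>lborel)"
        by (simp add: primitive1_def mult_ac)
      also have "\<dots> = - (\<eta> y * (\<integral>x. \<psi> x * g (x, y) \<partial>lborel))"
        by (simp add: primitive_test[OF elim t(1)])
      also have "\<dots> = - (\<integral>x. \<eta> y * (\<psi> x * g (x, y)) \<partial>lborel)" by simp
      also have "\<dots> = - (\<integral>x. \<psi> x * \<eta> y * g (x, y) \<partial>lborel)" by (simp add: mult_ac)
      finally show ?case .
    qed
  qed
  also have "\<dots> = - (\<integral>z. \<psi> (fst z) * \<eta> (snd z) * g z \<partial>lborel)"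
    using lborel_pair.integral_snd[OF i2]
    by (simp only: lborel_prod case_prod_beta' prod.collapse Bochner_Integration.integral_minus)
  finally show ?thesis .
qed

lemma loc_int_snd:
  assumes c: "loc_int1 c"
  shows "loc_int (\<lambda>z. c (snd z))"
  unfolding loc_int_def
proof (intro conjI allI)
  have [measurable]: "c \<in> borel_measurable borel" using c by (simp add: loc_int1_def)
  show "(\<lambda>z :: real \<times> real. c (snd z)) \<in> borel_measurable borel" by measurable
  fix R
  have "integrable lborel (\<lambda>z. indicator {-R..R} (fst z) * (indicator {-R..R} (snd z) * c (snd z)))"
    using c by (intro integrable_product_lborel integrable_real_indicator)
      (simp_all add: emeasure_lborel_Icc_eq loc_int1_def)
  then show "integrable lborel (\<lambda>z. indicator (square R) z * c (snd z))"
    by (simp add: indicator_square mult.assoc)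
qed

lemma loc_int_diff: "loc_int f \<Longrightarrow> loc_int g \<Longrightarrow> loc_int (\<lambda>z. f z - g z)"
  unfolding loc_int_def by (auto simp: right_diff_distrib)

text \<open>With \<rho> of integral one, every test function is a multiple of \<rho> plus the
  derivative of a test function. Hence F sees only the integral of \<psi>, and equals the function
  of y obtained by averaging it against \<rho>.\<close>

lemma loc_int_deriv_zero:
  assumes F: "loc_int F"
    and test: "\<And>\<psi> \<eta>. test1 \<psi> \<Longrightarrow> test1 \<eta> \<Longrightarrow> (\<integral>z. deriv \<psi> (fst z) * \<eta> (snd z) * F z \<partial>lborel) = 0"
  shows "\<exists>c. loc_int1 c \<and> (AE z in lborel. F z = c (snd z))"
proof -
  have [measurable]: "F \<in> borel_measurable borel" using F by (rule loc_int_measurable)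
  obtain \<rho> where \<rho>: "test1 \<rho>" "(\<integral>x. \<rho> x \<partial>lborel) = 1" using test1_normalized by blast
  have [measurable]: "\<rho> \<in> borel_measurable borel" using \<rho>(1) by (rule test1_measurable)
  define c where "c y = (\<integral>x. \<rho> x * F (x, y) \<partial>lborel)" for y
  have cm: "c \<in> borel_measurable borel"
  proof -
    have "(\<lambda>y. \<integral>x. \<rho> x * F (x, y) \<partial>lborel) \<in> borel_measurable borel"
      by (intro lborel.borel_measurable_lebesgue_integral) measurable
    then show ?thesis by (simp add: c_def[abs_def])
  qed
  have c: "loc_int1 c" unfolding loc_int1_def
  proof (intro conjI allI cm)
    fix R
    obtain B S where S: "\<forall>x. \<bar>\<rho> x\<bar> \<le> B * indicator {-S..S} x" "B > 0"
      using test1_sup[OF \<rho>(1)] by blast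
    have "integrable lborel (\<lambda>z. (\<rho> (fst z) * indicator {-R..R} (snd z)) * F z)"
    proof (rule loc_int_bound[OF F, where B=B and R="max R S"])
      fix z
      have "\<bar>\<rho> (fst z) * indicator {-R..R} (snd z)\<bar> \<le> (B * indicator {-S..S} (fst z)) * indicator {-R..R} (snd z)"
        unfolding abs_mult using S by (intro mult_mono) auto
      also have "\<dots> \<le> B * indicator (square (max R S)) z"
        using S(2) by (auto simp: indicator_def square_def mem_Times_iff)
      finally show "\<bar>\<rho> (fst z) * indicator {-R..R} (snd z)\<bar> \<le> B * indicator (square (max R S)) z" .
    qed measurable
    then have "integrable (lborel \<Otimes>\<^sub>M lborel) (\<lambda>(x, y). (\<rho> x * indicator {-R..R} y) * F (x, y))"
      by (simp only: lborel_prod case_prod_beta' prod.collapse)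
    from lborel_pair.integrable_snd[OF this]
    have "integrable lborel (\<lambda>y. \<integral>x. indicator {-R..R} y * (\<rho> x * F (x, y)) \<partial>lborel)"
      by (simp add: mult_ac)
    then show "integrable lborel (\<lambda>y. indicator {-R..R} y * c y)" by (simp add: c_def)
  qed
  have "AE z in lborel. F z - c (snd z) = 0"
  proof (rule loc_int_AE_zero[OF loc_int_diff[OF F loc_int_snd[OF c]]])
    fix \<psi> \<eta> assume t: "test1 \<psi>" "test1 \<eta>"
    define m where "m = (\<integral>x. \<psi> x \<partial>lborel)"
    \<comment> \<open>Removing the multiple of \<rho> leaves a test function of integral zero, hence
      the derivative of a test function, on which F vanishes by hypothesis.\<close>
    have "(\<integral>x. \<psi> x + (- m) * \<rho> x \<partial>lborel) = 0"
      using test1_integrable[OF t(1)] test1_integrable[OF \<rho>(1)] \<rho>(2) by (simp add: m_def)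
    with test1_add[OF t(1) test1_cmult[OF \<rho>(1)], of "- m"]
    obtain \<psi>' where \<psi>': "test1 \<psi>'" "deriv \<psi>' = (\<lambda>x. \<psi> x + (- m) * \<rho> x)"
      using test1_primitive by blast
    have iF: "integrable lborel (\<lambda>z. \<psi> (fst z) * \<eta> (snd z) * F z)"
      "integrable lborel (\<lambda>z. \<rho> (fst z) * \<eta> (snd z) * F z)"
      by (intro integrable_test_product t \<rho> F)+
    have "0 = (\<integral>z. deriv \<psi>' (fst z) * \<eta> (snd z) * F z \<partial>lborel)"
      using test[OF \<psi>'(1) t(2)] by simp
    also have "\<dots> = (\<integral>z. \<psi> (fst z) * \<eta> (snd z) * F z - m * (\<rho> (fst z) * \<eta> (snd z) * F z) \<partial>lborel)"
      by (simp add: \<psi>'(2) algebra_simps)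
    also have "\<dots> = (\<integral>z. \<psi> (fst z) * \<eta> (snd z) * F z \<partial>lborel) - m * (\<integral>z. \<rho> (fst z) * \<eta> (snd z) * F z \<partial>lborel)"
      using iF by simp
    finally have 1: "(\<integral>z. \<psi> (fst z) * \<eta> (snd z) * F z \<partial>lborel) = m * (\<integral>z. \<rho> (fst z) * \<eta> (snd z) * F z \<partial>lborel)"
      by simp
    have "integrable (lborel \<Otimes>\<^sub>M lborel) (\<lambda>(x, y). \<rho> x * \<eta> y * F (x, y))"
      using iF(2) by (simp only: lborel_prod case_prod_beta' prod.collapse)
    from lborel_pair.integral_snd[OF this]
    have 2: "(\<integral>z. \<rho> (fst z) * \<eta> (snd z) * F z \<partial>lborel) = (\<integral>y. (\<integral>x. \<rho> x * \<eta> y * F (x, y) \<partial>lborel) \<partial>lborel)"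
      by (simp only: lborel_prod case_prod_beta' prod.collapse)
    also have "\<dots> = (\<integral>y. (\<integral>x. \<eta> y * (\<rho> x * F (x, y)) \<partial>lborel) \<partial>lborel)"
      by (simp add: mult_ac)
    also have "\<dots> = (\<integral>y. \<eta> y * c y \<partial>lborel)" by (simp add: c_def)
    finally have 2: "(\<integral>z. \<rho> (fst z) * \<eta> (snd z) * F z \<partial>lborel) = (\<integral>y. \<eta> y * c y \<partial>lborel)" .
    have ic: "integrable lborel (\<lambda>z. \<psi> (fst z) * \<eta> (snd z) * c (snd z))"
      by (intro integrable_test_product t loc_int_snd c)
    then have "integrable (lborel \<Otimes>\<^sub>M lborel) (\<lambda>(x, y). \<psi> x * \<eta> y * c y)"
      by (simp only: lborel_prod case_prod_beta')
    from lborel_pair.integral_snd[OF this]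
    have "(\<integral>z. \<psi> (fst z) * \<eta> (snd z) * c (snd z) \<partial>lborel) = (\<integral>y. (\<integral>x. \<psi> x * \<eta> y * c y \<partial>lborel) \<partial>lborel)"
      by (simp only: lborel_prod case_prod_beta')
    also have "\<dots> = m * (\<integral>y. \<eta> y * c y \<partial>lborel)"
      by (simp add: m_def mult.assoc)
    finally have 3: "(\<integral>z. \<psi> (fst z) * \<eta> (snd z) * c (snd z) \<partial>lborel) = m * (\<integral>y. \<eta> y * c y \<partial>lborel)" .
    show "(\<integral>z. \<psi> (fst z) * \<eta> (snd z) * (F z - c (snd z)) \<partial>lborel) = 0"
      using iF(1) ic 1 2 3 by (simp add: right_diff_distrib)
  qed
  with c show ?thesis by auto
qed

section \<open>Weak partial derivatives of functions on pairs\<close>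

definition weak1 :: "(real \<times> real \<Rightarrow> real) \<Rightarrow> (real \<times> real \<Rightarrow> real) \<Rightarrow> bool" where
  "weak1 f g \<longleftrightarrow> (\<forall>\<psi> \<eta>. test1 \<psi> \<longrightarrow> test1 \<eta> \<longrightarrow>
     (\<integral>z. deriv \<psi> (fst z) * \<eta> (snd z) * f z \<partial>lborel) = - (\<integral>z. \<psi> (fst z) * \<eta> (snd z) * g z \<partial>lborel))"

text \<open>Exchanging the coordinates lets every statement about the first variable serve for the
  second.\<close>

definition swapped :: "(real \<times> real \<Rightarrow> real) \<Rightarrow> real \<times> real \<Rightarrow> real" where
  "swapped f z = f (prod.swap z)"

lemma loc_int_swapped: "loc_int f \<Longrightarrow> loc_int (swapped f)"
  using loc_int_swap[of f] by (simp add: swapped_def[abs_def])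

lemma swapped_swapped [simp]: "swapped (swapped f) = f"
  by (auto simp: swapped_def fun_eq_iff)

text \<open>Both f and \<open>primitive1 g\<close> have the weak derivative g in x, so their
  difference depends on y only.\<close>

lemma weak1_representation:
  assumes f: "loc_int f" and g: "loc_int g" and w: "weak1 f g"
  shows "\<exists>c. loc_int1 c \<and> (AE z in lborel. f z = c (snd z) + primitive1 g z)"
proof -
  have "\<exists>c. loc_int1 c \<and> (AE z in lborel. f z - primitive1 g z = c (snd z))"
  proof (rule loc_int_deriv_zero[OF loc_int_diff[OF f loc_int_primitive1[OF g]]])
    fix \<psi> \<eta> assume t: "test1 \<psi>" "test1 \<eta>"
    have "(\<integral>z. deriv \<psi> (fst z) * \<eta> (snd z) * (f z - primitive1 g z) \<partial>lborel)
       = (\<integral>z. deriv \<psi> (fst z) * \<eta> (snd z) * f z \<partial>lborel)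
         - (\<integral>z. deriv \<psi> (fst z) * \<eta> (snd z) * primitive1 g z \<partial>lborel)"
      unfolding right_diff_distrib
      by (intro Bochner_Integration.integral_diff integrable_test_product test1_deriv t f loc_int_primitive1 g)
    also have "\<dots> = 0"
      using w t primitive1_test[OF g t] by (simp add: weak1_def)
    finally show "(\<integral>z. deriv \<psi> (fst z) * \<eta> (snd z) * (f z - primitive1 g z) \<partial>lborel) = 0" .
  qed
  then obtain c where "loc_int1 c" and c: "AE z in lborel. f z - primitive1 g z = c (snd z)" by blast
  from c have "AE z in lborel. f z = c (snd z) + primitive1 g z"
    by eventually_elim simp
  with \<open>loc_int1 c\<close> show ?thesis by blast
qed

lemma convergent_bound:
  fixes X :: "nat \<Rightarrow> real"
  assumes "X \<longlonglongrightarrow> x"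
  shows "\<exists>R. \<bar>x\<bar> \<le> R \<and> (\<forall>n. \<bar>X n\<bar> \<le> R)"
proof -
  from convergent_imp_Bseq[OF convergentI[OF assms]] obtain K where K: "\<forall>n. norm (X n) \<le> K"
    by (auto elim: BseqE)
  then show ?thesis by (intro exI[of _ "max K \<bar>x\<bar>"]) (auto simp: max.coboundedI1)
qed

lemma primitive_continuous:
  assumes h: "loc_int1 h"
  shows "continuous_on UNIV (primitive h)"
proof (rule continuous_on_sequentiallyI)
  fix X :: "nat \<Rightarrow> real" and x assume X: "X \<longlonglongrightarrow> x"
  obtain R where R: "\<bar>x\<bar> \<le> R" "\<forall>n. \<bar>X n\<bar> \<le> R" using convergent_bound[OF X] by blast
  have [measurable]: "h \<in> borel_measurable borel" using h by (simp add: loc_int1_def)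
  show "(\<lambda>n. primitive h (X n)) \<longlonglongrightarrow> primitive h x"
    unfolding primitive_def
  proof (rule integral_dominated_convergence)
    show "integrable lborel (\<lambda>s. \<bar>indicator {-R..R} s * h s\<bar>)"
      using h by (intro integrable_abs) (simp add: loc_int1_def)
    have "AE s in lborel. s \<noteq> x" by (rule AE_lborel_singleton)
    then show "AE s in lborel. (\<lambda>n. kernel (X n) s * h s) \<longlonglongrightarrow> kernel x s * h s"
      by eventually_elim (intro tendsto_mult tendsto_const kernel_tendsto[OF X])
    fix n
    have "\<bar>X n\<bar> \<le> R" using R by blast
    from mult_right_mono[OF kernel_le[OF this]]
    show "AE s in lborel. norm (kernel (X n) s * h s) \<le> \<bar>indicator {-R..R} s * h s\<bar>"
      by (simp add: abs_mult)
  qed measurable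
qed

text \<open>The signed integral of g over the rectangle spanned by the origin and z. It is
  continuous for every locally integrable g, because horizontal and vertical lines are null
  sets.\<close>

definition primitive2 :: "(real \<times> real \<Rightarrow> real) \<Rightarrow> real \<times> real \<Rightarrow> real" where
  "primitive2 g z = (\<integral>w. kernel (fst z) (fst w) * kernel (snd z) (snd w) * g w \<partial>lborel)"

lemma kernel2_le:
  assumes "\<bar>x\<bar> \<le> R" "\<bar>y\<bar> \<le> R"
  shows "\<bar>kernel x (fst w) * kernel y (snd w)\<bar> \<le> indicator (square R) w"
  unfolding abs_mult indicator_square by (intro mult_mono kernel_le assms) auto

lemma primitive2_continuous:
  assumes g: "loc_int g"
  shows "continuous_on UNIV (primitive2 g)"
proof (rule continuous_on_sequentiallyI)
  fix Z :: "nat \<Rightarrow> real \<times> real" and z assume Z: "Z \<longlonglongrightarrow> z"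
  have X: "(\<lambda>n. fst (Z n)) \<longlonglongrightarrow> fst z" and Y: "(\<lambda>n. snd (Z n)) \<longlonglongrightarrow> snd z"
    using Z by (auto intro: tendsto_fst tendsto_snd)
  obtain R1 where R1: "\<bar>fst z\<bar> \<le> R1" "\<forall>n. \<bar>fst (Z n)\<bar> \<le> R1" using convergent_bound[OF X] by blast
  obtain R2 where R2: "\<bar>snd z\<bar> \<le> R2" "\<forall>n. \<bar>snd (Z n)\<bar> \<le> R2" using convergent_bound[OF Y] by blast
  define R where "R = max R1 R2"
  have [measurable]: "g \<in> borel_measurable borel" using g by (rule loc_int_measurable)
  show "(\<lambda>n. primitive2 g (Z n)) \<longlonglongrightarrow> primitive2 g z"
    unfolding primitive2_def
  proof (rule integral_dominated_convergence)
    show "integrable lborel (\<lambda>w. \<bar>indicator (square R) w * g w\<bar>)"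
      using g by (intro integrable_abs) (simp add: loc_int_def)
    have "AE w in (lborel :: (real \<times> real) measure). fst w \<noteq> fst z"
      by (rule AE_fst) (rule AE_lborel_singleton)
    moreover have "AE w in (lborel :: (real \<times> real) measure). snd w \<noteq> snd z"
      by (rule AE_snd) (rule AE_lborel_singleton)
    ultimately show "AE w in lborel. (\<lambda>n. kernel (fst (Z n)) (fst w) * kernel (snd (Z n)) (snd w) * g w)
        \<longlonglongrightarrow> kernel (fst z) (fst w) * kernel (snd z) (snd w) * g w"
      by eventually_elim (intro tendsto_mult tendsto_const kernel_tendsto X Y)
    fix n
    have "\<bar>fst (Z n)\<bar> \<le> R" "\<bar>snd (Z n)\<bar> \<le> R" using R1 R2 by (auto simp: R_def max.coboundedI1 max.coboundedI2)
    from mult_right_mono[OF kernel2_le[OF this]]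
    show "AE w in lborel. norm (kernel (fst (Z n)) (fst w) * kernel (snd (Z n)) (snd w) * g w) \<le> \<bar>indicator (square R) w * g w\<bar>"
      by (simp add: abs_mult)
  qed measurable
qed

lemma primitive2_iterated:
  assumes g: "loc_int g"
  shows "primitive2 g (x, y) = (\<integral>r. kernel y r * primitive1 g (x, r) \<partial>lborel)"
proof -
  have [measurable]: "g \<in> borel_measurable borel" using g by (rule loc_int_measurable)
  define R where "R = max \<bar>x\<bar> \<bar>y\<bar>"
  have "integrable lborel (\<lambda>w. (kernel x (fst w) * kernel y (snd w)) * g w)"
    by (rule loc_int_bound[OF g, where B=1 and R=R])
      (use kernel2_le[of x R y] in \<open>simp_all add: R_def\<close>)
  then have "integrable (lborel \<Otimes>\<^sub>M lborel) (\<lambda>(s, r). (kernel x s * kernel y r) * g (s, r))"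
    by (simp only: lborel_prod case_prod_beta' prod.collapse)
  from lborel_pair.integral_snd[OF this]
  have "primitive2 g (x, y) = (\<integral>r. (\<integral>s. (kernel x s * kernel y r) * g (s, r) \<partial>lborel) \<partial>lborel)"
    by (simp only: lborel_prod case_prod_beta' prod.collapse primitive2_def fst_conv snd_conv)
  also have "\<dots> = (\<integral>r. (\<integral>s. kernel y r * (kernel x s * g (s, r)) \<partial>lborel) \<partial>lborel)"
    by (simp add: mult_ac)
  also have "\<dots> = (\<integral>r. kernel y r * primitive1 g (x, r) \<partial>lborel)"
    by (simp add: primitive1_def primitive_def)
  finally show ?thesis .
qed

text \<open>Integrate \<partial>2 f = g2 in y and insert g2 = e(y) plus the x-primitive of g12.
  Everything is then continuous except a function c of x, which so far is merely measurable.\<close>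

lemma weak_mixed_half:
  assumes f: "loc_int f" and g2: "loc_int g2" and g12: "loc_int g12"
    and w2: "weak1 (swapped f) (swapped g2)" and w12: "weak1 g2 g12"
  shows "\<exists>c K. c \<in> borel_measurable borel \<and> continuous_on UNIV K \<and> (AE z in lborel. f z = c (fst z) + K z)"
proof -
  obtain c where c: "loc_int1 c" "AE z in lborel. swapped f z = c (snd z) + primitive1 (swapped g2) z"
    using weak1_representation[OF loc_int_swapped[OF f] loc_int_swapped[OF g2] w2] by blast
  obtain e where e: "loc_int1 e" "AE z in lborel. g2 z = e (snd z) + primitive1 g12 z"
    using weak1_representation[OF g2 g12 w12] by blast
  define K where "K z = primitive e (snd z) + primitive2 g12 z" for z
  have K: "continuous_on UNIV K"
  proof -
    have "continuous_on UNIV (\<lambda>z :: real \<times> real. primitive e (snd z))"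
      using continuous_on_compose2[OF primitive_continuous[OF e(1)] continuous_on_snd[OF continuous_on_id]] by simp
    then show ?thesis
      unfolding K_def[abs_def] by (intro continuous_on_add primitive2_continuous[OF g12])
  qed
  have eq: "AE z in lborel. f z = c (fst z) + primitive (\<lambda>r. g2 (fst z, r)) (snd z)"
    using AE_swap[OF c(2)] by (simp add: swapped_def primitive1_def prod.swap_def)
  have "AE x in lborel. \<forall>y. primitive (\<lambda>r. g2 (x, r)) y = K (x, y)"
    using AE_vertical[OF e(2)] loc_int_horizontal[OF loc_int_swapped[OF g2]]
  proof eventually_elim
    case (elim x)
    have l: "loc_int1 (\<lambda>r. g2 (x, r))" using elim(2) by (simp add: swapped_def)
    show ?case
    proof
      fix y
      have [measurable]: "g12 \<in> borel_measurable borel" using g12 by (rule loc_int_measurable)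
      have p12 [measurable]: "(\<lambda>r. primitive1 g12 (x, r)) \<in> borel_measurable borel" by measurable
      have gm [measurable]: "(\<lambda>r. g2 (x, r)) \<in> borel_measurable borel" "e \<in> borel_measurable borel"
        using l e(1) by (simp_all add: loc_int1_def)
      have i: "integrable lborel (\<lambda>r. kernel y r * g2 (x, r) - kernel y r * e r)"
        by (intro Bochner_Integration.integrable_diff integrable_kernel l e)
      have "AE r in lborel. kernel y r * g2 (x, r) - kernel y r * e r = kernel y r * primitive1 g12 (x, r)"
        using elim(1) by eventually_elim (simp add: algebra_simps)
      then have "(\<integral>r. kernel y r * g2 (x, r) - kernel y r * e r \<partial>lborel)
        = (\<integral>r. kernel y r * primitive1 g12 (x, r) \<partial>lborel)"
        by (intro integral_cong_AE) simp_all
      moreover have "(\<integral>r. kernel y r * g2 (x, r) - kernel y r * e r \<partial>lborel)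
         = primitive (\<lambda>r. g2 (x, r)) y - primitive e y"
        unfolding primitive_def
        by (intro Bochner_Integration.integral_diff integrable_kernel l e)
      ultimately show "primitive (\<lambda>r. g2 (x, r)) y = K (x, y)"
        by (simp add: K_def primitive2_iterated[OF g12])
    qed
  qed
  from AE_fst[OF this] eq have "AE z in lborel. f z = c (fst z) + K z"
    by eventually_elim simp
  moreover have "c \<in> borel_measurable borel" using c(1) by (simp add: loc_int1_def)
  ultimately show ?thesis using K by blast
qed

lemma continuous_swap: "continuous_on UNIV f \<Longrightarrow> continuous_on UNIV (swapped f)"
  unfolding swapped_def[abs_def]
  by (rule continuous_on_compose2[where s=UNIV and t=UNIV]) (auto intro: continuous_on_swap)

text \<open>A Sobolev embedding. Up to continuous terms, integrating in one order represents f by a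
  function of x alone, and in the other order by a function of y alone. Comparing the two on one
  generic horizontal line shows that the unknown function of x agrees almost everywhere with a
  continuous one.\<close>

lemma weak_mixed_continuous:
  assumes f: "loc_int f" and g: "loc_int g1" "loc_int g2" "loc_int g12"
    and w: "weak1 f g1" "weak1 (swapped f) (swapped g2)"
      "weak1 g2 g12" "weak1 (swapped g1) (swapped g12)"
  shows "\<exists>F. continuous_on UNIV F \<and> (AE z in lborel. f z = F z)"
proof -
  obtain c K where c: "c \<in> borel_measurable borel" and K: "continuous_on UNIV K"
    and eq: "AE z in lborel. f z = c (fst z) + K z"
    using weak_mixed_half[OF f g(2,3) w(2,3)] by blast
  have "weak1 (swapped (swapped f)) (swapped (swapped g1))" using w(1) by simp
  from weak_mixed_half[OF loc_int_swapped[OF f] loc_int_swapped[OF g(1)] loc_int_swapped[OF g(3)] this w(4)]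
  obtain c' K' where K': "continuous_on UNIV K'"
    and eq': "AE z in lborel. swapped f z = c' (fst z) + K' z"
    by blast
  have "AE z in lborel. f z = c' (snd z) + swapped K' z"
    using AE_swap[OF eq'] by (simp add: swapped_def)
  with eq have "AE z in lborel. c (fst z) = c' (snd z) + (swapped K' z - K z)"
    by eventually_elim simp
  from AE_horizontal[OF this]
  have "AE y in lborel. AE x in lborel. c x = c' y + (swapped K' (x, y) - K (x, y))" by simp
  moreover have "\<not> (AE y in (lborel :: real measure). False)"
    using AE_iff_null[of lborel "\<lambda>y :: real. False"] by (simp add: null_sets_def)
  \<comment> \<open>A line on which the two representations agree for almost every x; freezing y
    there expresses c through continuous functions.\<close>
  ultimately obtain y where y: "AE x in lborel. c x = c' y + (swapped K' (x, y) - K (x, y))"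
    by (metis (mono_tags, lifting) eventually_mono)
  define F where "F z = c' y + (swapped K' (fst z, y) - K (fst z, y)) + K z" for z
  have "AE z in lborel. f z = F z"
    using AE_fst[OF y] eq by eventually_elim (simp add: F_def)
  moreover have "continuous_on UNIV (\<lambda>z :: real \<times> real. H (fst z, y))" if "continuous_on UNIV H" for H :: "real \<times> real \<Rightarrow> real"
    by (rule continuous_on_compose2[OF that]) (auto intro!: continuous_intros)
  then have "continuous_on UNIV F"
    unfolding F_def[abs_def] using K continuous_swap[OF K']
    by (intro continuous_on_add continuous_on_diff continuous_on_const) auto
  ultimately show ?thesis by blast
qed

section \<open>Weak derivatives that are classical\<close>

lemma primitive_param_continuous:
  fixes g :: "real \<times> real \<Rightarrow> real"
  assumes g: "continuous_on UNIV g"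
  shows "continuous_on UNIV (\<lambda>y. primitive (\<lambda>s. g (s, y)) x)"
proof (rule continuous_on_sequentiallyI)
  fix Y :: "nat \<Rightarrow> real" and y assume Y: "Y \<longlonglongrightarrow> y"
  obtain R where R: "\<bar>y\<bar> \<le> R" "\<forall>n. \<bar>Y n\<bar> \<le> R" using convergent_bound[OF Y] by blast
  have gm [measurable]: "g \<in> borel_measurable borel" using g by (rule borel_measurable_continuous_onI)
  have "bounded (g ` ({-\<bar>x\<bar>..\<bar>x\<bar>} \<times> {-R..R}))"
    by (intro compact_imp_bounded compact_continuous_image compact_Times continuous_on_subset[OF g]) auto
  then obtain B where B0: "\<forall>p \<in> g ` ({-\<bar>x\<bar>..\<bar>x\<bar>} \<times> {-R..R}). norm p \<le> B"
    unfolding bounded_iff by blast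
  have B: "\<bar>g (s, r)\<bar> \<le> B" if "\<bar>s\<bar> \<le> \<bar>x\<bar>" "\<bar>r\<bar> \<le> R" for s r
  proof -
    from that have "(s, r) \<in> {-\<bar>x\<bar>..\<bar>x\<bar>} \<times> {-R..R}" by auto
    with B0 show ?thesis unfolding real_norm_def by blast
  qed
  show "(\<lambda>n. primitive (\<lambda>s. g (s, Y n)) x) \<longlonglongrightarrow> primitive (\<lambda>s. g (s, y)) x"
    unfolding primitive_def
  proof (rule integral_dominated_convergence)
    show "integrable lborel (\<lambda>s. B * indicator {-\<bar>x\<bar>..\<bar>x\<bar>} s)"
      by (intro integrable_mult_right integrable_real_indicator) (simp_all add: emeasure_lborel_Icc_eq)
    have "(\<lambda>n. g (s, Y n)) \<longlonglongrightarrow> g (s, y)" for s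
      by (rule continuous_on_tendsto_compose[OF g]) (auto intro!: tendsto_intros Y)
    then show "AE s in lborel. (\<lambda>n. kernel x s * g (s, Y n)) \<longlonglongrightarrow> kernel x s * g (s, y)"
      by (intro AE_I2 tendsto_mult tendsto_const)
    have "\<bar>kernel x s\<bar> * \<bar>g (s, Y n)\<bar> \<le> B * indicator {-\<bar>x\<bar>..\<bar>x\<bar>} s" for s n
    proof (cases "\<bar>s\<bar> \<le> \<bar>x\<bar>")
      case True
      then have "\<bar>kernel x s\<bar> * \<bar>g (s, Y n)\<bar> \<le> indicator {-\<bar>x\<bar>..\<bar>x\<bar>} s * B"
        using R B by (intro mult_mono kernel_le) auto
      then show ?thesis by (simp add: mult.commute)
    next
      case False
      then have "indicator {-\<bar>x\<bar>..\<bar>x\<bar>} s = (0 :: real)" by (intro indicator_simps(2)) auto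
      with kernel_le[of x "\<bar>x\<bar>" s] show ?thesis by simp
    qed
    then show "AE s in lborel. norm (kernel x s * g (s, Y n)) \<le> B * indicator {-\<bar>x\<bar>..\<bar>x\<bar>} s" for n
      by (simp add: abs_mult)
  qed measurable
qed

lemma continuous_horizontal:
  fixes g :: "real \<times> real \<Rightarrow> real"
  shows "continuous_on UNIV g \<Longrightarrow> continuous_on UNIV (\<lambda>s. g (s, y))"
  by (rule continuous_on_compose2[of UNIV g]) (auto intro!: continuous_intros)

lemma continuous_vertical:
  fixes g :: "real \<times> real \<Rightarrow> real"
  shows "continuous_on UNIV g \<Longrightarrow> continuous_on UNIV (\<lambda>s. g (x, s))"
  by (rule continuous_on_compose2[of UNIV g]) (auto intro!: continuous_intros)

text \<open>The representation by a primitive holds on almost every horizontal line, and both sides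
  depend continuously on y, so it holds on every line and can be differentiated there. The unknown
  function of y is eliminated through the value at x = 0.\<close>

lemma weak1_continuous_deriv:
  assumes f: "continuous_on UNIV f" and g: "continuous_on UNIV g" and w: "weak1 f g"
  shows "((\<lambda>x. f (x, y)) has_real_derivative g (x, y)) (at x)"
proof -
  obtain c where c: "AE z in lborel. f z = c (snd z) + primitive1 g z"
    using weak1_representation[OF continuous_loc_int[OF f] continuous_loc_int[OF g] w] by blast
  note gc = continuous_horizontal[OF g]
  have pc: "continuous_on UNIV (primitive (\<lambda>s. g (s, y)))" for y
    using DERIV_isCont[OF primitive_deriv[OF gc[of y]]] by (auto intro: continuous_at_imp_continuous_on)
  have "AE y in lborel. \<forall>x. f (x, y) = f (0, y) + primitive (\<lambda>s. g (s, y)) x"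
    using AE_horizontal[OF c]
  proof eventually_elim
    case (elim y)
    have "f (x, y) - primitive (\<lambda>s. g (s, y)) x = c y" for x
    proof (rule continuous_AE_eq[where f="\<lambda>x. f (x, y) - primitive (\<lambda>s. g (s, y)) x" and g="\<lambda>x. c y"])
      show "continuous_on UNIV (\<lambda>x. f (x, y) - primitive (\<lambda>s. g (s, y)) x)"
        by (intro continuous_on_diff continuous_horizontal f pc)
      from elim show "AE x in lborel. f (x, y) - primitive (\<lambda>s. g (s, y)) x = c y"
        by eventually_elim (simp add: primitive1_def)
    qed simp
    from this[of 0] this show ?case by (simp add: algebra_simps)
  qed
  then have ae: "AE y in lborel. f (x, y) = f (0, y) + primitive (\<lambda>s. g (s, y)) x" for x
    by eventually_elim blast
  have eq: "f (x, y) = f (0, y) + primitive (\<lambda>s. g (s, y)) x" for x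
    by (rule continuous_AE_eq[where f="\<lambda>y. f (x, y)"
          and g="\<lambda>y. f (0, y) + primitive (\<lambda>s. g (s, y)) x", OF _ _ ae])
      (intro continuous_on_add continuous_vertical f primitive_param_continuous g)+
  have "((\<lambda>x. f (0, y) + primitive (\<lambda>s. g (s, y)) x) has_real_derivative g (x, y)) (at x)"
    using DERIV_add[OF DERIV_const primitive_deriv[OF gc[of y]]] by fastforce
  then show ?thesis by (simp flip: eq)
qed

section \<open>Product test functions and periodization\<close>

lemma has_derivative_product:
  assumes "smooth1 \<alpha>" "smooth1 \<beta>"
  shows "((\<lambda>v :: real^2. \<alpha> (v $ 1) * \<beta> (v $ 2)) has_derivative
     (\<lambda>h. deriv \<alpha> (x $ 1) * h $ 1 * \<beta> (x $ 2) + \<alpha> (x $ 1) * (deriv \<beta> (x $ 2) * h $ 2))) (at x)"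
proof -
  have nth: "((\<lambda>v :: real^2. v $ i) has_derivative (\<lambda>h. h $ i)) (at x)" for i
    by (rule bounded_linear_imp_has_derivative) (rule bounded_linear_vec_nth)
  have a: "((\<lambda>v :: real^2. \<alpha> (v $ 1)) has_derivative (\<lambda>h. h $ 1 * deriv \<alpha> (x $ 1))) (at x)"
    using has_derivative_compose[OF nth[of 1] has_deriv_smooth1[OF assms(1), of "x $ 1", unfolded has_field_derivative_def]]
    by (simp add: mult.commute)
  have b: "((\<lambda>v :: real^2. \<beta> (v $ 2)) has_derivative (\<lambda>h. h $ 2 * deriv \<beta> (x $ 2))) (at x)"
    using has_derivative_compose[OF nth[of 2] has_deriv_smooth1[OF assms(2), of "x $ 2", unfolded has_field_derivative_def]]
    by (simp add: mult.commute)
  show ?thesis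
    by (rule has_derivative_eq_rhs[OF has_derivative_mult[OF a b]]) (simp add: fun_eq_iff algebra_simps)
qed

lemma pd_product:
  assumes "smooth1 \<alpha>" "smooth1 \<beta>"
  shows "pd 1 (\<lambda>v. \<alpha> (v $ 1) * \<beta> (v $ 2)) = (\<lambda>v. deriv \<alpha> (v $ 1) * \<beta> (v $ 2))"
    and "pd 2 (\<lambda>v. \<alpha> (v $ 1) * \<beta> (v $ 2)) = (\<lambda>v. \<alpha> (v $ 1) * deriv \<beta> (v $ 2))"
  by (auto simp: fun_eq_iff pd_def axis_def frechet_derivative_at[OF has_derivative_product[OF assms], symmetric])

lemma smooth1_iterate: "smooth1 \<alpha> \<Longrightarrow> smooth1 ((deriv ^^ n) \<alpha>)"
  by (induction n) (auto intro: smooth1_deriv)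

lemma pd_iterate_product:
  assumes "smooth1 \<alpha>" "smooth1 \<beta>"
  shows "(pd 1 ^^ a) ((pd 2 ^^ b) (\<lambda>v. \<alpha> (v $ 1) * \<beta> (v $ 2)))
    = (\<lambda>v. (deriv ^^ a) \<alpha> (v $ 1) * (deriv ^^ b) \<beta> (v $ 2))"
proof -
  have b: "(pd 2 ^^ b) (\<lambda>v. \<alpha> (v $ 1) * \<beta> (v $ 2)) = (\<lambda>v. \<alpha> (v $ 1) * (deriv ^^ b) \<beta> (v $ 2))"
  proof (induction b)
    case (Suc b)
    then show ?case using pd_product(2)[OF assms(1) smooth1_iterate[OF assms(2)]] by simp
  qed simp
  show ?thesis unfolding b
  proof (induction a)
    case (Suc a)
    then show ?case using pd_product(1)[OF smooth1_iterate[OF assms(1)] smooth1_iterate[OF assms(2)]] by simp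
  qed simp
qed

text \<open>All iterated partial derivatives of a product are again products of smooth functions;
  this is the invariant of the induction over the list.\<close>

lemma smooth_fun_product:
  assumes "smooth1 \<alpha>" "smooth1 \<beta>"
  shows "smooth_fun (\<lambda>v. \<alpha> (v $ 1) * \<beta> (v $ 2))"
  unfolding smooth_fun_def
proof (intro allI)
  fix js and x :: "real^2"
  have "\<exists>\<gamma> \<delta>. smooth1 \<gamma> \<and> smooth1 \<delta> \<and> foldr pd js (\<lambda>v. \<alpha> (v $ 1) * \<beta> (v $ 2)) = (\<lambda>v. \<gamma> (v $ 1) * \<delta> (v $ 2))"
  proof (induction js)
    case Nil
    show ?case using assms by auto
  next
    case (Cons j js)
    then obtain \<gamma> \<delta> where *: "smooth1 \<gamma>" "smooth1 \<delta>"
      "foldr pd js (\<lambda>v. \<alpha> (v $ 1) * \<beta> (v $ 2)) = (\<lambda>v. \<gamma> (v $ 1) * \<delta> (v $ 2))" by blast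
    from exhaust_2[of j] show ?case
    proof
      assume "j = 1"
      with * show ?thesis using pd_product(1)[OF *(1,2)] smooth1_deriv[OF *(1)] by auto
    next
      assume "j = 2"
      with * show ?thesis using pd_product(2)[OF *(1,2)] smooth1_deriv[OF *(2)] by auto
    qed
  qed
  then obtain \<gamma> \<delta> where *: "smooth1 \<gamma>" "smooth1 \<delta>"
    "foldr pd js (\<lambda>v. \<alpha> (v $ 1) * \<beta> (v $ 2)) = (\<lambda>v. \<gamma> (v $ 1) * \<delta> (v $ 2))" by blast
  show "foldr pd js (\<lambda>v. \<alpha> (v $ 1) * \<beta> (v $ 2)) differentiable at x"
    unfolding *(3) differentiable_def by (rule exI) (rule has_derivative_product[OF *(1,2)])
qed

lemma test_fun_Plane_product:
  assumes "test1 \<alpha>" "test1 \<beta>"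
  shows "test_fun Plane (\<lambda>v. \<alpha> (v $ 1) * \<beta> (v $ 2))"
proof -
  obtain R where R: "\<forall>x. R < \<bar>x\<bar> \<longrightarrow> \<alpha> x = 0" using test1_zero_outside[OF assms(1)] by blast
  obtain S where S: "\<forall>x. S < \<bar>x\<bar> \<longrightarrow> \<beta> x = 0" using test1_zero_outside[OF assms(2)] by blast
  have "{v :: real^2. \<alpha> (v $ 1) * \<beta> (v $ 2) \<noteq> 0} \<subseteq> cbox (vector [- R, - S]) (vector [R, S])"
    using R S by (auto simp: mem_box_cart forall_2) (smt (verit))+
  then have "bounded {v :: real^2. \<alpha> (v $ 1) * \<beta> (v $ 2) \<noteq> 0}"
    by (rule bounded_subset[OF bounded_cbox])
  with assms show ?thesis
    by (auto simp: test_fun_def test1_def smooth_fun_product compact_closure)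
qed

text \<open>Restricting the index set to the non-zero terms makes this a finite sum for f of compact
  support, without any summability argument, and periodicity is a shift of k.\<close>

definition periodize :: "(real \<Rightarrow> real) \<Rightarrow> real \<Rightarrow> real" where
  "periodize f x = (\<Sum>k :: int | f (x + 2 * pi * k) \<noteq> 0. f (x + 2 * pi * k))"

text \<open>A common finite index set for all x in a bounded range is what permits termwise
  differentiation and the exchange of sum and integral.\<close>

lemma periodize_eq:
  assumes R: "\<forall>x. R < \<bar>x\<bar> \<longrightarrow> f x = 0" and N: "R + \<bar>x\<bar> \<le> real_of_int N"
  shows "periodize f x = (\<Sum>k\<in>{-N..N}. f (x + 2 * pi * real_of_int k))"
  unfolding periodize_def
proof (rule sum.mono_neutral_left)
  show "{k. f (x + 2 * pi * real_of_int k) \<noteq> 0} \<subseteq> {-N..N}"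
  proof (rule subsetI, rule ccontr)
    fix k assume k: "k \<in> {k. f (x + 2 * pi * real_of_int k) \<noteq> 0}" "k \<notin> {-N..N}"
    then have "real_of_int N < \<bar>real_of_int k\<bar>" by auto
    also have "\<bar>real_of_int k\<bar> \<le> \<bar>2 * pi * real_of_int k\<bar>"
      using pi_gt3 by (simp add: abs_mult mult_le_cancel_right1)
    finally have "R < \<bar>x + 2 * pi * real_of_int k\<bar>" using N by linarith
    with R k(1) show False by blast
  qed
qed auto

lemma periodize_periodic: "periodize f (x + 2 * pi) = periodize f x"
  unfolding periodize_def
  by (rule sum.reindex_bij_witness[where i="\<lambda>k. k - 1" and j="\<lambda>k. k + 1"])
    (simp_all add: algebra_simps)

lemma periodize_deriv:
  assumes f: "test1 f"
  shows "(periodize f has_real_derivative periodize (deriv f) x) (at x)"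
proof -
  obtain R where R: "\<forall>x. R < \<bar>x\<bar> \<longrightarrow> f x = 0" using test1_zero_outside[OF f] by blast
  obtain R' where R': "\<forall>x. R' < \<bar>x\<bar> \<longrightarrow> deriv f x = 0" using test1_zero_outside[OF test1_deriv[OF f]] by blast
  obtain N :: int where N: "\<bar>R\<bar> + \<bar>R'\<bar> + \<bar>x\<bar> + 1 \<le> real_of_int N"
    using ex_le_of_int by blast
  have s: "smooth1 f" using f by (simp add: test1_def)
  have "((\<lambda>y. f (y + c)) has_real_derivative deriv f (x + c)) (at x)" for c
    using has_deriv_smooth1[OF s, of "x + c"] by (simp add: DERIV_shift)
  then have "((\<lambda>y. \<Sum>k\<in>{-N..N}. f (y + 2 * pi * real_of_int k)) has_real_derivative
     (\<Sum>k\<in>{-N..N}. deriv f (x + 2 * pi * real_of_int k))) (at x)"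
    by (rule DERIV_sum)
  also have "(\<Sum>k\<in>{-N..N}. deriv f (x + 2 * pi * real_of_int k)) = periodize (deriv f) x"
    by (rule periodize_eq[OF R', symmetric]) (use N in linarith)
  finally show ?thesis
  proof (rule has_field_derivative_transform_within_open[of _ _ _ "{x - 1<..<x + 1}"])
    fix y assume "y \<in> {x - 1<..<x + 1}"
    then have "\<bar>y\<bar> \<le> \<bar>x\<bar> + 1" by auto
    then show "(\<Sum>k\<in>{-N..N}. f (y + 2 * pi * real_of_int k)) = periodize f y"
      by (intro periodize_eq[OF R, symmetric]) (use N in linarith)
  qed auto
qed

lemma smooth1_periodize: "test1 f \<Longrightarrow> smooth1 (periodize f)"
proof -
  have "test1 f \<Longrightarrow> times_differentiable n (periodize f)" for n
    by (induction n arbitrary: f) (auto intro: times_differentiable_SucI[OF periodize_deriv] test1_deriv)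
  then show "test1 f \<Longrightarrow> ?thesis" by (simp add: smooth1_def)
qed

lemma deriv_periodize: "test1 f \<Longrightarrow> deriv (periodize f) = periodize (deriv f)"
  by (rule ext) (rule DERIV_imp_deriv[OF periodize_deriv])

lemma test1_iterate: "test1 f \<Longrightarrow> test1 ((deriv ^^ n) f)"
  by (induction n) (auto intro: test1_deriv)

lemma iterate_periodize: "test1 f \<Longrightarrow> (deriv ^^ n) (periodize f) = periodize ((deriv ^^ n) f)"
  by (induction n) (auto simp: deriv_periodize test1_iterate)

lemma test_fun_Torus_product:
  assumes "test1 \<alpha>" "test1 \<beta>"
  shows "test_fun Torus (\<lambda>v. periodize \<alpha> (v $ 1) * periodize \<beta> (v $ 2))"
proof -
  have "fun_on Torus (\<lambda>v. periodize \<alpha> (v $ 1) * periodize \<beta> (v $ 2))"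
    unfolding fun_on.simps
  proof (intro allI)
    fix x :: "real^2" and i :: 2
    show "periodize \<alpha> ((x + axis i (2 * pi)) $ 1) * periodize \<beta> ((x + axis i (2 * pi)) $ 2) =
      periodize \<alpha> (x $ 1) * periodize \<beta> (x $ 2)"
      using exhaust_2[of i] by (auto simp: axis_def periodize_periodic)
  qed
  then show ?thesis
    using smooth_fun_product[OF smooth1_periodize[OF assms(1)] smooth1_periodize[OF assms(2)]]
    by (simp add: test_fun_def)
qed

section \<open>Passage to coordinates\<close>

definition coords :: "real^2 \<Rightarrow> real \<times> real" where
  "coords v = (v $ 1, v $ 2)"

lemma coords_measurable [measurable]: "coords \<in> borel_measurable borel"
  unfolding coords_def[abs_def] by (intro borel_measurable_continuous_onI continuous_intros)

lemma vector_coords [simp]: "vector [fst (coords v), snd (coords v)] = v"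
  by (simp add: coords_def vec_eq_iff forall_2)

text \<open>A Borel measure that gives every box its volume is Lebesgue measure, and the preimage of
  a box under \<open>coords\<close> is a box with the same sides. Fubini for pairs thereby becomes
  available for integrals over \<open>real^2\<close>.\<close>

lemma distr_coords: "distr lborel borel coords = lborel"
proof (rule lborel_eqI[symmetric])
  fix l u :: "real \<times> real" assume *: "\<And>b. b \<in> Basis \<Longrightarrow> l \<bullet> b \<le> u \<bullet> b"
  from *[of "(1, 0)"] *[of "(0, 1)"] have le: "fst l \<le> fst u" "snd l \<le> snd u"
    by (cases l; cases u; simp add: Basis_prod_def)+
  let ?l = "vector [fst l, snd l] :: real^2" and ?u = "vector [fst u, snd u] :: real^2"
  have B: "(Basis :: (real^2) set) = {axis 1 1, axis 2 1}"
    by (auto simp: Basis_vec_def UNIV_2)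
  have neq: "axis 1 1 \<noteq> (axis 2 1 :: real^2)" by (simp add: axis_eq_axis)
  have "emeasure (distr lborel borel coords) (box l u) = emeasure lborel (coords -` box l u)"
    by (subst emeasure_distr) simp_all
  also have "coords -` box l u = box ?l ?u"
    by (auto simp: coords_def box_Times mem_box_cart forall_2)
  also have "emeasure lborel (box ?l ?u) = ennreal (prod ((\<bullet>) (?u - ?l)) Basis)"
  proof (rule emeasure_lborel_box)
    fix b :: "real^2" assume "b \<in> Basis"
    then show "?l \<bullet> b \<le> ?u \<bullet> b" using le unfolding B by (auto simp: inner_axis)
  qed
  also have "prod ((\<bullet>) (?u - ?l)) Basis = (fst u - fst l) * (snd u - snd l)"
    unfolding B using neq by (simp add: inner_axis)
  also have "\<dots> = prod ((\<bullet>) (u - l)) Basis"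
    by (cases l; cases u) (simp add: Basis_prod_def)
  finally show "emeasure (distr lborel borel coords) (box l u) = ennreal (prod ((\<bullet>) (u - l)) Basis)" .
qed simp

lemma AE_coords:
  "AE z in lborel. P z \<Longrightarrow> AE v in lebesgue. P (coords v)"
  unfolding distr_coords[symmetric] AE_completion_iff
  by (rule AE_distrD[of coords lborel borel]) simp_all

lemma AE_coords_eq:
  assumes [measurable]: "F \<in> borel_measurable borel" "G \<in> borel_measurable borel"
    and "AE v in lebesgue. F (coords v) = (G (coords v) :: real)"
  shows "AE z in lborel. F z = G z"
proof -
  have "(AE z in distr lborel borel coords. F z = G z) = (AE v in lborel. F (coords v) = G (coords v))"
    by (rule AE_distr_iff) simp_all
  with assms(3) have "AE z in distr lborel borel coords. F z = G z"
    by (simp add: AE_completion_iff)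
  then show ?thesis unfolding distr_coords .
qed

lemma lebesgue_coords:
  fixes h :: "real \<times> real \<Rightarrow> real"
  assumes [measurable]: "h \<in> borel_measurable borel"
  shows integral_coords: "(\<integral>v. h (coords v) \<partial>lebesgue) = (\<integral>z. h z \<partial>lborel)"
    and integrable_coords: "integrable lebesgue (\<lambda>v. h (coords v)) \<longleftrightarrow> integrable lborel h"
proof -
  have "(\<integral>v. h (coords v) \<partial>lebesgue) = (\<integral>v. h (coords v) \<partial>lborel)"
    by (rule integral_completion) simp
  also have "\<dots> = (\<integral>z. h z \<partial>distr lborel borel coords)"
    by (rule integral_distr[symmetric]) simp_all
  finally show "(\<integral>v. h (coords v) \<partial>lebesgue) = (\<integral>z. h z \<partial>lborel)" by (simp add: distr_coords)
  have "integrable lebesgue (\<lambda>v. h (coords v)) \<longleftrightarrow> integrable lborel (\<lambda>v. h (coords v))"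
    by (rule integrable_completion) simp
  also have "\<dots> \<longleftrightarrow> integrable (distr lborel borel coords) h"
    by (rule integrable_distr_eq[symmetric]) simp_all
  finally show "integrable lebesgue (\<lambda>v. h (coords v)) \<longleftrightarrow> integrable lborel h" by (simp add: distr_coords)
qed

lemma coords_square: "{v. coords v \<in> square R} = cbox (vector [- R, - R]) (vector [R, R])"
  by (auto simp: coords_def square_def mem_box_cart forall_2)

lemma loc_integrable_measurable:
  fixes f :: "real^2 \<Rightarrow> 'a :: euclidean_space"
  assumes f: "loc_integrable D f"
  shows "f \<in> borel_measurable lebesgue"
proof (rule borel_measurable_LIMSEQ_metric)
  fix n :: nat
  have "set_integrable lebesgue {v. coords v \<in> square (real n)} f"
    using f unfolding coords_square loc_integrable_def by (simp add: compact_cbox)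
  then show "(\<lambda>v. indicator {v. coords v \<in> square (real n)} v *\<^sub>R f v) \<in> borel_measurable lebesgue"
    unfolding set_integrable_def by (rule borel_measurable_integrable)
next
  fix v :: "real^2"
  obtain n where n: "\<bar>v $ 1\<bar> + \<bar>v $ 2\<bar> < real n" using reals_Archimedean2 by blast
  have "\<forall>\<^sub>F n in sequentially. indicator {v. coords v \<in> square (real n)} v *\<^sub>R f v = f v"
    using eventually_ge_at_top[of n]
  proof eventually_elim
    case (elim m)
    then have "coords v \<in> square (real m)" using n by (auto simp: coords_def square_def)
    then show ?case by simp
  qed
  then show "(\<lambda>n. indicator {v. coords v \<in> square (real n)} v *\<^sub>R f v) \<longlonglongrightarrow> f v"
    by (rule tendsto_eventually)
qed

text \<open>A Lebesgue measurable function differs from a Borel one only on a null set; the Borel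
  one is composed with the inverse of \<open>coords\<close>.\<close>

lemma loc_integrable_representative:
  fixes f :: "real^2 \<Rightarrow> real"
  assumes f: "loc_integrable D f"
  shows "\<exists>F. loc_int F \<and> (AE v in lebesgue. f v = F (coords v))"
proof -
  obtain f0 where f0 [measurable]: "f0 \<in> borel_measurable lborel" and ae: "AE v in lborel. f v = f0 v"
    using completion_ex_borel_measurable_real[OF loc_integrable_measurable[OF f]] by blast
  define F where "F z = f0 (vector [fst z, snd z])" for z :: "real \<times> real"
  have "(\<lambda>z :: real \<times> real. vector [fst z, snd z] :: real^2) \<in> borel_measurable borel"
  proof (rule borel_measurable_continuous_onI)
    have eq: "(\<lambda>z :: real \<times> real. vector [fst z, snd z] :: real^2) = (\<lambda>z. fst z *\<^sub>R axis 1 1 + snd z *\<^sub>R axis 2 1 :: real^2)"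
      by (auto simp: fun_eq_iff vec_eq_iff forall_2 axis_def)
    show "continuous_on UNIV (\<lambda>z :: real \<times> real. vector [fst z, snd z] :: real^2)"
      unfolding eq by (intro continuous_intros)
  qed
  from measurable_compose[OF this, of f0] have Fm [measurable]: "F \<in> borel_measurable borel"
    using f0 by (simp add: F_def[abs_def])
  have eq: "AE v in lebesgue. f v = F (coords v)"
    using ae by (simp add: F_def AE_completion_iff)
  moreover have "loc_int F" unfolding loc_int_def
  proof (intro conjI allI Fm)
    fix R
    have "set_integrable lebesgue {v. coords v \<in> square R} f"
      using f unfolding coords_square loc_integrable_def by (simp add: compact_cbox)
    then have i: "integrable lebesgue (\<lambda>v. indicator {v. coords v \<in> square R} v *\<^sub>R f v)"
      unfolding set_integrable_def .
    have m: "(\<lambda>v. indicator (square R) (coords v) * F (coords v)) \<in> borel_measurable lebesgue"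
      by (rule measurable_completion) measurable
    have "integrable lebesgue (\<lambda>v. indicator (square R) (coords v) * F (coords v))"
      using i
    proof (rule Bochner_Integration.integrable_bound[OF _ m])
      from eq show "AE v in lebesgue. norm (indicator (square R) (coords v) * F (coords v))
          \<le> norm (indicator {v. coords v \<in> square R} v *\<^sub>R f v)"
        by eventually_elim (simp add: indicator_def)
    qed
    then show "integrable lborel (\<lambda>z. indicator (square R) z * F z)"
      using integrable_coords[of "\<lambda>z. indicator (square R) z * F z"] by simp
  qed
  ultimately show ?thesis by blast
qed

lemma integral_coords_AE:
  fixes f :: "real^2 \<Rightarrow> real"
  assumes f: "f \<in> borel_measurable lebesgue" and [measurable]: "F \<in> borel_measurable borel" "h \<in> borel_measurable borel"
    and eq: "AE v in lebesgue. f v = F (coords v)"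
  shows "(\<integral>v. h (coords v) * f v \<partial>lebesgue) = (\<integral>z. h z * F z \<partial>lborel)"
    and "integrable lebesgue (\<lambda>v. h (coords v) * f v) \<longleftrightarrow> integrable lborel (\<lambda>z. h z * F z)"
proof -
  have ae: "AE v in lebesgue. h (coords v) * f v = h (coords v) * F (coords v)"
    using eq by eventually_elim simp
  have m: "(\<lambda>v. h (coords v) * F (coords v)) \<in> borel_measurable lebesgue"
    "(\<lambda>v. h (coords v)) \<in> borel_measurable lebesgue"
    by (rule measurable_completion, measurable)+
  have m': "(\<lambda>v. h (coords v) * f v) \<in> borel_measurable lebesgue"
    using m(2) f by (rule borel_measurable_times)
  have "(\<integral>v. h (coords v) * f v \<partial>lebesgue) = (\<integral>v. h (coords v) * F (coords v) \<partial>lebesgue)"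
    by (rule integral_cong_AE[OF m' m(1) ae])
  then show "(\<integral>v. h (coords v) * f v \<partial>lebesgue) = (\<integral>z. h z * F z \<partial>lborel)"
    using integral_coords[of "\<lambda>z. h z * F z"] by simp
  have "integrable lebesgue (\<lambda>v. h (coords v) * f v) \<longleftrightarrow> integrable lebesgue (\<lambda>v. h (coords v) * F (coords v))"
    by (rule integrable_cong_AE[OF m' m(1) ae])
  then show "integrable lebesgue (\<lambda>v. h (coords v) * f v) \<longleftrightarrow> integrable lborel (\<lambda>z. h z * F z)"
    using integrable_coords[of "\<lambda>z. h z * F z"] by simp
qed

lemma loc_integrable_bound:
  fixes f :: "real^2 \<Rightarrow> 'a :: euclidean_space"
  assumes f: "loc_integrable D f" and [measurable]: "h \<in> borel_measurable borel"
    and h: "\<And>z. \<bar>h z\<bar> \<le> B * indicator (square R) z"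
  shows "integrable lebesgue (\<lambda>v. h (coords v) *\<^sub>R f v)"
proof (rule Bochner_Integration.integrable_bound)
  have "set_integrable lebesgue {v. coords v \<in> square R} f"
    using f unfolding coords_square loc_integrable_def by (simp add: compact_cbox)
  then show "integrable lebesgue (\<lambda>v. B *\<^sub>R (indicator {v. coords v \<in> square R} v *\<^sub>R f v))"
    unfolding set_integrable_def by (rule integrable_scaleR_right)
  have "(\<lambda>v. h (coords v)) \<in> borel_measurable lebesgue"
    by (rule measurable_completion) measurable
  then show "(\<lambda>v. h (coords v) *\<^sub>R f v) \<in> borel_measurable lebesgue"
    using loc_integrable_measurable[OF f] by (rule borel_measurable_scaleR)
  show "AE v in lebesgue. norm (h (coords v) *\<^sub>R f v) \<le> norm (B *\<^sub>R (indicator {v. coords v \<in> square R} v *\<^sub>R f v))"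
  proof (rule AE_I2)
    fix v
    have "\<bar>h (coords v)\<bar> * norm (f v) \<le> (\<bar>B\<bar> * indicator {v. coords v \<in> square R} v) * norm (f v)"
      using h[of "coords v"] by (intro mult_right_mono) (auto simp: indicator_def split: if_splits)
    then show "norm (h (coords v) *\<^sub>R f v) \<le> norm (B *\<^sub>R (indicator {v. coords v \<in> square R} v *\<^sub>R f v))"
      by (simp add: abs_mult mult.assoc)
  qed
qed

section \<open>Unfolding integrals over the torus\<close>

lemma lebesgue_translation:
  fixes h :: "real^2 \<Rightarrow> 'a :: euclidean_space"
  assumes h: "integrable lebesgue h"
  shows "integrable lebesgue (\<lambda>v. h (v + T))" and "(\<integral>v. h (v + T) \<partial>lebesgue) = (\<integral>v. h v \<partial>lebesgue)"
proof -
  have e: "(\<lambda>x :: real^2. T + (\<Sum>j\<in>Basis. (1 * (x \<bullet> j)) *\<^sub>R j)) = (\<lambda>x. x + T)"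
    by (simp add: euclidean_representation add.commute)
  have m: "(\<lambda>x. x + T) \<in> lebesgue \<rightarrow>\<^sub>M lebesgue"
    using lebesgue_affine_measurable[of "\<lambda>j. 1" T] unfolding e by simp
  have d: "distr lebesgue lebesgue (\<lambda>x. x + T) = lebesgue"
    using lebesgue_affine_euclidean[of "\<lambda>j. 1" T] unfolding e by (simp add: density_1)
  have hm: "h \<in> borel_measurable lebesgue" using h by (rule borel_measurable_integrable)
  show "integrable lebesgue (\<lambda>v. h (v + T))"
    using integrable_distr_eq[OF m hm] h unfolding d by simp
  show "(\<integral>v. h (v + T) \<partial>lebesgue) = (\<integral>v. h v \<partial>lebesgue)"
    using integral_distr[OF m hm] unfolding d by simp
qed

text \<open>Periodicity is given for one positive period; negative multiples follow by shifting
  forward from the translated point.\<close>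

lemma fun_on_Torus_axis:
  assumes "fun_on Torus f"
  shows "f (v + axis i (2 * pi * real_of_int k)) = f v"
proof -
  have up: "f (v + axis i (2 * pi)) = f v" for v using assms by simp
  have nat: "f (v + axis i (2 * pi * real n)) = f v" for n v
  proof (induction n)
    case (Suc n)
    have "v + axis i (2 * pi * real (Suc n)) = (v + axis i (2 * pi * real n)) + axis i (2 * pi)"
      by (auto simp: vec_eq_iff axis_def algebra_simps)
    then show ?case using Suc up by metis
  qed (simp add: axis_def zero_vec_def[symmetric])
  show ?thesis
  proof (cases "k \<ge> 0")
    case True
    then show ?thesis using nat[of v "nat k"] by simp
  next
    case False
    then have eq: "(v + axis i (2 * pi * real_of_int k)) + axis i (2 * pi * real (nat (- k))) = v"
      by (auto simp: vec_eq_iff axis_def)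
    show ?thesis using nat[of "v + axis i (2 * pi * real_of_int k)" "nat (- k)"] unfolding eq by (rule sym)
  qed
qed

definition period :: "int \<times> int \<Rightarrow> real^2" where
  "period p = vector [2 * pi * real_of_int (fst p), 2 * pi * real_of_int (snd p)]"

lemma fun_on_Torus_period: "fun_on Torus f \<Longrightarrow> f (v + period p) = f v"
proof -
  assume f: "fun_on Torus f"
  have "v + period p = (v + axis 1 (2 * pi * real_of_int (fst p))) + axis 2 (2 * pi * real_of_int (snd p))"
    by (auto simp: vec_eq_iff forall_2 axis_def period_def)
  then show ?thesis using fun_on_Torus_axis[OF f] by metis
qed

lemma cell_Torus_iff: "v \<in> cell Torus \<longleftrightarrow> v $ 1 \<in> {0..2*pi} \<and> v $ 2 \<in> {0..2*pi}"
  by (auto simp: mem_box_cart forall_2)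

text \<open>The closed period intervals overlap at their end points, which is why lattice points are
  excluded. Any other x lies in exactly one of them, with index the floor of x / (2 pi); this index
  is in range because 2 pi >= 1.\<close>

lemma sum_cells:
  assumes x: "\<And>k. x \<noteq> 2 * pi * real_of_int k" and N: "\<bar>x\<bar> \<le> real_of_int N"
  shows "(\<Sum>k\<in>{-N..N}. indicator {0..2*pi} (x - 2 * pi * real_of_int k)) = (1 :: real)"
proof -
  define k0 where "k0 = \<lfloor>x / (2 * pi)\<rfloor>"
  have "real_of_int k0 \<le> x / (2 * pi)" "x / (2 * pi) < real_of_int k0 + 1"
    unfolding k0_def by linarith+
  then have k0: "2 * pi * real_of_int k0 \<le> x" "x < 2 * pi * (real_of_int k0 + 1)"
    using pi_gt_zero by (simp_all add: field_simps)
  have "indicator {0..2*pi} (x - 2 * pi * real_of_int k) = (if k = k0 then 1 else 0 :: real)" for k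
  proof (cases "k = k0")
    case True
    then show ?thesis using k0 by (auto simp: indicator_def algebra_simps)
  next
    case False
    then consider "k + 1 \<le> k0" | "k0 + 1 \<le> k" by linarith
    then have "x - 2 * pi * real_of_int k \<notin> {0..2*pi}"
    proof cases
      case 1
      then have "2 * pi * (real_of_int k + 1) \<le> 2 * pi * real_of_int k0" by (intro mult_left_mono) auto
      moreover have "x \<noteq> 2 * pi * (real_of_int k + 1)" using x[of "k + 1"] by simp
      ultimately have "2 * pi < x - 2 * pi * real_of_int k" using k0 by (simp add: algebra_simps)
      then show ?thesis by simp
    next
      case 2
      then have "2 * pi * (real_of_int k0 + 1) \<le> 2 * pi * real_of_int k" by (intro mult_left_mono) auto
      then have "x - 2 * pi * real_of_int k < 0" using k0(2) by linarith
      then show ?thesis by simp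
    qed
    with False show ?thesis by simp
  qed
  then have "(\<Sum>k\<in>{-N..N}. indicator {0..2*pi} (x - 2 * pi * real_of_int k)) = (if k0 \<in> {-N..N} then 1 else 0 :: real)"
    by simp
  moreover have "k0 \<in> {-N..N}"
  proof -
    have "\<bar>x / (2 * pi)\<bar> \<le> \<bar>x\<bar>" using pi_gt3 by (simp add: divide_le_eq mult_le_cancel_left1)
    then have "- real_of_int N \<le> x / (2 * pi)" "x / (2 * pi) \<le> real_of_int N"
      using N by linarith+
    then show ?thesis unfolding k0_def by (simp add: le_floor_iff floor_le_iff)
  qed
  ultimately show ?thesis by simp
qed

lemma sum_times:
  fixes A B :: "int \<Rightarrow> real"
  shows "(\<Sum>k\<in>X. A k) * (\<Sum>k\<in>Y. B k) = (\<Sum>p\<in>X \<times> Y. A (fst p) * B (snd p))"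
  by (simp add: sum_product sum.cartesian_product case_prod_beta')

lemma AE_coords_generic:
  "AE v in (lebesgue :: (real^2) measure). \<forall>k. v $ 1 \<noteq> 2 * pi * real_of_int k \<and> v $ 2 \<noteq> 2 * pi * real_of_int k"
proof -
  have "AE x in lborel. \<forall>k. x \<noteq> 2 * pi * real_of_int k"
    unfolding AE_all_countable by (intro allI AE_lborel_singleton)
  from AE_coords[OF AE_fst[OF this]] AE_coords[OF AE_snd[OF this]] show ?thesis
    by eventually_elim (simp add: coords_def)
qed

text \<open>By periodicity of f, the term of the periodization with period p contributes the
  integral over the cell translated by p, and these cells tile the plane up to a null set. So
  compactly supported products can also be used to test on the torus.\<close>

lemma torus_unfold:
  fixes f :: "real^2 \<Rightarrow> 'a :: euclidean_space"
  assumes f: "loc_integrable Torus f" and t: "test1 \<alpha>" "test1 \<beta>"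
  shows "(\<integral>v. (periodize \<alpha> (v $ 1) * periodize \<beta> (v $ 2)) *\<^sub>R f v \<partial>dom_measure Torus)
     = (\<integral>v. (\<alpha> (v $ 1) * \<beta> (v $ 2)) *\<^sub>R f v \<partial>lebesgue)"
proof -
  have per: "f (v + period p) = f v" for v p
    using f by (intro fun_on_Torus_period) (simp add: loc_integrable_def)
  have [measurable]: "\<alpha> \<in> borel_measurable borel" "\<beta> \<in> borel_measurable borel"
    using t by (auto intro: test1_measurable)
  obtain B R where BR: "\<And>z. \<bar>\<alpha> (fst z) * \<beta> (snd z)\<bar> \<le> B * indicator (square R) z"
    using test_product_bound[OF t] by blast
  obtain R1 where R1: "\<forall>x. R1 < \<bar>x\<bar> \<longrightarrow> \<alpha> x = 0" using test1_zero_outside[OF t(1)] by blast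
  obtain R2 where R2: "\<forall>x. R2 < \<bar>x\<bar> \<longrightarrow> \<beta> x = 0" using test1_zero_outside[OF t(2)] by blast
  obtain N :: int where N: "\<bar>R1\<bar> + \<bar>R2\<bar> + 2 * pi \<le> real_of_int N" using ex_le_of_int by blast
  define S where "S = {-N..N} \<times> {-N..N}"
  \<comment> \<open>The part of the test function that lies over the cell translated by
    \<open>period p\<close>.\<close>
  define H where "H p z = indicator {0..2*pi} (fst z - 2 * pi * real_of_int (fst p))
     * indicator {0..2*pi} (snd z - 2 * pi * real_of_int (snd p)) * (\<alpha> (fst z) * \<beta> (snd z))"
    for p :: "int \<times> int" and z :: "real \<times> real"
  define h where "h p v = H p (coords v) *\<^sub>R f v" for p v
  have h: "integrable lebesgue (h p)" for p
    unfolding h_def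
  proof (rule loc_integrable_bound[OF f])
    show "H p \<in> borel_measurable borel" unfolding H_def[abs_def] by measurable
    fix z
    have "\<bar>H p z\<bar> \<le> \<bar>\<alpha> (fst z) * \<beta> (snd z)\<bar>" by (auto simp: H_def indicator_def)
    with BR[of z] show "\<bar>H p z\<bar> \<le> B * indicator (square R) z" by linarith
  qed
  have "(\<integral>v. (periodize \<alpha> (v $ 1) * periodize \<beta> (v $ 2)) *\<^sub>R f v \<partial>dom_measure Torus)
     = (\<integral>v. indicator (cell Torus) v *\<^sub>R (periodize \<alpha> (v $ 1) * periodize \<beta> (v $ 2)) *\<^sub>R f v \<partial>lebesgue)"
    by (subst integral_restrict_space) simp_all
  also have "\<dots> = (\<integral>v. (\<Sum>p\<in>S. h p (v + period p)) \<partial>lebesgue)"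
  proof (rule Bochner_Integration.integral_cong[OF refl])
    fix v :: "real^2"
    have ind: "h p (v + period p) = (indicator (cell Torus) v * (\<alpha> (v $ 1 + 2 * pi * real_of_int (fst p))
        * \<beta> (v $ 2 + 2 * pi * real_of_int (snd p)))) *\<^sub>R f v" for p
      unfolding h_def per by (simp add: H_def coords_def period_def indicator_def cell_Torus_iff del: cell.simps)
    show "indicator (cell Torus) v *\<^sub>R (periodize \<alpha> (v $ 1) * periodize \<beta> (v $ 2)) *\<^sub>R f v = (\<Sum>p\<in>S. h p (v + period p))"
    proof (cases "v \<in> cell Torus")
      case True
      then have v: "\<bar>v $ 1\<bar> \<le> 2 * pi" "\<bar>v $ 2\<bar> \<le> 2 * pi" unfolding cell_Torus_iff by auto
      have "periodize \<alpha> (v $ 1) = (\<Sum>k\<in>{-N..N}. \<alpha> (v $ 1 + 2 * pi * real_of_int k))"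
        by (rule periodize_eq[OF R1]) (use N v in linarith)
      moreover have "periodize \<beta> (v $ 2) = (\<Sum>k\<in>{-N..N}. \<beta> (v $ 2 + 2 * pi * real_of_int k))"
        by (rule periodize_eq[OF R2]) (use N v in linarith)
      ultimately have "periodize \<alpha> (v $ 1) * periodize \<beta> (v $ 2)
         = (\<Sum>p\<in>S. \<alpha> (v $ 1 + 2 * pi * real_of_int (fst p)) * \<beta> (v $ 2 + 2 * pi * real_of_int (snd p)))"
        unfolding S_def by (simp add: sum_times)
      then show ?thesis using True by (simp add: ind scaleR_sum_left del: cell.simps)
    next
      case False
      then show ?thesis by (simp add: ind del: cell.simps)
    qed
  qed
  also have "\<dots> = (\<Sum>p\<in>S. \<integral>v. h p (v + period p) \<partial>lebesgue)"
    by (rule Bochner_Integration.integral_sum) (rule lebesgue_translation(1)[OF h])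
  also have "\<dots> = (\<Sum>p\<in>S. \<integral>v. h p v \<partial>lebesgue)"
    by (simp only: lebesgue_translation(2)[OF h])
  also have "\<dots> = (\<integral>v. (\<Sum>p\<in>S. h p v) \<partial>lebesgue)"
    by (rule Bochner_Integration.integral_sum[symmetric]) (rule h)
  also have "\<dots> = (\<integral>v. (\<alpha> (v $ 1) * \<beta> (v $ 2)) *\<^sub>R f v \<partial>lebesgue)"
  proof (rule integral_cong_AE)
    show "(\<lambda>v. \<Sum>p\<in>S. h p v) \<in> borel_measurable lebesgue"
      by (rule borel_measurable_sum) (rule borel_measurable_integrable[OF h])
    have "integrable lebesgue (\<lambda>v. (\<alpha> (fst (coords v)) * \<beta> (snd (coords v))) *\<^sub>R f v)"
      by (rule loc_integrable_bound[OF f, of "\<lambda>z. \<alpha> (fst z) * \<beta> (snd z)", OF _ BR]) measurable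
    then show "(\<lambda>v. (\<alpha> (v $ 1) * \<beta> (v $ 2)) *\<^sub>R f v) \<in> borel_measurable lebesgue"
      unfolding coords_def fst_conv snd_conv by (rule borel_measurable_integrable)
    show "AE v in lebesgue. (\<Sum>p\<in>S. h p v) = (\<alpha> (v $ 1) * \<beta> (v $ 2)) *\<^sub>R f v"
      using AE_coords_generic
    proof eventually_elim
      case (elim v)
      have "(\<Sum>p\<in>S. H p (coords v)) = (\<Sum>k\<in>{-N..N}. indicator {0..2*pi} (v $ 1 - 2 * pi * real_of_int k))
         * (\<Sum>k\<in>{-N..N}. indicator {0..2*pi} (v $ 2 - 2 * pi * real_of_int k)) * (\<alpha> (v $ 1) * \<beta> (v $ 2))"
        unfolding S_def H_def sum_times unfolding sum_distrib_right by (simp add: coords_def)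
      also have "\<dots> = \<alpha> (v $ 1) * \<beta> (v $ 2)"
      proof (cases "\<bar>v $ 1\<bar> \<le> R1 \<and> \<bar>v $ 2\<bar> \<le> R2")
        case True
        then have "\<bar>v $ 1\<bar> \<le> real_of_int N" "\<bar>v $ 2\<bar> \<le> real_of_int N"
          using N pi_gt_zero by linarith+
        with sum_cells elim show ?thesis by simp
      next
        case False
        then have "\<alpha> (v $ 1) = 0 \<or> \<beta> (v $ 2) = 0" using R1 R2 by (auto simp: not_le)
        then show ?thesis by auto
      qed
      finally show ?case by (simp add: h_def scaleR_sum_left[symmetric])
    qed
  qed
  finally show ?thesis .
qed

text \<open>On the torus the admissible test function is the product of the periodizations, and
  \<open>torus_unfold\<close> turns both integrals into integrals over the plane. Henceforth the two
  domains obey the same weak identity.\<close>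

lemma has_weak_deriv_product_test:
  fixes f g :: "real^2 \<Rightarrow> 'a :: euclidean_space"
  assumes w: "has_weak_deriv D a b f g" and t: "test1 \<psi>" "test1 \<eta>"
  shows "(\<integral>v. ((deriv ^^ a) \<psi> (v $ 1) * (deriv ^^ b) \<eta> (v $ 2)) *\<^sub>R f v \<partial>lebesgue)
    = (-1) ^ (a + b) *\<^sub>R (\<integral>v. (\<psi> (v $ 1) * \<eta> (v $ 2)) *\<^sub>R g v \<partial>lebesgue)"
proof (cases D)
  case Plane
  have s: "smooth1 \<psi>" "smooth1 \<eta>" using t by (auto simp: test1_def)
  show ?thesis
    using w[unfolded has_weak_deriv_def, THEN conjunct2, THEN conjunct2, rule_format,
        of "\<lambda>v. \<psi> (v $ 1) * \<eta> (v $ 2)"] test_fun_Plane_product[OF t]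
    unfolding pd_iterate_product[OF s] Plane by (simp add: lebesgue_on_UNIV_eq)
next
  case Torus
  have l: "loc_integrable Torus f" "loc_integrable Torus g"
    using w by (auto simp: has_weak_deriv_def Torus)
  note s = smooth1_periodize[OF t(1)] smooth1_periodize[OF t(2)]
  show ?thesis
    using w[unfolded has_weak_deriv_def, THEN conjunct2, THEN conjunct2, rule_format,
        of "\<lambda>v. periodize \<psi> (v $ 1) * periodize \<eta> (v $ 2)"] test_fun_Torus_product[OF t]
    unfolding pd_iterate_product[OF s] Torus iterate_periodize[OF t(1)] iterate_periodize[OF t(2)]
    by (simp only: torus_unfold[OF l(1) test1_iterate[OF t(1)] test1_iterate[OF t(2)]] torus_unfold[OF l(2) t])
qed

section \<open>Weak derivatives in coordinates and their classical representatives\<close>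

definition weak_ab :: "nat \<Rightarrow> nat \<Rightarrow> (real \<times> real \<Rightarrow> real) \<Rightarrow> (real \<times> real \<Rightarrow> real) \<Rightarrow> bool" where
  "weak_ab a b F G \<longleftrightarrow> (\<forall>\<psi> \<eta>. test1 \<psi> \<longrightarrow> test1 \<eta> \<longrightarrow>
     (\<integral>z. (deriv ^^ a) \<psi> (fst z) * (deriv ^^ b) \<eta> (snd z) * F z \<partial>lborel)
     = (-1) ^ (a + b) * (\<integral>z. \<psi> (fst z) * \<eta> (snd z) * G z \<partial>lborel))"

lemma loc_integrable_inner:
  "loc_integrable D f \<Longrightarrow> loc_integrable D (\<lambda>v. f v \<bullet> c)"
  unfolding loc_integrable_def
  by (cases D) (auto intro: absolutely_integrable_component)

text \<open>The inner product with c selects a component, which reduces vector-valued weak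
  derivatives to scalar ones.\<close>

lemma has_weak_deriv_weak_ab:
  fixes f g :: "real^2 \<Rightarrow> 'a :: euclidean_space"
  assumes w: "has_weak_deriv D a b f g"
    and F: "loc_int F" "AE v in lebesgue. f v \<bullet> c = F (coords v)"
    and G: "loc_int G" "AE v in lebesgue. g v \<bullet> c = G (coords v)"
  shows "weak_ab a b F G"
  unfolding weak_ab_def
proof (intro allI impI)
  fix \<psi> \<eta> assume t: "test1 \<psi>" "test1 \<eta>"
  have l: "loc_integrable D f" "loc_integrable D g" using w by (auto simp: has_weak_deriv_def)
  have inner: "(\<integral>v. (\<alpha> (v $ 1) * \<beta> (v $ 2)) *\<^sub>R h v \<partial>lebesgue) \<bullet> c = (\<integral>z. \<alpha> (fst z) * \<beta> (snd z) * H z \<partial>lborel)"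
    if t: "test1 \<alpha>" "test1 \<beta>" and h: "loc_integrable D h" and H: "loc_int H" "AE v in lebesgue. h v \<bullet> c = H (coords v)"
    for \<alpha> \<beta> H and h :: "real^2 \<Rightarrow> 'a"
  proof -
    have [measurable]: "\<alpha> \<in> borel_measurable borel" "\<beta> \<in> borel_measurable borel" "H \<in> borel_measurable borel"
      using t H(1) by (auto intro: test1_measurable loc_int_measurable)
    obtain B R where BR: "\<And>z. \<bar>\<alpha> (fst z) * \<beta> (snd z)\<bar> \<le> B * indicator (square R) z"
      using test_product_bound[OF t] by blast
    have "integrable lebesgue (\<lambda>v. (\<alpha> (fst (coords v)) * \<beta> (snd (coords v))) *\<^sub>R h v)"
      by (rule loc_integrable_bound[OF h, of "\<lambda>z. \<alpha> (fst z) * \<beta> (snd z)", OF _ BR]) measurable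
    then have "(\<integral>v. (\<alpha> (v $ 1) * \<beta> (v $ 2)) *\<^sub>R h v \<partial>lebesgue) \<bullet> c
       = (\<integral>v. (\<alpha> (v $ 1) * \<beta> (v $ 2)) * (h v \<bullet> c) \<partial>lebesgue)"
      by (subst integral_inner_left[symmetric]) (simp_all add: coords_def)
    also have "\<dots> = (\<integral>z. \<alpha> (fst z) * \<beta> (snd z) * H z \<partial>lborel)"
      using integral_coords_AE(1)[OF loc_integrable_measurable[OF loc_integrable_inner[OF h, of c]], of H
          "\<lambda>z. \<alpha> (fst z) * \<beta> (snd z)"] H(2) by (simp add: coords_def)
    finally show ?thesis .
  qed
  show "(\<integral>z. (deriv ^^ a) \<psi> (fst z) * (deriv ^^ b) \<eta> (snd z) * F z \<partial>lborel)
     = (-1) ^ (a + b) * (\<integral>z. \<psi> (fst z) * \<eta> (snd z) * G z \<partial>lborel)"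
    using arg_cong[OF has_weak_deriv_product_test[OF w t], of "\<lambda>x. x \<bullet> c"]
    by (simp add: inner[OF test1_iterate[OF t(1)] test1_iterate[OF t(2)] l(1) F] inner[OF t l(2) G])
qed

lemma weak_ab_unique:
  assumes G: "loc_int G" "loc_int G'" and w: "weak_ab a b F G" "weak_ab a b F G'"
  shows "AE z in lborel. G z = G' z"
proof -
  have "AE z in lborel. G z - G' z = 0"
  proof (rule loc_int_AE_zero[OF loc_int_diff[OF G]])
    fix \<psi> \<eta> assume t: "test1 \<psi>" "test1 \<eta>"
    have "(-1 :: real) ^ (a + b) * (\<integral>z. \<psi> (fst z) * \<eta> (snd z) * G z \<partial>lborel)
      = (-1) ^ (a + b) * (\<integral>z. \<psi> (fst z) * \<eta> (snd z) * G' z \<partial>lborel)"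
      using w(1)[unfolded weak_ab_def, rule_format, OF t] w(2)[unfolded weak_ab_def, rule_format, OF t] by simp
    then show "(\<integral>z. \<psi> (fst z) * \<eta> (snd z) * (G z - G' z) \<partial>lborel) = 0"
      using integrable_test_product[OF t G(1)] integrable_test_product[OF t G(2)]
      by (simp add: right_diff_distrib)
  qed
  then show ?thesis by eventually_elim simp
qed

lemma integral_swap:
  fixes h :: "real \<times> real \<Rightarrow> real"
  assumes "h \<in> borel_measurable borel"
  shows "(\<integral>z. h (prod.swap z) \<partial>lborel) = (\<integral>z. h z \<partial>lborel)"
proof -
  have "h \<in> borel_measurable (lborel \<Otimes>\<^sub>M lborel)" using assms by (simp add: lborel_prod)
  from lborel_pair.integral_product_swap[OF this] show ?thesis
    by (simp add: lborel_prod case_prod_beta' prod.swap_def)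
qed

text \<open>Use \<open>deriv \<psi>\<close> as test function in the identity of order (a, b): its
  a-th derivative is the derivative of \<psi> of order a + 1, to which the second identity
  applies.\<close>

lemma weak_ab_weak1:
  assumes "weak_ab a b F G" "weak_ab (Suc a) b F H"
  shows "weak1 G H"
  unfolding weak1_def
proof (intro allI impI)
  fix \<psi> \<eta> assume t: "test1 \<psi>" "test1 \<eta>"
  have "(-1 :: real) ^ (a + b) * (\<integral>z. deriv \<psi> (fst z) * \<eta> (snd z) * G z \<partial>lborel)
    = (\<integral>z. (deriv ^^ a) (deriv \<psi>) (fst z) * (deriv ^^ b) \<eta> (snd z) * F z \<partial>lborel)"
    by (rule assms(1)[unfolded weak_ab_def, rule_format, OF test1_deriv[OF t(1)] t(2), symmetric])
  also have "(deriv ^^ a) (deriv \<psi>) = (deriv ^^ Suc a) \<psi>" by (simp add: funpow_swap1)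
  also have "(\<integral>z. (deriv ^^ Suc a) \<psi> (fst z) * (deriv ^^ b) \<eta> (snd z) * F z \<partial>lborel)
    = (-1) ^ (Suc a + b) * (\<integral>z. \<psi> (fst z) * \<eta> (snd z) * H z \<partial>lborel)"
    by (rule assms(2)[unfolded weak_ab_def, rule_format, OF t])
  also have "\<dots> = (-1) ^ (a + b) * (- (\<integral>z. \<psi> (fst z) * \<eta> (snd z) * H z \<partial>lborel))" by simp
  finally show "(\<integral>z. deriv \<psi> (fst z) * \<eta> (snd z) * G z \<partial>lborel) = - (\<integral>z. \<psi> (fst z) * \<eta> (snd z) * H z \<partial>lborel)"
    by (subst (asm) mult_cancel_left) simp
qed

lemma weak_ab_weak1_swapped:
  assumes "weak_ab a b F G" "weak_ab a (Suc b) F H" and l: "loc_int G" "loc_int H"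
  shows "weak1 (swapped G) (swapped H)"
  unfolding weak1_def
proof (intro allI impI)
  fix \<psi> \<eta> assume t: "test1 \<psi>" "test1 \<eta>"
  have sw: "(\<integral>z. \<alpha> (fst z) * \<beta> (snd z) * swapped J z \<partial>lborel) = (\<integral>z. \<beta> (fst z) * \<alpha> (snd z) * J z \<partial>lborel)"
    if "test1 \<alpha>" "test1 \<beta>" "loc_int J" for \<alpha> \<beta> J
  proof -
    have [measurable]: "\<alpha> \<in> borel_measurable borel" "\<beta> \<in> borel_measurable borel" "J \<in> borel_measurable borel"
      using that by (auto intro: test1_measurable loc_int_measurable)
    have "(\<lambda>z. \<beta> (fst z) * \<alpha> (snd z) * J z) \<in> borel_measurable borel" by measurable
    from integral_swap[OF this] show ?thesis by (simp add: swapped_def mult.commute[of "\<alpha> _"])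
  qed
  have "(-1 :: real) ^ (a + b) * (\<integral>z. \<eta> (fst z) * deriv \<psi> (snd z) * G z \<partial>lborel)
    = (\<integral>z. (deriv ^^ a) \<eta> (fst z) * (deriv ^^ b) (deriv \<psi>) (snd z) * F z \<partial>lborel)"
    by (rule assms(1)[unfolded weak_ab_def, rule_format, OF t(2) test1_deriv[OF t(1)], symmetric])
  also have "(deriv ^^ b) (deriv \<psi>) = (deriv ^^ Suc b) \<psi>" by (simp add: funpow_swap1)
  also have "(\<integral>z. (deriv ^^ a) \<eta> (fst z) * (deriv ^^ Suc b) \<psi> (snd z) * F z \<partial>lborel)
    = (-1) ^ (a + Suc b) * (\<integral>z. \<eta> (fst z) * \<psi> (snd z) * H z \<partial>lborel)"
    by (rule assms(2)[unfolded weak_ab_def, rule_format, OF t(2,1)])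
  also have "\<dots> = (-1) ^ (a + b) * (- (\<integral>z. \<eta> (fst z) * \<psi> (snd z) * H z \<partial>lborel))" by simp
  finally have "(\<integral>z. \<eta> (fst z) * deriv \<psi> (snd z) * G z \<partial>lborel) = - (\<integral>z. \<eta> (fst z) * \<psi> (snd z) * H z \<partial>lborel)"
    by (subst (asm) mult_cancel_left) simp
  then show "(\<integral>z. deriv \<psi> (fst z) * \<eta> (snd z) * swapped G z \<partial>lborel)
      = - (\<integral>z. \<psi> (fst z) * \<eta> (snd z) * swapped H z \<partial>lborel)"
    by (simp add: sw[OF test1_deriv[OF t(1)] t(2) l(1)] sw[OF t l(2)])
qed

definition dx :: "(real \<times> real \<Rightarrow> real) \<Rightarrow> (real \<times> real \<Rightarrow> real) \<Rightarrow> bool" where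
  "dx f g \<longleftrightarrow> (\<forall>x y. ((\<lambda>x. f (x, y)) has_real_derivative g (x, y)) (at x))"

definition dy :: "(real \<times> real \<Rightarrow> real) \<Rightarrow> (real \<times> real \<Rightarrow> real) \<Rightarrow> bool" where
  "dy f g \<longleftrightarrow> (\<forall>x y. ((\<lambda>y. f (x, y)) has_real_derivative g (x, y)) (at y))"

lemma weak1_cong_AE:
  assumes l: "loc_int F" "loc_int G" "loc_int F'" "loc_int G'"
    and eq: "AE z in lborel. F z = F' z" "AE z in lborel. G z = G' z"
    and w: "weak1 F G"
  shows "weak1 F' G'"
  unfolding weak1_def
proof (intro allI impI)
  fix \<psi> \<eta> assume t: "test1 \<psi>" "test1 \<eta>"
  have cong: "(\<integral>z. \<alpha> (fst z) * \<beta> (snd z) * J z \<partial>lborel) = (\<integral>z. \<alpha> (fst z) * \<beta> (snd z) * J' z \<partial>lborel)"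
    if "test1 \<alpha>" "test1 \<beta>" "loc_int J" "loc_int J'" "AE z in lborel. J z = J' z" for \<alpha> \<beta> J J'
  proof (rule integral_cong_AE)
    show "(\<lambda>z. \<alpha> (fst z) * \<beta> (snd z) * J z) \<in> borel_measurable lborel"
      using that by (intro borel_measurable_integrable integrable_test_product)
    show "(\<lambda>z. \<alpha> (fst z) * \<beta> (snd z) * J' z) \<in> borel_measurable lborel"
      using that by (intro borel_measurable_integrable integrable_test_product)
    show "AE z in lborel. \<alpha> (fst z) * \<beta> (snd z) * J z = \<alpha> (fst z) * \<beta> (snd z) * J' z"
      using that(5) by eventually_elim simp
  qed
  show "(\<integral>z. deriv \<psi> (fst z) * \<eta> (snd z) * F' z \<partial>lborel) = - (\<integral>z. \<psi> (fst z) * \<eta> (snd z) * G' z \<partial>lborel)"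
    using w t cong[OF test1_deriv[OF t(1)] t(2) l(1,3) eq(1)] cong[OF t l(2,4) eq(2)]
    unfolding weak1_def by simp
qed

lemma weak1_dx:
  assumes l: "loc_int F" "loc_int G" and c: "continuous_on UNIV F'" "continuous_on UNIV G'"
    and eq: "AE z in lborel. F z = F' z" "AE z in lborel. G z = G' z"
    and w: "weak1 F G"
  shows "dx F' G'"
  unfolding dx_def
  using weak1_continuous_deriv[OF c weak1_cong_AE[OF l continuous_loc_int[OF c(1)] continuous_loc_int[OF c(2)] eq w]]
  by blast

lemma weak1_dy:
  assumes l: "loc_int F" "loc_int G" and c: "continuous_on UNIV F'" "continuous_on UNIV G'"
    and eq: "AE z in lborel. F z = F' z" "AE z in lborel. G z = G' z"
    and w: "weak1 (swapped F) (swapped G)"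
  shows "dy F' G'"
proof -
  have "AE z in lborel. swapped F z = swapped F' z" "AE z in lborel. swapped G z = swapped G' z"
    using AE_swap[OF eq(1)] AE_swap[OF eq(2)] by (simp_all add: swapped_def)
  from weak1_dx[OF loc_int_swapped[OF l(1)] loc_int_swapped[OF l(2)] continuous_swap[OF c(1)] continuous_swap[OF c(2)] this w]
  show ?thesis by (simp add: dx_def dy_def swapped_def)
qed

text \<open>Two orders are lost: continuity of the derivative (a, b) is drawn from the weak
  derivatives (a + 1, b), (a, b + 1) and (a + 1, b + 1), the last of order up to n + 2.\<close>

lemma weak_ab_classical:
  assumes W: "\<And>a b. a + b \<le> Suc (Suc n) \<Longrightarrow> loc_int (W a b) \<and> weak_ab a b F (W a b)"
  shows "\<exists>V. \<forall>a b. a + b \<le> n \<longrightarrow> continuous_on UNIV (V a b) \<and> (AE z in lborel. W a b z = V a b z)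
     \<and> (a + b < n \<longrightarrow> dx (V a b) (V (Suc a) b) \<and> dy (V a b) (V a (Suc b)))"
proof -
  have "\<forall>p. \<exists>V. fst p + snd p \<le> n \<longrightarrow> continuous_on UNIV V \<and> (AE z in lborel. W (fst p) (snd p) z = V z)"
  proof (rule allI)
    fix p :: "nat \<times> nat"
    obtain a b where p: "p = (a, b)" by (cases p)
    show "\<exists>V. fst p + snd p \<le> n \<longrightarrow> continuous_on UNIV V \<and> (AE z in lborel. W (fst p) (snd p) z = V z)"
    proof (cases "a + b \<le> n")
      case True
      have *: "loc_int (W a b)" "loc_int (W (Suc a) b)" "loc_int (W a (Suc b))" "loc_int (W (Suc a) (Suc b))"
        "weak_ab a b F (W a b)" "weak_ab (Suc a) b F (W (Suc a) b)" "weak_ab a (Suc b) F (W a (Suc b))"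
        "weak_ab (Suc a) (Suc b) F (W (Suc a) (Suc b))"
        using W True by auto
      show ?thesis
        using weak_mixed_continuous[OF *(1-4) weak_ab_weak1[OF *(5,6)] weak_ab_weak1_swapped[OF *(5,7,1,3)]
            weak_ab_weak1[OF *(7,8)] weak_ab_weak1_swapped[OF *(6,8,2,4)]] by (simp add: p)
    qed (simp add: p)
  qed
  from choice[OF this] obtain U where U: "\<forall>p. fst p + snd p \<le> n \<longrightarrow> continuous_on UNIV (U p) \<and> (AE z in lborel. W (fst p) (snd p) z = U p z)"
    by blast
  define V where "V a b = U (a, b)" for a b
  have V: "\<And>a b. a + b \<le> n \<Longrightarrow> continuous_on UNIV (V a b)"
      "\<And>a b. a + b \<le> n \<Longrightarrow> AE z in lborel. W a b z = V a b z"
    using U by (auto simp: V_def)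
  have "dx (V a b) (V (Suc a) b)" if ab: "a + b < n" for a b
  proof -
    have *: "loc_int (W a b)" "loc_int (W (Suc a) b)" "weak_ab a b F (W a b)" "weak_ab (Suc a) b F (W (Suc a) b)"
      "a + b \<le> n" "Suc a + b \<le> n"
      using W[of a b] W[of "Suc a" b] ab by simp_all
    show ?thesis
      by (rule weak1_dx[OF *(1,2) V(1)[OF *(5)] V(1)[OF *(6)] V(2)[OF *(5)] V(2)[OF *(6)] weak_ab_weak1[OF *(3,4)]])
  qed
  moreover have "dy (V a b) (V a (Suc b))" if ab: "a + b < n" for a b
  proof -
    have *: "loc_int (W a b)" "loc_int (W a (Suc b))" "weak_ab a b F (W a b)" "weak_ab a (Suc b) F (W a (Suc b))"
      "a + b \<le> n" "a + Suc b \<le> n"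
      using W[of a b] W[of a "Suc b"] ab by simp_all
    show ?thesis
      by (rule weak1_dy[OF *(1,2) V(1)[OF *(5)] V(1)[OF *(6)] V(2)[OF *(5)] V(2)[OF *(6)]
            weak_ab_weak1_swapped[OF *(3,4,1,2)]])
  qed
  ultimately show ?thesis using V by blast
qed

section \<open>The fundamental domain\<close>

lemma AE_translation:
  assumes "AE v in (lebesgue :: (real^2) measure). P v"
  shows "AE v in lebesgue. P (v + T)"
proof -
  have e: "(\<lambda>x :: real^2. T + (\<Sum>j\<in>Basis. (1 * (x \<bullet> j)) *\<^sub>R j)) = (\<lambda>x. x + T)"
    by (simp add: euclidean_representation add.commute)
  have m: "(\<lambda>x. x + T) \<in> lebesgue \<rightarrow>\<^sub>M lebesgue"
    using lebesgue_affine_measurable[of "\<lambda>j. 1" T] unfolding e by simp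
  have d: "distr lebesgue lebesgue (\<lambda>x. x + T) = lebesgue"
    using lebesgue_affine_euclidean[of "\<lambda>j. 1" T] unfolding e by (simp add: density_1)
  show ?thesis using AE_distrD[OF m, of P] assms unfolding d by simp
qed

lemma cell_lebesgue [measurable, simp]: "cell D \<in> sets lebesgue"
  by (cases D) simp_all

lemma AE_dom_measure_iff: "(AE v in dom_measure D. P v) \<longleftrightarrow> (AE v in lebesgue. v \<in> cell D \<longrightarrow> P v)"
  by (rule AE_restrict_space_iff) simp

lemma AE_dom_measure: "AE v in lebesgue. P v \<Longrightarrow> AE v in dom_measure D. P v"
  unfolding AE_dom_measure_iff by (erule eventually_mono) simp

text \<open>Countably many translates of the cell cover the plane, and by periodicity the
  exceptional set in each is a translate of the one in the cell.\<close>

lemma AE_dom_measure_periodic: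
  assumes P: "fun_on D P" and ae: "AE v in dom_measure D. P v"
  shows "AE v in lebesgue. P v"
proof (cases D)
  case Plane
  show ?thesis using ae unfolding Plane cell.simps lebesgue_on_UNIV_eq .
next
  case Torus
  have per: "P (v + period p) = P v" for v p
    using fun_on_Torus_period[of P] P Torus by simp
  have "AE v in lebesgue. v \<in> cell Torus \<longrightarrow> P v"
    using ae unfolding AE_dom_measure_iff Torus .
  then have "AE v in lebesgue. v + period p \<in> cell Torus \<longrightarrow> P v" for p
    using AE_translation[of "\<lambda>v. v \<in> cell Torus \<longrightarrow> P v" "period p"] by (simp only: per)
  then have "AE v in lebesgue. \<forall>p. v + period p \<in> cell Torus \<longrightarrow> P v"
    unfolding AE_all_countable by (rule allI)
  then show ?thesis
  proof eventually_elim
    case (elim v)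
    have ex: "\<exists>k. x + 2 * pi * real_of_int k \<in> {0..2*pi}" for x
    proof -
      define k0 where "k0 = \<lfloor>x / (2 * pi)\<rfloor>"
      have "real_of_int k0 \<le> x / (2 * pi)" "x / (2 * pi) < real_of_int k0 + 1"
        unfolding k0_def by linarith+
      then have "2 * pi * real_of_int k0 \<le> x" "x < 2 * pi * (real_of_int k0 + 1)"
        using pi_gt_zero by (simp_all add: field_simps)
      then show ?thesis by (intro exI[of _ "- k0"]) (simp add: algebra_simps)
    qed
    obtain k l where "v $ 1 + 2 * pi * real_of_int k \<in> {0..2*pi}" "v $ 2 + 2 * pi * real_of_int l \<in> {0..2*pi}"
      using ex by blast
    then have "v + period (k, l) \<in> cell Torus" unfolding cell_Torus_iff by (simp add: period_def)
    with elim show "P v" by blast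
  qed
qed

section \<open>Measures on the period interval and on the period cell\<close>

fun side :: "flow_domain \<Rightarrow> real set" where
  "side Plane = UNIV"
| "side Torus = {0..2*pi}"

lemma side_borel [measurable, simp]: "side D \<in> sets borel"
  by (cases D) simp_all

text \<open>A density of \<open>lborel\<close>, rather than a restriction, keeps the whole line as
  underlying space and the Borel sets as measurable sets, so that plane and torus share the same
  statements.\<close>

definition line_measure :: "flow_domain \<Rightarrow> real measure" where
  "line_measure D = density lborel (indicator (side D))"

definition plane_measure :: "flow_domain \<Rightarrow> (real \<times> real) measure" where
  "plane_measure D = density lborel (indicator (side D \<times> side D))"

lemma sets_line_measure [measurable_cong, simp]: "sets (line_measure D) = sets borel"
  and sets_plane_measure [measurable_cong, simp]: "sets (plane_measure D) = sets borel"
  and space_line_measure [simp]: "space (line_measure D) = UNIV"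
  and space_plane_measure [simp]: "space (plane_measure D) = UNIV"
  by (simp_all add: line_measure_def plane_measure_def)

lemma side_Times_borel [measurable]: "side D \<times> side D \<in> sets borel"
  by (cases D) (auto intro!: borel_closed closed_Times)

lemma sigma_finite_line_measure: "sigma_finite_measure (line_measure D)"
  unfolding line_measure_def
  by (subst sigma_finite_measure.sigma_finite_iff_density_finite[OF lborel.sigma_finite_measure_axioms])
    (auto simp: indicator_def)

lemma plane_measure_pair: "line_measure D \<Otimes>\<^sub>M line_measure D = plane_measure D"
proof -
  have "line_measure D \<Otimes>\<^sub>M line_measure D
    = density (lborel \<Otimes>\<^sub>M lborel) (\<lambda>(x, y). indicator (side D) x * indicator (side D) y)"
    unfolding line_measure_def
  proof (rule pair_measure_density)
    show "sigma_finite_measure (density lborel (indicator (side D) :: real \<Rightarrow> ennreal))"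
      using sigma_finite_line_measure[of D] by (simp add: line_measure_def)
  qed (simp_all add: lborel.sigma_finite_measure_axioms)
  also have "(\<lambda>(x, y). indicator (side D) x * indicator (side D) y :: ennreal) = indicator (side D \<times> side D)"
    by (auto simp: indicator_def fun_eq_iff)
  finally show ?thesis by (simp add: lborel_prod plane_measure_def)
qed

lemma pair_sigma_finite_line_measure: "pair_sigma_finite (line_measure D) (line_measure D)"
  unfolding pair_sigma_finite_def by (simp add: sigma_finite_line_measure)

lemma line_measure_integral:
  fixes f :: "real \<Rightarrow> real"
  assumes [measurable]: "f \<in> borel_measurable borel"
  shows integral_line_measure: "(\<integral>x. f x \<partial>line_measure D) = (\<integral>x. indicator (side D) x * f x \<partial>lborel)"
    and integrable_line_measure: "integrable (line_measure D) f \<longleftrightarrow> integrable lborel (\<lambda>x. indicator (side D) x * f x)"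
proof -
  have d: "line_measure D = density lborel (\<lambda>x. ennreal (indicator (side D) x))"
    unfolding line_measure_def by (simp add: ennreal_indicator)
  show "(\<integral>x. f x \<partial>line_measure D) = (\<integral>x. indicator (side D) x * f x \<partial>lborel)"
    unfolding d by (subst integral_real_density) simp_all
  show "integrable (line_measure D) f \<longleftrightarrow> integrable lborel (\<lambda>x. indicator (side D) x * f x)"
    unfolding d by (subst integrable_real_density) simp_all
qed

lemma plane_measure_integral:
  fixes f :: "real \<times> real \<Rightarrow> real"
  assumes [measurable]: "f \<in> borel_measurable borel"
  shows integral_plane_measure: "(\<integral>z. f z \<partial>plane_measure D) = (\<integral>z. indicator (side D \<times> side D) z * f z \<partial>lborel)"
    and integrable_plane_measure: "integrable (plane_measure D) f \<longleftrightarrow> integrable lborel (\<lambda>z. indicator (side D \<times> side D) z * f z)"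
proof -
  have d: "plane_measure D = density lborel (\<lambda>x. ennreal (indicator (side D \<times> side D) x))"
    unfolding plane_measure_def by (simp add: ennreal_indicator)
  show "(\<integral>z. f z \<partial>plane_measure D) = (\<integral>z. indicator (side D \<times> side D) z * f z \<partial>lborel)"
    unfolding d by (subst integral_real_density) simp_all
  show "integrable (plane_measure D) f \<longleftrightarrow> integrable lborel (\<lambda>z. indicator (side D \<times> side D) z * f z)"
    unfolding d by (subst integrable_real_density) simp_all
qed

lemma cell_coords: "v \<in> cell D \<longleftrightarrow> coords v \<in> side D \<times> side D"
  by (cases D) (auto simp: coords_def cell_Torus_iff simp del: cell.simps(2))

lemma dom_measure_integral:
  fixes f :: "real^2 \<Rightarrow> real"
  assumes f: "f \<in> borel_measurable lebesgue" and F [measurable]: "F \<in> borel_measurable borel"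
    and eq: "AE v in lebesgue. f v = F (coords v)"
  shows integral_dom_measure: "(\<integral>v. f v \<partial>dom_measure D) = (\<integral>z. F z \<partial>plane_measure D)"
    and integrable_dom_measure: "integrable (dom_measure D) f \<longleftrightarrow> integrable (plane_measure D) F"
proof -
  have ind: "indicator (cell D) v * f v = indicator (side D \<times> side D) (coords v) * f v" for v
    using cell_coords[of v D] by (simp add: indicator_def)
  have h [measurable]: "indicator (side D \<times> side D) \<in> borel_measurable (borel :: (real \<times> real) measure)"
    by measurable
  have "(\<integral>v. f v \<partial>dom_measure D) = (\<integral>v. indicator (side D \<times> side D) (coords v) * f v \<partial>lebesgue)"
    by (subst integral_restrict_space) (simp_all add: ind)
  then show "(\<integral>v. f v \<partial>dom_measure D) = (\<integral>z. F z \<partial>plane_measure D)"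
    using integral_coords_AE(1)[OF f F h eq] by (simp add: integral_plane_measure)
  have "integrable (dom_measure D) f \<longleftrightarrow> integrable lebesgue (\<lambda>v. indicator (side D \<times> side D) (coords v) * f v)"
    by (subst integrable_restrict_space) (simp_all add: ind)
  then show "integrable (dom_measure D) f \<longleftrightarrow> integrable (plane_measure D) F"
    using integral_coords_AE(2)[OF f F h eq] by (simp add: integrable_plane_measure)
qed

section \<open>Periodic continuous representatives of Sobolev functions\<close>

definition periodic :: "flow_domain \<Rightarrow> (real \<times> real \<Rightarrow> real) \<Rightarrow> bool" where
  "periodic D f \<longleftrightarrow> (D = Torus \<longrightarrow> (\<forall>x y. f (x + 2 * pi, y) = f (x, y) \<and> f (x, y + 2 * pi) = f (x, y)))"

text \<open>A translate of F by a period is continuous and agrees with F almost everywhere, hence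
  everywhere.\<close>

lemma periodic_representative:
  assumes f: "fun_on D f" and F: "continuous_on UNIV F" and eq: "AE v in lebesgue. f v = F (coords v)"
  shows "periodic D F"
  unfolding periodic_def
proof (intro impI)
  assume D: "D = Torus"
  have [measurable]: "F \<in> borel_measurable borel" using F by (rule borel_measurable_continuous_onI)
  have *: "F (z + c) = F z" if c: "\<And>v. coords (v + T) = coords v + c" and fT: "\<And>v. f (v + T) = f v" for T c z
  proof (rule continuous_AE_eq[where f="\<lambda>z. F (z + c)" and g=F, OF _ F])
    show cont: "continuous_on UNIV (\<lambda>z. F (z + c))"
      by (rule continuous_on_compose2[OF F]) (auto intro!: continuous_intros)
    then have "(\<lambda>z. F (z + c)) \<in> borel_measurable borel" by (rule borel_measurable_continuous_onI)
    moreover have "AE v in lebesgue. F (coords v + c) = F (coords v)"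
      using AE_translation[OF eq, of T] eq by eventually_elim (simp add: c fT)
    ultimately show "AE z in lborel. F (z + c) = F z" by (intro AE_coords_eq) simp_all
  qed
  have per: "f (v + axis i (2 * pi)) = f v" for v i using f D by simp
  have "coords (v + axis 1 (2 * pi)) = coords v + (2 * pi, 0)" "coords (v + axis 2 (2 * pi)) = coords v + (0, 2 * pi)" for v
    by (simp_all add: coords_def axis_def)
  from *[OF this(1) per] *[OF this(2) per]
  show "\<forall>x y. F (x + 2 * pi, y) = F (x, y) \<and> F (x, y + 2 * pi) = F (x, y)"
    by (metis add.right_neutral add_Pair)
qed

lemma has_weak_deriv_unique:
  fixes f g :: "real^2 \<Rightarrow> 'a :: euclidean_space"
  assumes w: "has_weak_deriv D a b f g" "has_weak_deriv D a b f' g'" and ff: "AE v in lebesgue. f v = f' v"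
  shows "AE v in lebesgue. g v = g' v"
proof -
  have "AE v in lebesgue. g v \<bullet> c = g' v \<bullet> c" for c
  proof -
    have l: "loc_integrable D f" "loc_integrable D g" "loc_integrable D g'"
      using w by (auto simp: has_weak_deriv_def)
    obtain F where F: "loc_int F" "AE v in lebesgue. f v \<bullet> c = F (coords v)"
      using loc_integrable_representative[OF loc_integrable_inner[OF l(1), of c]] by blast
    obtain G where G: "loc_int G" "AE v in lebesgue. g v \<bullet> c = G (coords v)"
      using loc_integrable_representative[OF loc_integrable_inner[OF l(2), of c]] by blast
    obtain G' where G': "loc_int G'" "AE v in lebesgue. g' v \<bullet> c = G' (coords v)"
      using loc_integrable_representative[OF loc_integrable_inner[OF l(3), of c]] by blast
    have F': "AE v in lebesgue. f' v \<bullet> c = F (coords v)" using F(2) ff by eventually_elim simp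
    from AE_coords[OF weak_ab_unique[OF G(1) G'(1) has_weak_deriv_weak_ab[OF w(1) F G]
          has_weak_deriv_weak_ab[OF w(2) F(1) F' G']]] G(2) G'(2)
    show ?thesis by eventually_elim simp
  qed
  then have "AE v in lebesgue. \<forall>c\<in>Basis. g v \<bullet> c = g' v \<bullet> c"
    by (intro AE_finite_allI) auto
  then show ?thesis by eventually_elim (rule euclidean_eqI, blast)
qed

lemma has_weak_deriv_wderiv: "has_weak_deriv D a b f g \<Longrightarrow> has_weak_deriv D a b f (wderiv D a b f)"
  unfolding wderiv_def using someI[of "has_weak_deriv D a b f" g] by simp

lemma wderiv_eq_AE:
  fixes f g :: "real^2 \<Rightarrow> 'a :: euclidean_space"
  assumes "has_weak_deriv D a b f g"
  shows "AE v in lebesgue. wderiv D a b f v = g v"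
  using has_weak_deriv_unique[OF has_weak_deriv_wderiv[OF assms] assms] by simp

lemma has_weak_deriv_0: "loc_integrable D f \<Longrightarrow> has_weak_deriv D 0 0 f f"
  by (simp add: has_weak_deriv_def)

lemma L2_space_cong_AE:
  fixes f g :: "real^2 \<Rightarrow> 'a :: euclidean_space"
  assumes f: "f \<in> L2_space D" and g: "loc_integrable D g" and eq: "AE v in lebesgue. f v = g v"
  shows "g \<in> L2_space D" "L2_norm_on D g = L2_norm_on D f"
proof -
  have m: "g \<in> borel_measurable (dom_measure D)"
    using loc_integrable_measurable[OF g] by (rule measurable_restrict_space1)
  have mf: "f \<in> borel_measurable (dom_measure D)" using f by (simp add: L2_space_def)
  have ae: "AE v in dom_measure D. (norm (g v))\<^sup>2 = (norm (f v))\<^sup>2"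
    using AE_dom_measure[OF eq, of D] by eventually_elim simp
  have "integrable (dom_measure D) (\<lambda>v. (norm (g v))\<^sup>2) \<longleftrightarrow> integrable (dom_measure D) (\<lambda>v. (norm (f v))\<^sup>2)"
    by (rule integrable_cong_AE) (use m mf ae in auto)
  then show "g \<in> L2_space D" using f g m by (simp add: L2_space_def loc_integrable_def)
  have "(\<integral>v. (norm (g v))\<^sup>2 \<partial>dom_measure D) = (\<integral>v. (norm (f v))\<^sup>2 \<partial>dom_measure D)"
    by (rule integral_cong_AE) (use m mf ae in auto)
  then show "L2_norm_on D g = L2_norm_on D f" by (simp add: L2_norm_on_def)
qed

text \<open>\<open>wderiv\<close> is some weak derivative, a priori not the square-integrable one
  that \<open>H_space\<close> provides; uniqueness almost everywhere transfers the
  integrability.\<close>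

lemma H_space_wderiv:
  assumes u: "u \<in> H_space D k" and ab: "a + b \<le> k"
  shows "has_weak_deriv D a b u (wderiv D a b u)" "wderiv D a b u \<in> L2_space D" "loc_integrable D (wderiv D a b u)"
proof -
  obtain g where g: "g \<in> L2_space D" "has_weak_deriv D a b u g" using u ab by (auto simp: H_space_def)
  show w: "has_weak_deriv D a b u (wderiv D a b u)" using g(2) by (rule has_weak_deriv_wderiv)
  then show l: "loc_integrable D (wderiv D a b u)" by (simp add: has_weak_deriv_def)
  show "wderiv D a b u \<in> L2_space D"
    using L2_space_cong_AE(1)[OF g(1) l] has_weak_deriv_unique[OF g(2) w] by simp
qed

lemma H_space_classical:
  fixes u :: "real^2 \<Rightarrow> real^2"
  assumes u: "u \<in> H_space D (Suc (Suc n))"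
  shows "\<exists>V. \<forall>a b. a + b \<le> n \<longrightarrow> continuous_on UNIV (V a b) \<and> periodic D (V a b)
     \<and> (AE v in lebesgue. wderiv D a b u v $ i = V a b (coords v))
     \<and> (a + b < n \<longrightarrow> dx (V a b) (V (Suc a) b) \<and> dy (V a b) (V a (Suc b)))"
proof -
  let ?c = "axis i 1 :: real^2"
  have comp: "x \<bullet> ?c = x $ i" for x by (simp add: inner_axis)
  note w = H_space_wderiv[OF u]
  have lu: "loc_integrable D u" using w(1)[of 0 0] by (simp add: has_weak_deriv_def)
  obtain F where F: "loc_int F" "AE v in lebesgue. u v \<bullet> ?c = F (coords v)"
    using loc_integrable_representative[OF loc_integrable_inner[OF lu]] by blast
  have "\<forall>p. \<exists>W. fst p + snd p \<le> Suc (Suc n) \<longrightarrow> loc_int W \<and> (AE v in lebesgue. wderiv D (fst p) (snd p) u v \<bullet> ?c = W (coords v))"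
    using loc_integrable_representative[OF loc_integrable_inner[OF w(3), of _ _ ?c]] by blast
  from choice[OF this] obtain W where W: "\<And>a b. a + b \<le> Suc (Suc n) \<Longrightarrow> loc_int (W (a, b))"
    "\<And>a b. a + b \<le> Suc (Suc n) \<Longrightarrow> AE v in lebesgue. wderiv D a b u v \<bullet> ?c = W (a, b) (coords v)"
    by auto
  have "loc_int (W (a, b)) \<and> weak_ab a b F (W (a, b))" if "a + b \<le> Suc (Suc n)" for a b
    using W(1)[OF that] has_weak_deriv_weak_ab[OF w(1)[OF that] F W(1)[OF that] W(2)[OF that]] by blast
  from weak_ab_classical[of n "\<lambda>a b. W (a, b)", OF this] obtain V where V:
    "\<And>a b. a + b \<le> n \<Longrightarrow> continuous_on UNIV (V a b) \<and> (AE z in lborel. W (a, b) z = V a b z)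
     \<and> (a + b < n \<longrightarrow> dx (V a b) (V (Suc a) b) \<and> dy (V a b) (V a (Suc b)))"
    by blast
  have ae: "AE v in lebesgue. wderiv D a b u v $ i = V a b (coords v)" if ab: "a + b \<le> n" for a b
  proof -
    have "AE z in lborel. W (a, b) z = V a b z" using V[OF ab] by blast
    then have "AE v in lebesgue. W (a, b) (coords v) = V a b (coords v)" by (rule AE_coords)
    moreover have "AE v in lebesgue. wderiv D a b u v \<bullet> ?c = W (a, b) (coords v)"
      by (rule W(2)) (use ab in simp)
    ultimately show ?thesis by eventually_elim (simp add: comp)
  qed
  have "periodic D (V a b)" if ab: "a + b \<le> n" for a b
  proof (rule periodic_representative[OF _ _ ae[OF ab]])
    show "fun_on D (\<lambda>v. wderiv D a b u v $ i)"
      using w(3)[of a b] ab by (cases D) (auto simp: loc_integrable_def)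
  qed (use V[OF ab] in blast)
  with V ae show ?thesis by blast
qed

section \<open>Square-integrable continuous functions\<close>

text \<open>The integral of (|f| - t |g|)^2 is a quadratic polynomial in t that is nowhere
  negative.\<close>

lemma Cauchy_Schwarz_integral:
  fixes f g :: "'a \<Rightarrow> real"
  assumes [measurable]: "f \<in> borel_measurable M" "g \<in> borel_measurable M"
    and f: "integrable M (\<lambda>x. (f x)\<^sup>2)" and g: "integrable M (\<lambda>x. (g x)\<^sup>2)"
  shows "integrable M (\<lambda>x. f x * g x)"
    and "(\<integral>x. \<bar>f x * g x\<bar> \<partial>M)\<^sup>2 \<le> (\<integral>x. (f x)\<^sup>2 \<partial>M) * (\<integral>x. (g x)\<^sup>2 \<partial>M)"
proof -
  show i: "integrable M (\<lambda>x. f x * g x)"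
  proof (rule Bochner_Integration.integrable_bound)
    show "integrable M (\<lambda>x. (f x)\<^sup>2 + (g x)\<^sup>2)" using f g by simp
    have "\<bar>f x * g x\<bar> \<le> (f x)\<^sup>2 + (g x)\<^sup>2" for x
    proof -
      have "0 \<le> (\<bar>f x\<bar> - \<bar>g x\<bar>)\<^sup>2" by simp
      then have "2 * (\<bar>f x\<bar> * \<bar>g x\<bar>) \<le> (f x)\<^sup>2 + (g x)\<^sup>2" by (simp add: power2_diff)
      moreover have "0 \<le> \<bar>f x\<bar> * \<bar>g x\<bar>" by simp
      ultimately show ?thesis unfolding abs_mult by linarith
    qed
    then show "AE x in M. norm (f x * g x) \<le> norm ((f x)\<^sup>2 + (g x)\<^sup>2)" by simp
  qed measurable
  let ?A = "\<integral>x. (f x)\<^sup>2 \<partial>M" and ?B = "\<integral>x. \<bar>f x * g x\<bar> \<partial>M" and ?C = "\<integral>x. (g x)\<^sup>2 \<partial>M"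
  have C: "0 \<le> ?C" by simp
  have q: "0 \<le> ?A - 2 * t * ?B + t\<^sup>2 * ?C" for t
  proof -
    have "0 \<le> (\<integral>x. (\<bar>f x\<bar> - t * \<bar>g x\<bar>)\<^sup>2 \<partial>M)" by simp
    also have "\<dots> = (\<integral>x. (f x)\<^sup>2 - 2 * t * \<bar>f x * g x\<bar> + t\<^sup>2 * (g x)\<^sup>2 \<partial>M)"
      by (rule Bochner_Integration.integral_cong) (auto simp: power2_diff power_mult_distrib abs_mult)
    also have "\<dots> = ?A - 2 * t * ?B + t\<^sup>2 * ?C"
      using f g integrable_abs[OF i] by simp
    finally show ?thesis .
  qed
  show "?B\<^sup>2 \<le> ?A * ?C"
  proof (cases "?C = 0")
    case True
    have "?B = 0"
    proof (rule ccontr)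
      assume "?B \<noteq> 0"
      \<comment> \<open>When the integral of g^2 is 0 the polynomial is linear in t, and this t
        gives it the value -1.\<close>
      with q[of "(?A + 1) / (2 * ?B)"] True show False by simp
    qed
    then show ?thesis by simp
  next
    case False
    then have "0 < ?C" using C by (metis order_le_less)
    then show ?thesis using q[of "?B / ?C"] by (simp add: field_simps power2_eq_square)
  qed
qed

section \<open>Continuous square-integrable functions and one-dimensional sup bounds\<close>

definition l2fun :: "flow_domain \<Rightarrow> (real \<times> real \<Rightarrow> real) \<Rightarrow> bool" where
  "l2fun D f \<longleftrightarrow> continuous_on UNIV f \<and> periodic D f \<and> integrable (plane_measure D) (\<lambda>z. (f z)\<^sup>2)"

definition nsq :: "flow_domain \<Rightarrow> (real \<times> real \<Rightarrow> real) \<Rightarrow> real" where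
  "nsq D f = (\<integral>z. (f z)\<^sup>2 \<partial>plane_measure D)"

lemma nsq_nonneg [simp]: "0 \<le> nsq D f"
  by (simp add: nsq_def)

lemma l2fun_measurable: "l2fun D f \<Longrightarrow> f \<in> borel_measurable borel"
  by (simp add: l2fun_def borel_measurable_continuous_onI)

lemma l2fun_mult:
  assumes "l2fun D f" "l2fun D g"
  shows "integrable (plane_measure D) (\<lambda>z. f z * g z)"
    and "(\<integral>z. \<bar>f z * g z\<bar> \<partial>plane_measure D)\<^sup>2 \<le> nsq D f * nsq D g"
  using Cauchy_Schwarz_integral[of f "plane_measure D" g] assms l2fun_measurable[of D]
  by (auto simp: l2fun_def nsq_def)

text \<open>The weight of the lower-order term in the one-dimensional sup bound: absent on the line,
  where square integrability excludes non-zero constants, and 1 on the circle, where constants must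
  be controlled.\<close>

definition lam :: "flow_domain \<Rightarrow> real" where
  "lam D = (if D = Plane then 0 else 1)"

text \<open>Integrate the derivative 2 \<phi> \<psi> of \<phi>^2 between the two points, then
  enlarge the interval to the whole side.\<close>

lemma square_diff_le:
  assumes d: "\<And>y. (\<phi> has_real_derivative \<psi> y) (at y)" and c: "continuous_on UNIV \<psi>"
    and i: "integrable (line_measure D) (\<lambda>y. \<phi> y * \<psi> y)" and y: "y \<in> side D" "y' \<in> side D"
  shows "(\<phi> y)\<^sup>2 \<le> (\<phi> y')\<^sup>2 + 2 * (\<integral>y. \<bar>\<phi> y * \<psi> y\<bar> \<partial>line_measure D)"
proof -
  have \<phi>c: "continuous_on UNIV \<phi>" using DERIV_isCont[OF d] by (simp add: continuous_at_imp_continuous_on)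
  have [measurable]: "\<phi> \<in> borel_measurable borel" "\<psi> \<in> borel_measurable borel"
    using c \<phi>c by (auto intro: borel_measurable_continuous_onI)
  define a b where "a = min y y'" and "b = max y y'"
  have ab: "a \<le> b" "{a..b} \<subseteq> side D" using y by (cases D; auto simp: a_def b_def)+
  have ftc: "(\<integral>s. indicator {a..b} s *\<^sub>R (2 * (\<phi> s * \<psi> s)) \<partial>lborel) = (\<phi> b)\<^sup>2 - (\<phi> a)\<^sup>2"
  proof (rule integral_FTC_atLeastAtMost[OF ab(1)])
    fix s
    have "((\<lambda>s. (\<phi> s)\<^sup>2) has_real_derivative 2 * (\<phi> s * \<psi> s)) (at s)"
      using d[of s] by (auto intro!: derivative_eq_intros)
    then show "((\<lambda>s. (\<phi> s)\<^sup>2) has_vector_derivative 2 * (\<phi> s * \<psi> s)) (at s within {a..b})"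
      unfolding has_real_derivative_iff_has_vector_derivative by (rule has_vector_derivative_at_within)
    show "continuous_on {a..b} (\<lambda>s. 2 * (\<phi> s * \<psi> s))"
      by (intro continuous_intros continuous_on_subset[OF c] continuous_on_subset[OF \<phi>c]) auto
  qed
  have int: "integrable lborel (\<lambda>s. indicator (side D) s * (\<phi> s * \<psi> s))"
    using i by (subst (asm) integrable_line_measure) measurable
  have "\<bar>(\<phi> b)\<^sup>2 - (\<phi> a)\<^sup>2\<bar> \<le> (\<integral>s. 2 * \<bar>indicator (side D) s * (\<phi> s * \<psi> s)\<bar> \<partial>lborel)"
    unfolding ftc[symmetric] real_norm_def[symmetric]
  proof (rule Bochner_Integration.integral_norm_bound_integral)
    have "integrable lborel (\<lambda>s. indicator {a..b} s *\<^sub>R (indicator (side D) s * (\<phi> s * \<psi> s)))"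
      by (rule integrable_mult_indicator[OF _ int]) simp
    also have "(\<lambda>s. indicator {a..b} s *\<^sub>R (indicator (side D) s * (\<phi> s * \<psi> s))) = (\<lambda>s. indicator {a..b} s *\<^sub>R (\<phi> s * \<psi> s))"
      using ab(2) by (auto simp: indicator_def fun_eq_iff)
    finally have "integrable lborel (\<lambda>s. 2 * (indicator {a..b} s *\<^sub>R (\<phi> s * \<psi> s)))" by simp
    then show "integrable lborel (\<lambda>s. indicator {a..b} s *\<^sub>R (2 * (\<phi> s * \<psi> s)))"
      by (simp add: mult.left_commute)
    show "integrable lborel (\<lambda>s. 2 * norm (indicator (side D) s * (\<phi> s * \<psi> s)))"
      using int by (intro integrable_mult_right integrable_norm)
    show "norm (indicator {a..b} s *\<^sub>R (2 * (\<phi> s * \<psi> s))) \<le> 2 * norm (indicator (side D) s * (\<phi> s * \<psi> s))" for s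
      using ab(2) by (auto simp: indicator_def abs_mult)
  qed
  also have "\<dots> = 2 * (\<integral>y. \<bar>\<phi> y * \<psi> y\<bar> \<partial>line_measure D)"
    by (simp add: integral_line_measure abs_mult)
  finally have "\<bar>(\<phi> b)\<^sup>2 - (\<phi> a)\<^sup>2\<bar> \<le> 2 * (\<integral>y. \<bar>\<phi> y * \<psi> y\<bar> \<partial>line_measure D)" .
  then show ?thesis by (cases "y \<le> y'") (auto simp: a_def b_def)
qed

lemma side_measure_Torus: "(\<integral>y. c \<partial>line_measure Torus) = 2 * pi * (c :: real)" "integrable (line_measure Torus) (\<lambda>y. c)"
  "measure (line_measure Torus) UNIV = 2 * pi"
proof -
  have *: "(\<integral>y. c \<partial>line_measure Torus) = 2 * pi * c" for c :: real
    by (subst integral_line_measure) (simp_all add: measure_lborel_Icc)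
  then show "(\<integral>y. c \<partial>line_measure Torus) = 2 * pi * c" .
  show "measure (line_measure Torus) UNIV = 2 * pi"
    using *[of 1] by simp
  have "integrable lborel (\<lambda>x :: real. indicator {0..2*pi} x * c)"
    by (intro integrable_mult_left integrable_real_indicator) (simp_all add: emeasure_lborel_Icc_eq)
  then show "integrable (line_measure Torus) (\<lambda>y. c)"
    by (subst integrable_line_measure) simp_all
qed

text \<open>\<open>square_diff_le\<close> compares the value at y with the value at any other point
  y'. On the line, the integrable function \<phi>^2 cannot stay above a positive constant; on the
  circle, averaging over y' costs the integral of \<phi>^2 divided by 2 pi.\<close>

lemma line_sup_bound:
  assumes d: "\<And>y. (\<phi> has_real_derivative \<psi> y) (at y)" and c: "continuous_on UNIV \<psi>"
    and i: "integrable (line_measure D) (\<lambda>y. \<phi> y * \<psi> y)" and i2: "integrable (line_measure D) (\<lambda>y. (\<phi> y)\<^sup>2)"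
    and y: "y \<in> side D"
  shows "(\<phi> y)\<^sup>2 \<le> (\<integral>y. lam D * (\<phi> y)\<^sup>2 + 2 * \<bar>\<phi> y * \<psi> y\<bar> \<partial>line_measure D)"
proof -
  have "continuous_on UNIV \<phi>" using DERIV_isCont[OF d] by (simp add: continuous_at_imp_continuous_on)
  then have [measurable]: "\<phi> \<in> borel_measurable borel" by (rule borel_measurable_continuous_onI)
  define K where "K = 2 * (\<integral>y. \<bar>\<phi> y * \<psi> y\<bar> \<partial>line_measure D)"
  have K: "(\<phi> y)\<^sup>2 \<le> (\<phi> y')\<^sup>2 + K" if "y' \<in> side D" for y'
    unfolding K_def by (rule square_diff_le[OF d c i y that])
  have eq: "(\<integral>y. lam D * (\<phi> y)\<^sup>2 + 2 * \<bar>\<phi> y * \<psi> y\<bar> \<partial>line_measure D) = lam D * (\<integral>y. (\<phi> y)\<^sup>2 \<partial>line_measure D) + K"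
    using i2 integrable_abs[OF i] by (simp add: K_def)
  show ?thesis unfolding eq
  proof (cases D)
    case Plane
    show "(\<phi> y)\<^sup>2 \<le> lam D * (\<integral>y. (\<phi> y)\<^sup>2 \<partial>line_measure D) + K"
    proof (rule ccontr)
      assume "\<not> ?thesis"
      then have pos: "0 < (\<phi> y)\<^sup>2 - K" by (simp add: lam_def Plane)
      have "integrable lborel (\<lambda>y. (\<phi> y)\<^sup>2)"
        using i2 by (subst (asm) integrable_line_measure) (simp_all add: Plane)
      then have "integrable lborel (\<lambda>x :: real. (\<phi> y)\<^sup>2 - K)"
      proof (rule Bochner_Integration.integrable_bound)
        have "norm ((\<phi> y)\<^sup>2 - K) \<le> norm ((\<phi> x)\<^sup>2)" for x
          using K[of x] pos by (simp add: Plane)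
        then show "AE x in lborel. norm ((\<phi> y)\<^sup>2 - K) \<le> norm ((\<phi> x)\<^sup>2)" by simp
      qed simp
      with pos show False by (simp add: integrable_iff_bounded ennreal_mult_top)
    qed
  next
    case Torus
    have "(\<integral>y'. (\<phi> y)\<^sup>2 \<partial>line_measure D) \<le> (\<integral>y'. (\<phi> y')\<^sup>2 + K \<partial>line_measure D)"
    proof (rule integral_mono_AE)
      show "AE x in line_measure D. (\<phi> y)\<^sup>2 \<le> (\<phi> x)\<^sup>2 + K"
        unfolding line_measure_def by (subst AE_density) (auto simp: indicator_def K)
    qed (use i2 Torus side_measure_Torus(2) in simp_all)
    also have "\<dots> = (\<integral>y'. (\<phi> y')\<^sup>2 \<partial>line_measure D) + 2 * pi * K"
      using i2 Torus side_measure_Torus by simp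
    finally have "2 * pi * ((\<phi> y)\<^sup>2 - K) \<le> (\<integral>y'. (\<phi> y')\<^sup>2 \<partial>line_measure D)"
      using Torus side_measure_Torus(3) by (simp add: algebra_simps)
    moreover have I: "0 \<le> (\<integral>y'. (\<phi> y')\<^sup>2 \<partial>line_measure D)" by (rule Bochner_Integration.integral_nonneg) simp
    ultimately have "(\<phi> y)\<^sup>2 - K \<le> (\<integral>y'. (\<phi> y')\<^sup>2 \<partial>line_measure D)"
    proof (cases "0 \<le> (\<phi> y)\<^sup>2 - K")
      case True
      \<comment> \<open>Replacing 1 / (2 pi) by the larger constant 1 is the reason for
        \<open>lam Torus = 1\<close>.\<close>
      then have "1 * ((\<phi> y)\<^sup>2 - K) \<le> 2 * pi * ((\<phi> y)\<^sup>2 - K)"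
        using pi_gt3 by (intro mult_right_mono) auto
      from order_trans[OF this \<open>2 * pi * ((\<phi> y)\<^sup>2 - K) \<le> _\<close>] show ?thesis by (simp only: mult_1)
    qed linarith
    then show "(\<phi> y)\<^sup>2 \<le> lam D * (\<integral>y. (\<phi> y)\<^sup>2 \<partial>line_measure D) + K"
      by (simp add: lam_def Torus)
  qed
qed

lemma plane_Fubini:
  fixes f :: "real \<times> real \<Rightarrow> real"
  assumes f: "integrable (plane_measure D) f"
  shows plane_integral_vertical: "(\<integral>z. f z \<partial>plane_measure D) = (\<integral>x. (\<integral>y. f (x, y) \<partial>line_measure D) \<partial>line_measure D)"
    and plane_integral_horizontal: "(\<integral>z. f z \<partial>plane_measure D) = (\<integral>y. (\<integral>x. f (x, y) \<partial>line_measure D) \<partial>line_measure D)"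
    and plane_integrable_vertical: "integrable (line_measure D) (\<lambda>x. \<integral>y. f (x, y) \<partial>line_measure D)"
    and plane_integrable_horizontal: "integrable (line_measure D) (\<lambda>y. \<integral>x. f (x, y) \<partial>line_measure D)"
    and plane_AE_vertical: "AE x in line_measure D. integrable (line_measure D) (\<lambda>y. f (x, y))"
    and plane_AE_horizontal: "AE y in line_measure D. integrable (line_measure D) (\<lambda>x. f (x, y))"
proof -
  interpret P: pair_sigma_finite "line_measure D" "line_measure D" by (rule pair_sigma_finite_line_measure)
  have g: "integrable (line_measure D \<Otimes>\<^sub>M line_measure D) f" using f by (simp add: plane_measure_pair)
  then have g': "integrable (line_measure D \<Otimes>\<^sub>M line_measure D) (\<lambda>(x, y). f (x, y))" by simp
  show "(\<integral>z. f z \<partial>plane_measure D) = (\<integral>x. (\<integral>y. f (x, y) \<partial>line_measure D) \<partial>line_measure D)"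
    using P.integral_fst'[OF g] by (simp add: plane_measure_pair)
  show "(\<integral>z. f z \<partial>plane_measure D) = (\<integral>y. (\<integral>x. f (x, y) \<partial>line_measure D) \<partial>line_measure D)"
    using P.integral_snd[OF g'] by (simp add: plane_measure_pair)
  show "integrable (line_measure D) (\<lambda>x. \<integral>y. f (x, y) \<partial>line_measure D)" by (rule P.integrable_fst'[OF g])
  show "integrable (line_measure D) (\<lambda>y. \<integral>x. f (x, y) \<partial>line_measure D)" by (rule P.integrable_snd[OF g'])
  show "AE x in line_measure D. integrable (line_measure D) (\<lambda>y. f (x, y))" by (rule P.AE_integrable_fst'[OF g])
  show "AE y in line_measure D. integrable (line_measure D) (\<lambda>x. f (x, y))" by (rule P.AE_integrable_snd[OF g'])
qed

lemma plane_product: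
  fixes A B :: "real \<Rightarrow> real"
  assumes A: "integrable (line_measure D) A" and B: "integrable (line_measure D) B"
  shows "integrable (plane_measure D) (\<lambda>z. A (fst z) * B (snd z))"
    and "(\<integral>z. A (fst z) * B (snd z) \<partial>plane_measure D) = (\<integral>x. A x \<partial>line_measure D) * (\<integral>y. B y \<partial>line_measure D)"
proof -
  interpret P: pair_sigma_finite "line_measure D" "line_measure D" by (rule pair_sigma_finite_line_measure)
  have [measurable]: "A \<in> borel_measurable (line_measure D)" "B \<in> borel_measurable (line_measure D)"
    using A B by auto
  have "integrable (line_measure D \<Otimes>\<^sub>M line_measure D) (\<lambda>z. A (fst z) * B (snd z))"
  proof (rule P.Fubini_integrable)
    show "integrable (line_measure D) (\<lambda>x. \<integral>y. norm (A (fst (x, y)) * B (snd (x, y))) \<partial>line_measure D)"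
      using A by (simp add: abs_mult)
    show "AE x in line_measure D. integrable (line_measure D) (\<lambda>y. A (fst (x, y)) * B (snd (x, y)))"
      using B by simp
  qed measurable
  then show i: "integrable (plane_measure D) (\<lambda>z. A (fst z) * B (snd z))" by (simp add: plane_measure_pair)
  show "(\<integral>z. A (fst z) * B (snd z) \<partial>plane_measure D) = (\<integral>x. A x \<partial>line_measure D) * (\<integral>y. B y \<partial>line_measure D)"
    by (simp add: plane_integral_vertical[OF i])
qed

lemma AE_plane_fst: "AE x in line_measure D. P x \<Longrightarrow> AE z in plane_measure D. P (fst z)"
  and AE_plane_snd: "AE x in line_measure D. P x \<Longrightarrow> AE z in plane_measure D. P (snd z)"
proof -
  assume "AE x in line_measure D. P x"
  then have *: "AE x in lborel. x \<in> side D \<longrightarrow> P x"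
    unfolding line_measure_def by (subst (asm) AE_density) (auto simp: indicator_def)
  show "AE z in plane_measure D. P (fst z)"
    using AE_fst[OF *] unfolding plane_measure_def
    by (subst AE_density) (auto simp: indicator_def elim!: eventually_mono)
  show "AE z in plane_measure D. P (snd z)"
    using AE_snd[OF *] unfolding plane_measure_def
    by (subst AE_density) (auto simp: indicator_def elim!: eventually_mono)
qed

lemma AE_plane_side: "AE z in plane_measure D. fst z \<in> side D \<and> snd z \<in> side D"
  unfolding plane_measure_def by (subst AE_density) (auto simp: indicator_def)

text \<open>On almost every vertical line f^2 is at most a number A(x), and on almost every
  horizontal line h^2 is at most B(y). Hence the integral of (f h)^2 is at most the product of the
  integrals of A and B. Cauchy-Schwarz bounds each of these, and once more separates g.\<close>

lemma triple_product_bound: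
  assumes g: "l2fun D g" and f: "l2fun D f" "l2fun D f2" "dy f f2" and h: "l2fun D h" "l2fun D h1" "dx h h1"
  shows "integrable (plane_measure D) (\<lambda>z. g z * (f z * h z))"
    and "(\<integral>z. \<bar>g z * (f z * h z)\<bar> \<partial>plane_measure D)\<^sup>2
      \<le> nsq D g * ((lam D * nsq D f + 2 * sqrt (nsq D f * nsq D f2)) * (lam D * nsq D h + 2 * sqrt (nsq D h * nsq D h1)))"
proof -
  note [measurable] = l2fun_measurable[OF g] l2fun_measurable[OF f(1)] l2fun_measurable[OF f(2)]
    l2fun_measurable[OF h(1)] l2fun_measurable[OF h(2)]
  let ?a = "\<lambda>z. lam D * (f z)\<^sup>2 + 2 * \<bar>f z * f2 z\<bar>" and ?b = "\<lambda>z. lam D * (h z)\<^sup>2 + 2 * \<bar>h z * h1 z\<bar>"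
  have ff: "integrable (plane_measure D) (\<lambda>z. (f z)\<^sup>2)" and hh: "integrable (plane_measure D) (\<lambda>z. (h z)\<^sup>2)"
    using f h by (auto simp: l2fun_def)
  note ff2 = l2fun_mult[OF f(1,2)] and hh1 = l2fun_mult[OF h(1,2)]
  have a: "integrable (plane_measure D) ?a" and b: "integrable (plane_measure D) ?b"
    using ff hh integrable_abs[OF ff2(1)] integrable_abs[OF hh1(1)] by simp_all
  define A where "A x = (\<integral>y. ?a (x, y) \<partial>line_measure D)" for x
  define B where "B y = (\<integral>x. ?b (x, y) \<partial>line_measure D)" for y
  have Ai: "integrable (line_measure D) A" and Bi: "integrable (line_measure D) B"
    unfolding A_def B_def using plane_integrable_vertical[OF a] plane_integrable_horizontal[OF b] by auto
  have A_le: "(\<integral>x. A x \<partial>line_measure D) \<le> lam D * nsq D f + 2 * sqrt (nsq D f * nsq D f2)"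
  proof -
    have "(\<integral>x. A x \<partial>line_measure D) = (\<integral>z. ?a z \<partial>plane_measure D)"
      unfolding A_def by (rule plane_integral_vertical[OF a, symmetric])
    also have "\<dots> = lam D * nsq D f + 2 * (\<integral>z. \<bar>f z * f2 z\<bar> \<partial>plane_measure D)"
      using ff integrable_abs[OF ff2(1)] by (simp add: nsq_def)
    finally show ?thesis using real_le_rsqrt[OF ff2(2)] by simp
  qed
  have B_le: "(\<integral>y. B y \<partial>line_measure D) \<le> lam D * nsq D h + 2 * sqrt (nsq D h * nsq D h1)"
  proof -
    have "(\<integral>x. B x \<partial>line_measure D) = (\<integral>z. ?b z \<partial>plane_measure D)"
      unfolding B_def by (rule plane_integral_horizontal[OF b, symmetric])
    also have "\<dots> = lam D * nsq D h + 2 * (\<integral>z. \<bar>h z * h1 z\<bar> \<partial>plane_measure D)"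
      using hh integrable_abs[OF hh1(1)] by (simp add: nsq_def)
    finally show ?thesis using real_le_rsqrt[OF hh1(2)] by simp
  qed
  have cf: "continuous_on UNIV f2" "continuous_on UNIV h1" using f h by (auto simp: l2fun_def)
  have "AE x in line_measure D. \<forall>y\<in>side D. (f (x, y))\<^sup>2 \<le> A x"
    using plane_AE_vertical[OF ff] plane_AE_vertical[OF ff2(1)]
  proof eventually_elim
    case (elim x)
    show ?case unfolding A_def
      using line_sup_bound[OF _ continuous_vertical[OF cf(1)] elim(2,1)] f(3) by (auto simp: dy_def)
  qed
  then have fA: "AE z in plane_measure D. \<forall>y\<in>side D. (f (fst z, y))\<^sup>2 \<le> A (fst z)" by (rule AE_plane_fst)
  have "AE y in line_measure D. \<forall>x\<in>side D. (h (x, y))\<^sup>2 \<le> B y"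
    using plane_AE_horizontal[OF hh] plane_AE_horizontal[OF hh1(1)]
  proof eventually_elim
    case (elim y)
    show ?case unfolding B_def
      using line_sup_bound[OF _ continuous_horizontal[OF cf(2)] elim(2,1)] h(3) by (auto simp: dx_def)
  qed
  then have hB: "AE z in plane_measure D. \<forall>x\<in>side D. (h (x, snd z))\<^sup>2 \<le> B (snd z)" by (rule AE_plane_snd)
  from fA hB AE_plane_side have le: "AE z in plane_measure D. (f z * h z)\<^sup>2 \<le> A (fst z) * B (snd z)"
  proof eventually_elim
    case (elim z)
    then have "(f z)\<^sup>2 \<le> A (fst z)" "(h z)\<^sup>2 \<le> B (snd z)" by (cases z; auto)+
    then show ?case unfolding power_mult_distrib
      by (intro mult_mono) (auto intro: order_trans[OF zero_le_power2])
  qed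
  have fh: "integrable (plane_measure D) (\<lambda>z. (f z * h z)\<^sup>2)"
    by (rule Bochner_Integration.integrable_bound[OF plane_product(1)[OF Ai Bi]])
      (use le in \<open>auto elim!: eventually_mono\<close>)
  have "(\<integral>z. (f z * h z)\<^sup>2 \<partial>plane_measure D) \<le> (\<integral>z. A (fst z) * B (snd z) \<partial>plane_measure D)"
    by (rule integral_mono_AE[OF fh plane_product(1)[OF Ai Bi] le])
  also have "\<dots> = (\<integral>x. A x \<partial>line_measure D) * (\<integral>y. B y \<partial>line_measure D)"
    by (rule plane_product(2)[OF Ai Bi])
  also have "\<dots> \<le> (lam D * nsq D f + 2 * sqrt (nsq D f * nsq D f2)) * (lam D * nsq D h + 2 * sqrt (nsq D h * nsq D h1))"
    using A_le B_le by (intro mult_mono) (auto simp: A_def B_def lam_def intro!: add_nonneg_nonneg Bochner_Integration.integral_nonneg)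
  finally have fhle: "(\<integral>z. (f z * h z)\<^sup>2 \<partial>plane_measure D)
      \<le> (lam D * nsq D f + 2 * sqrt (nsq D f * nsq D f2)) * (lam D * nsq D h + 2 * sqrt (nsq D h * nsq D h1))" .
  have gg: "integrable (plane_measure D) (\<lambda>z. (g z)\<^sup>2)" using g by (simp add: l2fun_def)
  have m: "g \<in> borel_measurable (plane_measure D)" "(\<lambda>z. f z * h z) \<in> borel_measurable (plane_measure D)"
    by measurable
  show "integrable (plane_measure D) (\<lambda>z. g z * (f z * h z))"
    by (rule Cauchy_Schwarz_integral(1)[OF m gg fh])
  have "(\<integral>z. \<bar>g z * (f z * h z)\<bar> \<partial>plane_measure D)\<^sup>2 \<le> nsq D g * (\<integral>z. (f z * h z)\<^sup>2 \<partial>plane_measure D)"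
    unfolding nsq_def by (rule Cauchy_Schwarz_integral(2)[OF m gg fh])
  also have "\<dots> \<le> nsq D g * ((lam D * nsq D f + 2 * sqrt (nsq D f * nsq D f2)) * (lam D * nsq D h + 2 * sqrt (nsq D h * nsq D h1)))"
    by (intro mult_left_mono fhle) simp
  finally show "(\<integral>z. \<bar>g z * (f z * h z)\<bar> \<partial>plane_measure D)\<^sup>2
      \<le> nsq D g * ((lam D * nsq D f + 2 * sqrt (nsq D f * nsq D f2)) * (lam D * nsq D h + 2 * sqrt (nsq D h * nsq D h1)))" .
qed

section \<open>The divergence theorem\<close>

lemma line_measure_Plane: "line_measure Plane = lborel"
  by (simp add: line_measure_def density_1)

lemma plane_measure_Plane: "plane_measure Plane = lborel"
proof -
  have "indicator (side Plane \<times> side Plane) = (\<lambda>z :: real \<times> real. 1 :: ennreal)" by (auto simp: indicator_def)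
  then show ?thesis by (simp only: plane_measure_def density_1)
qed

lemma FTC_compact:
  assumes d: "\<And>x. (\<phi> has_real_derivative \<psi> x) (at x)" and c: "continuous_on UNIV \<psi>"
    and z: "\<And>x. R < \<bar>x\<bar> \<Longrightarrow> \<phi> x = 0 \<and> \<psi> x = 0"
  shows "(\<integral>x. \<psi> x \<partial>lborel) = 0"
proof -
  define S where "S = \<bar>R\<bar> + 1"
  have S: "R < \<bar>S\<bar>" "R < \<bar>- S\<bar>" "- S \<le> S" by (auto simp: S_def)
  have "(\<integral>x. indicator {-S..S} x *\<^sub>R \<psi> x \<partial>lborel) = \<phi> S - \<phi> (- S)"
  proof (rule integral_FTC_atLeastAtMost[OF S(3)])
    show "(\<phi> has_vector_derivative \<psi> x) (at x within {-S..S})" for x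
      using d[of x] unfolding has_real_derivative_iff_has_vector_derivative by (rule has_vector_derivative_at_within)
  qed (rule continuous_on_subset[OF c subset_UNIV])
  also have "\<phi> S - \<phi> (- S) = 0" using z[OF S(1)] z[OF S(2)] by simp
  also have "(\<lambda>x. indicator {-S..S} x *\<^sub>R \<psi> x) = \<psi>"
  proof (rule ext)
    fix x
    show "indicator {-S..S} x *\<^sub>R \<psi> x = \<psi> x"
    proof (cases "x \<in> {-S..S}")
      case False
      then have "R < \<bar>x\<bar>" by (auto simp: S_def)
      then show ?thesis using z[of x] by simp
    qed simp
  qed
  finally show ?thesis .
qed

lemma compact_dx_integral:
  assumes d: "dx K k" and c: "continuous_on UNIV k"
    and z: "\<And>z. z \<notin> square R \<Longrightarrow> K z = 0 \<and> k z = 0"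
  shows "integrable lborel k" "(\<integral>z. k z \<partial>lborel) = 0"
proof -
  have "integrable lborel (\<lambda>z. indicator (square R) z * k z)"
    using continuous_loc_int[OF c] by (simp add: loc_int_def)
  moreover have "(\<lambda>w. indicator (square R) w * k w) = k"
    using z by (auto simp: fun_eq_iff indicator_def)
  ultimately show i: "integrable lborel k" by simp
  then have eq: "(\<integral>z. k z \<partial>lborel) = (\<integral>y. (\<integral>x. k (x, y) \<partial>lborel) \<partial>lborel)"
    using plane_integral_horizontal[of Plane k] by (simp add: plane_measure_Plane line_measure_Plane)
  have "(\<integral>x. k (x, y) \<partial>lborel) = 0" for y
  proof (rule FTC_compact[where \<phi>="\<lambda>x. K (x, y)" and R=R])
    show "((\<lambda>x. K (x, y)) has_real_derivative k (x, y)) (at x)" for x using d by (simp add: dx_def)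
    show "K (x, y) = 0 \<and> k (x, y) = 0" if "R < \<bar>x\<bar>" for x
      using that by (intro z) (auto simp: square_def)
  qed (rule continuous_horizontal[OF c])
  then show "(\<integral>z. k z \<partial>lborel) = 0" by (simp add: eq)
qed

lemma dy_swapped: "dy K k \<longleftrightarrow> dx (swapped K) (swapped k)"
  by (auto simp: dx_def dy_def swapped_def)

lemma compact_dy_integral:
  assumes d: "dy K k" and c: "continuous_on UNIV k"
    and z: "\<And>z. z \<notin> square R \<Longrightarrow> K z = 0 \<and> k z = 0"
  shows "integrable lborel k" "(\<integral>z. k z \<partial>lborel) = 0"
proof -
  have "integrable lborel (\<lambda>z. indicator (square R) z * k z)"
    using continuous_loc_int[OF c] by (simp add: loc_int_def)
  moreover have "(\<lambda>w. indicator (square R) w * k w) = k"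
    using z by (auto simp: fun_eq_iff indicator_def)
  ultimately show i: "integrable lborel k" by simp
  have "swapped K z = 0 \<and> swapped k z = 0" if "z \<notin> square R" for z
  proof -
    have "prod.swap z \<notin> square R" using that by (cases z) (auto simp: square_def)
    then show ?thesis using z by (simp add: swapped_def)
  qed
  from compact_dx_integral(2)[OF d[unfolded dy_swapped] continuous_swap[OF c] this]
  show "(\<integral>z. k z \<partial>lborel) = 0"
    using integral_swap[of k] c by (simp add: swapped_def borel_measurable_continuous_onI)
qed

lemma continuous_integrable_Torus:
  fixes f :: "real \<times> real \<Rightarrow> real"
  assumes f: "continuous_on UNIV f"
  shows "integrable (plane_measure Torus) f"
proof -
  have m [measurable]: "f \<in> borel_measurable borel" using f by (rule borel_measurable_continuous_onI)
  have "integrable lborel (\<lambda>z. indicator (side Torus \<times> side Torus) z * f z)"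
  proof (rule loc_int_bound[OF continuous_loc_int[OF f], where B=1 and R="2 * pi"])
    show "indicator (side Torus \<times> side Torus) \<in> borel_measurable borel"
      by (rule borel_measurable_indicator) (rule side_Times_borel)
    show "\<bar>indicator (side Torus \<times> side Torus) z\<bar> \<le> 1 * (indicator (square (2 * pi)) z :: real)" for z
      by (cases z) (auto simp: indicator_def square_def)
  qed
  then show ?thesis by (subst integrable_plane_measure) simp_all
qed

lemma line_integral_periodic:
  assumes d: "\<And>x. (\<phi> has_real_derivative \<psi> x) (at x)" and c: "continuous_on UNIV \<psi>"
    and p: "\<phi> (2 * pi) = \<phi> 0"
  shows "(\<integral>x. \<psi> x \<partial>line_measure Torus) = 0"
proof -
  have "(\<integral>x. indicator {0..2*pi} x *\<^sub>R \<psi> x \<partial>lborel) = \<phi> (2 * pi) - \<phi> 0"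
  proof (rule integral_FTC_atLeastAtMost)
    show "(\<phi> has_vector_derivative \<psi> x) (at x within {0..2*pi})" for x
      using d[of x] unfolding has_real_derivative_iff_has_vector_derivative by (rule has_vector_derivative_at_within)
  qed (simp, rule continuous_on_subset[OF c subset_UNIV])
  then show ?thesis
    using c p by (subst integral_line_measure) (simp_all add: borel_measurable_continuous_onI)
qed

lemma dxD: "dx f g \<Longrightarrow> ((\<lambda>x. f (x, y)) has_real_derivative g (x, y)) (at x)"
  and dyD: "dy f g \<Longrightarrow> ((\<lambda>y. f (x, y)) has_real_derivative g (x, y)) (at y)"
  by (simp_all add: dx_def dy_def)

text \<open>Cut off at the scale 1 / \<open>e n\<close>: the derivatives of the cutoff contribute at
  most \<open>e n\<close> times a constant and the L^1 norms of F1 and F2. G1 and G2 enter the limit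
  only through their sum, so terms that cancel between them need not be integrable.\<close>

lemma divergence_Plane:
  assumes c: "continuous_on UNIV F1" "continuous_on UNIV F2" "continuous_on UNIV G1" "continuous_on UNIV G2"
    and d: "dx F1 G1" "dy F2 G2"
    and i: "integrable lborel F1" "integrable lborel F2" "integrable lborel (\<lambda>z. G1 z + G2 z)"
  shows "(\<integral>z. G1 z + G2 z \<partial>lborel) = 0"
proof -
  define \<chi>0 where "\<chi>0 = box_bump (-1) 1 1"
  have t: "test1 \<chi>0" unfolding \<chi>0_def by (rule box_bump_test)
  have s: "smooth1 \<chi>0" using t by (simp add: test1_def)
  \<comment> \<open>In the limit the cutoff becomes the constant given by the square of
    \<open>\<chi>0 0\<close>; a positive constant serves as well as 1.\<close>
  have pos: "0 < \<chi>0 0" by (simp add: \<chi>0_def box_bump_def flat_exp_def)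
  obtain B1 where B1: "B1 > 0" "\<And>x. \<bar>\<chi>0 x\<bar> \<le> B1" using test1_bounded[OF t] by blast
  obtain B2 where B2: "B2 > 0" "\<And>x. \<bar>deriv \<chi>0 x\<bar> \<le> B2" using test1_bounded[OF test1_deriv[OF t]] by blast
  obtain R1 where R1: "R1 > 0" "\<And>x. R1 < \<bar>x\<bar> \<Longrightarrow> \<chi>0 x = 0" using test1_zero_outside[OF t] by blast
  obtain R2 where R2: "R2 > 0" "\<And>x. R2 < \<bar>x\<bar> \<Longrightarrow> deriv \<chi>0 x = 0" using test1_zero_outside[OF test1_deriv[OF t]] by blast
  define R where "R = max R1 R2"
  define e where "e n = inverse (real (Suc n))" for n
  have e: "0 < e n" for n by (simp add: e_def)
  define C where "C n z = \<chi>0 (e n * fst z) * \<chi>0 (e n * snd z)" for n z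
  define E1 where "E1 n z = deriv \<chi>0 (e n * fst z) * \<chi>0 (e n * snd z)" for n z
  define E2 where "E2 n z = \<chi>0 (e n * fst z) * deriv \<chi>0 (e n * snd z)" for n z
  have cont: "continuous_on UNIV (\<lambda>z :: real \<times> real. \<chi>0 (e n * fst z))" "continuous_on UNIV (\<lambda>z :: real \<times> real. \<chi>0 (e n * snd z))"
    "continuous_on UNIV (\<lambda>z :: real \<times> real. deriv \<chi>0 (e n * fst z))" "continuous_on UNIV (\<lambda>z :: real \<times> real. deriv \<chi>0 (e n * snd z))" for n
    by (rule continuous_on_compose2[OF smooth1_continuous[of _ UNIV]],
        auto intro!: s smooth1_deriv continuous_intros)+
  have C_cont: "continuous_on UNIV (C n)" "continuous_on UNIV (E1 n)" "continuous_on UNIV (E2 n)" for n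
    unfolding C_def[abs_def] E1_def[abs_def] E2_def[abs_def] by (intro continuous_on_mult cont)+
  have meas [measurable]: "C n \<in> borel_measurable borel" "E1 n \<in> borel_measurable borel" "E2 n \<in> borel_measurable borel" for n
    using C_cont by (auto intro: borel_measurable_continuous_onI)
  have meas' [measurable]: "F1 \<in> borel_measurable borel" "F2 \<in> borel_measurable borel" "G1 \<in> borel_measurable borel" "G2 \<in> borel_measurable borel"
    using c by (auto intro: borel_measurable_continuous_onI)
  have bound: "\<bar>C n z\<bar> \<le> B1 * B1" "\<bar>E1 n z\<bar> \<le> B2 * B1" "\<bar>E2 n z\<bar> \<le> B1 * B2" for n z
    unfolding C_def E1_def E2_def abs_mult using B1 B2 by (auto intro!: mult_mono)
  have out: "C n z = 0 \<and> E1 n z = 0 \<and> E2 n z = 0" if "z \<notin> square (R * real (Suc n))" for n z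
  proof -
    have *: "R < \<bar>e n * x\<bar>" if "R * real (Suc n) < \<bar>x\<bar>" for x
      using that by (simp add: e_def abs_mult field_simps)
    have "R * real (Suc n) < \<bar>fst z\<bar> \<or> R * real (Suc n) < \<bar>snd z\<bar>"
      using that by (cases z) (auto simp: square_def)
    then show ?thesis
      using *[of "fst z"] *[of "snd z"] R1(2) R2(2) by (auto simp: C_def E1_def E2_def R_def)
  qed
  have dchi: "((\<lambda>x. \<chi>0 (e n * x)) has_real_derivative e n * deriv \<chi>0 (e n * x)) (at x)" for n x
  proof -
    have "((\<lambda>x. e n * x) has_real_derivative e n) (at x)" by (auto intro!: derivative_eq_intros)
    from DERIV_chain2[OF has_deriv_smooth1[OF s] this] show ?thesis by (simp add: mult.commute)
  qed
  have dx1: "dx (\<lambda>z. C n z * F1 z) (\<lambda>z. e n * (E1 n z * F1 z) + C n z * G1 z)" for n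
    unfolding dx_def C_def E1_def fst_conv snd_conv
  proof (intro allI)
    fix x y
    have "((\<lambda>x. \<chi>0 (e n * x) * \<chi>0 (e n * y)) has_real_derivative e n * deriv \<chi>0 (e n * x) * \<chi>0 (e n * y)) (at x)"
      by (rule DERIV_cmult_right[OF dchi])
    from DERIV_mult[OF this dxD[OF d(1)]]
    show "((\<lambda>x. \<chi>0 (e n * x) * \<chi>0 (e n * y) * F1 (x, y)) has_real_derivative
        e n * (deriv \<chi>0 (e n * x) * \<chi>0 (e n * y) * F1 (x, y)) + \<chi>0 (e n * x) * \<chi>0 (e n * y) * G1 (x, y)) (at x)"
      by (simp add: algebra_simps)
  qed
  have dy2: "dy (\<lambda>z. C n z * F2 z) (\<lambda>z. e n * (E2 n z * F2 z) + C n z * G2 z)" for n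
    unfolding dy_def C_def E2_def fst_conv snd_conv
  proof (intro allI)
    fix x y
    have "((\<lambda>y. \<chi>0 (e n * x) * \<chi>0 (e n * y)) has_real_derivative \<chi>0 (e n * x) * (e n * deriv \<chi>0 (e n * y))) (at y)"
      by (rule DERIV_cmult[OF dchi])
    from DERIV_mult[OF this dyD[OF d(2)]]
    show "((\<lambda>y. \<chi>0 (e n * x) * \<chi>0 (e n * y) * F2 (x, y)) has_real_derivative
        e n * (\<chi>0 (e n * x) * deriv \<chi>0 (e n * y) * F2 (x, y)) + \<chi>0 (e n * x) * \<chi>0 (e n * y) * G2 (x, y)) (at y)"
      by (simp add: algebra_simps)
  qed
  have c1: "continuous_on UNIV (\<lambda>z. e n * (E1 n z * F1 z) + C n z * G1 z)"
    "continuous_on UNIV (\<lambda>z. e n * (E2 n z * F2 z) + C n z * G2 z)" for n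
    by (intro continuous_on_add continuous_on_mult continuous_on_const C_cont c)+
  have k1: "integrable lborel (\<lambda>z. e n * (E1 n z * F1 z) + C n z * G1 z)" "(\<integral>z. e n * (E1 n z * F1 z) + C n z * G1 z \<partial>lborel) = 0" for n
    by (rule compact_dx_integral[OF dx1 c1(1), of "R * real (Suc n)"], use out in simp)+
  have k2: "integrable lborel (\<lambda>z. e n * (E2 n z * F2 z) + C n z * G2 z)" "(\<integral>z. e n * (E2 n z * F2 z) + C n z * G2 z \<partial>lborel) = 0" for n
    by (rule compact_dy_integral[OF dy2 c1(2), of "R * real (Suc n)"], use out in simp)+
  have iE: "integrable lborel (\<lambda>z. E n z * F z)" if "integrable lborel F" "E n \<in> borel_measurable borel" "\<And>z. \<bar>E n z\<bar> \<le> B" 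
    for E :: "nat \<Rightarrow> real \<times> real \<Rightarrow> real" and F :: "real \<times> real \<Rightarrow> real" and B n
  proof (rule Bochner_Integration.integrable_bound)
    show "integrable lborel (\<lambda>z. B * F z)" using that(1) by simp
    show "AE z in lborel. norm (E n z * F z) \<le> norm (B * F z)"
      using that(3) by (auto simp: abs_mult intro!: AE_I2 mult_right_mono order_trans[OF that(3)])
    show "(\<lambda>z. E n z * F z) \<in> borel_measurable lborel"
      using that(2) borel_measurable_integrable[OF that(1)] by (simp add: borel_measurable_times)
  qed
  have iE1: "integrable lborel (\<lambda>z. E1 n z * F1 z)" and iE2: "integrable lborel (\<lambda>z. E2 n z * F2 z)"
    and iC: "integrable lborel (\<lambda>z. C n z * (G1 z + G2 z))" for n
    by (rule iE, rule i, rule meas, rule bound)+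
  have eq: "(\<integral>z. C n z * (G1 z + G2 z) \<partial>lborel) = - e n * ((\<integral>z. E1 n z * F1 z \<partial>lborel) + (\<integral>z. E2 n z * F2 z \<partial>lborel))" for n
  proof -
    have "0 = (\<integral>z. (e n * (E1 n z * F1 z) + C n z * G1 z) + (e n * (E2 n z * F2 z) + C n z * G2 z) \<partial>lborel)"
      by (subst Bochner_Integration.integral_add[OF k1(1) k2(1)]) (simp only: k1(2) k2(2))
    also have "\<dots> = (\<integral>z. C n z * (G1 z + G2 z) + e n * (E1 n z * F1 z + E2 n z * F2 z) \<partial>lborel)"
      by (simp add: algebra_simps)
    also have "\<dots> = (\<integral>z. C n z * (G1 z + G2 z) \<partial>lborel) + e n * ((\<integral>z. E1 n z * F1 z \<partial>lborel) + (\<integral>z. E2 n z * F2 z \<partial>lborel))"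
      by (subst Bochner_Integration.integral_add) (use iE1 iE2 iC in auto)
    finally show ?thesis by simp
  qed
  define M where "M = B2 * B1 * ((\<integral>z. \<bar>F1 z\<bar> \<partial>lborel) + (\<integral>z. \<bar>F2 z\<bar> \<partial>lborel))"
  have le: "\<bar>\<integral>z. C n z * (G1 z + G2 z) \<partial>lborel\<bar> \<le> e n * M" for n
  proof -
    have *: "\<bar>\<integral>z. E n z * F z \<partial>lborel\<bar> \<le> B2 * B1 * (\<integral>z. \<bar>F z\<bar> \<partial>lborel)"
      if "integrable lborel F" "integrable lborel (\<lambda>z. E n z * F z)" "\<And>z. \<bar>E n z\<bar> \<le> B2 * B1"
      for E :: "nat \<Rightarrow> real \<times> real \<Rightarrow> real" and F
    proof -
      have "norm (\<integral>z. E n z * F z \<partial>lborel) \<le> (\<integral>z. B2 * B1 * \<bar>F z\<bar> \<partial>lborel)"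
        by (rule Bochner_Integration.integral_norm_bound_integral[OF that(2)])
          (use that in \<open>auto simp: abs_mult intro!: mult_right_mono\<close>)
      then show ?thesis by simp
    qed
    have "\<bar>(\<integral>z. E1 n z * F1 z \<partial>lborel) + (\<integral>z. E2 n z * F2 z \<partial>lborel)\<bar> \<le> M"
      using *[of F1 E1, OF i(1) iE1 bound(2)] *[of F2 E2, OF i(2) iE2] bound(3)[of n]
      by (simp add: M_def distrib_left mult.commute[of B1 B2])
    then show ?thesis unfolding eq using e[of n] by (simp add: abs_mult)
  qed
  have e0: "e \<longlonglongrightarrow> 0" unfolding e_def[abs_def] by (rule LIMSEQ_inverse_real_of_nat)
  then have "(\<lambda>n. e n * M) \<longlonglongrightarrow> 0" using tendsto_mult_left_zero by blast
  then have "(\<lambda>n. \<integral>z. C n z * (G1 z + G2 z) \<partial>lborel) \<longlonglongrightarrow> 0"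
    by (rule Lim_null_comparison[rotated]) (use le in auto)
  moreover have "(\<lambda>n. \<integral>z. C n z * (G1 z + G2 z) \<partial>lborel) \<longlonglongrightarrow> (\<integral>z. (\<chi>0 0 * \<chi>0 0) * (G1 z + G2 z) \<partial>lborel)"
  proof (rule integral_dominated_convergence)
    show "integrable lborel (\<lambda>z. B1 * B1 * \<bar>G1 z + G2 z\<bar>)" using i(3) by simp
    have "(\<lambda>n. \<chi>0 (e n * x)) \<longlonglongrightarrow> \<chi>0 0" for x
    proof (rule isCont_tendsto_compose[of 0 \<chi>0])
      show "isCont \<chi>0 0" using has_deriv_smooth1[OF s] by (rule DERIV_isCont)
      show "(\<lambda>n. e n * x) \<longlonglongrightarrow> 0" using tendsto_mult_left_zero[OF e0] by blast
    qed
    then show "AE z in lborel. (\<lambda>n. C n z * (G1 z + G2 z)) \<longlonglongrightarrow> (\<chi>0 0 * \<chi>0 0) * (G1 z + G2 z)"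
      unfolding C_def by (intro AE_I2 tendsto_mult tendsto_const)
    show "AE z in lborel. norm (C n z * (G1 z + G2 z)) \<le> B1 * B1 * \<bar>G1 z + G2 z\<bar>" for n
      using bound(1) by (auto simp: abs_mult intro!: AE_I2 mult_right_mono)
  qed measurable
  ultimately have "(\<integral>z. (\<chi>0 0 * \<chi>0 0) * (G1 z + G2 z) \<partial>lborel) = 0" using LIMSEQ_unique by blast
  then show ?thesis using pos by simp
qed

text \<open>On the torus continuity already gives integrability over the cell, and each derivative
  integrates to zero along its own closed lines.\<close>

lemma divergence_theorem:
  assumes c: "continuous_on UNIV F1" "continuous_on UNIV F2" "continuous_on UNIV G1" "continuous_on UNIV G2"
    and p: "periodic D F1" "periodic D F2"
    and d: "dx F1 G1" "dy F2 G2"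
    and i: "integrable (plane_measure D) F1" "integrable (plane_measure D) F2"
      "integrable (plane_measure D) (\<lambda>z. G1 z + G2 z)"
  shows "(\<integral>z. G1 z + G2 z \<partial>plane_measure D) = 0"
proof (cases D)
  case Plane
  then show ?thesis using divergence_Plane[OF c d] i by (simp add: plane_measure_Plane)
next
  case Torus
  have "(\<integral>x. G1 (x, y) \<partial>line_measure Torus) = 0" for y
    by (rule line_integral_periodic[OF dxD[OF d(1)] continuous_horizontal[OF c(3)]])
      (use p(1) Torus in \<open>metis add_0 periodic_def\<close>)
  then have 1: "(\<integral>z. G1 z \<partial>plane_measure Torus) = 0"
    by (simp add: plane_integral_horizontal[OF continuous_integrable_Torus[OF c(3)]])
  have "(\<integral>y. G2 (x, y) \<partial>line_measure Torus) = 0" for x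
    by (rule line_integral_periodic[OF dyD[OF d(2)] continuous_vertical[OF c(4)]])
      (use p(2) Torus in \<open>metis add_0 periodic_def\<close>)
  then have 2: "(\<integral>z. G2 z \<partial>plane_measure Torus) = 0"
    by (simp add: plane_integral_vertical[OF continuous_integrable_Torus[OF c(4)]])
  show ?thesis
    using 1 2 continuous_integrable_Torus[OF c(3)] continuous_integrable_Torus[OF c(4)] Torus by simp
qed

text \<open>As the x-derivative of a periodic function, g has a zero on each horizontal line by the
  mean value theorem; comparison with that zero bounds g^2 by twice the integral of |g g1| over the
  line. Integrating over x multiplies this by the length 2 pi, and Cauchy-Schwarz followed by
  division by \<open>nsq Torus g\<close> squares the constant 4 pi.\<close>

lemma Poincare_Torus:
  assumes f: "periodic Torus f" "dx f g" and g: "l2fun Torus g" "l2fun Torus g1" "dx g g1"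
  shows "nsq Torus g \<le> (4 * pi)\<^sup>2 * nsq Torus g1"
proof -
  note m = l2fun_mult[OF g(1,2)]
  have gg: "integrable (plane_measure Torus) (\<lambda>z. (g z)\<^sup>2)" using g by (simp add: l2fun_def)
  define N where "N y = (\<integral>x. \<bar>g (x, y) * g1 (x, y)\<bar> \<partial>line_measure Torus)" for y
  have Ni: "integrable (line_measure Torus) N"
    unfolding N_def using plane_integrable_horizontal[OF integrable_abs[OF m(1)]] .
  have one: "integrable (line_measure Torus) (\<lambda>x. 2 :: real)" by (rule side_measure_Torus)
  have "AE y in line_measure Torus. \<forall>x\<in>side Torus. (g (x, y))\<^sup>2 \<le> 2 * N y"
    using plane_AE_horizontal[OF m(1)]
  proof eventually_elim
    case (elim y)
    show ?case
    proof
      fix x assume x: "x \<in> side Torus"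
      have "f (2 * pi, y) = f (0, y)" using f(1) by (metis add_0 periodic_def)
      moreover have "\<exists>\<xi>. 0 < \<xi> \<and> \<xi> < 2 * pi \<and> f (2 * pi, y) - f (0, y) = (2 * pi - 0) * g (\<xi>, y)"
        by (rule MVT2) (auto intro: dxD[OF f(2)])
      ultimately obtain \<xi> where "0 < \<xi>" "\<xi> < 2 * pi" "0 = (2 * pi - 0) * g (\<xi>, y)" by auto
      then have \<xi>: "\<xi> \<in> side Torus" "g (\<xi>, y) = 0" by simp_all
      have "continuous_on UNIV g1" using g(2) by (simp add: l2fun_def)
      from square_diff_le[OF dxD[OF g(3)] continuous_horizontal[OF this] elim x \<xi>(1)] \<xi>(2)
      show "(g (x, y))\<^sup>2 \<le> 2 * N y" by (simp add: N_def)
    qed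
  qed
  then have "AE z in plane_measure Torus. \<forall>x\<in>side Torus. (g (x, snd z))\<^sup>2 \<le> 2 * N (snd z)" by (rule AE_plane_snd)
  then have le: "AE z in plane_measure Torus. (g z)\<^sup>2 \<le> 2 * N (snd z)"
    using AE_plane_side[of Torus]
  proof eventually_elim
    case (elim z)
    then show ?case by (cases z) auto
  qed
  have "nsq Torus g \<le> (\<integral>z. 2 * N (snd z) \<partial>plane_measure Torus)"
    unfolding nsq_def by (rule integral_mono_AE[OF gg plane_product(1)[OF one Ni] le])
  also have "\<dots> = 4 * pi * (\<integral>y. N y \<partial>line_measure Torus)"
    using plane_product(2)[OF one Ni] side_measure_Torus(3) by simp
  also have "(\<integral>y. N y \<partial>line_measure Torus) = (\<integral>z. \<bar>g z * g1 z\<bar> \<partial>plane_measure Torus)"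
    unfolding N_def by (rule plane_integral_horizontal[OF integrable_abs[OF m(1)], symmetric])
  finally have 1: "nsq Torus g \<le> 4 * pi * (\<integral>z. \<bar>g z * g1 z\<bar> \<partial>plane_measure Torus)" .
  have "(nsq Torus g)\<^sup>2 \<le> (4 * pi * (\<integral>z. \<bar>g z * g1 z\<bar> \<partial>plane_measure Torus))\<^sup>2"
    by (rule power_mono[OF 1]) simp
  also have "\<dots> \<le> (4 * pi)\<^sup>2 * (nsq Torus g * nsq Torus g1)"
    unfolding power_mult_distrib[of "4 * pi"] by (intro mult_left_mono m(2)) simp
  finally have 2: "nsq Torus g * nsq Torus g \<le> nsq Torus g * ((4 * pi)\<^sup>2 * nsq Torus g1)"
    by (simp add: power2_eq_square mult_ac)
  show ?thesis
  proof (cases "nsq Torus g = 0")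
    case False
    then have "0 < nsq Torus g" by (metis nsq_nonneg order_le_less)
    with 2 show ?thesis by (simp only: mult_le_cancel_left_pos)
  qed simp
qed

section \<open>Orthogonality of the pressure gradient\<close>

lemma integral_test_swapped:
  assumes t: "test1 \<alpha>" "test1 \<beta>" and J: "loc_int J"
  shows "(\<integral>z. \<alpha> (fst z) * \<beta> (snd z) * swapped J z \<partial>lborel) = (\<integral>z. \<beta> (fst z) * \<alpha> (snd z) * J z \<partial>lborel)"
proof -
  have [measurable]: "\<alpha> \<in> borel_measurable borel" "\<beta> \<in> borel_measurable borel" "J \<in> borel_measurable borel"
    using t J by (auto intro: test1_measurable loc_int_measurable)
  have "(\<lambda>z. \<beta> (fst z) * \<alpha> (snd z) * J z) \<in> borel_measurable borel" by measurable
  from integral_swap[OF this] show ?thesis by (simp add: swapped_def mult.commute[of "\<alpha> _"])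
qed

text \<open>Integration by parts: \<psi> \<eta> f has compact support, so the integral of its
  x-derivative is zero.\<close>

lemma dx_weak1:
  assumes d: "dx f g" and c: "continuous_on UNIV f" "continuous_on UNIV g"
  shows "weak1 f g"
  unfolding weak1_def
proof (intro allI impI)
  fix \<psi> \<eta> assume t: "test1 \<psi>" "test1 \<eta>"
  have s: "smooth1 \<psi>" "smooth1 \<eta>" using t by (auto simp: test1_def)
  obtain R1 where R1: "\<And>x. R1 < \<bar>x\<bar> \<Longrightarrow> \<psi> x = 0" using test1_zero_outside[OF t(1)] by blast
  obtain R2 where R2: "\<And>x. R2 < \<bar>x\<bar> \<Longrightarrow> deriv \<psi> x = 0" using test1_zero_outside[OF test1_deriv[OF t(1)]] by blast
  obtain R3 where R3: "\<And>x. R3 < \<bar>x\<bar> \<Longrightarrow> \<eta> x = 0" using test1_zero_outside[OF t(2)] by blast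
  let ?k = "\<lambda>z. deriv \<psi> (fst z) * \<eta> (snd z) * f z + \<psi> (fst z) * \<eta> (snd z) * g z"
  have cont: "continuous_on UNIV (\<lambda>z :: real \<times> real. \<psi> (fst z))" "continuous_on UNIV (\<lambda>z :: real \<times> real. \<eta> (snd z))"
    "continuous_on UNIV (\<lambda>z :: real \<times> real. deriv \<psi> (fst z))"
    by (rule continuous_on_compose2[OF smooth1_continuous[of _ UNIV]],
        auto intro!: s smooth1_deriv continuous_intros)+
  have "(\<integral>z. ?k z \<partial>lborel) = 0"
  proof (rule compact_dx_integral(2)[where K="\<lambda>z. \<psi> (fst z) * \<eta> (snd z) * f z" and R="max R1 (max R2 R3)"])
    show "dx (\<lambda>z. \<psi> (fst z) * \<eta> (snd z) * f z) ?k"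
      unfolding dx_def fst_conv snd_conv
    proof (intro allI)
      fix x y
      from DERIV_mult[OF DERIV_cmult_right[OF has_deriv_smooth1[OF s(1), of x], where c="\<eta> y"] dxD[OF d]]
      show "((\<lambda>x. \<psi> x * \<eta> y * f (x, y)) has_real_derivative
          deriv \<psi> x * \<eta> y * f (x, y) + \<psi> x * \<eta> y * g (x, y)) (at x)"
        by (simp add: algebra_simps)
    qed
    show "continuous_on UNIV ?k" by (intro continuous_on_add continuous_on_mult cont c)
    fix z :: "real \<times> real" assume "z \<notin> square (max R1 (max R2 R3))"
    then have "max R1 (max R2 R3) < \<bar>fst z\<bar> \<or> max R1 (max R2 R3) < \<bar>snd z\<bar>"
      by (cases z) (auto simp: square_def)
    then show "\<psi> (fst z) * \<eta> (snd z) * f z = 0 \<and> ?k z = 0"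
      using R1[of "fst z"] R2[of "fst z"] R3[of "snd z"] by auto
  qed
  moreover have "integrable lborel (\<lambda>z. deriv \<psi> (fst z) * \<eta> (snd z) * f z)" "integrable lborel (\<lambda>z. \<psi> (fst z) * \<eta> (snd z) * g z)"
    by (intro integrable_test_product test1_deriv t continuous_loc_int c)+
  ultimately show "(\<integral>z. deriv \<psi> (fst z) * \<eta> (snd z) * f z \<partial>lborel) = - (\<integral>z. \<psi> (fst z) * \<eta> (snd z) * g z \<partial>lborel)"
    by simp
qed

lemma dy_weak1:
  assumes "dy f g" "continuous_on UNIV f" "continuous_on UNIV g"
  shows "weak1 (swapped f) (swapped g)"
  using dx_weak1[OF _ continuous_swap[OF assms(2)] continuous_swap[OF assms(3)]] assms(1) by (simp add: dy_swapped)

text \<open>Both R1 and R2 are the weak derivative \<partial>1\<partial>2 p, so they agree by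
  uniqueness. With this mixed derivative at hand \<open>weak_mixed_continuous\<close> yields a
  continuous representative of p, whose classical gradient is (Q1, Q2).\<close>

lemma continuous_potential:
  assumes w: "has_weak_deriv D 1 0 p q1" "has_weak_deriv D 0 1 p q2"
    and Q: "AE v in lebesgue. q1 v = Q1 (coords v)" "AE v in lebesgue. q2 v = Q2 (coords v)"
    and c: "continuous_on UNIV Q1" "continuous_on UNIV Q2" "continuous_on UNIV R1" "continuous_on UNIV R2"
    and d: "dy Q1 R1" "dx Q2 R2"
  shows "R1 = R2" and "\<exists>P. continuous_on UNIV P \<and> periodic D P \<and> dx P Q1 \<and> dy P Q2"
proof -
  have lp: "loc_integrable D p" using w by (simp add: has_weak_deriv_def)
  obtain F where F: "loc_int F" "AE v in lebesgue. p v = F (coords v)"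
    using loc_integrable_representative[OF lp] by blast
  have F': "AE v in lebesgue. p v \<bullet> 1 = F (coords v)" using F(2) by simp
  note l = continuous_loc_int[OF c(1)] continuous_loc_int[OF c(2)] continuous_loc_int[OF c(3)] continuous_loc_int[OF c(4)]
  have w1: "weak_ab 1 0 F Q1"
    using has_weak_deriv_weak_ab[OF w(1) F(1) F' l(1)] Q(1) by simp
  have w2: "weak_ab 0 1 F Q2"
    using has_weak_deriv_weak_ab[OF w(2) F(1) F' l(2)] Q(2) by simp
  have w0: "weak_ab 0 0 F F" by (simp add: weak_ab_def)
  have a: "weak1 F Q1" using weak_ab_weak1[OF w0] w1 by simp
  have b: "weak1 (swapped F) (swapped Q2)" using weak_ab_weak1_swapped[OF w0 _ F(1) l(2)] w2 by simp
  have d1: "weak1 (swapped Q1) (swapped R1)" by (rule dy_weak1[OF d(1) c(1,3)])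
  have d2: "weak1 Q2 R2" by (rule dx_weak1[OF d(2) c(2,4)])
  have "weak_ab 1 1 F R1"
    unfolding weak_ab_def
  proof (intro allI impI)
    fix \<psi> \<eta> assume t: "test1 \<psi>" "test1 \<eta>"
    have "(\<integral>z. deriv \<psi> (fst z) * deriv \<eta> (snd z) * F z \<partial>lborel) = - (\<integral>z. \<psi> (fst z) * deriv \<eta> (snd z) * Q1 z \<partial>lborel)"
      by (rule a[unfolded weak1_def, rule_format, OF t(1) test1_deriv[OF t(2)]])
    also have "(\<integral>z. \<psi> (fst z) * deriv \<eta> (snd z) * Q1 z \<partial>lborel) = - (\<integral>z. \<psi> (fst z) * \<eta> (snd z) * R1 z \<partial>lborel)"
      using d1[unfolded weak1_def, rule_format, OF t(2,1)]
      unfolding integral_test_swapped[OF test1_deriv[OF t(2)] t(1) l(1)] integral_test_swapped[OF t(2,1) l(3)] .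
    finally show "(\<integral>z. (deriv ^^ 1) \<psi> (fst z) * (deriv ^^ 1) \<eta> (snd z) * F z \<partial>lborel)
      = (- 1) ^ (1 + 1) * (\<integral>z. \<psi> (fst z) * \<eta> (snd z) * R1 z \<partial>lborel)" by simp
  qed
  moreover have "weak_ab 1 1 F R2"
    unfolding weak_ab_def
  proof (intro allI impI)
    fix \<psi> \<eta> assume t: "test1 \<psi>" "test1 \<eta>"
    have "(\<integral>z. deriv \<psi> (fst z) * deriv \<eta> (snd z) * F z \<partial>lborel) = - (\<integral>z. deriv \<psi> (fst z) * \<eta> (snd z) * Q2 z \<partial>lborel)"
      using b[unfolded weak1_def, rule_format, OF t(2) test1_deriv[OF t(1)]]
      unfolding integral_test_swapped[OF test1_deriv[OF t(2)] test1_deriv[OF t(1)] F(1)]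
        integral_test_swapped[OF t(2) test1_deriv[OF t(1)] l(2)] .
    also have "(\<integral>z. deriv \<psi> (fst z) * \<eta> (snd z) * Q2 z \<partial>lborel) = - (\<integral>z. \<psi> (fst z) * \<eta> (snd z) * R2 z \<partial>lborel)"
      by (rule d2[unfolded weak1_def, rule_format, OF t])
    finally show "(\<integral>z. (deriv ^^ 1) \<psi> (fst z) * (deriv ^^ 1) \<eta> (snd z) * F z \<partial>lborel)
      = (- 1) ^ (1 + 1) * (\<integral>z. \<psi> (fst z) * \<eta> (snd z) * R2 z \<partial>lborel)" by simp
  qed
  ultimately have "AE z in lborel. R1 z = R2 z" by (rule weak_ab_unique[OF l(3,4)])
  then show R: "R1 = R2" using continuous_AE_eq[OF c(3,4)] by blast
  from weak_mixed_continuous[OF F(1) l(1,2,3) a b _ d1] d2 R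
  obtain P where P: "continuous_on UNIV P" "AE z in lborel. F z = P z" by blast
  have "AE v in lebesgue. p v = P (coords v)"
    using F(2) AE_coords[OF P(2)] by eventually_elim simp
  then have "periodic D P"
    using lp by (intro periodic_representative[OF _ P(1)]) (auto simp: loc_integrable_def)
  moreover have "dx P Q1" by (rule weak1_dx[OF F(1) l(1) P(1) c(1) P(2) _ a]) simp
  moreover have "dy P Q2" by (rule weak1_dy[OF F(1) l(2) P(1) c(2) P(2) _ b]) simp
  ultimately show "\<exists>P. continuous_on UNIV P \<and> periodic D P \<and> dx P Q1 \<and> dy P Q2" using P(1) by blast
qed

text \<open>Cauchy-Schwarz on the segment gives one factor h; integrating over x, with Fubini and
  translation invariance, gives the other. Applied to u2 on horizontal lines it puts the stream
  function into L^2.\<close>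

lemma segment_average_l2:
  fixes v :: "real \<Rightarrow> real"
  assumes c: "continuous_on UNIV v" and v: "integrable lborel (\<lambda>x. (v x)\<^sup>2)" and h: "0 < h"
  shows "integrable lborel (\<lambda>x. (integral {0..h} (\<lambda>s. v (x + s)))\<^sup>2)"
    and "(\<integral>x. (integral {0..h} (\<lambda>s. v (x + s)))\<^sup>2 \<partial>lborel) \<le> h\<^sup>2 * (\<integral>x. (v x)\<^sup>2 \<partial>lborel)"
proof -
  have [measurable]: "v \<in> borel_measurable borel" using c by (rule borel_measurable_continuous_onI)
  let ?I = "indicator {0..h} :: real \<Rightarrow> real"
  let ?H = "\<lambda>s x. ?I s * (v (x + s))\<^sup>2"
  have tr: "integrable lborel (\<lambda>x. (v (x + s))\<^sup>2)" "(\<integral>x. (v (x + s))\<^sup>2 \<partial>lborel) = (\<integral>x. (v x)\<^sup>2 \<partial>lborel)" for s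
    using lborel_integrable_real_affine[OF v, of 1 s] lborel_integral_real_affine[of 1 "\<lambda>x. (v x)\<^sup>2" s]
    by (simp_all add: add.commute)
  have Ii: "integrable lborel ?I" by (intro integrable_real_indicator) (simp_all add: emeasure_lborel_Icc_eq)
  have Iint: "(\<integral>s. ?I s \<partial>lborel) = h" using h by simp
  have H: "integrable (lborel \<Otimes>\<^sub>M lborel) (\<lambda>z. ?H (fst z) (snd z))"
  proof (rule lborel_pair.Fubini_integrable)
    have "(\<lambda>x. \<integral>y. norm (?H (fst (x, y)) (snd (x, y))) \<partial>lborel) = (\<lambda>x. ?I x * (\<integral>x. (v x)\<^sup>2 \<partial>lborel))"
      by (simp add: tr(2) abs_mult)
    then show "integrable lborel (\<lambda>x. \<integral>y. norm (?H (fst (x, y)) (snd (x, y))) \<partial>lborel)"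
      using Ii by simp
    show "AE x in lborel. integrable lborel (\<lambda>y. ?H (fst (x, y)) (snd (x, y)))"
      using tr(1) by (intro AE_I2) simp
  qed measurable
  then have H': "integrable (lborel \<Otimes>\<^sub>M lborel) (\<lambda>(s, x). ?H s x)" by (simp add: case_prod_beta')
  define J where "J x = (\<integral>s. ?H s x \<partial>lborel)" for x
  have J: "integrable lborel J" unfolding J_def by (rule lborel_pair.integrable_snd[OF H'])
  have "(\<integral>x. J x \<partial>lborel) = (\<integral>s. (\<integral>x. ?H s x \<partial>lborel) \<partial>lborel)"
    unfolding J_def by (rule lborel_pair.Fubini_integral[OF H'])
  also have "\<dots> = (\<integral>s. ?I s * (\<integral>x. (v x)\<^sup>2 \<partial>lborel) \<partial>lborel)" by (simp add: tr(2))
  also have "\<dots> = h * (\<integral>x. (v x)\<^sup>2 \<partial>lborel)" using Iint by simp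
  finally have Jint: "(\<integral>x. J x \<partial>lborel) = h * (\<integral>x. (v x)\<^sup>2 \<partial>lborel)" .
  have vc: "continuous_on A (\<lambda>s. v (x + s))" for A x
    by (rule continuous_on_compose2[OF c]) (auto intro!: continuous_intros)
  have av: "integral {0..h} (\<lambda>s. v (x + s)) = (\<integral>s. ?I s * v (x + s) \<partial>lborel)" for x
  proof -
    have "set_integrable lborel {0..h} (\<lambda>s. v (x + s))"
      by (intro borel_integrable_atLeastAtMost' vc)
    from set_borel_integral_eq_integral(2)[OF this] show ?thesis by (simp add: set_lebesgue_integral_def)
  qed
  have le: "(integral {0..h} (\<lambda>s. v (x + s)))\<^sup>2 \<le> h * J x" for x
  proof -
    have i2: "integrable lborel (\<lambda>s. (?I s * v (x + s))\<^sup>2)"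
    proof -
      have "set_integrable lborel {0..h} (\<lambda>s. (v (x + s))\<^sup>2)"
        by (intro borel_integrable_atLeastAtMost' continuous_on_power vc)
      moreover have "(\<lambda>s. (?I s * v (x + s))\<^sup>2) = (\<lambda>s. ?I s *\<^sub>R (v (x + s))\<^sup>2)"
        by (auto simp: indicator_def fun_eq_iff)
      ultimately show ?thesis by (simp add: set_integrable_def)
    qed
    have I2: "(\<lambda>s. (?I s)\<^sup>2) = ?I" by (auto simp: indicator_def fun_eq_iff)
    have "(\<integral>s. \<bar>?I s * (?I s * v (x + s))\<bar> \<partial>lborel)\<^sup>2 \<le> (\<integral>s. (?I s)\<^sup>2 \<partial>lborel) * (\<integral>s. (?I s * v (x + s))\<^sup>2 \<partial>lborel)"
      by (rule Cauchy_Schwarz_integral(2)) (use i2 Ii in \<open>simp_all add: I2\<close>)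
    also have "(\<integral>s. (?I s * v (x + s))\<^sup>2 \<partial>lborel) = J x"
      unfolding J_def by (rule Bochner_Integration.integral_cong) (auto simp: indicator_def)
    also have "(\<integral>s. (?I s)\<^sup>2 \<partial>lborel) = h" unfolding I2 using h by simp
    also have "(\<integral>s. \<bar>?I s * (?I s * v (x + s))\<bar> \<partial>lborel) = (\<integral>s. \<bar>?I s * v (x + s)\<bar> \<partial>lborel)"
      by (rule Bochner_Integration.integral_cong) (auto simp: indicator_def)
    finally have 1: "(\<integral>s. \<bar>?I s * v (x + s)\<bar> \<partial>lborel)\<^sup>2 \<le> h * J x" .
    have "\<bar>integral {0..h} (\<lambda>s. v (x + s))\<bar> \<le> (\<integral>s. \<bar>?I s * v (x + s)\<bar> \<partial>lborel)"
      unfolding av using Bochner_Integration.integral_norm_bound[of lborel "\<lambda>s. ?I s * v (x + s)"] by simp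
    then have "\<bar>integral {0..h} (\<lambda>s. v (x + s))\<bar>\<^sup>2 \<le> (\<integral>s. \<bar>?I s * v (x + s)\<bar> \<partial>lborel)\<^sup>2"
      by (rule power_mono) simp
    with 1 show ?thesis by simp
  qed
  have m [measurable]: "(\<lambda>x. integral {0..h} (\<lambda>s. v (x + s))) \<in> borel_measurable borel"
    unfolding av by (intro lborel.borel_measurable_lebesgue_integral) measurable
  show i: "integrable lborel (\<lambda>x. (integral {0..h} (\<lambda>s. v (x + s)))\<^sup>2)"
  proof (rule Bochner_Integration.integrable_bound)
    show "integrable lborel (\<lambda>x. h * J x)" using J by simp
    show "AE x in lborel. norm ((integral {0..h} (\<lambda>s. v (x + s)))\<^sup>2) \<le> norm (h * J x)"
      using le by (intro AE_I2) (simp add: order_trans[OF le abs_ge_self])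
  qed measurable
  have "(\<integral>x. (integral {0..h} (\<lambda>s. v (x + s)))\<^sup>2 \<partial>lborel) \<le> (\<integral>x. h * J x \<partial>lborel)"
    by (rule Bochner_Integration.integral_mono[OF i]) (use J le in auto)
  also have "\<dots> = h\<^sup>2 * (\<integral>x. (v x)\<^sup>2 \<partial>lborel)" by (simp add: Jint power2_eq_square)
  finally show "(\<integral>x. (integral {0..h} (\<lambda>s. v (x + s)))\<^sup>2 \<partial>lborel) \<le> h\<^sup>2 * (\<integral>x. (v x)\<^sup>2 \<partial>lborel)" .
qed

section \<open>Translations, and orthogonality to divergence-free fields\<close>

lemma plane_shift:
  fixes f :: "real \<times> real \<Rightarrow> real"
  assumes [measurable]: "f \<in> borel_measurable borel"
  shows "(\<integral>z. f (z + c) \<partial>lborel) = (\<integral>z. f z \<partial>lborel)" "integrable lborel (\<lambda>z. f (z + c)) \<longleftrightarrow> integrable lborel f"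
proof -
  have m: "(+) c \<in> lborel \<rightarrow>\<^sub>M borel" by simp
  have d: "distr lborel borel ((+) c) = (lborel :: (real \<times> real) measure)" by (rule lborel_distr_plus)
  show "(\<integral>z. f (z + c) \<partial>lborel) = (\<integral>z. f z \<partial>lborel)"
    using integral_distr[OF m, of f] by (simp add: d add.commute)
  show "integrable lborel (\<lambda>z. f (z + c)) \<longleftrightarrow> integrable lborel f"
    using integrable_distr_eq[OF m, of f] by (simp add: d add.commute)
qed

text \<open>At every point either x <= -n/2 or x + n >= n/2. The integrand is therefore bounded by a
  tail of f against the translate of g, plus f against the translate of a tail of g, and the norms
  of the tails tend to 0.\<close>

lemma translates_weakly_null:
  fixes f g :: "real \<times> real \<Rightarrow> real"
  assumes [measurable]: "f \<in> borel_measurable borel" "g \<in> borel_measurable borel"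
    and f: "integrable lborel (\<lambda>z. (f z)\<^sup>2)" and g: "integrable lborel (\<lambda>z. (g z)\<^sup>2)"
  shows "(\<lambda>n. \<integral>z. f z * g (z + (real n, 0)) \<partial>lborel) \<longlonglongrightarrow> 0"
proof -
  define A where "A n = {z :: real \<times> real. fst z \<le> - (real n / 2)}" for n
  define B where "B n = {z :: real \<times> real. real n / 2 \<le> fst z}" for n
  have AB [measurable]: "A n \<in> sets borel" "B n \<in> sets borel" for n
    unfolding A_def B_def by measurable
  define a where "a n z = indicator (A n) z * f z" for n z
  define b where "b n z = indicator (B n) z * g z" for n z
  have [measurable]: "a n \<in> borel_measurable borel" "b n \<in> borel_measurable borel" for n
    unfolding a_def[abs_def] b_def[abs_def] by measurable
  have ind: "integrable lborel (\<lambda>z. (indicator S z * w z)\<^sup>2)"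
    if "S \<in> sets borel" "integrable lborel (\<lambda>z. (w z)\<^sup>2)" for S and w :: "real \<times> real \<Rightarrow> real"
  proof -
    have "integrable lborel (\<lambda>z. indicator S z *\<^sub>R (w z)\<^sup>2)"
      by (rule integrable_mult_indicator[OF _ that(2)]) (use that(1) in simp)
    moreover have "(\<lambda>z. (indicator S z * w z)\<^sup>2) = (\<lambda>z. indicator S z *\<^sub>R (w z)\<^sup>2)"
      by (auto simp: indicator_def fun_eq_iff)
    ultimately show ?thesis by simp
  qed
  have ai: "integrable lborel (\<lambda>z. (a n z)\<^sup>2)" for n unfolding a_def by (rule ind[OF AB(1) f])
  have bi: "integrable lborel (\<lambda>z. (b n z)\<^sup>2)" for n unfolding b_def by (rule ind[OF AB(2) g])
  have gs: "integrable lborel (\<lambda>z. (g (z + c))\<^sup>2)" "(\<integral>z. (g (z + c))\<^sup>2 \<partial>lborel) = (\<integral>z. (g z)\<^sup>2 \<partial>lborel)" for c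
    using plane_shift[of "\<lambda>z. (g z)\<^sup>2" c] g by auto
  have bs: "integrable lborel (\<lambda>z. (b n (z + c))\<^sup>2)" "(\<integral>z. (b n (z + c))\<^sup>2 \<partial>lborel) = (\<integral>z. (b n z)\<^sup>2 \<partial>lborel)" for c n
    using plane_shift[of "\<lambda>z. (b n z)\<^sup>2" c] bi[of n] by auto
  let ?r = "\<lambda>n. sqrt ((\<integral>z. (a n z)\<^sup>2 \<partial>lborel) * (\<integral>z. (g z)\<^sup>2 \<partial>lborel)) + sqrt ((\<integral>z. (f z)\<^sup>2 \<partial>lborel) * (\<integral>z. (b n z)\<^sup>2 \<partial>lborel))"
  have le: "\<bar>\<integral>z. f z * g (z + (real n, 0)) \<partial>lborel\<bar> \<le> ?r n" for n
  proof -
    let ?c = "(real n, 0 :: real)"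
    have sh: "(\<lambda>z. g (z + ?c)) \<in> borel_measurable lborel" "(\<lambda>z. b n (z + ?c)) \<in> borel_measurable lborel" by measurable
    have m: "f \<in> borel_measurable lborel" "a n \<in> borel_measurable lborel" by simp_all
    note c1 = Cauchy_Schwarz_integral[OF m(2) sh(1) ai gs(1)] and c2 = Cauchy_Schwarz_integral[OF m(1) sh(2) f bs(1)]
      and c3 = Cauchy_Schwarz_integral(1)[OF m(1) sh(1) f gs(1)]
    have "norm (\<integral>z. f z * g (z + ?c) \<partial>lborel) \<le> (\<integral>z. \<bar>a n z * g (z + ?c)\<bar> + \<bar>f z * b n (z + ?c)\<bar> \<partial>lborel)"
    proof (rule Bochner_Integration.integral_norm_bound_integral[OF c3])
      show "integrable lborel (\<lambda>z. \<bar>a n z * g (z + ?c)\<bar> + \<bar>f z * b n (z + ?c)\<bar>)"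
        by (intro Bochner_Integration.integrable_add integrable_abs c1(1) c2(1))
      fix z :: "real \<times> real"
      have "z \<in> A n \<or> z + ?c \<in> B n" by (cases z) (auto simp: A_def B_def)
      then show "norm (f z * g (z + ?c)) \<le> \<bar>a n z * g (z + ?c)\<bar> + \<bar>f z * b n (z + ?c)\<bar>"
        by (auto simp: a_def b_def)
    qed
    also have "\<dots> = (\<integral>z. \<bar>a n z * g (z + ?c)\<bar> \<partial>lborel) + (\<integral>z. \<bar>f z * b n (z + ?c)\<bar> \<partial>lborel)"
      by (intro Bochner_Integration.integral_add integrable_abs c1(1) c2(1))
    also have "\<dots> \<le> ?r n"
      using real_le_rsqrt[OF c1(2)] real_le_rsqrt[OF c2(2)] by (simp add: gs(2) bs(2))
    finally show ?thesis by simp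
  qed
  have lim: "(\<lambda>n. \<integral>z. (indicator (S n) z * w z)\<^sup>2 \<partial>lborel) \<longlonglongrightarrow> 0"
    if S: "\<And>n. S n \<in> sets borel" and w: "w \<in> borel_measurable borel" "integrable lborel (\<lambda>z. (w z)\<^sup>2)"
      and ev: "\<And>z. \<forall>\<^sub>F n in sequentially. z \<notin> S n" for S :: "nat \<Rightarrow> (real \<times> real) set" and w :: "real \<times> real \<Rightarrow> real"
  proof -
    have "(\<lambda>n. \<integral>z. (indicator (S n) z * w z)\<^sup>2 \<partial>lborel) \<longlonglongrightarrow> (\<integral>z. 0 \<partial>(lborel :: (real \<times> real) measure))"
    proof (rule integral_dominated_convergence[OF _ _ w(2)])
      show "(\<lambda>z. (indicator (S n) z * w z)\<^sup>2) \<in> borel_measurable lborel" for n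
        by (rule borel_measurable_integrable[OF ind[OF S w(2)]])
      have "(\<lambda>n. (indicator (S n) z * w z)\<^sup>2) \<longlonglongrightarrow> 0" for z
        by (rule tendsto_eventually) (use ev[of z] in \<open>eventually_elim, simp\<close>)
      then show "AE z in lborel. (\<lambda>n. (indicator (S n) z * w z)\<^sup>2) \<longlonglongrightarrow> 0" by simp
      show "AE z in lborel. norm ((indicator (S n) z * w z)\<^sup>2) \<le> (w z)\<^sup>2" for n
        by (intro AE_I2) (auto simp: indicator_def)
    qed simp
    then show ?thesis by simp
  qed
  have ev: "\<forall>\<^sub>F n in sequentially. K < real n / 2" for K
    using eventually_gt_at_top[of "nat \<lceil>2 * \<bar>K\<bar>\<rceil>"] by eventually_elim linarith
  have "\<forall>\<^sub>F n in sequentially. z \<notin> A n" for z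
    using ev[of "- fst z"] by eventually_elim (simp add: A_def)
  moreover have "\<forall>\<^sub>F n in sequentially. z \<notin> B n" for z
    using ev[of "fst z"] by eventually_elim (simp add: B_def)
  ultimately have "(\<lambda>n. \<integral>z. (a n z)\<^sup>2 \<partial>lborel) \<longlonglongrightarrow> 0" "(\<lambda>n. \<integral>z. (b n z)\<^sup>2 \<partial>lborel) \<longlonglongrightarrow> 0"
    unfolding a_def b_def by (intro lim AB f g; simp)+
  then have "?r \<longlonglongrightarrow> sqrt (0 * (\<integral>z. (g z)\<^sup>2 \<partial>lborel)) + sqrt ((\<integral>z. (f z)\<^sup>2 \<partial>lborel) * 0)"
    by (intro tendsto_add tendsto_real_sqrt tendsto_mult tendsto_const)
  then have "?r \<longlonglongrightarrow> 0" by simp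
  then show ?thesis
    by (rule Lim_null_comparison[rotated]) (use le in auto)
qed

lemma integral_segment_derivative:
  assumes d: "dx f f'" and c: "continuous_on UNIV f'" and h: "0 \<le> h"
  shows "integral {0..h} (\<lambda>s. f' (x + s, y)) = f (x + h, y) - f (x, y)"
proof -
  have "((\<lambda>s. f' (x + s, y)) has_integral (f (x + h, y) - f (x + 0, y))) {0..h}"
  proof (rule fundamental_theorem_of_calculus[OF h])
    fix s
    have "((\<lambda>t. f (t + x, y)) has_real_derivative f' (s + x, y)) (at s)"
      using dxD[OF d, of y "s + x"] by (simp only: DERIV_shift)
    then have "((\<lambda>s. f (x + s, y)) has_vector_derivative f' (x + s, y)) (at s)"
      by (simp add: has_real_derivative_iff_has_vector_derivative add.commute)
    then show "((\<lambda>s. f (x + s, y)) has_vector_derivative f' (x + s, y)) (at s within {0..h})"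
      by (rule has_vector_derivative_at_within)
  qed
  then show ?thesis by (simp add: integral_unique)
qed

text \<open>Translating u along the x-axis does not change the integral of Q . u, because the
  difference is the integral of the divergence of an integrable field. Moving u to infinity leaves
  0.\<close>

lemma orthogonal_Plane:
  assumes Q: "l2fun Plane Q1" "l2fun Plane Q2" "dy Q1 R" "dx Q2 R" "continuous_on UNIV R"
    and u: "l2fun Plane u1" "l2fun Plane u2" "dx u1 a" "dy u2 b" "dx u2 c"
    and cont: "continuous_on UNIV a" "continuous_on UNIV b" "continuous_on UNIV c"
    and div: "\<And>z. a z + b z = 0"
  shows "(\<integral>z. Q1 z * u1 z + Q2 z * u2 z \<partial>lborel) = 0"
proof -
  note m [measurable] = l2fun_measurable[OF Q(1)] l2fun_measurable[OF Q(2)] l2fun_measurable[OF u(1)] l2fun_measurable[OF u(2)]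
  have c': "continuous_on UNIV Q1" "continuous_on UNIV Q2" "continuous_on UNIV u1" "continuous_on UNIV u2"
    and sq: "integrable lborel (\<lambda>z. (Q1 z)\<^sup>2)" "integrable lborel (\<lambda>z. (Q2 z)\<^sup>2)"
      "integrable lborel (\<lambda>z. (u1 z)\<^sup>2)" "integrable lborel (\<lambda>z. (u2 z)\<^sup>2)"
    using Q u by (auto simp: l2fun_def plane_measure_Plane)
  have prod: "integrable lborel (\<lambda>z. f z * g z)"
    if "f \<in> borel_measurable borel" "g \<in> borel_measurable borel"
      "integrable lborel (\<lambda>z. (f z)\<^sup>2)" "integrable lborel (\<lambda>z. (g z)\<^sup>2)" for f g :: "real \<times> real \<Rightarrow> real"
    using Cauchy_Schwarz_integral(1)[of f lborel g] that by simp
  have shm: "(\<lambda>z. f (z + w)) \<in> borel_measurable borel" if "f \<in> borel_measurable borel" for f :: "real \<times> real \<Rightarrow> real" and w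
    using that by measurable
  have shs: "integrable lborel (\<lambda>z. (f (z + w))\<^sup>2)"
    if "f \<in> borel_measurable borel" "integrable lborel (\<lambda>z. (f z)\<^sup>2)" for f :: "real \<times> real \<Rightarrow> real" and w
    using plane_shift(2)[of "\<lambda>z. (f z)\<^sup>2" w] that by simp
  note p = prod[OF m(1,3) sq(1,3)] prod[OF m(2,4) sq(2,4)]
    prod[OF m(1) shm[OF m(3)] sq(1) shs[OF m(3) sq(3)]] prod[OF m(2) shm[OF m(4)] sq(2) shs[OF m(4) sq(4)]]
  have shift: "(\<integral>z. Q1 z * u1 z + Q2 z * u2 z \<partial>lborel)
      = (\<integral>z. Q1 z * u1 (z + (h, 0)) \<partial>lborel) + (\<integral>z. Q2 z * u2 (z + (h, 0)) \<partial>lborel)" if h: "0 < h" for h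
  proof -
    \<comment> \<open>The stream function of the difference of the translate and u. Integration over
      a segment of fixed length h keeps it square integrable; the stream function of u itself need
      not be.\<close>
    define \<phi> where "\<phi> z = integral {0..h} (\<lambda>s. u2 (fst z + s, snd z))" for z
    have u2c: "continuous_on A (\<lambda>s. u2 (x + s, y))" for A x y
      by (rule continuous_on_compose2[OF c'(4)]) (auto intro!: continuous_intros)
    have "continuous_on UNIV (\<lambda>z :: real \<times> real. integral (cbox 0 h) (\<lambda>s. u2 (fst z + s, snd z)))"
    proof (rule integral_continuous_on_param)
      show "continuous_on (UNIV \<times> cbox 0 h) (\<lambda>(z, s). u2 (fst z + s, snd z))"
        unfolding case_prod_beta' by (rule continuous_on_compose2[OF c'(4)]) (auto intro!: continuous_intros)
    qed
    then have \<phi>c: "continuous_on UNIV \<phi>" by (simp add: \<phi>_def[abs_def])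
    have dx\<phi>: "dx \<phi> (\<lambda>z. u2 (z + (h, 0)) - u2 z)"
      unfolding dx_def
    proof (intro allI)
      fix x y
      have "((\<lambda>x. integral (cbox 0 h) (\<lambda>s. u2 (x + s, y))) has_real_derivative integral (cbox 0 h) (\<lambda>s. c (x + s, y))) (at x within UNIV)"
      proof (rule leibniz_rule_field_derivative)
        show "((\<lambda>x. u2 (x + s, y)) has_real_derivative c (x + s, y)) (at x within UNIV)" for x s
          using dxD[OF u(5), of y "x + s"] by (simp only: DERIV_shift)
        show "(\<lambda>s. u2 (x + s, y)) integrable_on cbox 0 h" for x
          by (rule integrable_continuous) (rule u2c)
        show "continuous_on (UNIV \<times> cbox 0 h) (\<lambda>(x, s). c (x + s, y))"
          unfolding case_prod_beta' by (rule continuous_on_compose2[OF cont(3)]) (auto intro!: continuous_intros)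
      qed auto
      then show "((\<lambda>x. \<phi> (x, y)) has_real_derivative u2 ((x, y) + (h, 0)) - u2 (x, y)) (at x)"
        using integral_segment_derivative[OF u(5) cont(3), of h x y] h by (simp add: \<phi>_def)
    qed
    have dy\<phi>: "dy \<phi> (\<lambda>z. - (u1 (z + (h, 0)) - u1 z))"
      unfolding dy_def
    proof (intro allI)
      fix x y
      have "((\<lambda>y. integral (cbox 0 h) (\<lambda>s. u2 (x + s, y))) has_real_derivative integral (cbox 0 h) (\<lambda>s. b (x + s, y))) (at y within UNIV)"
      proof (rule leibniz_rule_field_derivative)
        show "((\<lambda>y. u2 (x + s, y)) has_real_derivative b (x + s, y)) (at y within UNIV)" for y s
          using dyD[OF u(4), of "x + s" y] by simp
        show "(\<lambda>s. u2 (x + s, y)) integrable_on cbox 0 h" for y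
          by (rule integrable_continuous) (rule u2c)
        show "continuous_on (UNIV \<times> cbox 0 h) (\<lambda>(y, s). b (x + s, y))"
          unfolding case_prod_beta' by (rule continuous_on_compose2[OF cont(2)]) (auto intro!: continuous_intros)
      qed auto
      \<comment> \<open>Incompressibility turns the segment integral of \<partial>2 u2 into minus
        that of \<partial>1 u1, which is a difference of boundary values of u1.\<close>
      moreover have "b z = - a z" for z using div[of z] by simp
      ultimately show "((\<lambda>y. \<phi> (x, y)) has_real_derivative - (u1 ((x, y) + (h, 0)) - u1 (x, y))) (at y)"
        using integral_segment_derivative[OF u(3) cont(1), of h x y] h by (simp add: \<phi>_def)
    qed
    have \<phi>2: "integrable lborel (\<lambda>z. (\<phi> z)\<^sup>2)"
    proof -
      have [measurable]: "\<phi> \<in> borel_measurable borel" using \<phi>c by (rule borel_measurable_continuous_onI)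
      have i4: "integrable (lborel \<Otimes>\<^sub>M lborel) (\<lambda>(x, y). (u2 (x, y))\<^sup>2)"
        using sq(4) by (simp add: lborel_prod case_prod_beta')
      have seg: "AE y in lborel. integrable lborel (\<lambda>x. (\<phi> (x, y))\<^sup>2)
         \<and> (\<integral>x. (\<phi> (x, y))\<^sup>2 \<partial>lborel) \<le> h\<^sup>2 * (\<integral>x. (u2 (x, y))\<^sup>2 \<partial>lborel)"
        using lborel_pair.AE_integrable_snd[OF i4]
      proof eventually_elim
        case (elim y)
        from segment_average_l2[OF continuous_horizontal[OF c'(4)] elim h] show ?case by (simp add: \<phi>_def)
      qed
      have "integrable (lborel \<Otimes>\<^sub>M lborel) (\<lambda>w. (\<phi> (snd w, fst w))\<^sup>2)"
      proof (rule lborel_pair.Fubini_integrable)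
        show "AE y in lborel. integrable lborel (\<lambda>x. (\<phi> (snd (y, x), fst (y, x)))\<^sup>2)"
          using seg by eventually_elim simp
        have i5: "integrable lborel (\<lambda>y. h\<^sup>2 * (\<integral>x. (u2 (x, y))\<^sup>2 \<partial>lborel))"
          using lborel_pair.integrable_snd[OF i4] by simp
        show "integrable lborel (\<lambda>y. \<integral>x. norm ((\<phi> (snd (y, x), fst (y, x)))\<^sup>2) \<partial>lborel)"
        proof (rule Bochner_Integration.integrable_bound[OF i5])
          show "AE y in lborel. norm (\<integral>x. norm ((\<phi> (snd (y, x), fst (y, x)))\<^sup>2) \<partial>lborel) \<le> norm (h\<^sup>2 * (\<integral>x. (u2 (x, y))\<^sup>2 \<partial>lborel))"
            using seg by eventually_elim simp
          have "(\<lambda>y. \<integral>x. norm ((\<phi> (x, y))\<^sup>2) \<partial>lborel) \<in> borel_measurable borel"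
            by (intro lborel.borel_measurable_lebesgue_integral) measurable
          then show "(\<lambda>y. \<integral>x. norm ((\<phi> (snd (y, x), fst (y, x)))\<^sup>2) \<partial>lborel) \<in> borel_measurable lborel" by simp
        qed
      qed measurable
      from lborel_pair.integrable_product_swap[OF this] show ?thesis
        by (simp add: lborel_prod case_prod_beta')
    qed
    have \<phi>m: "\<phi> \<in> borel_measurable borel" using \<phi>c by (rule borel_measurable_continuous_onI)
    have shc: "continuous_on UNIV (\<lambda>z. f (z + (h, 0)))" if "continuous_on UNIV f" for f :: "real \<times> real \<Rightarrow> real"
      by (rule continuous_on_compose2[OF that]) (auto intro!: continuous_intros)
    \<comment> \<open>The two parts of the divergence of (Q2 \<phi>, - Q1 \<phi>). The terms R
      \<phi> cancel because Q is curl-free, and what remains is Q against the difference of the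
      translate and u.\<close>
    let ?G1 = "\<lambda>z. R z * \<phi> z + (u2 (z + (h, 0)) - u2 z) * Q2 z"
    let ?G2 = "\<lambda>z. - (R z * \<phi> z + - (u1 (z + (h, 0)) - u1 z) * Q1 z)"
    have sum: "(\<lambda>z. ?G1 z + ?G2 z) = (\<lambda>z. (Q2 z * u2 (z + (h, 0)) + Q1 z * u1 (z + (h, 0))) - (Q1 z * u1 z + Q2 z * u2 z))"
      by (auto simp: fun_eq_iff algebra_simps)
    have "(\<integral>z. ?G1 z + ?G2 z \<partial>lborel) = 0"
    proof (rule divergence_Plane[where ?F1.0="\<lambda>z. Q2 z * \<phi> z" and ?F2.0="\<lambda>z. - (Q1 z * \<phi> z)"])
      show "dx (\<lambda>z. Q2 z * \<phi> z) ?G1"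
        using DERIV_mult[OF dxD[OF Q(4)] dxD[OF dx\<phi>]] by (simp add: dx_def)
      show "dy (\<lambda>z. - (Q1 z * \<phi> z)) ?G2"
        using DERIV_minus[OF DERIV_mult[OF dyD[OF Q(3)] dyD[OF dy\<phi>]]] by (simp add: dy_def)
      show "integrable lborel (\<lambda>z. Q2 z * \<phi> z)" "integrable lborel (\<lambda>z. - (Q1 z * \<phi> z))"
        using prod[OF m(2) \<phi>m sq(2) \<phi>2] prod[OF m(1) \<phi>m sq(1) \<phi>2] by simp_all
      show "integrable lborel (\<lambda>z. ?G1 z + ?G2 z)"
        unfolding sum by (intro Bochner_Integration.integrable_diff Bochner_Integration.integrable_add p)
      show "continuous_on UNIV (\<lambda>z. Q2 z * \<phi> z)" "continuous_on UNIV (\<lambda>z. - (Q1 z * \<phi> z))"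
        "continuous_on UNIV ?G1" "continuous_on UNIV ?G2"
        by (intro continuous_on_add continuous_on_mult continuous_on_minus continuous_on_diff shc c' Q(5) \<phi>c)+
    qed
    then show ?thesis
      unfolding sum using p by simp
  qed
  have 1: "(\<lambda>n. \<integral>z. Q1 z * u1 (z + (real n, 0)) \<partial>lborel) \<longlonglongrightarrow> 0"
    by (rule translates_weakly_null[OF m(1,3) sq(1,3)])
  have 2: "(\<lambda>n. \<integral>z. Q2 z * u2 (z + (real n, 0)) \<partial>lborel) \<longlonglongrightarrow> 0"
    by (rule translates_weakly_null[OF m(2,4) sq(2,4)])
  have "(\<lambda>n. (\<integral>z. Q1 z * u1 (z + (real n, 0)) \<partial>lborel) + (\<integral>z. Q2 z * u2 (z + (real n, 0)) \<partial>lborel)) \<longlonglongrightarrow> 0"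
    using tendsto_add[OF 1 2] by simp
  moreover have "\<forall>\<^sub>F n in sequentially. (\<integral>z. Q1 z * u1 (z + (real n, 0)) \<partial>lborel) + (\<integral>z. Q2 z * u2 (z + (real n, 0)) \<partial>lborel)
      = (\<integral>z. Q1 z * u1 z + Q2 z * u2 z \<partial>lborel)"
    using eventually_gt_at_top[of 0] by eventually_elim (rule shift[symmetric], simp)
  ultimately have "(\<lambda>n :: nat. \<integral>z. Q1 z * u1 z + Q2 z * u2 z \<partial>lborel) \<longlonglongrightarrow> 0"
    by (rule Lim_transform_eventually)
  then show ?thesis by (simp add: LIMSEQ_const_iff)
qed

lemma periodic_mult: "periodic D f \<Longrightarrow> periodic D g \<Longrightarrow> periodic D (\<lambda>z. f z * g z)"
  by (simp add: periodic_def)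

text \<open>Here the potential is periodic and continuous, hence bounded on the cell, so the
  divergence of P u, which is Q . u, can be integrated directly.\<close>

lemma orthogonal_Torus:
  assumes P: "continuous_on UNIV P" "periodic Torus P" "dx P Q1" "dy P Q2"
    and Q: "continuous_on UNIV Q1" "continuous_on UNIV Q2"
    and u: "l2fun Torus u1" "l2fun Torus u2" "dx u1 a" "dy u2 b"
    and cont: "continuous_on UNIV a" "continuous_on UNIV b"
    and div: "\<And>z. a z + b z = 0"
  shows "(\<integral>z. Q1 z * u1 z + Q2 z * u2 z \<partial>plane_measure Torus) = 0"
proof -
  have uc: "continuous_on UNIV u1" "continuous_on UNIV u2" "periodic Torus u1" "periodic Torus u2"
    using u by (auto simp: l2fun_def)
  let ?G1 = "\<lambda>z. Q1 z * u1 z + a z * P z" and ?G2 = "\<lambda>z. Q2 z * u2 z + b z * P z"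
  have "?G1 z + ?G2 z = Q1 z * u1 z + Q2 z * u2 z + (a z + b z) * P z" for z by (simp add: algebra_simps)
  then have sum: "(\<lambda>z. ?G1 z + ?G2 z) = (\<lambda>z. Q1 z * u1 z + Q2 z * u2 z)"
    by (intro ext) (simp only: div mult_zero_left add_0_right)
  have "(\<integral>z. ?G1 z + ?G2 z \<partial>plane_measure Torus) = 0"
  proof (rule divergence_theorem[where ?F1.0="\<lambda>z. P z * u1 z" and ?F2.0="\<lambda>z. P z * u2 z"])
    show "dx (\<lambda>z. P z * u1 z) ?G1" using DERIV_mult[OF dxD[OF P(3)] dxD[OF u(3)]] by (simp add: dx_def)
    show "dy (\<lambda>z. P z * u2 z) ?G2" using DERIV_mult[OF dyD[OF P(4)] dyD[OF u(4)]] by (simp add: dy_def)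
    show "periodic Torus (\<lambda>z. P z * u1 z)" "periodic Torus (\<lambda>z. P z * u2 z)"
      by (intro periodic_mult P uc)+
    show c: "continuous_on UNIV (\<lambda>z. P z * u1 z)" "continuous_on UNIV (\<lambda>z. P z * u2 z)"
      "continuous_on UNIV ?G1" "continuous_on UNIV ?G2"
      by (intro continuous_on_add continuous_on_mult P uc Q cont)+
    show "integrable (plane_measure Torus) (\<lambda>z. P z * u1 z)" "integrable (plane_measure Torus) (\<lambda>z. P z * u2 z)"
      "integrable (plane_measure Torus) (\<lambda>z. ?G1 z + ?G2 z)"
      by (intro continuous_integrable_Torus c continuous_on_add)+
  qed
  then show ?thesis unfolding sum .
qed

section \<open>Energy estimates at a fixed time\<close>

lemma dx_add: "dx f f' \<Longrightarrow> dx g g' \<Longrightarrow> dx (\<lambda>z. f z + g z) (\<lambda>z. f' z + g' z)"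
  and dx_mult: "dx f f' \<Longrightarrow> dx g g' \<Longrightarrow> dx (\<lambda>z. f z * g z) (\<lambda>z. f' z * g z + g' z * f z)"
  and dx_minus: "dx f f' \<Longrightarrow> dx (\<lambda>z. - f z) (\<lambda>z. - f' z)"
  and dx_const: "dx (\<lambda>z. c) (\<lambda>z. 0)"
  and dy_add: "dy f f' \<Longrightarrow> dy g g' \<Longrightarrow> dy (\<lambda>z. f z + g z) (\<lambda>z. f' z + g' z)"
  and dy_mult: "dy f f' \<Longrightarrow> dy g g' \<Longrightarrow> dy (\<lambda>z. f z * g z) (\<lambda>z. f' z * g z + g' z * f z)"
  and dy_minus: "dy f f' \<Longrightarrow> dy (\<lambda>z. - f z) (\<lambda>z. - f' z)"
  and dy_const: "dy (\<lambda>z. c) (\<lambda>z. 0)"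
  by (auto simp: dx_def dy_def intro!: DERIV_add DERIV_mult DERIV_minus)

lemma periodic_intros:
  "periodic D (\<lambda>z. c)"
  "periodic D f \<Longrightarrow> periodic D (\<lambda>z. - f z)"
  "periodic D f \<Longrightarrow> periodic D g \<Longrightarrow> periodic D (\<lambda>z. f z + g z)"
  "periodic D f \<Longrightarrow> periodic D g \<Longrightarrow> periodic D (\<lambda>z. f z * g z)"
  by (simp_all add: periodic_def)

text \<open>Matching H pointwise with the divergence separates the algebra from the analysis, and
  integrability is asked of H only, in which the highest derivatives have already cancelled.\<close>

lemma divergence_zero:
  assumes d: "dx F1 G1" "dy F2 G2"
    and c: "continuous_on UNIV F1" "continuous_on UNIV F2" "continuous_on UNIV G1" "continuous_on UNIV G2"
    and p: "periodic D F1" "periodic D F2"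
    and i: "integrable (plane_measure D) F1" "integrable (plane_measure D) F2"
    and eq: "\<And>z. H z = G1 z + G2 z" and H: "integrable (plane_measure D) H"
  shows "(\<integral>z. H z \<partial>plane_measure D) = 0"
proof -
  have "H = (\<lambda>z. G1 z + G2 z)" by (rule ext) (rule eq)
  then show ?thesis using divergence_theorem[OF c p d i] H by simp
qed

text \<open>Writing g = G G gives one factor G to each bracket. It is used as G <= F in the bracket
  of f, as G <= H in that of h, and as l G <= \<kappa> P in front of the lower-order terms, so that
  each bracket times G carries a factor P.\<close>

lemma triple_numeric:
  fixes g f f2 h h1 F H P \<kappa> l :: real
  assumes nn: "0 \<le> g" "0 \<le> f" "0 \<le> f2" "0 \<le> h" "0 \<le> h1" "0 \<le> F" "0 \<le> H" "0 \<le> P" "0 \<le> l" "0 \<le> \<kappa>"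
    and g: "g \<le> F\<^sup>2" "g \<le> H\<^sup>2" "l * sqrt g \<le> \<kappa> * P"
    and le: "f \<le> F\<^sup>2" "f2 \<le> P\<^sup>2" "h \<le> H\<^sup>2" "h1 \<le> P\<^sup>2"
  shows "g * ((l * f + 2 * sqrt (f * f2)) * (l * h + 2 * sqrt (h * h1))) \<le> ((\<kappa> + 2) * (F * H * P))\<^sup>2"
proof -
  define G where "G = sqrt g"
  have G: "0 \<le> G" "G \<le> F" "G \<le> H" "l * G \<le> \<kappa> * P" "g = G * G"
    using g nn by (auto simp: G_def real_le_lsqrt)
  have s1: "sqrt (f * f2) \<le> F * P"
  proof (rule real_le_lsqrt)
    show "f * f2 \<le> (F * P)\<^sup>2" unfolding power_mult_distrib using le nn by (intro mult_mono) auto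
  qed (use nn in simp)
  have s2: "sqrt (h * h1) \<le> H * P"
  proof (rule real_le_lsqrt)
    show "h * h1 \<le> (H * P)\<^sup>2" unfolding power_mult_distrib using le nn by (intro mult_mono) auto
  qed (use nn in simp)
  have 1: "l * f + 2 * sqrt (f * f2) \<le> F * (l * F + 2 * P)"
    using mult_left_mono[OF le(1) nn(9)] s1 by (simp add: algebra_simps power2_eq_square)
  have 2: "l * h + 2 * sqrt (h * h1) \<le> H * (l * H + 2 * P)"
    using mult_left_mono[OF le(3) nn(9)] s2 by (simp add: algebra_simps power2_eq_square)
  have 3: "G * (l * F + 2 * P) \<le> (\<kappa> + 2) * (F * P)"
    using mult_right_mono[OF G(4) nn(6)] mult_right_mono[OF G(2) nn(8)] by (simp add: algebra_simps)
  have 4: "G * (l * H + 2 * P) \<le> (\<kappa> + 2) * (H * P)"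
    using mult_right_mono[OF G(4) nn(7)] mult_right_mono[OF G(3) nn(8)] by (simp add: algebra_simps)
  have "g * ((l * f + 2 * sqrt (f * f2)) * (l * h + 2 * sqrt (h * h1)))
      \<le> g * ((F * (l * F + 2 * P)) * (H * (l * H + 2 * P)))"
    using nn by (intro mult_left_mono mult_mono 1 2) auto
  also have "\<dots> = F * H * ((G * (l * F + 2 * P)) * (G * (l * H + 2 * P)))"
    by (simp add: G(5) mult_ac)
  also have "\<dots> \<le> F * H * (((\<kappa> + 2) * (F * P)) * ((\<kappa> + 2) * (H * P)))"
    using nn G by (intro mult_left_mono mult_mono 3 4) auto
  also have "\<dots> = ((\<kappa> + 2) * (F * H * P))\<^sup>2" by (simp add: power2_eq_square mult_ac)
  finally show ?thesis .
qed

text \<open>The velocity is (a, b), its time derivative (s, t), the pressure gradient (q1, q2); the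
  digits 1 and 2 after a, b, s, t stand for partial derivatives. Third derivatives and
  \<open>r\<close> are continuous without any integrability: in each flux below they occur twice and
  cancel.\<close>

locale classical_flow =
  fixes D :: flow_domain
    and a a1 a2 a11 a12 a22 a122 b b1 b2 b11 b12 b22 b122 s s2 t t2 q1 q2 r :: "real \<times> real \<Rightarrow> real"
  assumes la: "l2fun D a" "l2fun D a1" "l2fun D a2" "l2fun D a11" "l2fun D a12" "l2fun D a22"
    and lb: "l2fun D b" "l2fun D b1" "l2fun D b2" "l2fun D b11" "l2fun D b12" "l2fun D b22"
    and lt: "l2fun D s" "l2fun D s2" "l2fun D t" "l2fun D t2"
    and lq: "l2fun D q1" "l2fun D q2"
    and c3: "continuous_on UNIV a122" "continuous_on UNIV b122" "continuous_on UNIV r"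
    and da: "dx a a1" "dy a a2" "dx a1 a11" "dy a1 a12" "dx a2 a12" "dy a2 a22" "dx a22 a122" "dy a12 a122"
    and db: "dx b b1" "dy b b2" "dx b1 b11" "dy b1 b12" "dx b2 b12" "dy b2 b22" "dx b22 b122" "dy b12 b122"
    and dt: "dy s s2" "dy t t2"
    and dq: "dy q1 r" "dx q2 r"
    and div: "\<And>z. a1 z + b2 z = 0"
    and eq1: "\<And>z. s z + (a z * a1 z + b z * a2 z) - a11 z + q1 z = 0"
    and eq2: "\<And>z. t z + (a z * b1 z + b z * b2 z) - b11 z + q2 z = 0"
    and orth: "(\<integral>z. q1 z * a z + q2 z * b z \<partial>plane_measure D) = 0"
begin

abbreviation "\<mu> \<equiv> plane_measure D"

lemma b2_eq: "b2 z = - a1 z" using div[of z] by simp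

text \<open>Differentiate the incompressibility condition in y.\<close>

lemma b22_eq: "b22 z = - a12 z"
proof -
  obtain x y where z: "z = (x, y)" by (cases z)
  have "((\<lambda>y. a1 (x, y) + b2 (x, y)) has_real_derivative a12 (x, y) + b22 (x, y)) (at y)"
    by (rule DERIV_add[OF dyD[OF da(4)] dyD[OF db(6)]])
  then have "((\<lambda>y. 0) has_real_derivative a12 (x, y) + b22 (x, y)) (at y)" by (simp only: div)
  from DERIV_unique[OF this DERIV_const] show ?thesis by (simp add: z)
qed

lemma cont: "l2fun D f \<Longrightarrow> continuous_on UNIV f"
  and per: "l2fun D f \<Longrightarrow> periodic D f"
  by (simp_all add: l2fun_def)

lemma int2: "l2fun D f \<Longrightarrow> l2fun D g \<Longrightarrow> integrable \<mu> (\<lambda>z. f z * g z)"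
  by (rule l2fun_mult)

lemmas tri_a = triple_product_bound(1)[OF _ la(1,3) da(2)]
  and tri_b = triple_product_bound(1)[OF _ lb(1,3) db(2)]

lemmas cont_rules = continuous_on_add continuous_on_mult continuous_on_minus continuous_on_const c3
  la[THEN cont] lb[THEN cont] lt[THEN cont] lq[THEN cont]
lemmas per_rules = periodic_intros la[THEN per] lb[THEN per] lt[THEN per] lq[THEN per]
lemmas int_add = Bochner_Integration.integrable_add

lemma nsq_eq: "l2fun D f \<Longrightarrow> (\<integral>z. f z * f z \<partial>\<mu>) = nsq D f"
  by (simp add: nsq_def power2_eq_square)

text \<open>Solve the equation for s and t. The viscous part is an x-derivative minus the
  dissipation \<open>?W\<close>, the transport part is a divergence, and the pressure part vanishes
  by \<open>orth\<close>.\<close>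

theorem energy_identity: "(\<integral>z. s z * a z + t z * b z \<partial>\<mu>) = - (nsq D a1 + nsq D b1)"
proof -
  let ?X = "\<lambda>z. (a11 z * a z + a1 z * a1 z) + (b11 z * b z + b1 z * b1 z)"
  let ?Y = "\<lambda>z. (a1 z * (a z * a z) + a2 z * (b z * a z)) + (b1 z * (a z * b z) + b2 z * (b z * b z))"
  let ?W = "\<lambda>z. a1 z * a1 z + b1 z * b1 z"
  let ?Z = "\<lambda>z. q1 z * a z + q2 z * b z"
  have iX: "integrable \<mu> ?X" by (intro int_add int2 la lb)
  have iW: "integrable \<mu> ?W" by (intro int_add int2 la lb)
  have iZ: "integrable \<mu> ?Z" by (intro int_add int2 la lb lq)
  note t_aa = tri_a[OF _ la(1,2) da(1)] and t_ab = tri_a[OF _ lb(1,2) db(1)]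
    and t_ba = tri_b[OF _ la(1,2) da(1)] and t_bb = tri_b[OF _ lb(1,2) db(1)]
  have iY: "integrable \<mu> ?Y" by (intro int_add t_aa t_ab t_ba t_bb la lb)
  have X: "(\<integral>z. ?X z \<partial>\<mu>) = 0"
  proof (rule divergence_zero[OF dx_add[OF dx_mult[OF da(3,1)] dx_mult[OF db(3,1)]] dy_const[of 0]])
    show "integrable \<mu> (\<lambda>z. a1 z * a z + b1 z * b z)" by (intro int_add int2 la lb)
    show "periodic D (\<lambda>z. a1 z * a z + b1 z * b z)" by (intro per_rules)
    show "?X z = (a11 z * a z + a1 z * a1 z) + (b11 z * b z + b1 z * b1 z) + 0" for z by simp
  qed (intro cont_rules per_rules integrable_zero iX)+
  have Y: "(\<integral>z. ?Y z \<partial>\<mu>) = 0"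
  proof -
    \<comment> \<open>Half of u |u|^2; its divergence is (u . grad u) . u because div u = 0.\<close>
    let ?F1 = "\<lambda>z. (1/2) * (a z * (a z * a z) + a z * (b z * b z))"
    let ?F2 = "\<lambda>z. (1/2) * (b z * (a z * a z) + b z * (b z * b z))"
    note d1 = dx_mult[OF dx_const[of "1/2"] dx_add[OF dx_mult[OF da(1) dx_mult[OF da(1) da(1)]] dx_mult[OF da(1) dx_mult[OF db(1) db(1)]]]]
    note d2 = dy_mult[OF dy_const[of "1/2"] dy_add[OF dy_mult[OF db(2) dy_mult[OF da(2) da(2)]] dy_mult[OF db(2) dy_mult[OF db(2) db(2)]]]]
    show ?thesis
    proof (rule divergence_zero[OF d1 d2])
      show "integrable \<mu> ?F1" by (intro integrable_mult_right int_add t_aa t_bb la)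
      show "integrable \<mu> ?F2" by (intro integrable_mult_right int_add t_aa t_bb lb)
    qed (intro cont_rules per_rules iY | simp add: b2_eq field_simps)+
  qed
  have pt: "s z * a z + t z * b z = ((?X z - ?Y z) - ?W z) - ?Z z" for z
  proof -
    have st: "s z = a11 z - (a z * a1 z + b z * a2 z) - q1 z" "t z = b11 z - (a z * b1 z + b z * b2 z) - q2 z"
      using eq1[of z] eq2[of z] by linarith+
    show ?thesis unfolding st by (simp add: algebra_simps)
  qed
  have "(\<integral>z. s z * a z + t z * b z \<partial>\<mu>) = (\<integral>z. ((?X z - ?Y z) - ?W z) - ?Z z \<partial>\<mu>)"
    by (rule Bochner_Integration.integral_cong[OF refl]) (rule pt)
  also have "\<dots> = (((\<integral>z. ?X z \<partial>\<mu>) - (\<integral>z. ?Y z \<partial>\<mu>)) - (\<integral>z. ?W z \<partial>\<mu>)) - (\<integral>z. ?Z z \<partial>\<mu>)"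
    by (simp only: Bochner_Integration.integral_diff Bochner_Integration.integrable_diff iX iY iW iZ)
  also have "(\<integral>z. ?W z \<partial>\<mu>) = nsq D a1 + nsq D b1"
    by (subst Bochner_Integration.integral_add) (simp_all only: int2 la lb nsq_eq)
  finally show ?thesis by (simp only: X Y orth)
qed

text \<open>Since \<open>?X\<close> is a y-derivative, \<partial>2 can be moved from the time
  derivative onto \<partial>2 u, after which the equation is inserted. Exchanging one x- and one
  y-derivative in \<open>?X4\<close> makes the viscous part the square of \<partial>1\<partial>2 u;
  the pressure drops out, and transport leaves the cubic remainder \<open>?V\<close>.\<close>

lemma enstrophy_identity:
  "(\<integral>z. s2 z * a2 z + t2 z * b2 z \<partial>\<mu>)
    = - (nsq D a12 + nsq D b12) - (\<integral>z. b2 z * (b1 z * a2 z) + b2 z * (b2 z * b2 z) \<partial>\<mu>)"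
proof -
  note tb1_a2 = triple_product_bound(1)[OF lb(3) lb(2) lb(5) db(4) la(3) la(5) da(5)]
    and tb2_b2 = triple_product_bound(1)[OF lb(3) lb(3) lb(6) db(6) lb(3) lb(5) db(5)]
  let ?X = "\<lambda>z. (s2 z * a2 z + a22 z * s z) + (t2 z * b2 z + b22 z * t z)"
  let ?V = "\<lambda>z. b2 z * (b1 z * a2 z) + b2 z * (b2 z * b2 z)"
  let ?Y = "\<lambda>z. ((a22 z * (a z * a1 z) + a22 z * (b z * a2 z)) + (b22 z * (a z * b1 z) + b22 z * (b z * b2 z))) + ?V z"
  let ?X4 = "\<lambda>z. (a11 z * a22 z + b11 z * b22 z) + - (a12 z * a12 z + b12 z * b12 z)"
  let ?W = "\<lambda>z. a12 z * a12 z + b12 z * b12 z"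
  let ?Z = "\<lambda>z. q1 z * a22 z + q2 z * b22 z"
  have iX: "integrable \<mu> ?X" by (intro int_add int2 la lb lt)
  have iW: "integrable \<mu> ?W" by (intro int_add int2 la lb)
  have iZ: "integrable \<mu> ?Z" by (intro int_add int2 la lb lq)
  have iV: "integrable \<mu> ?V" by (intro int_add tb1_a2 tb2_b2)
  have iX4: "integrable \<mu> ?X4" by (intro int_add int2 la lb integrable_minus)
  note t1 = tri_a[OF _ la(2,4) da(3)] tri_a[OF _ lb(2,4) db(3)] tri_b[OF _ la(3,5) da(5)] tri_b[OF _ lb(3,5) db(5)]
    tri_a[OF _ la(3,5) da(5)] tri_a[OF _ lb(3,5) db(5)]
  have iY: "integrable \<mu> ?Y" by (intro int_add[OF _ iV] int_add t1 la lb)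
  have X: "(\<integral>z. ?X z \<partial>\<mu>) = 0"
  proof (rule divergence_zero[OF dx_const[of 0] dy_add[OF dy_mult[OF dt(1) da(6)] dy_mult[OF dt(2) db(6)]]])
    show "integrable \<mu> (\<lambda>z. s z * a2 z + t z * b2 z)" by (intro int_add int2 la lb lt)
  qed (intro cont_rules per_rules integrable_zero iX | simp)+
  have Y: "(\<integral>z. ?Y z \<partial>\<mu>) = 0"
  proof -
    let ?e = "\<lambda>z. a2 z * a2 z + b2 z * b2 z"
    \<comment> \<open>The flux is (u . grad u) . \<partial>2 u in the y-direction minus half of u
      |\<partial>2 u|^2. In its divergence the cubic terms with the square of \<open>a2\<close>
      cancel by \<open>b2_eq\<close>, and \<open>?V\<close> is the cubic part that remains.\<close>
    let ?F1 = "\<lambda>z. - (1/2) * (a2 z * (a z * a2 z) + b2 z * (a z * b2 z))"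
    let ?F2 = "\<lambda>z. (a1 z * (a z * a2 z) + b1 z * (a z * b2 z)) + (1/2) * (a2 z * (b z * a2 z) + b2 z * (b z * b2 z))"
    note d1 = dx_mult[OF dx_const[of "- (1/2)"] dx_add[OF dx_mult[OF da(5) dx_mult[OF da(1) da(5)]] dx_mult[OF db(5) dx_mult[OF da(1) db(5)]]]]
    note d2 = dy_add[OF dy_add[OF dy_mult[OF da(4) dy_mult[OF da(2) da(6)]] dy_mult[OF db(4) dy_mult[OF da(2) db(6)]]]
      dy_mult[OF dy_const[of "1/2"] dy_add[OF dy_mult[OF da(6) dy_mult[OF db(2) da(6)]] dy_mult[OF db(6) dy_mult[OF db(2) db(6)]]]]]
    show ?thesis
    proof (rule divergence_zero[OF d1 d2])
      show "integrable \<mu> ?F1" by (intro integrable_mult_right int_add t1 la lb)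
      show "integrable \<mu> ?F2" by (intro integrable_mult_right int_add t1 la lb)
    qed (intro cont_rules per_rules iY | simp add: b2_eq b22_eq field_simps)+
  qed
  have X4: "(\<integral>z. ?X4 z \<partial>\<mu>) = 0"
  proof (rule divergence_zero[OF dx_add[OF dx_mult[OF da(3,7)] dx_mult[OF db(3,7)]]
        dy_minus[OF dy_add[OF dy_mult[OF da(4,8)] dy_mult[OF db(4,8)]]]])
    show "integrable \<mu> (\<lambda>z. a1 z * a22 z + b1 z * b22 z)" "integrable \<mu> (\<lambda>z. - (a1 z * a12 z + b1 z * b12 z))"
      by (intro int_add int2 la lb integrable_minus)+
  qed (intro cont_rules per_rules iX4 | simp add: algebra_simps)+
  \<comment> \<open>By \<open>b22_eq\<close>, (a22, b22) is the rotated gradient (\<partial>2, -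
    \<partial>1) of \<open>a2\<close>, to which the curl-free pressure gradient is
    orthogonal.\<close>
  have Z: "(\<integral>z. ?Z z \<partial>\<mu>) = 0"
  proof (rule divergence_zero[OF dx_minus[OF dx_mult[OF dq(2) da(5)]] dy_mult[OF dq(1) da(6)]])
    show "integrable \<mu> (\<lambda>z. - (q2 z * a2 z))" "integrable \<mu> (\<lambda>z. q1 z * a2 z)"
      by (intro int_add int2 la lq integrable_minus)+
  qed (intro cont_rules per_rules iZ | simp add: b22_eq algebra_simps)+
  have pt: "s2 z * a2 z + t2 z * b2 z = ((((?X z + ?Y z) - ?V z) - ?X4 z) - ?W z) + ?Z z" for z
  proof -
    have st: "s z = a11 z - (a z * a1 z + b z * a2 z) - q1 z" "t z = b11 z - (a z * b1 z + b z * b2 z) - q2 z"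
      using eq1[of z] eq2[of z] by linarith+
    show ?thesis unfolding st by (simp add: algebra_simps)
  qed
  have "(\<integral>z. s2 z * a2 z + t2 z * b2 z \<partial>\<mu>) = (\<integral>z. ((((?X z + ?Y z) - ?V z) - ?X4 z) - ?W z) + ?Z z \<partial>\<mu>)"
    by (rule Bochner_Integration.integral_cong[OF refl]) (rule pt)
  also have "\<dots> = ((((((\<integral>z. ?X z \<partial>\<mu>) + (\<integral>z. ?Y z \<partial>\<mu>)) - (\<integral>z. ?V z \<partial>\<mu>)) - (\<integral>z. ?X4 z \<partial>\<mu>)) - (\<integral>z. ?W z \<partial>\<mu>)) + (\<integral>z. ?Z z \<partial>\<mu>))"
    by (subst Bochner_Integration.integral_add, intro Bochner_Integration.integrable_diff Bochner_Integration.integrable_add[OF iX iY] iX iY iV iX4 iW iZ, rule iZ,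
        subst Bochner_Integration.integral_diff, intro Bochner_Integration.integrable_diff Bochner_Integration.integrable_add[OF iX iY] iV iX4, rule iW,
        subst Bochner_Integration.integral_diff, intro Bochner_Integration.integrable_diff Bochner_Integration.integrable_add[OF iX iY] iV, rule iX4,
        subst Bochner_Integration.integral_diff, rule Bochner_Integration.integrable_add[OF iX iY], rule iV,
        subst Bochner_Integration.integral_add[OF iX iY], rule refl)
  also have "(\<integral>z. ?W z \<partial>\<mu>) = nsq D a12 + nsq D b12"
    by (subst Bochner_Integration.integral_add) (simp_all only: int2 la lb nsq_eq)
  finally show ?thesis by (simp only: X Y X4 Z)
qed

text \<open>The bound K F H P of the cubic terms is linear in P, so half of the dissipation 2 P^2
  absorbs it. The price is a multiple of F^2 H^2, in which F^2 is integrable in time by the energy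
  identity.\<close>

theorem enstrophy_estimate:
  "2 * (\<integral>z. s2 z * a2 z + t2 z * b2 z \<partial>\<mu>)
    \<le> - (nsq D a12 + nsq D b12) + 4 * (4 * pi + 2)\<^sup>2 * (nsq D a1 + nsq D b1) * (nsq D a2 + nsq D b2)"
proof -
  define F where "F = sqrt (nsq D a1 + nsq D b1)"
  define H where "H = sqrt (nsq D a2 + nsq D b2)"
  define P where "P = sqrt (nsq D a12 + nsq D b12)"
  have sq: "F\<^sup>2 = nsq D a1 + nsq D b1" "H\<^sup>2 = nsq D a2 + nsq D b2" "P\<^sup>2 = nsq D a12 + nsq D b12"
    by (simp_all add: F_def H_def P_def)
  have nn: "0 \<le> F" "0 \<le> H" "0 \<le> P" by (simp_all add: F_def H_def P_def)
  \<comment> \<open>Incompressibility in terms of norms: \<open>b2\<close> is bounded by H as a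
    y-derivative and by F as minus an x-derivative, and \<open>b22\<close> is bounded by P.\<close>
  have eqs: "nsq D b2 = nsq D a1" "nsq D b22 = nsq D a12"
    by (simp_all add: nsq_def b2_eq b22_eq)
  have g: "lam D * sqrt (nsq D b2) \<le> (4 * pi) * P"
  proof (cases D)
    case Plane
    then show ?thesis using nn by (simp add: lam_def)
  next
    case Torus
    \<comment> \<open>Being the x-derivative of the periodic function -a is what gives
      \<open>b2\<close> a zero on each horizontal line, as Poincare's inequality requires.\<close>
    have "dx (\<lambda>z. - a z) b2" using dx_minus[OF da(1)] by (simp add: b2_eq[abs_def])
    moreover have "periodic Torus (\<lambda>z. - a z)" using periodic_intros(2)[OF per[OF la(1)]] Torus by simp
    ultimately have "nsq Torus b2 \<le> (4 * pi)\<^sup>2 * nsq Torus b12"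
      using Poincare_Torus lb(3,5) db(5) Torus by blast
    also have "\<dots> \<le> (4 * pi * P)\<^sup>2" unfolding power_mult_distrib[of _ P] sq using Torus by simp
    finally have "sqrt (nsq Torus b2) \<le> 4 * pi * P" using nn by (intro real_le_lsqrt) simp_all
    then show ?thesis using Torus by (simp add: lam_def)
  qed
  have lam: "0 \<le> lam D" by (simp add: lam_def)
  define K where "K = 4 * pi + 2"
  have K: "0 \<le> K" by (simp add: K_def)
  have T1: "(\<integral>z. \<bar>b2 z * (b1 z * a2 z)\<bar> \<partial>\<mu>) \<le> K * (F * H * P)"
  proof (rule power2_le_imp_le)
    show "(\<integral>z. \<bar>b2 z * (b1 z * a2 z)\<bar> \<partial>\<mu>)\<^sup>2 \<le> (K * (F * H * P))\<^sup>2"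
      unfolding K_def
      by (rule order_trans[OF triple_product_bound(2)[OF lb(3) lb(2) lb(5) db(4) la(3) la(5) da(5)] triple_numeric])
        (use nn lam g eqs in \<open>simp_all add: sq\<close>)
  qed (use nn K in simp)
  \<comment> \<open>The three factors \<open>b2\<close> play different roles: the second is measured
    by F through \<open>a1\<close>, with y-derivative \<open>b22\<close> measured by P, and the
    third by H, with x-derivative \<open>b12\<close>.\<close>
  have T2: "(\<integral>z. \<bar>b2 z * (b2 z * b2 z)\<bar> \<partial>\<mu>) \<le> K * (F * H * P)"
  proof (rule power2_le_imp_le)
    show "(\<integral>z. \<bar>b2 z * (b2 z * b2 z)\<bar> \<partial>\<mu>)\<^sup>2 \<le> (K * (F * H * P))\<^sup>2"
      unfolding K_def
      by (rule order_trans[OF triple_product_bound(2)[OF lb(3) lb(3) lb(6) db(6) lb(3) lb(5) db(5)] triple_numeric])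
        (use nn lam g eqs in \<open>simp_all add: sq\<close>)
  qed (use nn K in simp)
  note i1 = triple_product_bound(1)[OF lb(3) lb(2) lb(5) db(4) la(3) la(5) da(5)]
    and i2 = triple_product_bound(1)[OF lb(3) lb(3) lb(6) db(6) lb(3) lb(5) db(5)]
  have "- (\<integral>z. b2 z * (b1 z * a2 z) + b2 z * (b2 z * b2 z) \<partial>\<mu>)
     = - (\<integral>z. b2 z * (b1 z * a2 z) \<partial>\<mu>) - (\<integral>z. b2 z * (b2 z * b2 z) \<partial>\<mu>)"
    by (subst Bochner_Integration.integral_add[OF i1 i2]) simp
  also have "\<dots> \<le> (\<integral>z. \<bar>b2 z * (b1 z * a2 z)\<bar> \<partial>\<mu>) + (\<integral>z. \<bar>b2 z * (b2 z * b2 z)\<bar> \<partial>\<mu>)"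
    using integral_abs_bound[of \<mu> "\<lambda>z. b2 z * (b1 z * a2 z)"] integral_abs_bound[of \<mu> "\<lambda>z. b2 z * (b2 z * b2 z)"]
    by linarith
  finally have "(\<integral>z. s2 z * a2 z + t2 z * b2 z \<partial>\<mu>) \<le> - P\<^sup>2 + 2 * (K * (F * H * P))"
    using T1 T2 unfolding enstrophy_identity sq by linarith
  \<comment> \<open>Young's inequality in the form (P - 2 K F H)^2 >= 0; the outer factor 4 of the
    final constant arises here.\<close>
  moreover have "4 * (K * (F * H * P)) \<le> P\<^sup>2 + 4 * K\<^sup>2 * F\<^sup>2 * H\<^sup>2"
  proof -
    have "0 \<le> (P - 2 * (K * F * H))\<^sup>2" by simp
    then show ?thesis by (simp add: power2_eq_square algebra_simps)
  qed
  ultimately have "2 * (\<integral>z. s2 z * a2 z + t2 z * b2 z \<partial>\<mu>) \<le> - P\<^sup>2 + 4 * K\<^sup>2 * F\<^sup>2 * H\<^sup>2"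
    by linarith
  then show ?thesis by (simp only: sq K_def)
qed

end

section \<open>From Sobolev solutions to a classical flow\<close>

lemma fun_on_coords: "periodic D F \<Longrightarrow> fun_on D (\<lambda>v. F (coords v))"
proof (cases D)
  case Torus
  assume "periodic D F"
  then have p: "F (x + 2 * pi, y) = F (x, y)" "F (x, y + 2 * pi) = F (x, y)" for x y
    using Torus by (auto simp: periodic_def)
  show ?thesis unfolding Torus fun_on.simps
  proof (intro allI)
    fix v :: "real^2" and i :: 2
    show "F (coords (v + axis i (2 * pi))) = F (coords v)"
      using exhaust_2[of i] p by (auto simp: coords_def axis_def)
  qed
qed simp

lemma loc_integrable_nth: "loc_integrable D (f :: real^2 \<Rightarrow> real^2) \<Longrightarrow> loc_integrable D (\<lambda>v. f v $ i)"
  using loc_integrable_inner[of D f "axis i 1"] by (simp add: inner_axis)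

lemma L2_space_nth:
  fixes w :: "real^2 \<Rightarrow> real^2"
  assumes w: "w \<in> L2_space D" and m: "(\<lambda>v. w v $ i) \<in> borel_measurable lebesgue"
    and c: "continuous_on UNIV V" "periodic D V" and eq: "AE v in lebesgue. w v $ i = V (coords v)"
  shows "l2fun D V"
proof -
  have [measurable]: "V \<in> borel_measurable borel" using c(1) by (rule borel_measurable_continuous_onI)
  have "integrable (dom_measure D) (\<lambda>v. (w v $ i)\<^sup>2)"
  proof (rule Bochner_Integration.integrable_bound)
    show "integrable (dom_measure D) (\<lambda>v. (norm (w v))\<^sup>2)" using w by (simp add: L2_space_def)
    show "(\<lambda>v. (w v $ i)\<^sup>2) \<in> borel_measurable (dom_measure D)"
      using measurable_restrict_space1[OF m] by simp
    show "AE v in dom_measure D. norm ((w v $ i)\<^sup>2) \<le> norm ((norm (w v))\<^sup>2)"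
    proof (rule AE_I2)
      fix v
      have "\<bar>w v $ i\<bar>\<^sup>2 \<le> (norm (w v))\<^sup>2" by (intro power_mono component_le_norm_cart) simp
      then show "norm ((w v $ i)\<^sup>2) \<le> norm ((norm (w v))\<^sup>2)" by simp
    qed
  qed
  moreover have "AE v in lebesgue. (w v $ i)\<^sup>2 = (V (coords v))\<^sup>2" using eq by eventually_elim simp
  ultimately have "integrable (plane_measure D) (\<lambda>z. (V z)\<^sup>2)"
    using integrable_dom_measure[of "\<lambda>v. (w v $ i)\<^sup>2" "\<lambda>z. (V z)\<^sup>2" D] m by simp
  then show ?thesis using c by (simp add: l2fun_def)
qed

lemma integral_inner_coords:
  fixes w w' :: "real^2 \<Rightarrow> real^2"
  assumes m: "\<And>i. (\<lambda>v. w v $ i) \<in> borel_measurable lebesgue" "\<And>i. (\<lambda>v. w' v $ i) \<in> borel_measurable lebesgue"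
    and V: "l2fun D V1" "l2fun D V2" "l2fun D V1'" "l2fun D V2'"
    and eq: "AE v in lebesgue. w v $ 1 = V1 (coords v)" "AE v in lebesgue. w v $ 2 = V2 (coords v)"
      "AE v in lebesgue. w' v $ 1 = V1' (coords v)" "AE v in lebesgue. w' v $ 2 = V2' (coords v)"
  shows "(\<integral>v. w' v \<bullet> w v \<partial>dom_measure D) = (\<integral>z. V1' z * V1 z + V2' z * V2 z \<partial>plane_measure D)"
proof -
  note [measurable] = V[THEN l2fun_measurable]
  have i: "w' v \<bullet> w v = w' v $ 1 * w v $ 1 + w' v $ 2 * w v $ 2" for v
    by (simp add: inner_vec_def sum_2)
  show ?thesis
  proof (rule integral_dom_measure)
    show "(\<lambda>v. w' v \<bullet> w v) \<in> borel_measurable lebesgue"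
      unfolding i by (intro borel_measurable_add borel_measurable_times m)
    show "AE v in lebesgue. w' v \<bullet> w v = V1' (coords v) * V1 (coords v) + V2' (coords v) * V2 (coords v)"
      using eq by eventually_elim (simp add: i)
  qed measurable
qed

lemma L2_norm_sq: "(L2_norm_on D w)\<^sup>2 = (\<integral>v. w v \<bullet> w v \<partial>dom_measure D)"
  by (simp add: L2_norm_on_def power2_norm_eq_inner)

lemma L2_norm_coords:
  fixes w :: "real^2 \<Rightarrow> real^2"
  assumes m: "\<And>i. (\<lambda>v. w v $ i) \<in> borel_measurable lebesgue" and V: "l2fun D V1" "l2fun D V2"
    and eq: "AE v in lebesgue. w v $ 1 = V1 (coords v)" "AE v in lebesgue. w v $ 2 = V2 (coords v)"
  shows "(L2_norm_on D w)\<^sup>2 = nsq D V1 + nsq D V2"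
proof -
  have "(L2_norm_on D w)\<^sup>2 = (\<integral>z. V1 z * V1 z + V2 z * V2 z \<partial>plane_measure D)"
    unfolding L2_norm_sq by (rule integral_inner_coords[OF m m V V eq eq])
  also have "\<dots> = nsq D V1 + nsq D V2"
    using l2fun_mult(1)[OF V(1) V(1)] l2fun_mult(1)[OF V(2) V(2)]
    by (simp add: nsq_def power2_eq_square)
  finally show ?thesis .
qed

text \<open>Here 4 pi comes from the Poincare inequality on the torus, 2 is the factor of the mixed
  term in the sup bound, and the outer 4 comes from Young's inequality.\<close>

definition flow_const :: real where "flow_const = 4 * (4 * pi + 2)\<^sup>2"

text \<open>Each derivative in the equation is replaced by its continuous representative. Identities
  known almost everywhere on the cell then hold at every point, and \<open>classical_flow\<close>
  applies.\<close>

lemma flow_estimates: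
  fixes u ut :: "real^2 \<Rightarrow> real^2"
  assumes u: "u \<in> H_space D 5" and ut: "ut \<in> H_space D 3"
    and p: "has_weak_grad D p" "grad D p \<in> L2_space D"
    and eqn: "AE x in dom_measure D. ut x + advection D u x - wderiv D 2 0 u x = - grad D p x"
    and divg: "AE x in dom_measure D. divergence D u x = 0"
  shows "(\<integral>v. wderiv D 0 0 ut v \<bullet> wderiv D 0 0 u v \<partial>dom_measure D) = - (L2_norm_on D (wderiv D 1 0 u))\<^sup>2"
    and "2 * (\<integral>v. wderiv D 0 1 ut v \<bullet> wderiv D 0 1 u v \<partial>dom_measure D)
      \<le> - (L2_norm_on D (wderiv D 1 1 u))\<^sup>2 + flow_const * (L2_norm_on D (wderiv D 1 0 u))\<^sup>2 * (L2_norm_on D (wderiv D 0 1 u))\<^sup>2"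
proof -
  have u5: "u \<in> H_space D (Suc (Suc 3))" and ut3: "ut \<in> H_space D (Suc (Suc 1))"
    using u ut by (simp_all add: eval_nat_numeral)
  obtain A where A: "\<And>a b. a + b \<le> 3 \<Longrightarrow> continuous_on UNIV (A a b) \<and> periodic D (A a b)
     \<and> (AE v in lebesgue. wderiv D a b u v $ 1 = A a b (coords v))
     \<and> (a + b < 3 \<longrightarrow> dx (A a b) (A (Suc a) b) \<and> dy (A a b) (A a (Suc b)))"
    using H_space_classical[OF u5, of 1] by blast
  obtain B where B: "\<And>a b. a + b \<le> 3 \<Longrightarrow> continuous_on UNIV (B a b) \<and> periodic D (B a b)
     \<and> (AE v in lebesgue. wderiv D a b u v $ 2 = B a b (coords v))
     \<and> (a + b < 3 \<longrightarrow> dx (B a b) (B (Suc a) b) \<and> dy (B a b) (B a (Suc b)))"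
    using H_space_classical[OF u5, of 2] by blast
  obtain S where S: "\<And>a b. a + b \<le> 1 \<Longrightarrow> continuous_on UNIV (S a b) \<and> periodic D (S a b)
     \<and> (AE v in lebesgue. wderiv D a b ut v $ 1 = S a b (coords v))
     \<and> (a + b < 1 \<longrightarrow> dx (S a b) (S (Suc a) b) \<and> dy (S a b) (S a (Suc b)))"
    using H_space_classical[OF ut3, of 1] by blast
  obtain T where T: "\<And>a b. a + b \<le> 1 \<Longrightarrow> continuous_on UNIV (T a b) \<and> periodic D (T a b)
     \<and> (AE v in lebesgue. wderiv D a b ut v $ 2 = T a b (coords v))
     \<and> (a + b < 1 \<longrightarrow> dx (T a b) (T (Suc a) b) \<and> dy (T a b) (T a (Suc b)))"
    using H_space_classical[OF ut3, of 2] by blast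
  have mu: "(\<lambda>v. wderiv D a b u v $ i) \<in> borel_measurable lebesgue" if "a + b \<le> 3" for a b i
    by (rule loc_integrable_measurable[OF loc_integrable_nth[OF H_space_wderiv(3)[OF u5]]]) (use that in simp)
  have mt: "(\<lambda>v. wderiv D a b ut v $ i) \<in> borel_measurable lebesgue" if "a + b \<le> 1" for a b i
    by (rule loc_integrable_measurable[OF loc_integrable_nth[OF H_space_wderiv(3)[OF ut3]]]) (use that in simp)
  have Au: "l2fun D (A a b)" "AE v in lebesgue. wderiv D a b u v $ 1 = A a b (coords v)"
    and Bu: "l2fun D (B a b)" "AE v in lebesgue. wderiv D a b u v $ 2 = B a b (coords v)" if ab: "a + b \<le> 3" for a b
  proof -
    have w: "wderiv D a b u \<in> L2_space D" by (rule H_space_wderiv(2)[OF u5]) (use ab in simp)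
    show 1: "AE v in lebesgue. wderiv D a b u v $ 1 = A a b (coords v)"
      and 2: "AE v in lebesgue. wderiv D a b u v $ 2 = B a b (coords v)" using A[OF ab] B[OF ab] by auto
    show "l2fun D (A a b)" using A[OF ab] by (intro L2_space_nth[OF w mu[OF ab] _ _ 1]) auto
    show "l2fun D (B a b)" using B[OF ab] by (intro L2_space_nth[OF w mu[OF ab] _ _ 2]) auto
  qed
  have Sl: "l2fun D (S a b)" "AE v in lebesgue. wderiv D a b ut v $ 1 = S a b (coords v)"
    and Tl: "l2fun D (T a b)" "AE v in lebesgue. wderiv D a b ut v $ 2 = T a b (coords v)" if ab: "a + b \<le> 1" for a b
  proof -
    have w: "wderiv D a b ut \<in> L2_space D" by (rule H_space_wderiv(2)[OF ut3]) (use ab in simp)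
    show 1: "AE v in lebesgue. wderiv D a b ut v $ 1 = S a b (coords v)"
      and 2: "AE v in lebesgue. wderiv D a b ut v $ 2 = T a b (coords v)" using S[OF ab] T[OF ab] by auto
    show "l2fun D (S a b)" using S[OF ab] by (intro L2_space_nth[OF w mt[OF ab] _ _ 1]) auto
    show "l2fun D (T a b)" using T[OF ab] by (intro L2_space_nth[OF w mt[OF ab] _ _ 2]) auto
  qed
  have dA: "dx (A a b) (A (Suc a) b)" "dy (A a b) (A a (Suc b))"
    and dB: "dx (B a b) (B (Suc a) b)" "dy (B a b) (B a (Suc b))" if "a + b < 3" for a b
    using A[of a b] B[of a b] that by simp_all
  have dS: "dx (S 0 0) (S 1 0)" "dy (S 0 0) (S 0 1)" and dT: "dx (T 0 0) (T 1 0)" "dy (T 0 0) (T 0 1)"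
    using S[of 0 0] T[of 0 0] by simp_all
  note cA = A[THEN conjunct1] and cB = B[THEN conjunct1] and cS = S[THEN conjunct1] and cT = T[THEN conjunct1]
  note pA = A[THEN conjunct2, THEN conjunct1] and pB = B[THEN conjunct2, THEN conjunct1]
    and pS = S[THEN conjunct2, THEN conjunct1] and pT = T[THEN conjunct2, THEN conjunct1]
  have z3: "(0::nat) + 0 \<le> 3" "(1::nat) + 0 \<le> 3" "(0::nat) + 1 \<le> 3" "(2::nat) + 0 \<le> 3" "(1::nat) + 1 \<le> 3" "(0::nat) + 2 \<le> 3"
    "(1::nat) + 2 \<le> 3" "(2::nat) + 1 \<le> 3" "(3::nat) + 0 \<le> 3"
    and z1: "(0::nat) + 0 \<le> 1" "(1::nat) + 0 \<le> 1" "(0::nat) + 1 \<le> 1" by simp_all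
  have DA: "dx (A 0 0) (A 1 0)" "dy (A 0 0) (A 0 1)" "dx (A 1 0) (A 2 0)" "dy (A 1 0) (A 1 1)" "dx (A 0 1) (A 1 1)" "dy (A 0 1) (A 0 2)"
    "dx (A 0 2) (A 1 2)" "dy (A 1 1) (A 1 2)" "dy (A 2 0) (A 2 1)" "dx (A 2 0) (A 3 0)"
    and DB: "dx (B 0 0) (B 1 0)" "dy (B 0 0) (B 0 1)" "dx (B 1 0) (B 2 0)" "dy (B 1 0) (B 1 1)" "dx (B 0 1) (B 1 1)" "dy (B 0 1) (B 0 2)"
    "dx (B 0 2) (B 1 2)" "dy (B 1 1) (B 1 2)" "dy (B 2 0) (B 2 1)" "dx (B 2 0) (B 3 0)"
    using dA[of 0 0] dA[of 1 0] dA[of 0 1] dA[of 0 2] dA[of 1 1] dA[of 2 0]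
      dB[of 0 0] dB[of 1 0] dB[of 0 1] dB[of 0 2] dB[of 1 1] dB[of 2 0]
    by (simp_all add: eval_nat_numeral)
  have lu: "loc_integrable D u" "loc_integrable D ut"
    using H_space_wderiv(1)[OF u5, of 0 0] H_space_wderiv(1)[OF ut3, of 0 0] by (auto simp: has_weak_deriv_def)
  have u00: "AE v in lebesgue. wderiv D 0 0 u v = u v" and ut00: "AE v in lebesgue. wderiv D 0 0 ut v = ut v"
    by (intro wderiv_eq_AE has_weak_deriv_0 lu)+
  have div: "A 1 0 z + B 0 1 z = 0" for z
  proof -
    have "AE v in dom_measure D. A 1 0 (coords v) + B 0 1 (coords v) = 0"
      using divg AE_dom_measure[OF Au(2)[OF z3(2)], of D] AE_dom_measure[OF Bu(2)[OF z3(3)], of D]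
      by eventually_elim (simp add: divergence_def)
    then have "AE v in lebesgue. A 1 0 (coords v) + B 0 1 (coords v) = 0"
      by (intro AE_dom_measure_periodic[of D])
        (use fun_on_coords[OF periodic_intros(3)[OF pA[OF z3(2)] pB[OF z3(3)]]] in \<open>cases D; simp\<close>)
    then have "AE z in lborel. A 1 0 z + B 0 1 z = 0"
      using cA[OF z3(2)] cB[OF z3(3)]
      by (intro AE_coords_eq) (auto intro!: borel_measurable_continuous_onI continuous_on_add)
    then show ?thesis
      using cA[OF z3(2)] cB[OF z3(3)]
      by (intro continuous_AE_eq[where f="\<lambda>z. A 1 0 z + B 0 1 z" and g="\<lambda>z. 0"] continuous_on_add continuous_on_const) auto
  qed
  \<comment> \<open>The equation solved for the pressure gradient. Three classical derivatives of u
    and one of its time derivative make the cross derivatives r1 and r2 exist and be continuous;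
    they contain the third derivatives \<open>A 2 1\<close> and \<open>B 3 0\<close>.\<close>
  define q1 where "q1 z = - ((S 0 0 z + (A 0 0 z * A 1 0 z + B 0 0 z * A 0 1 z)) + - A 2 0 z)" for z
  define q2 where "q2 z = - ((T 0 0 z + (A 0 0 z * B 1 0 z + B 0 0 z * B 0 1 z)) + - B 2 0 z)" for z
  define r1 where "r1 z = - ((S 0 1 z + ((A 0 1 z * A 1 0 z + A 1 1 z * A 0 0 z) + (B 0 1 z * A 0 1 z + A 0 2 z * B 0 0 z))) + - A 2 1 z)" for z
  define r2 where "r2 z = - ((T 1 0 z + ((A 1 0 z * B 1 0 z + B 2 0 z * A 0 0 z) + (B 1 0 z * B 0 1 z + B 1 1 z * B 0 0 z))) + - B 3 0 z)" for z
  note cr = continuous_on_add continuous_on_mult continuous_on_minus z3[THEN cA] z3[THEN cB] z1[THEN cS] z1[THEN cT]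
  have cq: "continuous_on UNIV q1" "continuous_on UNIV q2" "continuous_on UNIV r1" "continuous_on UNIV r2"
    unfolding q1_def[abs_def] q2_def[abs_def] r1_def[abs_def] r2_def[abs_def] by (intro cr)+
  have pq: "periodic D q1" "periodic D q2"
    unfolding q1_def[abs_def] q2_def[abs_def]
    by (intro periodic_intros z3[THEN pA] z3[THEN pB] z1[THEN pS] z1[THEN pT])+
  have dq: "dy q1 r1" "dx q2 r2"
    unfolding q1_def[abs_def] q2_def[abs_def] r1_def[abs_def] r2_def[abs_def]
    by (rule dy_minus dy_add dy_mult dx_minus dx_add dx_mult DA DB dS dT)+
  obtain g1 g2 where "has_weak_deriv D 1 0 p g1" "has_weak_deriv D 0 1 p g2"
    using p(1) by (auto simp: has_weak_grad_def)
  then have wp: "has_weak_deriv D 1 0 p (wderiv D 1 0 p)" "has_weak_deriv D 0 1 p (wderiv D 0 1 p)"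
    by (auto intro: has_weak_deriv_wderiv)
  then have lp: "loc_integrable D (wderiv D 1 0 p)" "loc_integrable D (wderiv D 0 1 p)"
    by (auto simp: has_weak_deriv_def)
  have "AE v in dom_measure D. wderiv D 1 0 p v = q1 (coords v) \<and> wderiv D 0 1 p v = q2 (coords v)"
    using eqn AE_dom_measure[OF u00, of D] AE_dom_measure[OF ut00, of D]
      AE_dom_measure[OF Au(2)[OF z3(1)], of D] AE_dom_measure[OF Bu(2)[OF z3(1)], of D]
      AE_dom_measure[OF Au(2)[OF z3(2)], of D] AE_dom_measure[OF Bu(2)[OF z3(2)], of D]
      AE_dom_measure[OF Au(2)[OF z3(3)], of D] AE_dom_measure[OF Bu(2)[OF z3(3)], of D]
      AE_dom_measure[OF Au(2)[OF z3(4)], of D] AE_dom_measure[OF Bu(2)[OF z3(4)], of D]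
      AE_dom_measure[OF Sl(2)[OF z1(1)], of D] AE_dom_measure[OF Tl(2)[OF z1(1)], of D]
  proof eventually_elim
    case (elim v)
    have "(ut v + advection D u v - wderiv D 2 0 u v) $ i = (- grad D p v) $ i" for i
      using elim(1) by simp
    from this[of 1] this[of 2] elim(2-) show ?case
      by (simp add: advection_def grad_def q1_def q2_def)
  qed
  then have Q: "AE v in dom_measure D. wderiv D 1 0 p v = q1 (coords v)" "AE v in dom_measure D. wderiv D 0 1 p v = q2 (coords v)"
    by (auto elim: eventually_mono)
  \<comment> \<open>Both sides are periodic, so the identity spreads from the cell to the
    plane.\<close>
  have Q1: "AE v in lebesgue. wderiv D 1 0 p v = q1 (coords v)"
    by (rule AE_dom_measure_periodic[OF _ Q(1)])
      (use fun_on_coords[OF pq(1)] lp(1) in \<open>cases D; simp add: loc_integrable_def\<close>)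
  have Q2: "AE v in lebesgue. wderiv D 0 1 p v = q2 (coords v)"
    by (rule AE_dom_measure_periodic[OF _ Q(2)])
      (use fun_on_coords[OF pq(2)] lp(2) in \<open>cases D; simp add: loc_integrable_def\<close>)
  have lq: "l2fun D q1" "l2fun D q2"
    by (rule L2_space_nth[OF p(2), where i=1], use loc_integrable_measurable[OF lp(1)] cq pq Q1 in \<open>simp_all add: grad_def\<close>)
      (rule L2_space_nth[OF p(2), where i=2], use loc_integrable_measurable[OF lp(2)] cq pq Q2 in \<open>simp_all add: grad_def\<close>)
  \<comment> \<open>The curl of the pressure gradient vanishes, although p is only known to have
    weak first derivatives.\<close>
  have r: "r1 = r2" by (rule continuous_potential(1)[OF wp Q1 Q2 cq dq])
  obtain P where P: "continuous_on UNIV P" "periodic D P" "dx P q1" "dy P q2"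
    using continuous_potential(2)[OF wp Q1 Q2 cq dq] by blast
  have orth: "(\<integral>z. q1 z * A 0 0 z + q2 z * B 0 0 z \<partial>plane_measure D) = 0"
  proof (cases D)
    case Plane
    have "(\<integral>z. q1 z * A 0 0 z + q2 z * B 0 0 z \<partial>lborel) = 0"
      by (rule orthogonal_Plane[of q1 q2 r1 _ _ "A 1 0" "B 0 1" "B 1 0"])
        (use lq Au(1)[OF z3(1)] Bu(1)[OF z3(1)] Plane dq r cq DA DB div cr in simp_all)
    then show ?thesis by (simp add: Plane plane_measure_Plane)
  next
    case Torus
    have "(\<integral>z. q1 z * A 0 0 z + q2 z * B 0 0 z \<partial>plane_measure Torus) = 0"
      by (rule orthogonal_Torus[of P q1 q2 _ _ "A 1 0" "B 0 1"])
        (use P Au(1)[OF z3(1)] Bu(1)[OF z3(1)] Torus cq DA DB div cr in simp_all)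
    then show ?thesis by (simp add: Torus)
  qed
  interpret classical_flow D "A 0 0" "A 1 0" "A 0 1" "A 2 0" "A 1 1" "A 0 2" "A 1 2"
    "B 0 0" "B 1 0" "B 0 1" "B 2 0" "B 1 1" "B 0 2" "B 1 2" "S 0 0" "S 0 1" "T 0 0" "T 0 1" q1 q2 r1
    by unfold_locales
      (fact Au(1)[OF z3(1)] Au(1)[OF z3(2)] Au(1)[OF z3(3)] Au(1)[OF z3(4)] Au(1)[OF z3(5)] Au(1)[OF z3(6)]
        Bu(1)[OF z3(1)] Bu(1)[OF z3(2)] Bu(1)[OF z3(3)] Bu(1)[OF z3(4)] Bu(1)[OF z3(5)] Bu(1)[OF z3(6)]
        Sl(1)[OF z1(1)] Sl(1)[OF z1(3)] Tl(1)[OF z1(1)] Tl(1)[OF z1(3)] lq cA[OF z3(7)] cB[OF z3(7)] cq(3)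
        DA DB dS dT dq(1) dq(2)[folded r] div orth | simp add: q1_def q2_def)+
  have norms: "(L2_norm_on D (wderiv D a b u))\<^sup>2 = nsq D (A a b) + nsq D (B a b)" if "a + b \<le> 3" for a b
    by (rule L2_norm_coords[OF mu[OF that] Au(1)[OF that] Bu(1)[OF that] Au(2)[OF that] Bu(2)[OF that]])
  have inners: "(\<integral>v. wderiv D a b ut v \<bullet> wderiv D a b u v \<partial>dom_measure D)
      = (\<integral>z. S a b z * A a b z + T a b z * B a b z \<partial>plane_measure D)" if ab: "a + b \<le> 1" for a b
  proof -
    have ab3: "a + b \<le> 3" using ab by simp
    show ?thesis
      by (rule integral_inner_coords[OF mu[OF ab3] mt[OF ab] Au(1)[OF ab3] Bu(1)[OF ab3] Sl(1)[OF ab] Tl(1)[OF ab]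
            Au(2)[OF ab3] Bu(2)[OF ab3] Sl(2)[OF ab] Tl(2)[OF ab]])
  qed
  show "(\<integral>v. wderiv D 0 0 ut v \<bullet> wderiv D 0 0 u v \<partial>dom_measure D) = - (L2_norm_on D (wderiv D 1 0 u))\<^sup>2"
    unfolding inners[OF z1(1)] norms[OF z3(2)] by (rule energy_identity)
  show "2 * (\<integral>v. wderiv D 0 1 ut v \<bullet> wderiv D 0 1 u v \<partial>dom_measure D)
      \<le> - (L2_norm_on D (wderiv D 1 1 u))\<^sup>2 + flow_const * (L2_norm_on D (wderiv D 1 0 u))\<^sup>2 * (L2_norm_on D (wderiv D 0 1 u))\<^sup>2"
    unfolding inners[OF z1(3)] norms[OF z3(2)] norms[OF z3(3)] norms[OF z3(5)] flow_const_def by (rule enstrophy_estimate)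
qed

section \<open>Linearity of weak derivatives\<close>

lemma pd_zero_on_open:
  assumes "open U" "\<And>x. x \<in> U \<Longrightarrow> \<phi> x = 0" "x \<in> U"
  shows "pd i \<phi> x = 0"
proof -
  have "((\<lambda>x. 0) has_derivative (\<lambda>h. 0)) (at x)" by simp
  then have "(\<phi> has_derivative (\<lambda>h. 0)) (at x)"
    by (rule has_derivative_transform_within_open[OF _ assms(1,3)]) (simp add: assms(2))
  then show ?thesis by (simp add: pd_def frechet_derivative_at[symmetric])
qed

text \<open>Derivatives at a point of an open set see only values in that set. Applied to the
  complement of the closed support, this confines every derivative of a test function to the
  support.\<close>

lemma pd_iterate_zero_on_open:
  assumes "open U" "\<And>x. x \<in> U \<Longrightarrow> \<phi> x = 0"
  shows "x \<in> U \<Longrightarrow> (pd 1 ^^ a) ((pd 2 ^^ b) \<phi>) x = 0"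
proof -
  have b: "(pd 2 ^^ b) \<phi> x = 0" if "x \<in> U" for x
    using that
  proof (induction b arbitrary: x)
    case (Suc b)
    then show ?case using pd_zero_on_open[OF assms(1), of "(pd 2 ^^ b) \<phi>"] by simp
  qed (simp add: assms(2))
  show "x \<in> U \<Longrightarrow> (pd 1 ^^ a) ((pd 2 ^^ b) \<phi>) x = 0"
  proof (induction a arbitrary: x)
    case (Suc a)
    then show ?case using pd_zero_on_open[OF assms(1), of "(pd 1 ^^ a) ((pd 2 ^^ b) \<phi>)"] by simp
  qed (simp add: b)
qed

lemma test_fun_derivative_continuous:
  assumes "test_fun D \<phi>"
  shows "continuous_on A ((pd 1 ^^ a) ((pd 2 ^^ b) \<phi>))"
proof -
  have "\<forall>js x. foldr pd js \<phi> differentiable at x"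
    using assms by (simp add: test_fun_def smooth_fun_def)
  \<comment> \<open>The mixed derivative is the fold over a list of a ones followed by b twos, so
    smoothness makes it differentiable and hence continuous.\<close>
  then have "foldr pd (replicate a 1 @ replicate b 2) \<phi> differentiable at x" for x by blast
  then have "(pd 1 ^^ a) ((pd 2 ^^ b) \<phi>) differentiable at x" for x by simp
  then show ?thesis
    by (intro continuous_at_imp_continuous_on ballI differentiable_imp_continuous_within)
qed

text \<open>On a compact set, the support in the plane or the cell of the torus, the derivative of
  the test function is bounded and f is integrable. Arbitrary test functions must be treated here,
  because \<open>has_weak_deriv\<close> quantifies over all of them.\<close>

lemma test_fun_integrable:
  fixes f :: "real^2 \<Rightarrow> 'a :: euclidean_space"
  assumes t: "test_fun D \<phi>" and f: "loc_integrable D f"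
  shows "integrable (dom_measure D) (\<lambda>x. ((pd 1 ^^ a) ((pd 2 ^^ b) \<phi>)) x *\<^sub>R f x)"
proof -
  let ?\<psi> = "(pd 1 ^^ a) ((pd 2 ^^ b) \<phi>)"
  have c: "continuous_on A ?\<psi>" for A by (rule test_fun_derivative_continuous[OF t])
  have \<psi>m: "?\<psi> \<in> borel_measurable lebesgue"
    by (rule measurable_completion) (simp add: borel_measurable_continuous_onI c)
  define K where "K = (if D = Plane then closure {x. \<phi> x \<noteq> 0} else cell Torus)"
  have K: "compact K" using t by (cases D) (auto simp: K_def test_fun_def compact_cbox)
  then have Kl: "K \<in> sets lebesgue" by (intro sets_completionI_sets) (simp add: borel_compact)
  have "bounded (?\<psi> ` K)" by (intro compact_imp_bounded compact_continuous_image c K)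
  then obtain C where C: "\<And>x. x \<in> K \<Longrightarrow> \<bar>?\<psi> x\<bar> \<le> C" by (auto simp: bounded_iff)
  have i: "integrable lebesgue (\<lambda>x. indicator K x *\<^sub>R f x)"
    using f K by (simp add: loc_integrable_def set_integrable_def)
  have "integrable lebesgue (\<lambda>x. indicator (cell D) x *\<^sub>R (?\<psi> x *\<^sub>R f x))"
  proof (rule Bochner_Integration.integrable_bound)
    show "integrable lebesgue (\<lambda>x. C *\<^sub>R (indicator K x *\<^sub>R f x))" using i by (rule integrable_scaleR_right)
    show "(\<lambda>x. indicator (cell D) x *\<^sub>R (?\<psi> x *\<^sub>R f x)) \<in> borel_measurable lebesgue"
      by (intro borel_measurable_scaleR borel_measurable_indicator cell_lebesgue \<psi>m loc_integrable_measurable[OF f])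
    show "AE x in lebesgue. norm (indicator (cell D) x *\<^sub>R (?\<psi> x *\<^sub>R f x)) \<le> norm (C *\<^sub>R (indicator K x *\<^sub>R f x))"
    proof (rule AE_I2)
      fix x
      show "norm (indicator (cell D) x *\<^sub>R (?\<psi> x *\<^sub>R f x)) \<le> norm (C *\<^sub>R (indicator K x *\<^sub>R f x))"
      proof (cases "x \<in> K")
        case True
        then have "\<bar>?\<psi> x\<bar> \<le> \<bar>C\<bar>" using C[of x] by linarith
        then have "indicator (cell D) x * (\<bar>?\<psi> x\<bar> * norm (f x)) \<le> 1 * (\<bar>C\<bar> * norm (f x))"
          by (intro mult_mono mult_right_mono) (auto simp: indicator_def)
        then show ?thesis using True by (simp add: abs_mult)
      next
        case False
        have "indicator (cell D) x *\<^sub>R (?\<psi> x *\<^sub>R f x) = 0"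
        proof (cases D)
          case Plane
          have "?\<psi> x = 0"
          proof (rule pd_iterate_zero_on_open)
            show "open (- closure {x. \<phi> x \<noteq> 0})" by (rule open_Compl) simp
            show "\<phi> y = 0" if "y \<in> - closure {x. \<phi> x \<noteq> 0}" for y
              using that closure_subset[of "{x. \<phi> x \<noteq> 0}"] by auto
            show "x \<in> - closure {x. \<phi> x \<noteq> 0}" using False Plane by (simp add: K_def)
          qed
          then show ?thesis by simp
        next
          case Torus
          then show ?thesis using False by (simp add: K_def del: cell.simps)
        qed
        then show ?thesis by (simp only: norm_zero norm_ge_zero)
      qed
    qed
  qed
  then show ?thesis by (subst integrable_restrict_space) simp_all
qed

lemma loc_integrable_diff:
  fixes f g :: "real^2 \<Rightarrow> 'a :: euclidean_space"
  shows "loc_integrable D f \<Longrightarrow> loc_integrable D g \<Longrightarrow> loc_integrable D (\<lambda>x. f x - g x)"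
  unfolding loc_integrable_def by (cases D) (auto intro: set_integral_diff(1))

lemma loc_integrable_scale:
  fixes f :: "real^2 \<Rightarrow> 'a :: euclidean_space"
  shows "loc_integrable D f \<Longrightarrow> loc_integrable D (\<lambda>x. c *\<^sub>R f x)"
  unfolding loc_integrable_def by (cases D) (auto intro: absolutely_integrable_scaleR_left)

text \<open>With \<open>has_weak_deriv_scale\<close>, this identifies the weak derivative of a
  difference quotient in time with the difference quotient of the weak derivatives.\<close>

lemma has_weak_deriv_diff:
  fixes f g f' g' :: "real^2 \<Rightarrow> 'a :: euclidean_space"
  assumes "has_weak_deriv D a b f g" "has_weak_deriv D a b f' g'"
  shows "has_weak_deriv D a b (\<lambda>x. f x - f' x) (\<lambda>x. g x - g' x)"
proof -
  have l: "loc_integrable D f" "loc_integrable D g" "loc_integrable D f'" "loc_integrable D g'"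
    using assms by (auto simp: has_weak_deriv_def)
  show ?thesis unfolding has_weak_deriv_def
  proof (intro conjI allI impI loc_integrable_diff l)
    fix \<phi> assume t: "test_fun D \<phi>"
    have i: "integrable (dom_measure D) (\<lambda>x. \<phi> x *\<^sub>R h x)" if "loc_integrable D h" for h :: "real^2 \<Rightarrow> 'a"
      using test_fun_integrable[OF t that, of 0 0] by simp
    have e1: "(\<integral>x. ((pd 1 ^^ a) ((pd 2 ^^ b) \<phi>)) x *\<^sub>R f x \<partial>dom_measure D) = (-1) ^ (a + b) *\<^sub>R (\<integral>x. \<phi> x *\<^sub>R g x \<partial>dom_measure D)"
      and e2: "(\<integral>x. ((pd 1 ^^ a) ((pd 2 ^^ b) \<phi>)) x *\<^sub>R f' x \<partial>dom_measure D) = (-1) ^ (a + b) *\<^sub>R (\<integral>x. \<phi> x *\<^sub>R g' x \<partial>dom_measure D)"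
      using assms t by (auto simp: has_weak_deriv_def)
    show "(\<integral>x. ((pd 1 ^^ a) ((pd 2 ^^ b) \<phi>)) x *\<^sub>R (f x - f' x) \<partial>dom_measure D)
        = (-1) ^ (a + b) *\<^sub>R (\<integral>x. \<phi> x *\<^sub>R (g x - g' x) \<partial>dom_measure D)"
      unfolding scaleR_diff_right
      by (simp only: Bochner_Integration.integral_diff test_fun_integrable[OF t] l i e1 e2 scaleR_diff_right)
  qed
qed

lemma has_weak_deriv_scale:
  fixes f g :: "real^2 \<Rightarrow> 'a :: euclidean_space"
  assumes "has_weak_deriv D a b f g"
  shows "has_weak_deriv D a b (\<lambda>x. c *\<^sub>R f x) (\<lambda>x. c *\<^sub>R g x)"
proof -
  have l: "loc_integrable D f" "loc_integrable D g"
    using assms by (auto simp: has_weak_deriv_def)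
  show ?thesis unfolding has_weak_deriv_def
  proof (intro conjI allI impI loc_integrable_scale l)
    fix \<phi> assume t: "test_fun D \<phi>"
    have e: "(\<integral>x. ((pd 1 ^^ a) ((pd 2 ^^ b) \<phi>)) x *\<^sub>R f x \<partial>dom_measure D) = (-1) ^ (a + b) *\<^sub>R (\<integral>x. \<phi> x *\<^sub>R g x \<partial>dom_measure D)"
      using assms t by (auto simp: has_weak_deriv_def)
    show "(\<integral>x. ((pd 1 ^^ a) ((pd 2 ^^ b) \<phi>)) x *\<^sub>R (c *\<^sub>R f x) \<partial>dom_measure D)
        = (-1) ^ (a + b) *\<^sub>R (\<integral>x. \<phi> x *\<^sub>R (c *\<^sub>R g x) \<partial>dom_measure D)"
      unfolding scaleR_left_commute[of _ c] by (simp only: integral_scaleR_right e scaleR_left_commute[of _ c])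
  qed
qed

lemma loc_integrable_cong_AE:
  fixes f g :: "real^2 \<Rightarrow> 'a :: euclidean_space"
  assumes f: "loc_integrable D f" and g: "fun_on D g" and eq: "AE v in lebesgue. f v = g v"
  shows "loc_integrable D g"
  unfolding loc_integrable_def
proof (intro conjI allI impI g)
  fix K :: "(real^2) set" assume K: "compact K"
  from eq[unfolded eventually_ae_filter] obtain N where N: "N \<in> null_sets lebesgue" "{v. f v \<noteq> g v} \<subseteq> N"
    by auto
  show "g absolutely_integrable_on K"
  proof (rule absolutely_integrable_spike[where f=f and S=N])
    show "f absolutely_integrable_on K" using f K by (simp add: loc_integrable_def)
    show "negligible N" using N(1) by (simp add: negligible_iff_null_sets)
    show "g x = f x" if "x \<in> K - N" for x using that N(2) by (metis (mono_tags) DiffD2 mem_Collect_eq subsetD)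
  qed
qed

lemma has_weak_deriv_cong_AE:
  fixes f f' g :: "real^2 \<Rightarrow> 'a :: euclidean_space"
  assumes w: "has_weak_deriv D a b f g" and f': "fun_on D f'" and eq: "AE v in lebesgue. f v = f' v"
  shows "has_weak_deriv D a b f' g"
proof -
  have l: "loc_integrable D f" "loc_integrable D g" using w by (auto simp: has_weak_deriv_def)
  have l': "loc_integrable D f'" by (rule loc_integrable_cong_AE[OF l(1) f' eq])
  show ?thesis unfolding has_weak_deriv_def
  proof (intro conjI allI impI l l')
    fix \<phi> assume t: "test_fun D \<phi>"
    have "(\<integral>x. ((pd 1 ^^ a) ((pd 2 ^^ b) \<phi>)) x *\<^sub>R f' x \<partial>dom_measure D)
       = (\<integral>x. ((pd 1 ^^ a) ((pd 2 ^^ b) \<phi>)) x *\<^sub>R f x \<partial>dom_measure D)"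
    proof (rule integral_cong_AE)
      show "AE x in dom_measure D. ((pd 1 ^^ a) ((pd 2 ^^ b) \<phi>)) x *\<^sub>R f' x = ((pd 1 ^^ a) ((pd 2 ^^ b) \<phi>)) x *\<^sub>R f x"
        using AE_dom_measure[OF eq, of D] by eventually_elim simp
    qed (rule borel_measurable_integrable[OF test_fun_integrable[OF t l']],
        rule borel_measurable_integrable[OF test_fun_integrable[OF t l(1)]])
    then show "(\<integral>x. ((pd 1 ^^ a) ((pd 2 ^^ b) \<phi>)) x *\<^sub>R f' x \<partial>dom_measure D) = (-1) ^ (a + b) *\<^sub>R (\<integral>x. \<phi> x *\<^sub>R g x \<partial>dom_measure D)"
      using w t by (simp add: has_weak_deriv_def)
  qed
qed

section \<open>Evolution of the norms\<close>

lemma L2_norm_le_H_norm: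
  assumes "a + b \<le> k"
  shows "L2_norm_on D (wderiv D a b f) \<le> H_norm D k f"
proof -
  have fin: "finite {(a, b). a + b \<le> (k :: nat)}"
    by (rule finite_subset[of _ "{..k} \<times> {..k}"]) auto
  have "(L2_norm_on D (wderiv D a b f))\<^sup>2 \<le> (\<Sum>(a, b) \<in> {(a, b). a + b \<le> k}. (L2_norm_on D (wderiv D a b f))\<^sup>2)"
    using member_le_sum[OF _ _ fin, of "(a, b)" "\<lambda>(a, b). (L2_norm_on D (wderiv D a b f))\<^sup>2"] assms by auto
  then show ?thesis unfolding H_norm_def by (rule real_le_rsqrt)
qed

lemma L2_norm_nonneg: "0 \<le> L2_norm_on D f"
  by (simp add: L2_norm_on_def)

lemma L2_space_measurable: "f \<in> L2_space D \<Longrightarrow> f \<in> borel_measurable (dom_measure D)"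
  by (simp add: L2_space_def)

lemma L2_inner:
  fixes f g :: "real^2 \<Rightarrow> 'a :: euclidean_space"
  assumes f: "f \<in> L2_space D" and g: "g \<in> L2_space D"
  shows "integrable (dom_measure D) (\<lambda>v. f v \<bullet> g v)"
    and "\<bar>\<integral>v. f v \<bullet> g v \<partial>dom_measure D\<bar> \<le> L2_norm_on D f * L2_norm_on D g"
proof -
  note m = L2_space_measurable[OF f] L2_space_measurable[OF g]
  have nm: "(\<lambda>v. norm (f v)) \<in> borel_measurable (dom_measure D)" "(\<lambda>v. norm (g v)) \<in> borel_measurable (dom_measure D)"
    using m by (auto intro: borel_measurable_norm)
  have i: "integrable (dom_measure D) (\<lambda>v. (norm (f v))\<^sup>2)" "integrable (dom_measure D) (\<lambda>v. (norm (g v))\<^sup>2)"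
    using f g by (auto simp: L2_space_def)
  note cs = Cauchy_Schwarz_integral[OF nm i]
  show int: "integrable (dom_measure D) (\<lambda>v. f v \<bullet> g v)"
    by (rule Bochner_Integration.integrable_bound[OF cs(1) borel_measurable_inner[OF m]])
      (simp add: abs_mult Cauchy_Schwarz_ineq2)
  have "norm (\<integral>v. f v \<bullet> g v \<partial>dom_measure D) \<le> (\<integral>v. \<bar>norm (f v) * norm (g v)\<bar> \<partial>dom_measure D)"
    by (rule Bochner_Integration.integral_norm_bound_integral[OF int integrable_abs[OF cs(1)]])
      (simp add: Cauchy_Schwarz_ineq2)
  also have "\<dots> \<le> L2_norm_on D f * L2_norm_on D g"
    using real_le_rsqrt[OF cs(2)] by (simp add: L2_norm_on_def real_sqrt_mult)
  finally show "\<bar>\<integral>v. f v \<bullet> g v \<partial>dom_measure D\<bar> \<le> L2_norm_on D f * L2_norm_on D g" by simp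
qed

lemma L2_expand:
  fixes f g :: "real^2 \<Rightarrow> 'a :: euclidean_space"
  assumes f: "f \<in> L2_space D" and g: "g \<in> L2_space D"
  shows "(L2_norm_on D (\<lambda>v. f v + c *\<^sub>R g v))\<^sup>2
    = (L2_norm_on D f)\<^sup>2 + 2 * c * (\<integral>v. f v \<bullet> g v \<partial>dom_measure D) + c\<^sup>2 * (L2_norm_on D g)\<^sup>2"
proof -
  have e: "(f v + c *\<^sub>R g v) \<bullet> (f v + c *\<^sub>R g v) = (f v \<bullet> f v + (2 * c) * (f v \<bullet> g v)) + c\<^sup>2 * (g v \<bullet> g v)" for v
    by (simp add: inner_add_left inner_add_right inner_commute power2_eq_square algebra_simps)
  have sq: "(L2_norm_on D h)\<^sup>2 = (\<integral>v. h v \<bullet> h v \<partial>dom_measure D)" for h :: "real^2 \<Rightarrow> 'a"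
    by (simp add: L2_norm_on_def power2_norm_eq_inner)
  show ?thesis unfolding sq e
    using L2_inner(1)[OF f f] L2_inner(1)[OF f g] L2_inner(1)[OF g g] by simp
qed

text \<open>Expand the square of \<open>w t\<close> plus (s - t) times (w' + \<rho>). The remainder
  \<rho> is a function of its own, tied to the difference quotient only almost everywhere, because
  it will be an independent choice of weak derivative.\<close>

lemma L2_norm_sq_deriv:
  fixes w :: "real \<Rightarrow> real^2 \<Rightarrow> 'a :: euclidean_space" and w' :: "real^2 \<Rightarrow> 'a"
  assumes w: "\<And>s. 0 \<le> s \<Longrightarrow> w s \<in> L2_space D" "w' \<in> L2_space D"
    and \<rho>: "\<And>s. 0 \<le> s \<Longrightarrow> \<rho> s \<in> L2_space D" "\<And>s. 0 \<le> s \<Longrightarrow> s \<noteq> t \<Longrightarrow> AE v in dom_measure D. \<rho> s v = (w s v - w t v) /\<^sub>R (s - t) - w' v"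
    and lim: "((\<lambda>s. L2_norm_on D (\<rho> s)) \<longlongrightarrow> 0) (at t within {0..})" and t: "0 \<le> t"
  shows "((\<lambda>s. (L2_norm_on D (w s))\<^sup>2) has_real_derivative 2 * (\<integral>v. w' v \<bullet> w t v \<partial>dom_measure D)) (at t within {0..})"
  unfolding has_field_derivative_iff
proof (rule Lim_transform_eventually)
  let ?N = "\<lambda>f. L2_norm_on D f" and ?I = "\<lambda>f g. \<integral>v. f v \<bullet> g v \<partial>dom_measure D"
  let ?q = "\<lambda>s. 2 * (?I (w t) w' + ?I (w t) (\<rho> s)) + (s - t) * ((?N w')\<^sup>2 + 2 * ?I w' (\<rho> s) + (?N (\<rho> s))\<^sup>2)"
  have ev: "\<forall>\<^sub>F s in at t within {0..}. 0 \<le> s \<and> s \<noteq> t"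
    by (auto simp: eventually_at_filter)
  have inner0: "((\<lambda>s. ?I f (\<rho> s)) \<longlongrightarrow> 0) (at t within {0..})" if f: "f \<in> L2_space D" for f
  proof (rule Lim_null_comparison)
    show "\<forall>\<^sub>F s in at t within {0..}. norm (?I f (\<rho> s)) \<le> ?N f * ?N (\<rho> s)"
      using ev by eventually_elim (simp add: L2_inner(2)[OF f \<rho>(1)])
    show "((\<lambda>s. ?N f * ?N (\<rho> s)) \<longlongrightarrow> 0) (at t within {0..})"
      using tendsto_mult_right_zero[OF lim] by simp
  qed
  have "(?q \<longlongrightarrow> 2 * (?I (w t) w' + 0) + (t - t) * ((?N w')\<^sup>2 + 2 * 0 + 0\<^sup>2)) (at t within {0..})"
    by (intro tendsto_intros inner0 lim w t)
  then show "(?q \<longlongrightarrow> 2 * (\<integral>v. w' v \<bullet> w t v \<partial>dom_measure D)) (at t within {0..})"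
    by (simp add: inner_commute)
  show "\<forall>\<^sub>F s in at t within {0..}. ?q s = ((?N (w s))\<^sup>2 - (?N (w t))\<^sup>2) / (s - t)"
    using ev
  proof eventually_elim
    case (elim s)
    then have s: "0 \<le> s" "s \<noteq> t" by auto
    \<comment> \<open>Almost everywhere this is the difference quotient itself, so the quotient of
      the squared norms is twice the inner product of \<open>w t\<close> with \<open>h\<close> plus
      (s - t) times the squared norm of \<open>h\<close>.\<close>
    define h where "h v = w' v + 1 *\<^sub>R \<rho> s v" for v
    have hm: "h \<in> borel_measurable (dom_measure D)"
      unfolding h_def[abs_def] using L2_space_measurable[OF w(2)] L2_space_measurable[OF \<rho>(1)[OF s(1)]] by simp
    have on: "fun_on D h" using w(2) \<rho>(1)[OF s(1)] unfolding h_def[abs_def] by (cases D) (simp_all add: L2_space_def)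
    have hi: "integrable (dom_measure D) (\<lambda>v. (norm (h v))\<^sup>2)"
    proof -
      have "(\<lambda>v. (norm (h v))\<^sup>2) = (\<lambda>v. (w' v \<bullet> w' v + 2 * (w' v \<bullet> \<rho> s v)) + \<rho> s v \<bullet> \<rho> s v)"
        by (simp add: fun_eq_iff power2_norm_eq_inner h_def inner_add_left inner_add_right inner_commute)
      then show ?thesis
        using L2_inner(1)[OF w(2) w(2)] L2_inner(1)[OF w(2) \<rho>(1)[OF s(1)]] L2_inner(1)[OF \<rho>(1)[OF s(1)] \<rho>(1)[OF s(1)]] by simp
    qed
    have h: "h \<in> L2_space D" using hm on hi by (simp add: L2_space_def)
    have ae: "AE v in dom_measure D. (norm (w s v))\<^sup>2 = (norm (w t v + (s - t) *\<^sub>R h v))\<^sup>2"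
      using \<rho>(2)[OF s] by eventually_elim (simp add: h_def s(2))
    have "(?N (w s))\<^sup>2 = (?N (\<lambda>v. w t v + (s - t) *\<^sub>R h v))\<^sup>2"
      unfolding L2_norm_on_def
      by (subst integral_cong_AE[OF _ _ ae])
        (use L2_space_measurable[OF w(1)[OF s(1)]] L2_space_measurable[OF w(1)[OF t]] hm in simp_all)
    also have "\<dots> = (?N (w t))\<^sup>2 + 2 * (s - t) * ?I (w t) h + (s - t)\<^sup>2 * (?N h)\<^sup>2"
      by (rule L2_expand[OF w(1)[OF t] h])
    also have "(?N h)\<^sup>2 = (?N w')\<^sup>2 + 2 * ?I w' (\<rho> s) + (?N (\<rho> s))\<^sup>2"
      unfolding h_def[abs_def] L2_expand[OF w(2) \<rho>(1)[OF s(1)]] by simp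
    also have "?I (w t) h = ?I (w t) w' + ?I (w t) (\<rho> s)"
      unfolding h_def inner_add_right scaleR_one
      by (rule Bochner_Integration.integral_add[OF L2_inner(1)[OF w(1)[OF t] w(2)] L2_inner(1)[OF w(1)[OF t] \<rho>(1)[OF s(1)]]])
    finally show ?case using s(2) by (simp add: field_simps power2_eq_square)
  qed
qed

lemma L2_norm_sq_continuous:
  fixes w :: "real \<Rightarrow> real^2 \<Rightarrow> 'a :: euclidean_space"
  assumes w: "\<And>s. 0 \<le> s \<Longrightarrow> w s \<in> L2_space D"
    and \<rho>: "\<And>s. 0 \<le> s \<Longrightarrow> \<rho> s \<in> L2_space D" "\<And>s. 0 \<le> s \<Longrightarrow> AE v in dom_measure D. \<rho> s v = w s v - w t v"
    and lim: "((\<lambda>s. L2_norm_on D (\<rho> s)) \<longlongrightarrow> 0) (at t within {0..})" and t: "0 \<le> t"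
  shows "((\<lambda>s. (L2_norm_on D (w s))\<^sup>2) \<longlongrightarrow> (L2_norm_on D (w t))\<^sup>2) (at t within {0..})"
proof (rule Lim_transform_eventually)
  let ?N = "\<lambda>f. L2_norm_on D f" and ?I = "\<lambda>f g. \<integral>v. f v \<bullet> g v \<partial>dom_measure D"
  have ev: "\<forall>\<^sub>F s in at t within {0..}. 0 \<le> s" by (auto simp: eventually_at_filter)
  have "((\<lambda>s. ?I (w t) (\<rho> s)) \<longlongrightarrow> 0) (at t within {0..})"
  proof (rule Lim_null_comparison)
    show "\<forall>\<^sub>F s in at t within {0..}. norm (?I (w t) (\<rho> s)) \<le> ?N (w t) * ?N (\<rho> s)"
      using ev by eventually_elim (simp add: L2_inner(2)[OF w[OF t] \<rho>(1)])
    show "((\<lambda>s. ?N (w t) * ?N (\<rho> s)) \<longlongrightarrow> 0) (at t within {0..})"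
      using tendsto_mult_right_zero[OF lim] by simp
  qed
  then have "((\<lambda>s. (?N (w t))\<^sup>2 + 2 * 1 * ?I (w t) (\<rho> s) + 1\<^sup>2 * (?N (\<rho> s))\<^sup>2) \<longlongrightarrow> (?N (w t))\<^sup>2 + 2 * 1 * 0 + 1\<^sup>2 * 0\<^sup>2) (at t within {0..})"
    by (intro tendsto_intros lim)
  then show "((\<lambda>s. (?N (w t))\<^sup>2 + 2 * 1 * ?I (w t) (\<rho> s) + 1\<^sup>2 * (?N (\<rho> s))\<^sup>2) \<longlongrightarrow> (?N (w t))\<^sup>2) (at t within {0..})" by simp
  show "\<forall>\<^sub>F s in at t within {0..}. (?N (w t))\<^sup>2 + 2 * 1 * ?I (w t) (\<rho> s) + 1\<^sup>2 * (?N (\<rho> s))\<^sup>2 = (?N (w s))\<^sup>2"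
    using ev
  proof eventually_elim
    case (elim s)
    have ae: "AE v in dom_measure D. (norm (w s v))\<^sup>2 = (norm (w t v + 1 *\<^sub>R \<rho> s v))\<^sup>2"
      using \<rho>(2)[OF elim] by eventually_elim simp
    have "(?N (w s))\<^sup>2 = (?N (\<lambda>v. w t v + 1 *\<^sub>R \<rho> s v))\<^sup>2"
      unfolding L2_norm_on_def
      by (subst integral_cong_AE[OF _ _ ae])
        (use L2_space_measurable[OF w[OF elim]] L2_space_measurable[OF w[OF t]] L2_space_measurable[OF \<rho>(1)[OF elim]] in simp_all)
    also have "\<dots> = (?N (w t))\<^sup>2 + 2 * 1 * ?I (w t) (\<rho> s) + 1\<^sup>2 * (?N (\<rho> s))\<^sup>2"
      by (rule L2_expand[OF w[OF t] \<rho>(1)[OF elim]])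
    finally show ?case by simp
  qed
qed

lemma L2_space_diff:
  fixes f g :: "real^2 \<Rightarrow> 'a :: euclidean_space"
  assumes f: "f \<in> L2_space D" and g: "g \<in> L2_space D"
  shows "(\<lambda>v. f v - g v) \<in> L2_space D"
proof -
  have e: "(\<lambda>v. (norm (f v - g v))\<^sup>2) = (\<lambda>v. (f v \<bullet> f v - 2 * (f v \<bullet> g v)) + g v \<bullet> g v)"
    by (simp add: fun_eq_iff power2_norm_eq_inner inner_diff_left inner_diff_right inner_commute)
  have "integrable (dom_measure D) (\<lambda>v. (norm (f v - g v))\<^sup>2)"
    unfolding e using L2_inner(1)[OF f f] L2_inner(1)[OF f g] L2_inner(1)[OF g g] by simp
  moreover have "fun_on D (\<lambda>v. f v - g v)" using f g by (cases D) (simp_all add: L2_space_def)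
  ultimately show ?thesis
    using L2_space_measurable[OF f] L2_space_measurable[OF g] by (simp add: L2_space_def)
qed

lemma L2_space_scale:
  fixes f :: "real^2 \<Rightarrow> 'a :: euclidean_space"
  assumes f: "f \<in> L2_space D"
  shows "(\<lambda>v. c *\<^sub>R f v) \<in> L2_space D"
proof -
  have "fun_on D (\<lambda>v. c *\<^sub>R f v)" using f by (cases D) (simp_all add: L2_space_def)
  then show ?thesis
    using L2_space_measurable[OF f] f by (simp add: L2_space_def power_mult_distrib)
qed

lemma wderiv_in_L2:
  fixes f g :: "real^2 \<Rightarrow> 'a :: euclidean_space"
  assumes w: "has_weak_deriv D a b f g" and g: "g \<in> L2_space D"
  shows "wderiv D a b f \<in> L2_space D" "L2_norm_on D (wderiv D a b f) = L2_norm_on D g"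
proof -
  have l: "loc_integrable D (wderiv D a b f)"
    using has_weak_deriv_wderiv[OF w] by (simp add: has_weak_deriv_def)
  have "AE v in lebesgue. g v = wderiv D a b f v"
    using wderiv_eq_AE[OF w] by eventually_elim simp
  from L2_space_cong_AE[OF g l this]
  show "wderiv D a b f \<in> L2_space D" "L2_norm_on D (wderiv D a b f) = L2_norm_on D g" .
qed

text \<open>By linearity, differentiation in space commutes with the difference quotient in time, so
  convergence in H^k gives L^2 convergence for every derivative of order at most k.\<close>

lemma C1_H_norm_deriv:
  fixes u ut :: "real \<Rightarrow> real^2 \<Rightarrow> 'a :: euclidean_space"
  assumes u: "C1_H_with_deriv D k u ut" and ab: "a + b \<le> k" and t: "0 \<le> t"
  shows "((\<lambda>s. (L2_norm_on D (wderiv D a b (u s)))\<^sup>2) has_real_derivative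
     2 * (\<integral>v. wderiv D a b (ut t) v \<bullet> wderiv D a b (u t) v \<partial>dom_measure D)) (at t within {0..})"
proof -
  have H: "u s \<in> H_space D k" "ut s \<in> H_space D k" if "0 \<le> s" for s
    using u that by (auto simp: C1_H_with_deriv_def C_H_def)
  have lim: "((\<lambda>s. H_norm D k (\<lambda>x. (u s x - u t x) /\<^sub>R (s - t) - ut t x)) \<longlongrightarrow> 0) (at t within {0..})"
    using u t by (simp add: C1_H_with_deriv_def)
  \<comment> \<open>\<open>H_norm\<close> is built from \<open>wderiv\<close> of the whole
    remainder, so this particular choice is the one whose norm is controlled; it agrees almost
    everywhere with the combination of the single derivatives.\<close>
  define \<rho> where "\<rho> s = wderiv D a b (\<lambda>x. (u s x - u t x) /\<^sub>R (s - t) - ut t x)" for s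
  have W: "has_weak_deriv D a b (\<lambda>x. (u s x - u t x) /\<^sub>R (s - t) - ut t x)
      (\<lambda>x. (wderiv D a b (u s) x - wderiv D a b (u t) x) /\<^sub>R (s - t) - wderiv D a b (ut t) x)" if s: "0 \<le> s" for s
    by (intro has_weak_deriv_diff has_weak_deriv_scale H_space_wderiv(1)[OF H(1)] H_space_wderiv(1)[OF H(2)] s t ab)
  show ?thesis
  proof (rule L2_norm_sq_deriv[where \<rho>=\<rho>])
    show "wderiv D a b (u s) \<in> L2_space D" if "0 \<le> s" for s
      by (rule H_space_wderiv(2)[OF H(1)[OF that] ab])
    show "wderiv D a b (ut t) \<in> L2_space D" by (rule H_space_wderiv(2)[OF H(2)[OF t] ab])
    show "\<rho> s \<in> L2_space D" if s: "0 \<le> s" for s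
      unfolding \<rho>_def
      by (rule wderiv_in_L2(1)[OF W[OF s]])
        (intro L2_space_diff L2_space_scale H_space_wderiv(2)[OF H(1)] H_space_wderiv(2)[OF H(2)] s t ab)
    show "AE v in dom_measure D. \<rho> s v = (wderiv D a b (u s) v - wderiv D a b (u t) v) /\<^sub>R (s - t) - wderiv D a b (ut t) v"
      if s: "0 \<le> s" for s
      unfolding \<rho>_def by (rule AE_dom_measure[OF wderiv_eq_AE[OF W[OF s]]])
    show "((\<lambda>s. L2_norm_on D (\<rho> s)) \<longlongrightarrow> 0) (at t within {0..})"
      by (rule Lim_null_comparison[OF _ lim])
        (simp add: \<rho>_def L2_norm_nonneg L2_norm_le_H_norm[OF ab])
  qed (rule t)
qed

lemma C_H_norm_continuous:
  fixes u :: "real \<Rightarrow> real^2 \<Rightarrow> 'a :: euclidean_space"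
  assumes u: "C_H D k u" and ab: "a + b \<le> k"
  shows "continuous_on {0..} (\<lambda>s. (L2_norm_on D (wderiv D a b (u s)))\<^sup>2)"
  unfolding continuous_on_def
proof
  fix t :: real assume "t \<in> {0..}"
  then have t: "0 \<le> t" by simp
  have H: "u s \<in> H_space D k" if "0 \<le> s" for s using u that by (auto simp: C_H_def)
  have lim: "((\<lambda>s. H_norm D k (\<lambda>x. u s x - u t x)) \<longlongrightarrow> 0) (at t within {0..})"
    using u t by (simp add: C_H_def)
  define \<rho> where "\<rho> s = wderiv D a b (\<lambda>x. u s x - u t x)" for s
  have W: "has_weak_deriv D a b (\<lambda>x. u s x - u t x) (\<lambda>x. wderiv D a b (u s) x - wderiv D a b (u t) x)" if s: "0 \<le> s" for s
    by (intro has_weak_deriv_diff H_space_wderiv(1)[OF H] s t ab)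
  show "((\<lambda>s. (L2_norm_on D (wderiv D a b (u s)))\<^sup>2) \<longlongrightarrow> (L2_norm_on D (wderiv D a b (u t)))\<^sup>2) (at t within {0..})"
  proof (rule L2_norm_sq_continuous[where \<rho>=\<rho>])
    show "wderiv D a b (u s) \<in> L2_space D" if "0 \<le> s" for s
      by (rule H_space_wderiv(2)[OF H[OF that] ab])
    show "\<rho> s \<in> L2_space D" if s: "0 \<le> s" for s
      unfolding \<rho>_def
      by (rule wderiv_in_L2(1)[OF W[OF s]]) (intro L2_space_diff H_space_wderiv(2)[OF H] s t ab)
    show "AE v in dom_measure D. \<rho> s v = wderiv D a b (u s) v - wderiv D a b (u t) v" if s: "0 \<le> s" for s
      unfolding \<rho>_def by (rule AE_dom_measure[OF wderiv_eq_AE[OF W[OF s]]])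
    show "((\<lambda>s. L2_norm_on D (\<rho> s)) \<longlongrightarrow> 0) (at t within {0..})"
      by (rule Lim_null_comparison[OF _ lim])
        (simp add: \<rho>_def L2_norm_nonneg L2_norm_le_H_norm[OF ab])
  qed (rule t)
qed

text \<open>Since y' = - 2 F, the function exp(K y / 2) is an integrating factor for E' <= - P + K F
  E; the integral of F never has to be formed. The product of E plus the integral of P with this
  factor is nonincreasing, as the integral of P is nonnegative.\<close>

lemma Gronwall_energy:
  fixes y E F P :: "real \<Rightarrow> real"
  assumes y: "\<And>t. 0 \<le> t \<Longrightarrow> (y has_real_derivative - 2 * F t) (at t within {0..})"
    and E: "\<And>t. 0 \<le> t \<Longrightarrow> (E has_real_derivative E' t) (at t within {0..})"
    and le: "\<And>t. 0 \<le> t \<Longrightarrow> E' t \<le> - P t + K * F t * E t"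
    and P: "continuous_on {0..} P"
    and nn: "0 \<le> K" "\<And>t. 0 \<le> F t" "\<And>t. 0 \<le> P t" "\<And>t. 0 \<le> E t" "\<And>t. 0 \<le> y t"
    and t: "0 \<le> t"
  shows "E t + integral {0..t} P \<le> E 0 * exp (K / 2 * y 0)"
proof -
  have Pc: "continuous_on {0..x} P" for x by (rule continuous_on_subset[OF P]) auto
  have Pi: "P integrable_on {0..x}" for x by (rule integrable_continuous_interval[OF Pc])
  have I0: "0 \<le> integral {0..x} P" for x by (rule integral_nonneg[OF Pi]) (rule nn)
  define Z where "Z s = (E s + integral {0..s} P) * exp (K / 2 * y s)" for s
  have "Z t \<le> Z 0"
  proof (rule DERIV_nonpos_imp_decreasing_open[OF t])
    fix x assume x: "0 < x" "x < t"
    have at: "at x within {0..} = at x" "at x within {0..t} = at x"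
      using x by (auto intro!: at_within_interior simp: at_within_Icc_at)
    have dE: "(E has_real_derivative E' x) (at x)" and dy: "(y has_real_derivative - 2 * F x) (at x)"
      using E[of x] y[of x] x unfolding at by auto
    have dI: "((\<lambda>s. integral {0..s} P) has_real_derivative P x) (at x)"
      using integral_has_real_derivative[OF Pc, of x t] x unfolding at by auto
    have dexp: "((\<lambda>s. exp (K / 2 * y s)) has_real_derivative exp (K / 2 * y x) * (K / 2 * (- 2 * F x))) (at x)"
      by (rule DERIV_chain2[OF DERIV_exp DERIV_cmult[OF dy]])
    have "(Z has_real_derivative (E' x + P x) * exp (K / 2 * y x)
        + (exp (K / 2 * y x) * (K / 2 * (- 2 * F x))) * (E x + integral {0..x} P)) (at x)"
      unfolding Z_def[abs_def] by (rule DERIV_mult[OF DERIV_add[OF dE dI] dexp])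
    moreover have "(E' x + P x) * exp (K / 2 * y x)
        + (exp (K / 2 * y x) * (K / 2 * (- 2 * F x))) * (E x + integral {0..x} P)
        = exp (K / 2 * y x) * ((E' x + P x - K * F x * E x) - K * F x * integral {0..x} P)"
      by (simp add: algebra_simps)
    moreover have "\<dots> \<le> 0"
    proof (rule mult_nonneg_nonpos)
      have "0 \<le> K * F x * integral {0..x} P" using nn I0 by simp
      then show "(E' x + P x - K * F x * E x) - K * F x * integral {0..x} P \<le> 0"
        using le[of x] x by linarith
    qed simp
    ultimately show "\<exists>z. (Z has_real_derivative z) (at x) \<and> z \<le> 0" by auto
  next
    have "continuous_on {0..} E" "continuous_on {0..} y"
      using E y by (auto intro!: DERIV_continuous_on)
    then have "continuous_on {0..t} E" "continuous_on {0..t} y" by (auto elim!: continuous_on_subset)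
    then show "continuous_on {0..t} Z"
      unfolding Z_def[abs_def] by (intro continuous_intros indefinite_integral_continuous_1[OF Pi])
  qed
  then have Z: "(E t + integral {0..t} P) * exp (K / 2 * y t) \<le> E 0 * exp (K / 2 * y 0)" by (simp add: Z_def)
  have "(E t + integral {0..t} P) * 1 \<le> (E t + integral {0..t} P) * exp (K / 2 * y t)"
    using nn I0[of t] by (intro mult_left_mono) (auto intro!: add_nonneg_nonneg)
  with Z show ?thesis by simp
qed

theorem lemma3p2:
  fixes D :: flow_domain
  shows "\<exists>(m::nat) (C::real). m \<ge> 2 \<and> C > 0 \<and>
    (\<forall>(u :: real \<Rightarrow> real^2 \<Rightarrow> real^2) (p :: real \<Rightarrow> real^2 \<Rightarrow> real) (u\<^sub>0 :: real^2 \<Rightarrow> real^2).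
       global_solution D m u p u\<^sub>0 \<longrightarrow>
       (\<forall>t\<ge>0.
          (L2_norm_on D (wderiv D 0 1 (u t)))\<^sup>2
            + integral {0..t} (\<lambda>s. (L2_norm_on D (wderiv D 1 1 (u s)))\<^sup>2)
          \<le> (L2_norm_on D (wderiv D 0 1 u\<^sub>0))\<^sup>2 * exp (C * (L2_norm_on D u\<^sub>0)\<^sup>2)))"
\<comment> \<open>Order 5 is three classical derivatives plus the two lost in the embedding; the
  time derivative then lies in H^3, which leaves it one. Halving \<open>flow_const\<close> reflects
  that the squared norm of u decreases at twice the rate of the dissipation.\<close>
proof (rule exI[of _ 5], rule exI[of _ "flow_const / 2"], intro conjI allI impI)
  show "(2::nat) \<le> 5" by simp
  have "0 < 4 * pi + 2" using pi_gt_zero by linarith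
  then have K: "0 < flow_const" unfolding flow_const_def by simp
  then show "0 < flow_const / 2" by simp
  fix u :: "real \<Rightarrow> real^2 \<Rightarrow> real^2" and p :: "real \<Rightarrow> real^2 \<Rightarrow> real" and u\<^sub>0 :: "real^2 \<Rightarrow> real^2" and t :: real
  assume sol: "global_solution D 5 u p u\<^sub>0" and t: "0 \<le> t"
  obtain ut where ut: "C1_H_with_deriv D 3 u ut"
    and eqn: "\<And>t. 0 \<le> t \<Longrightarrow> AE x in dom_measure D. ut t x + advection D (u t) x - wderiv D 2 0 (u t) x = - grad D (p t) x"
    using sol by (auto simp: global_solution_def)
  have CH: "C_H D 5 u" using sol by (simp add: global_solution_def)
  have est: "(\<integral>v. wderiv D 0 0 (ut t) v \<bullet> wderiv D 0 0 (u t) v \<partial>dom_measure D) = - (L2_norm_on D (wderiv D 1 0 (u t)))\<^sup>2"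
    "2 * (\<integral>v. wderiv D 0 1 (ut t) v \<bullet> wderiv D 0 1 (u t) v \<partial>dom_measure D)
      \<le> - (L2_norm_on D (wderiv D 1 1 (u t)))\<^sup>2
        + flow_const * (L2_norm_on D (wderiv D 1 0 (u t)))\<^sup>2 * (L2_norm_on D (wderiv D 0 1 (u t)))\<^sup>2" if t: "0 \<le> t" for t
  proof -
    have "u t \<in> H_space D 5" "ut t \<in> H_space D 3" "has_weak_grad D (p t)" "grad D (p t) \<in> L2_space D"
      "AE x in dom_measure D. divergence D (u t) x = 0"
      using sol ut t by (auto simp: global_solution_def C_H_def C_L2_def C1_H_with_deriv_def)
    note * = this(1-4) eqn[OF t] this(5)
    show "(\<integral>v. wderiv D 0 0 (ut t) v \<bullet> wderiv D 0 0 (u t) v \<partial>dom_measure D) = - (L2_norm_on D (wderiv D 1 0 (u t)))\<^sup>2"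
      by (rule flow_estimates(1)[OF *])
    show "2 * (\<integral>v. wderiv D 0 1 (ut t) v \<bullet> wderiv D 0 1 (u t) v \<partial>dom_measure D)
      \<le> - (L2_norm_on D (wderiv D 1 1 (u t)))\<^sup>2
        + flow_const * (L2_norm_on D (wderiv D 1 0 (u t)))\<^sup>2 * (L2_norm_on D (wderiv D 0 1 (u t)))\<^sup>2"
      by (rule flow_estimates(2)[OF *])
  qed
  have main: "(L2_norm_on D (wderiv D 0 1 (u t)))\<^sup>2 + integral {0..t} (\<lambda>s. (L2_norm_on D (wderiv D 1 1 (u s)))\<^sup>2)
      \<le> (L2_norm_on D (wderiv D 0 1 (u 0)))\<^sup>2 * exp (flow_const / 2 * (L2_norm_on D (wderiv D 0 0 (u 0)))\<^sup>2)"
  proof (rule Gronwall_energy[where y="\<lambda>s. (L2_norm_on D (wderiv D 0 0 (u s)))\<^sup>2"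
        and E="\<lambda>s. (L2_norm_on D (wderiv D 0 1 (u s)))\<^sup>2" and F="\<lambda>s. (L2_norm_on D (wderiv D 1 0 (u s)))\<^sup>2"
        and P="\<lambda>s. (L2_norm_on D (wderiv D 1 1 (u s)))\<^sup>2"
        and E'="\<lambda>t. 2 * (\<integral>v. wderiv D 0 1 (ut t) v \<bullet> wderiv D 0 1 (u t) v \<partial>dom_measure D)"])
    fix t :: real assume t: "0 \<le> t"
    show "((\<lambda>s. (L2_norm_on D (wderiv D 0 0 (u s)))\<^sup>2) has_real_derivative - 2 * (L2_norm_on D (wderiv D 1 0 (u t)))\<^sup>2) (at t within {0..})"
      using C1_H_norm_deriv[OF ut, of 0 0 t] t est(1)[OF t] by simp
    show "((\<lambda>s. (L2_norm_on D (wderiv D 0 1 (u s)))\<^sup>2) has_real_derivative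
        2 * (\<integral>v. wderiv D 0 1 (ut t) v \<bullet> wderiv D 0 1 (u t) v \<partial>dom_measure D)) (at t within {0..})"
      by (rule C1_H_norm_deriv[OF ut _ t]) simp
  next
    show "continuous_on {0..} (\<lambda>s. (L2_norm_on D (wderiv D 1 1 (u s)))\<^sup>2)"
      by (rule C_H_norm_continuous[OF CH]) simp
  qed (use est(2) K t in auto)
  \<comment> \<open>The initial datum equals \<open>u 0\<close> only almost everywhere on the cell.
    Periodicity extends this to the plane, and uniqueness of weak derivatives carries both norms
    over.\<close>
  have u0H: "u 0 \<in> H_space D 5" using CH by (simp add: C_H_def)
  have u0: "fun_on D u\<^sub>0" "AE x in dom_measure D. u 0 x = u\<^sub>0 x" using sol by (auto simp: global_solution_def)
  have l0: "loc_integrable D (u 0)"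
    using H_space_wderiv(1)[OF u0H, of 0 0] by (simp add: has_weak_deriv_def)
  have ae: "AE v in lebesgue. u 0 v = u\<^sub>0 v"
    by (rule AE_dom_measure_periodic[OF _ u0(2)])
      (use u0(1) l0 in \<open>cases D; simp add: loc_integrable_def\<close>)
  have "AE v in lebesgue. wderiv D 0 0 (u 0) v = u\<^sub>0 v"
    using wderiv_eq_AE[OF has_weak_deriv_0[OF l0]] ae by eventually_elim simp
  then have n0: "L2_norm_on D u\<^sub>0 = L2_norm_on D (wderiv D 0 0 (u 0))"
    by (intro L2_space_cong_AE(2) H_space_wderiv(2)[OF u0H] loc_integrable_cong_AE[OF l0 u0(1) ae]) simp_all
  have "has_weak_deriv D 0 1 u\<^sub>0 (wderiv D 0 1 (u 0))"
    by (rule has_weak_deriv_cong_AE[OF H_space_wderiv(1)[OF u0H] u0(1) ae]) simp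
  then have n1: "L2_norm_on D (wderiv D 0 1 u\<^sub>0) = L2_norm_on D (wderiv D 0 1 (u 0))"
    by (rule wderiv_in_L2(2)) (rule H_space_wderiv(2)[OF u0H], simp)
  show "(L2_norm_on D (wderiv D 0 1 (u t)))\<^sup>2 + integral {0..t} (\<lambda>s. (L2_norm_on D (wderiv D 1 1 (u s)))\<^sup>2)
      \<le> (L2_norm_on D (wderiv D 0 1 u\<^sub>0))\<^sup>2 * exp (flow_const / 2 * (L2_norm_on D u\<^sub>0)\<^sup>2)"
    using main by (simp only: n0 n1)
qed

end
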